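(* Let $G$ be a finite $p$-group. Then $\delta_{\mathcal{CD}}(G)\leqslant p^{2}+p$ if and only if $G$ is one of the following groups: (1) $\mathrm{C}_{p^{k}}$, where $k=1,2,\ldots,p^{2}+p$ (in this case, $\delta_{\mathcal{CD}}(G)=k$); (2) $\mathrm{C}_{p^t}\times\mathrm{C}_{p}$, where $t=1,2,\ldots,p-1$ (in this case, $\delta_{\mathcal{CD}}(G)=t(p+1)+1$); (3) $\mathrm{Q}_{8}$ (in this case, $\delta_{\mathcal{CD}}(G)=1$); (4) $\langle a,b\mid a^{p^k}=b^p=1,\ a^b=a^{1+p^{k-1}}\rangle$, where $k=2,3,\ldots,p+1$ (in this case, $\delta_{\mathcal{CD}}(G)=(k-1)(p+1)$).
   Context: Here $p$ is a prime. For a finite group $G$ and a subgroup $H\le G$, the Chermak-Delgado measure of $H$ in $G$ is $m_G(H)=|H|\cdot|C_G(H)|$, where $C_G(H)$ is the centralizer of $H$ in $G$. Put $m^*(G)=\max\{m_G(H)\mid H\le G\}$ and $\mathcal{CD}(G)=\{H\le G\mid m_G(H)=m^*(G)\}$ (the Chermak-Delgado lattice of $G$). Let $\mathcal{L}(G)$ be the set of all subgroups of $G$, and let $\delta_{\mathcal{CD}}(G)=|\mathcal{L}(G)|-|\mathcal{CD}(G)|$ be the number of subgroups of $G$ not in $\mathcal{CD}(G)$. $\mathrm{C}_{m}$ denotes the cyclic group of order $m$, $\mathrm{Q}_{8}$ denotes the quaternion group of order $8$, and $a^b=b^{-1}ab$.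
   Formalization: In (4) the value of δ_CD(G) for p=k=2 (dihedral group of order 8) is corrected from 3 to 5; and G is assumed nontrivial, since the trivial group has δ_CD=0 but is not in the list. *)

theory Defs
  imports "HOL-Algebra.Algebra"
begin

section \<open>The Chermak-Delgado lattice\<close>

definition subgroups_of :: "('a, 'b) monoid_scheme \<Rightarrow> 'a set set" where
  "subgroups_of G = {H. subgroup H G}"

definition centralizer :: "('a, 'b) monoid_scheme \<Rightarrow> 'a set \<Rightarrow> 'a set" where
  "centralizer G H = {g \<in> carrier G. \<forall>h\<in>H. g \<otimes>\<^bsub>G\<^esub> h = h \<otimes>\<^bsub>G\<^esub> g}"

definition cd_measure :: "('a, 'b) monoid_scheme \<Rightarrow> 'a set \<Rightarrow> nat" where
  "cd_measure G H = card H * card (centralizer G H)"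

definition max_cd_measure :: "('a, 'b) monoid_scheme \<Rightarrow> nat" where
  "max_cd_measure G = Max (cd_measure G ` subgroups_of G)"

definition cd_lattice :: "('a, 'b) monoid_scheme \<Rightarrow> 'a set set" where
  "cd_lattice G = {H \<in> subgroups_of G. cd_measure G H = max_cd_measure G}"

definition cd_defect :: "('a, 'b) monoid_scheme \<Rightarrow> nat" where
  "cd_defect G = card (subgroups_of G) - card (cd_lattice G)"


section \<open>Groups given by generators and relations\<close>

text \<open>A letter \<open>(x, True)\<close> stands for the generator \<open>x\<close> and \<open>(x, False)\<close> for its inverse.
  A pair \<open>(u, v)\<close> in the set of relations stands for the relation \<open>u = v\<close>.  The generators are
  all elements of the type \<open>'g\<close>.\<close>

type_synonym 'g gword = "('g \<times> bool) list"

inductive pres_eq :: "('g gword \<times> 'g gword) set \<Rightarrow> 'g gword \<Rightarrow> 'g gword \<Rightarrow> bool"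
  for R :: "('g gword \<times> 'g gword) set" where
  refl: "pres_eq R u u"
| sym: "pres_eq R u v \<Longrightarrow> pres_eq R v u"
| trans: "pres_eq R u v \<Longrightarrow> pres_eq R v w \<Longrightarrow> pres_eq R u w"
| append: "pres_eq R u u' \<Longrightarrow> pres_eq R v v' \<Longrightarrow> pres_eq R (u @ v) (u' @ v')"
| cancel: "pres_eq R [(x, e), (x, \<not> e)] []"
| rel: "(u, v) \<in> R \<Longrightarrow> pres_eq R u v"

definition pres_class :: "('g gword \<times> 'g gword) set \<Rightarrow> 'g gword \<Rightarrow> 'g gword set" where
  "pres_class R u = {v. pres_eq R u v}"

definition presented_group :: "('g gword \<times> 'g gword) set \<Rightarrow> 'g gword set monoid" where
  "presented_group R =
     \<lparr>carrier = range (pres_class R),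
      monoid.mult = (\<lambda>U V. \<Union>u\<in>U. \<Union>v\<in>V. pres_class R (u @ v)),
      one = pres_class R []\<rparr>"

lemma pres_class_eq_iff: "pres_class R u = pres_class R v \<longleftrightarrow> pres_eq R u v"
proof
  assume "pres_class R u = pres_class R v"
  then have "v \<in> pres_class R u"
    by (simp add: pres_class_def pres_eq.refl)
  then show "pres_eq R u v" by (simp add: pres_class_def)
next
  assume uv: "pres_eq R u v"
  then show "pres_class R u = pres_class R v"
    unfolding pres_class_def
    using pres_eq.trans[OF uv] pres_eq.trans[OF pres_eq.sym[OF uv]] by blast
qed

lemma presented_group_carrier: "carrier (presented_group R) = range (pres_class R)"
  by (simp add: presented_group_def)

lemma presented_group_one: "\<one>\<^bsub>presented_group R\<^esub> = pres_class R []"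
  by (simp add: presented_group_def)

lemma presented_group_mult:
  "pres_class R u \<otimes>\<^bsub>presented_group R\<^esub> pres_class R v = pres_class R (u @ v)"
proof -
  have "(\<Union>u'\<in>pres_class R u. \<Union>v'\<in>pres_class R v. pres_class R (u' @ v')) = pres_class R (u @ v)"
    (is "?L = _")
  proof
    have "pres_class R (u' @ v') = pres_class R (u @ v)"
      if "u' \<in> pres_class R u" "v' \<in> pres_class R v" for u' v'
    proof -
      have "pres_eq R (u @ v) (u' @ v')"
        using that by (intro pres_eq.append) (simp_all add: pres_class_def)
      then show ?thesis by (simp only: pres_class_eq_iff pres_eq.sym)
    qed
    then show "?L \<subseteq> pres_class R (u @ v)" by blast
    have "u \<in> pres_class R u" "v \<in> pres_class R v"
      by (simp_all add: pres_class_def pres_eq.refl)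
    then show "pres_class R (u @ v) \<subseteq> ?L" by blast
  qed
  then show ?thesis by (simp add: presented_group_def)
qed

lemma pres_eq_inverse: "pres_eq R (rev (map (\<lambda>(x, e). (x, \<not> e)) u) @ u) []"
proof (induction u)
  case Nil
  show ?case by (simp add: pres_eq.refl)
next
  case (Cons a u)
  obtain x e where a: "a = (x, e)" by (cases a)
  let ?i = "rev (map (\<lambda>(x, e). (x, \<not> e)) u)"
  have "pres_eq R ([(x, \<not> e), (x, e)] @ u) ([] @ u)"
    using pres_eq.append[OF pres_eq.cancel[of R x "\<not> e"] pres_eq.refl[of R u]] by simp
  then have "pres_eq R (?i @ [(x, \<not> e), (x, e)] @ u) (?i @ [] @ u)"
    by (rule pres_eq.append[OF pres_eq.refl])
  then have "pres_eq R (?i @ [(x, \<not> e), (x, e)] @ u) (?i @ u)" by simp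
  from pres_eq.trans[OF this Cons.IH] show ?case by (simp add: a)
qed

lemma group_presented_group: "group (presented_group R)"
proof (rule groupI)
  fix U assume "U \<in> carrier (presented_group R)"
  then obtain u where U: "U = pres_class R u"
    by (auto simp: presented_group_carrier)
  show "\<exists>V\<in>carrier (presented_group R). V \<otimes>\<^bsub>presented_group R\<^esub> U = \<one>\<^bsub>presented_group R\<^esub>"
    by (rule bexI[of _ "pres_class R (rev (map (\<lambda>(x, e). (x, \<not> e)) u))"])
       (simp add: U presented_group_mult presented_group_one pres_class_eq_iff pres_eq_inverse,
        simp only: presented_group_carrier rangeI)
qed (auto simp: presented_group_carrier presented_group_mult presented_group_one)

text \<open>Evaluation of a word in a group, and von Dyck's theorem.\<close>

fun eval_word :: "('a, 'b) monoid_scheme \<Rightarrow> ('g \<Rightarrow> 'a) \<Rightarrow> 'g gword \<Rightarrow> 'a" where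
  "eval_word G f [] = \<one>\<^bsub>G\<^esub>"
| "eval_word G f ((x, e) # u) = (if e then f x else inv\<^bsub>G\<^esub> (f x)) \<otimes>\<^bsub>G\<^esub> eval_word G f u"

lemma (in group) eval_word_closed:
  "(\<And>x. f x \<in> carrier G) \<Longrightarrow> eval_word G f u \<in> carrier G"
  by (induction u) auto

lemma (in group) eval_word_append:
  "(\<And>x. f x \<in> carrier G) \<Longrightarrow> eval_word G f (u @ v) = eval_word G f u \<otimes> eval_word G f v"
  by (induction u) (auto simp: eval_word_closed m_assoc)

lemma (in group) eval_word_pres_eq:
  assumes "pres_eq R u v" and f: "\<And>x. f x \<in> carrier G"
    and R: "\<And>u v. (u, v) \<in> R \<Longrightarrow> eval_word G f u = eval_word G f v"
  shows "eval_word G f u = eval_word G f v"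
  using assms(1)
proof induction
  case (cancel x e)
  show ?case using f[of x] by (cases e) simp_all
qed (simp_all add: eval_word_append f R)

lemma (in group) von_dyck:
  assumes f: "\<And>x. f x \<in> carrier G"
    and R: "\<And>u v. (u, v) \<in> R \<Longrightarrow> eval_word G f u = eval_word G f v"
  shows "\<exists>h \<in> hom (presented_group R) G. \<forall>x. h (pres_class R [(x, True)]) = f x"
proof -
  define h where "h U = eval_word G f (SOME u. U = pres_class R u)" for U
  have h: "h (pres_class R u) = eval_word G f u" for u
  proof -
    have "pres_class R u = pres_class R (SOME v. pres_class R u = pres_class R v)"
      by (rule someI[of _ u]) simp
    then have "pres_eq R u (SOME v. pres_class R u = pres_class R v)"
      by (simp only: pres_class_eq_iff)
    from eval_word_pres_eq[OF this f R] show ?thesis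
      by (simp add: h_def)
  qed
  have "h \<in> hom (presented_group R) G"
    by (rule homI)
       (auto simp: presented_group_carrier presented_group_mult h eval_word_append
          eval_word_closed f)
  moreover have "h (pres_class R [(x, True)]) = f x" for x
    using f by (simp add: h)
  ultimately show ?thesis by blast
qed


section \<open>The groups in the classification\<close>

datatype ab_gen = GenA | GenB

text \<open>\<open>\<langle>a, b | a\<^bsup>p^k\<^esup> = b\<^bsup>p\<^esup> = 1, b\<^sup>-\<^sup>1 a b = a\<^bsup>1 + p^(k-1)\<^esup>\<rangle>\<close>, of order
  \<open>p\<^bsup>k + 1\<^esup>\<close> for \<open>k \<ge> 2\<close>.  For \<open>p = k = 2\<close> this is the dihedral group of order 8: it has ten subgroups,
  five of them in the Chermak-Delgado lattice, so its defect is 5 and not \<open>(k - 1) (p + 1) = 3\<close>.\<close>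

definition modular_p_group :: "nat \<Rightarrow> nat \<Rightarrow> ab_gen gword set monoid" where
  "modular_p_group p k = presented_group
     {(replicate (p ^ k) (GenA, True), []),
      (replicate p (GenB, True), []),
      ([(GenB, False), (GenA, True), (GenB, True)], replicate (1 + p ^ (k - 1)) (GenA, True))}"

text \<open>\<open>Q\<^sub>8 = {\<plusminus>1, \<plusminus>i, \<plusminus>j, \<plusminus>k}\<close>; the pair \<open>(s, x)\<close> with \<open>s \<in> {1, -1}\<close> stands for \<open>s x\<close>.\<close>

datatype quat_unit = Q1 | QI | QJ | QK

fun quat_mult :: "quat_unit \<Rightarrow> quat_unit \<Rightarrow> int \<times> quat_unit" where
  "quat_mult Q1 x = (1, x)"
| "quat_mult x Q1 = (1, x)"
| "quat_mult QI QI = (-1, Q1)"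
| "quat_mult QJ QJ = (-1, Q1)"
| "quat_mult QK QK = (-1, Q1)"
| "quat_mult QI QJ = (1, QK)"
| "quat_mult QJ QK = (1, QI)"
| "quat_mult QK QI = (1, QJ)"
| "quat_mult QJ QI = (-1, QK)"
| "quat_mult QK QJ = (-1, QI)"
| "quat_mult QI QK = (-1, QJ)"

definition quaternion_group :: "(int \<times> quat_unit) monoid" where
  "quaternion_group =
     \<lparr>carrier = {1, -1} \<times> UNIV,
      monoid.mult = (\<lambda>(s, x) (t, y). (s * t * fst (quat_mult x y), snd (quat_mult x y))),
      one = (1, Q1)\<rparr>"

lemma quat_mult_sign: "fst (quat_mult x y) \<in> {1, -1}"
  by (cases x; cases y) auto

lemma quat_mult_assoc:
  "fst (quat_mult x y) * fst (quat_mult (snd (quat_mult x y)) z) =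
     fst (quat_mult y z) * fst (quat_mult x (snd (quat_mult y z)))"
  "snd (quat_mult (snd (quat_mult x y)) z) = snd (quat_mult x (snd (quat_mult y z)))"
  by (cases x; cases y; cases z; simp)+

lemma quat_mult_self: "quat_mult x x = (if x = Q1 then 1 else -1, Q1)"
  by (cases x) auto

lemma group_quaternion_group: "group quaternion_group"
proof (rule groupI)
  fix x y assume "x \<in> carrier quaternion_group" "y \<in> carrier quaternion_group"
  then show "x \<otimes>\<^bsub>quaternion_group\<^esub> y \<in> carrier quaternion_group"
    using quat_mult_sign[of "snd x" "snd y"] by (auto simp: quaternion_group_def)
next
  fix x y z :: "int \<times> quat_unit"
  obtain a x' b y' c z' where xyz: "x = (a, x')" "y = (b, y')" "z = (c, z')"
    by (metis surj_pair)
  have eq: "a * b * P * c * Q = a * (b * c * R) * S" if "P * Q = R * S" for P Q R S :: int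
  proof -
    have "a * b * P * c * Q = a * b * c * (P * Q)" by (simp only: ac_simps)
    also have "\<dots> = a * b * c * (R * S)" by (simp only: that)
    also have "\<dots> = a * (b * c * R) * S" by (simp only: ac_simps)
    finally show ?thesis .
  qed
  show "x \<otimes>\<^bsub>quaternion_group\<^esub> y \<otimes>\<^bsub>quaternion_group\<^esub> z =
      x \<otimes>\<^bsub>quaternion_group\<^esub> (y \<otimes>\<^bsub>quaternion_group\<^esub> z)"
    by (simp add: quaternion_group_def xyz quat_mult_assoc(2) eq[OF quat_mult_assoc(1)])
next
  fix x assume "x \<in> carrier quaternion_group"
  then obtain s u where x: "x = (s, u)" "s = 1 \<or> s = -1"
    by (auto simp: quaternion_group_def)
  show "\<exists>y\<in>carrier quaternion_group. y \<otimes>\<^bsub>quaternion_group\<^esub> x = \<one>\<^bsub>quaternion_group\<^esub>"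
    using x by (intro bexI[of _ "(if u = Q1 then s else - s, u)"])
      (auto simp: quaternion_group_def quat_mult_self)
qed (auto simp: quaternion_group_def)

lemma order_quaternion_group: "order quaternion_group = 8"
proof -
  have "(UNIV :: quat_unit set) = {Q1, QI, QJ, QK}"
    using quat_unit.exhaust by auto
  then have "card (UNIV :: quat_unit set) = card {Q1, QI, QJ, QK}" by (rule arg_cong)
  then have "card (UNIV :: quat_unit set) = 4" by simp
  then show ?thesis
    by (simp add: order_def quaternion_group_def card_cartesian_product)
qed

end

theory Submission
  imports Defs "HOL-Number_Theory.Residues"
begin

text \<open>A member of the Chermak-Delgado lattice contains the center, so the trivial subgroup and all
  subgroups of order \<open>p\<close> other than the center lie outside the lattice, and few subgroups outside the
  lattice means few subgroups of small order.  If there is only one subgroup of order \<open>p\<close>, the group is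
  cyclic or generalized quaternion.

  For odd \<open>p\<close> and \<open>G\<close> noncyclic, the elements with \<open>x\<^sup>p = 1\<close> either number at least \<open>p\<^sup>3\<close>, which gives
  more than \<open>p\<^sup>2 + p\<close> subgroups of order \<open>p\<close>, or form a subgroup \<open>E\<close> of
  order \<open>p\<^sup>2\<close>.  In the second case either \<open>G / E\<close> has many elements of order \<open>p\<close>, and there are too many
  subgroups of order \<open>p\<^sup>2\<close> outside the lattice, or \<open>G\<close> has a cyclic maximal subgroup \<open>\<langle>a\<rangle>\<close>.  Then \<open>G\<close>
  splits over \<open>\<langle>a\<rangle>\<close> and is one of the groups (2) and (4); the subgroups of such a group are counted by
  their intersection with \<open>\<langle>a\<rangle>\<close>.

  For \<open>p = 2\<close> the bound is 6, and at least 7 subgroups outside the lattice are found by distinguishing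
  whether \<open>G\<close> itself lies in the lattice, the index of the center, and the order of the center; the
  involutions, the subgroups of order 4 and the maximal subgroups supply them.\<close>

section \<open>Finite p-groups\<close>

text \<open>Everything hinges on the geometric sum 1 + r + ... + r^(p-1) for an element x acting on
  a cyclic group <a> by a -> a^r, with r = 1 modulo p. It controls the p-th powers of the elements x
  a^i. For odd p it is always p times a unit modulo p, for p = 2 only if r = 1 modulo 4. When it is,
  some x a^i has trivial p-th power as soon as x^p is a power of a^p. The failure for p = 2 leaves
  room for the quaternion groups, makes the dihedral group of order 8 an exception to the formula
  for the modular groups, and is the reason for a separate treatment of p = 2.

  The bound p^2 + p is one less than (p^3 - 1) / (p - 1), the number of subgroups of order p that
  p^3 solutions of x^p = 1 provide. One of these may be the center and lie in the lattice; the
  trivial subgroup makes up for it.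

  For p = 2 subgroups of order 2 alone are too few. If G lies in the lattice, every abelian subgroup
  A satisfies |A|^2 <= |G| |Z(G)|, which cuts down the possible orders; if it does not, the center
  is outside the lattice as well.\<close>

context group begin

lemma inv_cancel_left [simp]:
  "\<lbrakk>x \<in> carrier G; y \<in> carrier G\<rbrakk> \<Longrightarrow> x \<otimes> (inv x \<otimes> y) = y"
  "\<lbrakk>x \<in> carrier G; y \<in> carrier G\<rbrakk> \<Longrightarrow> inv x \<otimes> (x \<otimes> y) = y"
  by (simp_all flip: m_assoc)

lemmas group_normalize = m_assoc inv_mult_group

lemma conj_eq_iff:
  assumes "x \<in> carrier G" "y \<in> carrier G" "z \<in> carrier G"
  shows "inv x \<otimes> y \<otimes> x = z \<longleftrightarrow> y \<otimes> x = x \<otimes> z"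
    and "x \<otimes> y \<otimes> inv x = z \<longleftrightarrow> x \<otimes> y = z \<otimes> x"
  using assms inv_solve_left'[of z x "y \<otimes> x"] inv_solve_right'[of z "x \<otimes> y" x]
  by (simp_all only: m_assoc m_closed inv_closed)

lemma pow_conj:
  assumes "x \<in> carrier G" "y \<in> carrier G"
  shows "(inv x \<otimes> y \<otimes> x) [^] (n::nat) = inv x \<otimes> y [^] n \<otimes> x"
  using assms by (induction n) (simp_all add: m_assoc)

lemma commute_inv:
  assumes "x \<in> carrier G" "y \<in> carrier G" "x \<otimes> y = y \<otimes> x"
  shows "inv x \<otimes> y = y \<otimes> inv x"
  using assms conj_eq_iff(1)[of x y y] conj_eq_iff(2)[of "inv x" y y] by simp

lemma subgroup_pow_closed:
  assumes "subgroup H G" "x \<in> H"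
  shows "x [^] (n::nat) \<in> H"
  using subgroup.one_closed[OF assms(1)] subgroup.m_closed[OF assms(1) _ assms(2)]
  by (induction n) simp_all

lemma subgroup_cancel:
  assumes "subgroup H G" "x \<in> H" "y \<in> carrier G"
  shows "x \<otimes> y \<in> H \<longleftrightarrow> y \<in> H" "y \<otimes> x \<in> H \<longleftrightarrow> y \<in> H"
proof -
  have x: "x \<in> carrier G" by (rule subgroup.mem_carrier[OF assms(1,2)])
  have ix: "inv x \<in> H" using subgroup.m_inv_closed[OF assms(1,2)] .
  have "inv x \<otimes> (x \<otimes> y) = y" using assms x by simp
  then show "x \<otimes> y \<in> H \<longleftrightarrow> y \<in> H"
    using subgroup.m_closed[OF assms(1) ix, of "x \<otimes> y"] subgroup.m_closed[OF assms(1,2), of y] by auto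
  have "y \<otimes> x \<otimes> inv x = y" using assms x by (simp add: m_assoc)
  then show "y \<otimes> x \<in> H \<longleftrightarrow> y \<in> H"
    using subgroup.m_closed[OF assms(1) _ ix, of "y \<otimes> x"] subgroup.m_closed[OF assms(1) _ assms(2), of y]
    by auto
qed

text \<open>Orbit lengths divide p^n, so every orbit with more than one point contributes a multiple
  of p. The action is given as a plain function, so that translation of cosets and conjugation of
  subgroups can be plugged in directly.\<close>

lemma card_fixed_points_mod:
  assumes p: "Factorial_Ring.prime (p::nat)" and ord: "order G = p ^ n" and fin: "finite S"
    and act: "\<And>g x. \<lbrakk>g \<in> carrier G; x \<in> S\<rbrakk> \<Longrightarrow> f g x \<in> S"
    and one: "\<And>x. x \<in> S \<Longrightarrow> f \<one> x = x"
    and mult: "\<And>g h x. \<lbrakk>g \<in> carrier G; h \<in> carrier G; x \<in> S\<rbrakk> \<Longrightarrow> f (g \<otimes> h) x = f g (f h x)"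
  shows "[card {x \<in> S. \<forall>g\<in>carrier G. f g x = x} = card S] (mod p)"
proof -
  \<comment> \<open>\<open>BijGroup\<close> consists of extensional maps, hence the restriction to
    \<open>S\<close>.\<close>
  define \<phi> where "\<phi> g = restrict (f g) S" for g
  have bij: "bij_betw (f g) S S" if "g \<in> carrier G" for g
    using that act one mult by (intro bij_betwI[where g = "f (inv g)"]) (auto simp flip: mult)
  have hom: "\<phi> \<in> hom G (BijGroup S)"
  proof (rule homI)
    show "\<phi> g \<in> carrier (BijGroup S)" if "g \<in> carrier G" for g
      using bij[OF that] by (auto simp: BijGroup_def \<phi>_def Bij_def)
    show "\<phi> (g \<otimes> h) = \<phi> g \<otimes>\<^bsub>BijGroup S\<^esub> \<phi> h" if "g \<in> carrier G" "h \<in> carrier G" for g h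
      using bij that act mult
      by (auto simp: BijGroup_def \<phi>_def Bij_def compose_def fun_eq_iff)
  qed
  interpret group_action G S \<phi>
    by (intro group_action.intro group_hom.intro group_axioms group_BijGroup group_hom_axioms.intro hom)
  define F where "F = {x \<in> S. \<forall>g\<in>carrier G. f g x = x}"
  have "p dvd card (orbit G \<phi> x)" if x: "x \<in> S - F" for x
  proof -
    have "card (orbit G \<phi> x) dvd p ^ n"
      using orbit_stabilizer_theorem[of x] x ord by (metis DiffD1 dvd_triv_left)
    then obtain j where j: "card (orbit G \<phi> x) = p ^ j"
      using p divides_primepow_nat by blast
    obtain g where g: "g \<in> carrier G" "f g x \<noteq> x" using x by (auto simp: F_def)
    have "\<phi> \<one> x = x" "\<phi> g x = f g x" using x one by (auto simp: \<phi>_def)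
    then have "x \<in> orbit G \<phi> x" "f g x \<in> orbit G \<phi> x"
      using g(1) one_closed unfolding orbit_def by (metis (mono_tags, lifting) mem_Collect_eq)+
    then have "card (orbit G \<phi> x) \<noteq> 1" using g(2) by (auto simp: card_1_singleton_iff)
    then have "j \<noteq> 0" using j by auto
    then show ?thesis using j by auto
  qed
  \<comment> \<open>A point moved onto a fixed point is itself fixed, so the other points are closed
    under the action.\<close>
  moreover have "S - F = \<Union> (orbit G \<phi> ` (S - F))"
  proof -
    have "f h x \<in> S - F" if "h \<in> carrier G" "x \<in> S - F" for h x
    proof (rule ccontr)
      assume "f h x \<notin> S - F"
      then have F: "f h x \<in> F" using that act by blast
      have "f (inv h) (f h x) = x" using that one by (simp flip: mult)
      then have "f h x = x" using F that by (auto simp: F_def)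
      then show False using F that by simp
    qed
    moreover have "x \<in> orbit G \<phi> x" if "x \<in> S" for x
      using that one by (force simp: orbit_def \<phi>_def)
    ultimately show ?thesis by (fastforce simp: orbit_def \<phi>_def)
  qed
  moreover have "disjoint (orbit G \<phi> ` (S - F))"
    using disjoint_union by (auto simp: pairwise_def disjnt_def orbits_def)
  ultimately have "p dvd card (S - F)"
    using fin by (intro dvd_partition[of "orbit G \<phi> ` (S - F)", folded \<open>S - F = _\<close>])
      (auto simp: pairwise_def disjnt_def)
  then have "[card (S - F) + card F = 0 + card F] (mod p)"
    by (intro cong_add) (auto simp: cong_0_iff)
  moreover have "card (S - F) + card F = card S"
    using fin by (metis (no_types, lifting) F_def add.commute card_Diff_subset card_mono
      finite_subset le_add_diff_inverse mem_Collect_eq subsetI)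
  ultimately show ?thesis by (simp add: F_def cong_sym)
qed

text \<open>If p does not divide i, Bezout gives i u = p v + 1 and expresses x through x^i and x^p,
  which would both lie in \<open>N\<close>.\<close>

lemma pow_mem_subgroup_iff:
  assumes N: "subgroup N G" and x: "x \<in> carrier G" "x \<notin> N" "x [^] (p::nat) \<in> N"
    and p: "Factorial_Ring.prime p"
  shows "x [^] (i::nat) \<in> N \<longleftrightarrow> p dvd i"
proof
  assume "p dvd i"
  then obtain j where "i = p * j" by auto
  then have "x [^] i = (x [^] p) [^] j" using x by (simp add: nat_pow_pow)
  then show "x [^] i \<in> N" using subgroup_pow_closed[OF N x(3)] by simp
next
  assume i: "x [^] i \<in> N"
  show "p dvd i"
  proof (rule ccontr)
    assume "\<not> p dvd i"
    then have "coprime i p" using p by (metis coprime_commute prime_imp_coprime)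
    moreover have "i \<noteq> 0" using \<open>\<not> p dvd i\<close> by (metis dvd_0_right)
    ultimately obtain u v where "i * u = p * v + 1"
      using bezout_nat[of i p] by auto
    then have "(x [^] i) [^] u = (x [^] p) [^] v \<otimes> x"
      using x by (simp add: nat_pow_pow nat_pow_mult)
    then have "(x [^] p) [^] v \<otimes> x \<in> N" using subgroup_pow_closed[OF N i] by metis
    then show False
      using subgroup_cancel(1)[OF N subgroup_pow_closed[OF N x(3)] x(1)] x(2) by blast
  qed
qed

lemma conj_pow_mem:
  assumes N: "subgroup N G" and x: "x \<in> carrier G" "\<And>n. n \<in> N \<Longrightarrow> inv x \<otimes> n \<otimes> x \<in> N"
    and n: "n \<in> N"
  shows "inv (x [^] (j::nat)) \<otimes> n \<otimes> x [^] j \<in> N"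
proof (induction j)
  case (Suc j)
  have "inv (x [^] Suc j) \<otimes> n \<otimes> x [^] Suc j = inv x \<otimes> (inv (x [^] j) \<otimes> n \<otimes> x [^] j) \<otimes> x"
    using x(1) subgroup.mem_carrier[OF N n] by (simp add: group_normalize)
  then show ?case using x(2)[OF Suc] by simp
qed (use n subgroup.mem_carrier[OF N n] in simp)

end

text \<open>Natural exponents suffice in a finite group (\<open>cyc_eq_generate\<close>). As no
  inverse occurs, the set does not change when the carrier is cut down to a subgroup, which gives
  \<open>cyc_restrict\<close>.\<close>

definition cyc :: "('a, 'b) monoid_scheme \<Rightarrow> 'a \<Rightarrow> 'a set" where
  "cyc G x = range (\<lambda>i::nat. x [^]\<^bsub>G\<^esub> i)"

lemma cyc_restrict [simp]: "cyc (G\<lparr>carrier := H\<rparr>) x = cyc G x"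
  by (simp add: cyc_def nat_pow_def)

lemma pow_in_cyc [simp, intro]: "x [^]\<^bsub>G\<^esub> (i::nat) \<in> cyc G x"
  by (simp add: cyc_def)

section \<open>Cyclic subgroups and adjoining a normalizing element\<close>

locale finite_group = group G for G (structure) +
  assumes fin [simp, intro]: "finite (carrier G)"
begin

lemma cyc_eq_generate: "x \<in> carrier G \<Longrightarrow> cyc G x = generate G {x}"
  using generate_pow_on_finite_carrier[OF fin, of x] by (auto simp: cyc_def)

lemma subgroup_cyc: "x \<in> carrier G \<Longrightarrow> subgroup (cyc G x) G"
  using cyc_eq_generate generate_is_subgroup by simp

lemma card_cyc: "x \<in> carrier G \<Longrightarrow> card (cyc G x) = ord x"
  using cyc_eq_generate generate_pow_card by simp

lemma self_in_cyc: "x \<in> carrier G \<Longrightarrow> x \<in> cyc G x"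
  using pow_in_cyc[of G x 1] by simp

lemma cyc_subset: "\<lbrakk>subgroup H G; x \<in> H\<rbrakk> \<Longrightarrow> cyc G x \<subseteq> H"
  using subgroup_pow_closed by (auto simp: cyc_def)

lemma ord_pos: "x \<in> carrier G \<Longrightarrow> 0 < ord x"
  using ord_ge_1[OF fin, of x] by simp

lemma finite_subgroup: "subgroup H G \<Longrightarrow> finite H"
  using finite_subset[OF subgroup.subset] by blast

lemma finite_subgroups_of: "finite (subgroups_of G)"
  by (rule finite_subset[of _ "Pow (carrier G)"]) (auto simp: subgroups_of_def dest: subgroup.subset)

lemma order_pos: "0 < order G"
  by (simp add: order_gt_0_iff_finite)

lemma finite_group_restrict: "subgroup H G \<Longrightarrow> finite_group (G\<lparr>carrier := H\<rparr>)"
  by (simp add: finite_group_axioms_def finite_group_def finite_subgroup subgroup.subgroup_is_group)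

lemma inv_eq_pow: "x \<in> carrier G \<Longrightarrow> inv x = x [^] (ord x - 1)"
  using ord_pos[of x] pow_ord_eq_1[of x] by (metis Suc_diff_1 inv_equality nat_pow_Suc nat_pow_closed)

lemma subgroup_finiteI:
  assumes "H \<subseteq> carrier G" "\<one> \<in> H" "\<And>x y. \<lbrakk>x \<in> H; y \<in> H\<rbrakk> \<Longrightarrow> x \<otimes> y \<in> H"
  shows "subgroup H G"
proof (rule subgroupI)
  fix x assume x: "x \<in> H"
  have "x [^] (i::nat) \<in> H" for i using assms x by (induction i) auto
  then show "inv x \<in> H" using assms(1) x inv_eq_pow by auto
qed (use assms in auto)

text \<open>The subgroup generated by a subgroup \<open>N\<close> and an element \<open>x\<close> normalizing it.\<close>

definition adjoin :: "'a set \<Rightarrow> 'a \<Rightarrow> 'a set" where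
  "adjoin N x = {x [^] (j::nat) \<otimes> n | j n. n \<in> N}"

lemma adjoin_superset: "subgroup N G \<Longrightarrow> N \<subseteq> adjoin N x"
  unfolding adjoin_def using subgroup.mem_carrier[of N G] l_one nat_pow_0
  by (smt (verit, ccfv_SIG) mem_Collect_eq subsetI)

lemma adjoin_self: "\<lbrakk>subgroup N G; x \<in> carrier G\<rbrakk> \<Longrightarrow> x \<in> adjoin N x"
  unfolding adjoin_def
  by (auto intro!: exI[of _ "1::nat"] exI[of _ \<one>] simp: subgroup.one_closed)

lemma subgroup_adjoin:
  assumes N: "subgroup N G" and x: "x \<in> carrier G" "\<And>n. n \<in> N \<Longrightarrow> inv x \<otimes> n \<otimes> x \<in> N"
  shows "subgroup (adjoin N x) G"
proof (rule subgroup_finiteI)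
  show "adjoin N x \<subseteq> carrier G"
    using x subgroup.mem_carrier[OF N] by (auto simp: adjoin_def)
  show "\<one> \<in> adjoin N x" using adjoin_superset[OF N] subgroup.one_closed[OF N] by blast
  fix u v assume "u \<in> adjoin N x" "v \<in> adjoin N x"
  then obtain i j :: nat and m n where uv: "u = x [^] i \<otimes> m" "v = x [^] j \<otimes> n" "m \<in> N" "n \<in> N"
    by (auto simp: adjoin_def)
  have "u \<otimes> v = x [^] (i + j) \<otimes> ((inv (x [^] j) \<otimes> m \<otimes> x [^] j) \<otimes> n)"
    using uv x(1) subgroup.mem_carrier[OF N] by (simp add: group_normalize flip: nat_pow_mult)
  moreover have "(inv (x [^] j) \<otimes> m \<otimes> x [^] j) \<otimes> n \<in> N"
    using conj_pow_mem[OF N x uv(3)] uv(4) subgroup.m_closed[OF N] by blast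
  ultimately show "u \<otimes> v \<in> adjoin N x" unfolding adjoin_def by blast
qed

text \<open>If x^j m with m in \<open>N\<close> lies in \<open>A\<close>, then so does x^j. Hence p
  divides j, and x^j is already in \<open>N\<close>.\<close>

lemma adjoin_Int:
  assumes N: "subgroup N G" and A: "subgroup A G" "N \<subseteq> A"
    and x: "x \<in> carrier G" "x \<notin> A" "x [^] (p::nat) \<in> N"
    and p: "Factorial_Ring.prime p"
  shows "adjoin N x \<inter> A = N"
proof
  show "N \<subseteq> adjoin N x \<inter> A" using adjoin_superset[OF N] A by blast
  show "adjoin N x \<inter> A \<subseteq> N"
  proof
    fix u assume u: "u \<in> adjoin N x \<inter> A"
    then obtain j :: nat and n where jn: "u = x [^] j \<otimes> n" "n \<in> N" by (auto simp: adjoin_def)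
    then have "x [^] j \<in> A" using u subgroup_cancel(2)[OF A(1), of n "x [^] j"] A(2) x(1) by auto
    then have "p dvd j" using pow_mem_subgroup_iff[OF A(1) x(1,2) _ p] A(2) x(3) by blast
    moreover have "x \<notin> N" using A x by blast
    ultimately have "x [^] j \<in> N" using pow_mem_subgroup_iff[OF N x(1) _ x(3) p] by blast
    then show "u \<in> N" using jn subgroup.m_closed[OF N] by blast
  qed
qed

text \<open>The p cosets x^j \<open>N\<close> with j < p are distinct and, since x^p is in
  \<open>N\<close>, exhaust the set.\<close>

lemma card_adjoin:
  assumes N: "subgroup N G" and x: "x \<in> carrier G" "x \<notin> N" "x [^] (p::nat) \<in> N"
    and p: "Factorial_Ring.prime p"
  shows "card (adjoin N x) = p * card N"
proof -
  have memN: "m \<in> carrier G" if "m \<in> N" for m using subgroup.mem_carrier[OF N that] .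
  let ?f = "\<lambda>(j::nat, n). x [^] j \<otimes> n"
  have key: "i = j \<and> m = n" if "x [^] i \<otimes> m = x [^] j \<otimes> n" "i \<le> j" "j < p" "m \<in> N" "n \<in> N" for i j m n
  proof -
    have "x [^] i \<otimes> m = x [^] i \<otimes> (x [^] (j - i) \<otimes> n)"
      using that x(1) memN by (simp add: nat_pow_mult flip: m_assoc)
    then have "m = x [^] (j - i) \<otimes> n" using that x(1) memN by simp
    then have "x [^] (j - i) \<in> N" using subgroup_cancel(2)[OF N, of n "x [^] (j - i)"] that x(1) by auto
    then have "p dvd j - i" using pow_mem_subgroup_iff[OF N x p] by blast
    then have "j - i = 0" using that by (metis less_imp_diff_less nat_dvd_not_less neq0_conv)
    then have "i = j" using that(2) by simp
    then show ?thesis using \<open>m = x [^] (j - i) \<otimes> n\<close> that memN by simp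
  qed
  have "inj_on ?f ({..<p} \<times> N)"
  proof (rule inj_onI)
    fix u v assume uv: "u \<in> {..<p} \<times> N" "v \<in> {..<p} \<times> N" "?f u = ?f v"
    obtain i m j n where eq: "u = (i, m)" "v = (j, n)" by (metis surj_pair)
    with uv have A: "i < p" "j < p" "m \<in> N" "n \<in> N" "x [^] i \<otimes> m = x [^] j \<otimes> n" by auto
    have "i = j \<and> m = n"
    proof (cases "i \<le> j")
      case True then show ?thesis using key[OF A(5)] A by simp
    next
      case False then show ?thesis using key[OF A(5)[symmetric]] A by simp
    qed
    then show "u = v" using eq by simp
  qed
  moreover have "?f ` ({..<p} \<times> N) = adjoin N x"
  proof
    show "?f ` ({..<p} \<times> N) \<subseteq> adjoin N x" by (auto simp: adjoin_def)
    show "adjoin N x \<subseteq> ?f ` ({..<p} \<times> N)"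
    proof
      fix u assume "u \<in> adjoin N x"
      then obtain j :: nat and n where jn: "u = x [^] j \<otimes> n" "n \<in> N" by (auto simp: adjoin_def)
      have "x [^] j = x [^] (j mod p) \<otimes> (x [^] p) [^] (j div p)"
        using x(1) by (simp add: nat_pow_pow nat_pow_mult)
      then have "u = x [^] (j mod p) \<otimes> ((x [^] p) [^] (j div p) \<otimes> n)"
        using jn x(1) memN by (simp add: m_assoc)
      moreover have "(x [^] p) [^] (j div p) \<otimes> n \<in> N"
        using jn subgroup_pow_closed[OF N x(3)] subgroup.m_closed[OF N] by blast
      moreover have "j mod p < p" using p prime_gt_0_nat by simp
      ultimately show "u \<in> ?f ` ({..<p} \<times> N)" by force
    qed
  qed
  ultimately show ?thesis
    by (metis card_cartesian_product card_image card_lessThan)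
qed

end

section \<open>Groups of prime power order: growing normalizers and maximal subgroups\<close>

locale p_group = finite_group G for G (structure) +
  fixes p n :: nat
  assumes prime_p: "Factorial_Ring.prime p" and order_eq: "order G = p ^ n"
begin

lemma p_gt: "p > 0" "p > 1" "p \<ge> 2"
  using prime_p prime_gt_0_nat prime_gt_1_nat prime_ge_2_nat by auto

lemma card_subgroup:
  assumes "subgroup H G"
  shows "\<exists>j\<le>n. card H = p ^ j"
proof -
  have "card H dvd p ^ n" using lagrange[OF assms] order_eq by (metis dvd_triv_right)
  then show ?thesis using prime_p divides_primepow_nat by blast
qed

lemma p_group_restrict: "subgroup H G \<Longrightarrow> card H = p ^ j \<Longrightarrow> p_group (G\<lparr>carrier := H\<rparr>) p j"
  using finite_group_restrict prime_p by (simp add: p_group_def p_group_axioms_def order_def)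

lemma ord_dvd: "x \<in> carrier G \<Longrightarrow> ord x dvd p ^ n"
  using ord_dvd_group_order order_eq by metis

lemma ord_eq_pow: "x \<in> carrier G \<Longrightarrow> \<exists>j\<le>n. ord x = p ^ j"
  using ord_dvd divides_primepow_nat[OF prime_p] by blast

text \<open>The order of x is a power of p, so among x, x^p, x^(p^2), ... there is a last one
  outside \<open>H\<close>.\<close>

lemma ex_pow_leaving:
  assumes H: "subgroup H G" and x: "x \<in> carrier G" "x \<notin> H"
  shows "\<exists>m::nat. x [^] m \<notin> H \<and> (x [^] m) [^] p \<in> H"
proof -
  define j where "j = (LEAST j. x [^] (p ^ j) \<in> H)"
  have "x [^] (p ^ n) \<in> H"
    using x(1) pow_order_eq_1[OF x(1)] order_eq subgroup.one_closed[OF H] by simp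
  then have j: "x [^] (p ^ j) \<in> H" unfolding j_def by (rule LeastI)
  have "j \<noteq> 0" using j x by (intro notI) simp
  then have "j - 1 < (LEAST j. x [^] (p ^ j) \<in> H)" unfolding j_def by simp
  then have "x [^] (p ^ (j - 1)) \<notin> H" by (rule not_less_Least)
  moreover have "(x [^] (p ^ (j - 1))) [^] p = x [^] (p ^ j)"
    using \<open>j \<noteq> 0\<close> x(1) by (metis nat_pow_pow power_minus_mult gr0I)
  ultimately show ?thesis using j by metis
qed

text \<open>Normalizers grow: \<open>H\<close> acts on its cosets, and the fixed cosets are those inside its normalizer.\<close>

lemma ex_normalizing:
  assumes H: "subgroup H G" "H \<noteq> carrier G"
  shows "\<exists>x\<in>carrier G - H. x [^] p \<in> H \<and> (\<forall>h\<in>H. inv x \<otimes> h \<otimes> x \<in> H)"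
proof -
  have Hc: "H \<subseteq> carrier G" using H(1) subgroup.subset by blast
  obtain j where j: "card H = p ^ j" using card_subgroup[OF H(1)] by blast
  interpret Hg: p_group "G\<lparr>carrier := H\<rparr>" p j using p_group_restrict[OF H(1) j] .
  \<comment> \<open>The inverse turns right translation into a left action.\<close>
  let ?f = "\<lambda>h C. C #> inv h"
  let ?F = "{C \<in> rcosets H. \<forall>h\<in>H. ?f h C = C}"
  have finR: "finite (rcosets H)" using rcosets_finite[OF _ Hc finite_subgroup[OF H(1)]]
    by (metis finite_Pow_iff finite_subset fin rcosets_subset_PowG[OF H(1)])
  have sub: "C \<subseteq> carrier G" if "C \<in> rcosets H" for C
    using that rcosets_subset_PowG[OF H(1)] by blast
  have fixed: "[card {C \<in> rcosets H. \<forall>h\<in>carrier (G\<lparr>carrier := H\<rparr>). ?f h C = C} = card (rcosets H)] (mod p)"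
  proof (rule Hg.card_fixed_points_mod[OF prime_p Hg.order_eq finR])
    fix h C assume "h \<in> carrier (G\<lparr>carrier := H\<rparr>)" "C \<in> rcosets H"
    moreover then obtain g where "g \<in> carrier G" "C = H #> g" by (auto simp: RCOSETS_def)
    ultimately have "C #> inv h = H #> (g \<otimes> inv h)" "g \<otimes> inv h \<in> carrier G"
      using Hc by (auto simp: coset_mult_assoc subset_iff)
    then show "C #> inv h \<in> rcosets H" using rcosetsI[OF Hc] by metis
  next
    fix C assume "C \<in> rcosets H"
    then show "C #> inv \<one>\<^bsub>G\<lparr>carrier := H\<rparr>\<^esub> = C" using sub by simp
  next
    fix g h C assume "g \<in> carrier (G\<lparr>carrier := H\<rparr>)" "h \<in> carrier (G\<lparr>carrier := H\<rparr>)" "C \<in> rcosets H"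
    then show "C #> inv (g \<otimes>\<^bsub>G\<lparr>carrier := H\<rparr>\<^esub> h) = C #> inv h #> inv g"
      using sub Hc by (simp add: coset_mult_assoc inv_mult_group subset_iff)
  qed
  have lag: "card (rcosets H) * p ^ j = p ^ n" using lagrange[OF H(1)] order_eq j by simp
  have "card (rcosets H) \<noteq> 1"
  proof
    assume "card (rcosets H) = 1"
    then have "card H = card (carrier G)" using lag j order_eq by (simp add: order_def)
    then show False using H(2) Hc card_subset_eq[OF fin Hc] by blast
  qed
  moreover have "card (rcosets H) dvd p ^ n" using lag by (metis dvd_triv_left)
  ultimately have "p dvd card (rcosets H)" using divides_primepow_nat[OF prime_p]
    by (metis dvd_power gr0I power_0)
  then have "p dvd card ?F" using fixed by (simp add: cong_dvd_iff)
  moreover have "H \<in> ?F"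
  proof -
    have "H = H #> \<one>" using Hc by simp
    then have "H \<in> rcosets H" using rcosetsI[OF Hc one_closed] by simp
    moreover have "H #> inv h = H" if "h \<in> H" for h
      using that H(1) Hc subgroup.m_inv_closed[OF H(1)] by (intro coset_join2) auto
    ultimately show ?thesis by blast
  qed
  moreover have "finite ?F" using finR by simp
  ultimately have "card ?F \<ge> p" "H \<in> ?F" by (auto intro!: dvd_imp_le simp: card_gt_0_iff)
  \<comment> \<open>The number of fixed cosets is a positive multiple of p, so \<open>H\<close> is
    not the only one. A representative g of another one satisfies g h g^-1 \<in> H for all h in
    H.\<close>
  then have "\<not> ?F \<subseteq> {H}" using p_gt(2) card_mono[of "{H}" ?F] by auto
  then obtain C where C: "C \<in> ?F" "C \<noteq> H" by blast
  then obtain g where g: "g \<in> carrier G" "C = H #> g" by (auto simp: RCOSETS_def)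
  have gH: "g \<notin> H" using g C(2) coset_join2[OF g(1) H(1)] by blast
  have conj: "g \<otimes> h \<otimes> inv g \<in> H" if "h \<in> H" for h
  proof -
    have hc: "h \<in> carrier G" using that Hc by blast
    have "H #> g #> h = H #> g"
    proof -
      have "C #> inv (inv h) = C" using C(1) subgroup.m_inv_closed[OF H(1) that] by blast
      then show ?thesis using g(2) hc by simp
    qed
    then have "H #> (g \<otimes> h) = H #> g" using g hc Hc by (simp add: coset_mult_assoc)
    then have "g \<otimes> h \<in> H #> g" using rcos_self[of "g \<otimes> h" H] g hc H(1) by simp
    then obtain k where "k \<in> H" "g \<otimes> h = k \<otimes> g" by (auto simp: r_coset_def)
    then show ?thesis using g(1) Hc conj_eq_iff(2)[of g h k] hc by auto
  qed
  define x where "x = inv g"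
  have x: "x \<in> carrier G" "x \<notin> H" "\<And>h. h \<in> H \<Longrightarrow> inv x \<otimes> h \<otimes> x \<in> H"
    using g gH conj subgroup.m_inv_closed[OF H(1), of "inv g"] by (auto simp: x_def)
  \<comment> \<open>A suitable power has its p-th power in \<open>H\<close>, and powers still
    normalize \<open>H\<close>.\<close>
  obtain m :: nat where m: "x [^] m \<notin> H" "(x [^] m) [^] p \<in> H" using ex_pow_leaving[OF H(1) x(1,2)] by blast
  show ?thesis
    using m x(1) conj_pow_mem[OF H(1) x(1,3), of _ m] by (intro bexI[of _ "x [^] m"]) auto
qed

lemma adjoin_normalizing:
  assumes H: "subgroup H G" "H \<noteq> carrier G"
  obtains x where "x \<in> carrier G" "x \<notin> H" "x [^] p \<in> H" "\<And>h. h \<in> H \<Longrightarrow> inv x \<otimes> h \<otimes> x \<in> H"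
    "subgroup (adjoin H x) G" "card (adjoin H x) = p * card H" "H \<subseteq> adjoin H x" "x \<in> adjoin H x"
  using ex_normalizing[OF H] subgroup_adjoin[OF H(1)] card_adjoin[OF H(1) _ _ _ prime_p]
    adjoin_superset[OF H(1)] adjoin_self[OF H(1)]
  by (metis DiffE)

text \<open>Adjoining to \<open>M\<close> an element that normalizes it already gives all of
  G.\<close>

lemma index_p_normal:
  assumes M: "subgroup M G" "order G = p * card M" and g: "g \<in> carrier G" "m \<in> M"
  shows "inv g \<otimes> m \<otimes> g \<in> M"
proof -
  have "0 < card M" using finite_subgroup[OF M(1)] subgroup.one_closed[OF M(1)] card_gt_0_iff by blast
  then have "M \<noteq> carrier G" using M(2) p_gt by (auto simp: order_def)
  then obtain x where x: "x \<in> carrier G" "\<And>h. h \<in> M \<Longrightarrow> inv x \<otimes> h \<otimes> x \<in> M"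
    "subgroup (adjoin M x) G" "card (adjoin M x) = p * card M"
    using adjoin_normalizing[OF M(1)] by metis
  then have "adjoin M x = carrier G"
    using M(2) card_subset_eq[OF fin subgroup.subset[OF x(3)]] by (simp add: order_def)
  then have "g \<in> adjoin M x" using g(1) by simp
  then obtain j :: nat and k where jk: "g = x [^] j \<otimes> k" "k \<in> M" by (auto simp: adjoin_def)
  have c: "k \<in> carrier G" "m \<in> carrier G" using jk g subgroup.mem_carrier[OF M(1)] by auto
  have "inv g \<otimes> m \<otimes> g = inv k \<otimes> (inv (x [^] j) \<otimes> m \<otimes> x [^] j) \<otimes> k"
    using jk c x(1) by (simp add: group_normalize)
  then show ?thesis
    using conj_pow_mem[OF M(1) x(1,2) g(2)] jk(2)
    by (simp add: subgroup.m_closed[OF M(1)] subgroup.m_inv_closed[OF M(1)])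
qed

text \<open>A proper subgroup over \<open>H\<close> of largest order is enlarged by
  \<open>adjoin_normalizing\<close> by the factor p, and the result can only be G.\<close>

lemma ex_maximal_supergroup:
  assumes H: "subgroup H G" "H \<noteq> carrier G"
  shows "\<exists>M. subgroup M G \<and> H \<subseteq> M \<and> order G = p * card M"
proof -
  let ?S = "{M. subgroup M G \<and> H \<subseteq> M \<and> M \<noteq> carrier G}"
  have "finite ?S" by (rule finite_subset[OF _ finite_subgroups_of]) (auto simp: subgroups_of_def)
  moreover have "?S \<noteq> {}" using H by blast
  ultimately have "Max (card ` ?S) \<in> card ` ?S" by (intro Max_in) auto
  then obtain M where "M \<in> ?S" "card M = Max (card ` ?S)" by (metis (no_types, lifting) imageE)
  then have M: "M \<in> ?S" "\<And>N. N \<in> ?S \<Longrightarrow> card N \<le> card M"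
    using \<open>finite ?S\<close> by auto
  then obtain x where x: "subgroup (adjoin M x) G" "card (adjoin M x) = p * card M" "M \<subseteq> adjoin M x"
    using adjoin_normalizing[of M] by (metis (mono_tags, lifting) mem_Collect_eq)
  have "0 < card M" using M(1) finite_subgroup subgroup.one_closed card_gt_0_iff by blast
  then have "card M < card (adjoin M x)" using x(2) p_gt by simp
  then have "adjoin M x = carrier G" using M x by (metis (mono_tags, lifting) mem_Collect_eq not_less order_trans)
  then show ?thesis using M x by (auto simp: order_def)
qed

end

section \<open>Chermak-Delgado measure\<close>

context group begin

abbreviation center :: "'a set" where
  "center \<equiv> centralizer G (carrier G)"

lemma centralizer_subset: "centralizer G S \<subseteq> carrier G"
  by (auto simp: centralizer_def)

lemma centralizerD: "\<lbrakk>g \<in> centralizer G S; h \<in> S\<rbrakk> \<Longrightarrow> g \<otimes> h = h \<otimes> g"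
  by (auto simp: centralizer_def)

lemma centralizer_antimono: "S \<subseteq> T \<Longrightarrow> centralizer G T \<subseteq> centralizer G S"
  by (auto simp: centralizer_def)

lemma centralizer_Un: "centralizer G (S \<union> T) = centralizer G S \<inter> centralizer G T"
  by (auto simp: centralizer_def)

lemma subgroup_centralizer:
  assumes "S \<subseteq> carrier G"
  shows "subgroup (centralizer G S) G"
proof (rule subgroupI)
  fix a b assume a: "a \<in> centralizer G S"
  then have ac: "a \<in> carrier G" by (simp add: centralizer_def)
  show "inv a \<in> centralizer G S"
    using a ac assms commute_inv[of a] by (auto simp: centralizer_def)
  assume b: "b \<in> centralizer G S"
  then have bc: "b \<in> carrier G" by (simp add: centralizer_def)
  have "a \<otimes> b \<otimes> s = s \<otimes> (a \<otimes> b)" if "s \<in> S" for s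
  proof -
    have s: "s \<in> carrier G" using that assms by blast
    have "a \<otimes> b \<otimes> s = a \<otimes> s \<otimes> b" using ac bc s centralizerD[OF b that] by (simp add: m_assoc)
    then show ?thesis using ac bc s centralizerD[OF a that] by (simp add: m_assoc)
  qed
  then show "a \<otimes> b \<in> centralizer G S" using ac bc by (simp add: centralizer_def)
next
  have "\<one> \<in> centralizer G S" using assms by (auto simp: centralizer_def)
  then show "centralizer G S \<noteq> {}" by blast
qed (auto simp: centralizer_def)

lemma subgroup_center: "subgroup center G"
  by (rule subgroup_centralizer) simp

text \<open>The double centralizer of \<open>S\<close> is a subgroup containing \<open>S\<close>, so
  it contains what \<open>S\<close> generates.\<close>

lemma centralizer_generate:
  assumes "S \<subseteq> carrier G"
  shows "centralizer G (generate G S) = centralizer G S"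
proof
  show "centralizer G (generate G S) \<subseteq> centralizer G S"
    by (rule centralizer_antimono) (auto intro: generate.incl)
  have "S \<subseteq> centralizer G (centralizer G S)" using assms by (auto simp: centralizer_def)
  then have "generate G S \<subseteq> centralizer G (centralizer G S)"
    by (rule generate_subgroup_incl[OF _ subgroup_centralizer[OF centralizer_subset]])
  then show "centralizer G S \<subseteq> centralizer G (generate G S)"
    by (fastforce simp: centralizer_def)
qed

lemma normal_centralizer:
  assumes "A \<lhd> G"
  shows "centralizer G A \<lhd> G"
proof (rule normal_invI)
  have A: "A \<subseteq> carrier G" using assms normal_imp_subgroup subgroup.subset by blast
  show "subgroup (centralizer G A) G" using A by (rule subgroup_centralizer)
  fix x h assume x: "x \<in> carrier G" and h: "h \<in> centralizer G A"
  have hc: "h \<in> carrier G" using h by (simp add: centralizer_def)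
  have "x \<otimes> h \<otimes> inv x \<otimes> a = a \<otimes> (x \<otimes> h \<otimes> inv x)" if a: "a \<in> A" for a
  proof -
    have ac: "a \<in> carrier G" using a A by blast
    have "inv x \<otimes> a \<otimes> x \<in> A" using assms x a by (simp add: normal.inv_op_closed1)
    then have "h \<otimes> (inv x \<otimes> a \<otimes> x) = (inv x \<otimes> a \<otimes> x) \<otimes> h" using centralizerD[OF h] by blast
    then have "x \<otimes> (h \<otimes> (inv x \<otimes> a \<otimes> x)) \<otimes> inv x = x \<otimes> ((inv x \<otimes> a \<otimes> x) \<otimes> h) \<otimes> inv x" by simp
    then show ?thesis using ac x hc by (simp add: group_normalize)
  qed
  then show "x \<otimes> h \<otimes> inv x \<in> centralizer G A" using x hc by (auto simp: centralizer_def)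
qed

lemma commutative_imp_subset_centralizer:
  assumes "H \<subseteq> carrier G" "\<And>x y. \<lbrakk>x \<in> H; y \<in> H\<rbrakk> \<Longrightarrow> x \<otimes> y = y \<otimes> x"
  shows "H \<subseteq> centralizer G H"
  using assms by (auto simp: centralizer_def)

end

section \<open>Lattice properties of the subgroups of maximal measure\<close>

context finite_group begin

lemma card_subgroup_pos: "subgroup H G \<Longrightarrow> 0 < card H"
  using finite_subgroup subgroup.one_closed card_gt_0_iff by blast

lemma finite_centralizer: "finite (centralizer G S)"
  using finite_subset[OF centralizer_subset] by blast

lemma cd_measure_le_max: "subgroup H G \<Longrightarrow> cd_measure G H \<le> max_cd_measure G"
  unfolding max_cd_measure_def using finite_subgroups_of by (intro Max_ge) (auto simp: subgroups_of_def)

lemma mem_cd_lattice_iff: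
  "H \<in> cd_lattice G \<longleftrightarrow> subgroup H G \<and> (\<forall>K. subgroup K G \<longrightarrow> cd_measure G K \<le> cd_measure G H)"
proof
  assume "H \<in> cd_lattice G"
  then show "subgroup H G \<and> (\<forall>K. subgroup K G \<longrightarrow> cd_measure G K \<le> cd_measure G H)"
    using cd_measure_le_max by (auto simp: cd_lattice_def subgroups_of_def)
next
  assume H: "subgroup H G \<and> (\<forall>K. subgroup K G \<longrightarrow> cd_measure G K \<le> cd_measure G H)"
  have "max_cd_measure G \<in> cd_measure G ` subgroups_of G"
    unfolding max_cd_measure_def using finite_subgroups_of H
    by (intro Max_in) (auto simp: subgroups_of_def)
  then show "H \<in> cd_lattice G"
    using H cd_measure_le_max[of H] by (auto simp: cd_lattice_def subgroups_of_def intro: le_antisym)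
qed

lemma cd_lattice_subgroup: "H \<in> cd_lattice G \<Longrightarrow> subgroup H G"
  by (simp add: mem_cd_lattice_iff)

lemma cd_measure_cd_lattice: "\<lbrakk>H \<in> cd_lattice G; K \<in> cd_lattice G\<rbrakk> \<Longrightarrow> cd_measure G H = cd_measure G K"
  by (simp add: cd_lattice_def)

lemma notin_cd_latticeI: "\<lbrakk>subgroup K G; cd_measure G H < cd_measure G K\<rbrakk> \<Longrightarrow> H \<notin> cd_lattice G"
  using mem_cd_lattice_iff by (metis not_le)

lemma cd_defect_eq: "cd_defect G = card (subgroups_of G - cd_lattice G)"
  unfolding cd_defect_def using finite_subgroups_of
  by (subst card_Diff_subset) (auto simp: cd_lattice_def intro: finite_subset[OF _ finite_subgroups_of])

lemma card_le_cd_defect: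
  assumes "\<And>H. H \<in> S \<Longrightarrow> subgroup H G" "\<And>H. H \<in> S \<Longrightarrow> H \<notin> cd_lattice G"
  shows "card S \<le> cd_defect G"
  unfolding cd_defect_eq using assms finite_subgroups_of
  by (intro card_mono) (auto simp: subgroups_of_def)

text \<open>Joining the center to \<open>H\<close> leaves the centralizer unchanged, so by
  maximality of the measure the join is not larger than \<open>H\<close>.\<close>

lemma center_subset_cd:
  assumes H: "H \<in> cd_lattice G"
  shows "center \<subseteq> H"
proof -
  have sub: "subgroup H G" using H by (rule cd_lattice_subgroup)
  then have Hc: "H \<subseteq> carrier G" by (rule subgroup.subset)
  let ?J = "generate G (H \<union> center)"
  have Jc: "H \<union> center \<subseteq> carrier G" using Hc centralizer_subset by blast
  have J: "subgroup ?J G" by (rule generate_is_subgroup[OF Jc])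
  have "centralizer G center = carrier G" by (auto simp: centralizer_def)
  then have "centralizer G ?J = centralizer G H"
    using centralizer_generate[OF Jc] centralizer_subset by (auto simp: centralizer_Un)
  moreover have "cd_measure G ?J \<le> cd_measure G H" using H J by (simp add: mem_cd_lattice_iff)
  moreover have "0 < card (centralizer G H)" by (rule card_subgroup_pos[OF subgroup_centralizer[OF Hc]])
  ultimately have "card ?J \<le> card H" by (simp add: cd_measure_def)
  moreover have "H \<union> center \<subseteq> ?J" by (auto intro: generate.incl)
  ultimately have "?J = H" using finite_subgroup[OF J] by (metis Un_subset_iff card_seteq)
  then show ?thesis using \<open>H \<union> center \<subseteq> ?J\<close> by blast
qed

lemma double_centralizer_superset: "H \<subseteq> carrier G \<Longrightarrow> H \<subseteq> centralizer G (centralizer G H)"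
  by (auto simp: centralizer_def)

text \<open>The measure of C(H) is |C(H)| |C(C(H))| >= |C(H)| |H|. Maximality at \<open>H\<close>
  turns this into an equality.\<close>

lemma cd_centralizer:
  assumes H: "H \<in> cd_lattice G"
  shows "centralizer G H \<in> cd_lattice G" "centralizer G (centralizer G H) = H"
proof -
  have Hc: "H \<subseteq> carrier G" using cd_lattice_subgroup[OF H] subgroup.subset by blast
  let ?C = "centralizer G H"
  have C: "subgroup ?C G" by (rule subgroup_centralizer[OF Hc])
  have le: "card H \<le> card (centralizer G ?C)"
    by (rule card_mono[OF finite_centralizer double_centralizer_superset[OF Hc]])
  have "cd_measure G ?C \<le> cd_measure G H" using H C by (simp add: mem_cd_lattice_iff)
  then have "card (centralizer G ?C) \<le> card H"
    using card_subgroup_pos[OF C] by (simp add: cd_measure_def mult.commute)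
  then show "centralizer G ?C = H"
    using card_seteq[OF finite_centralizer double_centralizer_superset[OF Hc]] by simp
  then have "cd_measure G ?C = cd_measure G H" by (simp add: cd_measure_def)
  then show "?C \<in> cd_lattice G" using H C by (simp add: mem_cd_lattice_iff)
qed

text \<open>This is |HK| |H \<inter> K| = |H| |K|, with the product set HK enlarged to the subgroup
  it generates.\<close>

lemma card_mult_le_generate:
  assumes H: "subgroup H G" and K: "subgroup K G"
  shows "card H * card K \<le> card (generate G (H \<union> K)) * card (H \<inter> K)"
proof -
  let ?J = "generate G (H \<union> K)"
  have c: "H \<subseteq> carrier G" "K \<subseteq> carrier G" using H K subgroup.subset by auto
  have J: "subgroup ?J G" using c by (intro generate_is_subgroup) auto
  \<comment> \<open>\<open>r\<close> fixes one factorization of every product h k. Its deviation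
    from (h, k) is an element of \<open>H \<inter> K\<close>, which makes the map \<open>?f\<close>
    below injective.\<close>
  define r where "r y = (SOME hk. fst hk \<in> H \<and> snd hk \<in> K \<and> fst hk \<otimes> snd hk = y)" for y
  have r: "fst (r (h \<otimes> k)) \<in> H \<and> snd (r (h \<otimes> k)) \<in> K \<and> fst (r (h \<otimes> k)) \<otimes> snd (r (h \<otimes> k)) = h \<otimes> k"
    if "h \<in> H" "k \<in> K" for h k
    unfolding r_def by (rule someI[of _ "(h, k)"]) (use that in simp)
  let ?f = "\<lambda>(h, k). (h \<otimes> k, inv (fst (r (h \<otimes> k))) \<otimes> h)"
  have "inj_on ?f (H \<times> K)"
  proof (rule inj_onI)
    fix u v assume uv: "u \<in> H \<times> K" "v \<in> H \<times> K" "?f u = ?f v"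
    obtain h k h' k' where eq: "u = (h, k)" "v = (h', k')" by (metis surj_pair)
    with uv have hk: "h \<in> H" "k \<in> K" "h' \<in> H" "k' \<in> K" "h \<otimes> k = h' \<otimes> k'"
      and e: "inv (fst (r (h \<otimes> k))) \<otimes> h = inv (fst (r (h' \<otimes> k'))) \<otimes> h'" by auto
    have "fst (r (h \<otimes> k)) \<in> carrier G" using r[OF hk(1,2)] c by auto
    then have "h = h'" using e hk c by (metis inv_closed l_cancel subsetD)
    then show "u = v" using hk c eq by (metis l_cancel subsetD)
  qed
  moreover have "?f ` (H \<times> K) \<subseteq> ?J \<times> (H \<inter> K)"
  proof clarify
    fix h k assume hk: "h \<in> H" "k \<in> K"
    obtain a b where ab: "r (h \<otimes> k) = (a, b)" by (metis surj_pair)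
    then have m: "a \<in> H" "b \<in> K" "a \<otimes> b = h \<otimes> k" using r[OF hk] by auto
    have cc: "a \<in> carrier G" "b \<in> carrier G" "h \<in> carrier G" "k \<in> carrier G" using m hk c by auto
    then have "h = a \<otimes> b \<otimes> inv k" unfolding m(3) by (simp add: m_assoc)
    then have "inv a \<otimes> h = inv a \<otimes> (a \<otimes> b \<otimes> inv k)" by simp
    then have "inv a \<otimes> h = b \<otimes> inv k" using cc by (simp only: m_assoc inv_cancel_left m_closed inv_closed)
    then have "inv a \<otimes> h \<in> H \<inter> K"
      using m hk subgroup.m_closed[OF H subgroup.m_inv_closed[OF H m(1)] hk(1)]
        subgroup.m_closed[OF K m(2) subgroup.m_inv_closed[OF K hk(2)]] by simp
    moreover have "h \<otimes> k \<in> ?J" using hk by (intro generate.eng) (auto intro: generate.incl)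
    ultimately show "h \<otimes> k \<in> ?J \<and> inv (fst (r (h \<otimes> k))) \<otimes> h \<in> H \<inter> K" using ab by simp
  qed
  moreover have "finite (?J \<times> (H \<inter> K))" using finite_subgroup[OF J] finite_subgroup[OF H] by simp
  ultimately have "card (H \<times> K) \<le> card (?J \<times> (H \<inter> K))" by (rule card_inj_on_le)
  then show ?thesis by (simp add: card_cartesian_product)
qed

text \<open>Centralizing exchanges joins and meets: the centralizer of \<open>?J\<close> is the meet
  of the two centralizers, and that of \<open>?I\<close> contains their join. The product inequality
  is used for both pairs.\<close>

lemma cd_measure_mult_le:
  assumes H: "subgroup H G" and K: "subgroup K G"
  shows "cd_measure G H * cd_measure G K \<le> cd_measure G (generate G (H \<union> K)) * cd_measure G (H \<inter> K)"
proof -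
  let ?J = "generate G (H \<union> K)" and ?I = "H \<inter> K"
  let ?CH = "centralizer G H" and ?CK = "centralizer G K"
  have c: "H \<subseteq> carrier G" "K \<subseteq> carrier G" using H K subgroup.subset by auto
  have "generate G (?CH \<union> ?CK) \<subseteq> centralizer G ?I"
    using c by (intro generate_subgroup_incl subgroup_centralizer) (auto simp: centralizer_def)
  moreover have "?CH \<inter> ?CK = centralizer G ?J"
    using c by (simp add: centralizer_generate centralizer_Un)
  ultimately have "card ?CH * card ?CK \<le> card (centralizer G ?I) * card (centralizer G ?J)"
    using card_mult_le_generate[OF subgroup_centralizer[OF c(1)] subgroup_centralizer[OF c(2)]]
      card_mono[OF finite_centralizer] by (metis (no_types, lifting) mult_le_mono1 order_trans)
  then have "(card H * card K) * (card ?CH * card ?CK)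
      \<le> (card ?J * card ?I) * (card (centralizer G ?I) * card (centralizer G ?J))"
    by (intro mult_le_mono[OF card_mult_le_generate[OF H K]])
  then show ?thesis by (simp add: cd_measure_def ac_simps)
qed

text \<open>Neither factor on the right of \<open>cd_measure_mult_le\<close> exceeds the maximum,
  while the left side is its square; so both factors attain it.\<close>

lemma cd_lattice_join_meet:
  assumes H: "H \<in> cd_lattice G" and K: "K \<in> cd_lattice G"
  shows "generate G (H \<union> K) \<in> cd_lattice G" "H \<inter> K \<in> cd_lattice G"
proof -
  let ?J = "generate G (H \<union> K)" and ?I = "H \<inter> K" and ?m = "max_cd_measure G"
  have sub: "subgroup H G" "subgroup K G" using H K cd_lattice_subgroup by auto
  have J: "subgroup ?J G"
    using subgroup.subset[OF sub(1)] subgroup.subset[OF sub(2)] by (intro generate_is_subgroup) auto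
  have I: "subgroup ?I G" using sub by (rule subgroups_Inter_pair)
  have pos: "0 < ?m" using H card_subgroup_pos[OF sub(1)]
      card_subgroup_pos[OF subgroup_centralizer[OF subgroup.subset[OF sub(1)]]]
    unfolding cd_lattice_def cd_measure_def by (metis (mono_tags, lifting) mem_Collect_eq mult_pos_pos)
  have le: "?m * ?m \<le> cd_measure G ?J * cd_measure G ?I"
    using cd_measure_mult_le[OF sub] H K by (simp add: cd_lattice_def)
  have "?m \<le> cd_measure G ?J"
  proof (rule ccontr)
    assume "\<not> ?m \<le> cd_measure G ?J"
    then have "cd_measure G ?J * cd_measure G ?I < ?m * ?m"
      using cd_measure_le_max[OF I] pos
      by (metis mult_le_mono2 mult_less_mono1 not_le order_le_less_trans)
    then show False using le by simp
  qed
  then show "?J \<in> cd_lattice G" using J cd_measure_le_max[OF J] by (simp add: cd_lattice_def subgroups_of_def)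
  have "?m \<le> cd_measure G ?I"
  proof (rule ccontr)
    assume "\<not> ?m \<le> cd_measure G ?I"
    then have "cd_measure G ?J * cd_measure G ?I < ?m * ?m"
      using cd_measure_le_max[OF J] pos
      by (metis mult_le_mono1 mult_less_mono2 not_le order_less_le_trans)
    then show False using le by simp
  qed
  then show "?I \<in> cd_lattice G" using I cd_measure_le_max[OF I] by (simp add: cd_lattice_def subgroups_of_def)
qed

lemma cd_lattice_abelian:
  assumes "\<And>x y. \<lbrakk>x \<in> carrier G; y \<in> carrier G\<rbrakk> \<Longrightarrow> x \<otimes> y = y \<otimes> x"
  shows "cd_lattice G = {carrier G}"
proof -
  have C: "centralizer G H = carrier G" if "subgroup H G" for H
    using assms subgroup.subset[OF that] by (auto simp: centralizer_def)
  have "cd_measure G H = card H * order G" if "subgroup H G" for H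
    using C[OF that] by (simp add: cd_measure_def order_def)
  moreover have "card H \<le> card (carrier G)" "card (carrier G) \<le> card H \<longleftrightarrow> H = carrier G"
    if "subgroup H G" for H
    using card_mono[OF fin subgroup.subset[OF that]] card_seteq[OF fin subgroup.subset[OF that]] by auto
  ultimately have "H \<in> cd_lattice G \<longleftrightarrow> H = carrier G" for H
    using order_pos subgroup_self by (metis mem_cd_lattice_iff mult_le_cancel2)
  then show ?thesis by auto
qed

lemma cd_measure_carrier_center:
  "cd_measure G (carrier G) = order G * card center" "cd_measure G center = card center * order G"
proof -
  have "centralizer G center = carrier G" by (auto simp: centralizer_def)
  then show "cd_measure G center = card center * order G" by (simp add: cd_measure_def order_def)
qed (simp add: cd_measure_def order_def)

end

subsection \<open>Invariance under isomorphism\<close>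

lemma iso_subgroups_cd_measure:
  assumes "finite_group G" "finite_group K" and iso: "h \<in> iso G K"
  shows "bij_betw ((`) h) (subgroups_of G) (subgroups_of K)"
    and "\<And>H. subgroup H G \<Longrightarrow> cd_measure K (h ` H) = cd_measure G H"
proof -
  interpret G: finite_group G by fact
  interpret K: finite_group K by fact
  interpret group_hom G K h using iso by unfold_locales (simp add: iso_def)
  have inj: "inj_on h (carrier G)" and surj: "h ` carrier G = carrier K"
    using iso by (auto simp: iso_def bij_betw_def)
  show "bij_betw ((`) h) (subgroups_of G) (subgroups_of K)"
  proof (rule bij_betwI')
    fix H H' assume "H \<in> subgroups_of G" "H' \<in> subgroups_of G"
    then show "h ` H = h ` H' \<longleftrightarrow> H = H'"
      using inj inj_on_image_eq_iff[OF inj] by (simp add: subgroups_of_def subgroup.subset)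
  next
    fix H assume "H \<in> subgroups_of G"
    then show "h ` H \<in> subgroups_of K" by (simp add: subgroups_of_def subgroup_img_is_subgroup)
  next
    fix L assume L: "L \<in> subgroups_of K"
    then have "L \<subseteq> h ` carrier G" using surj subgroup.subset by (auto simp: subgroups_of_def)
    then have "h ` {x \<in> carrier G. h x \<in> L} = L" by auto
    moreover have "subgroup {x \<in> carrier G. h x \<in> L} G"
      using L by (intro G.subgroupI) (auto simp: subgroups_of_def subgroup.m_closed subgroup.m_inv_closed
          intro!: exI[of _ "\<one>\<^bsub>G\<^esub>"] dest: subgroup.one_closed)
    ultimately show "\<exists>H\<in>subgroups_of G. L = h ` H" by (auto simp: subgroups_of_def)
  qed
  fix H assume H: "subgroup H G"
  have Hc: "H \<subseteq> carrier G" using H by (rule subgroup.subset)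
  have "centralizer K (h ` H) = h ` centralizer G H"
  proof
    show "h ` centralizer G H \<subseteq> centralizer K (h ` H)"
    proof clarify
      fix g assume g: "g \<in> centralizer G H"
      have "h g \<otimes>\<^bsub>K\<^esub> h x = h x \<otimes>\<^bsub>K\<^esub> h g" if "x \<in> H" for x
        using that Hc g by (metis (no_types, lifting) G.centralizerD G.centralizer_subset hom_mult subsetD)
      then show "h g \<in> centralizer K (h ` H)" using g by (auto simp: centralizer_def)
    qed
    show "centralizer K (h ` H) \<subseteq> h ` centralizer G H"
    proof
      fix y assume y: "y \<in> centralizer K (h ` H)"
      then obtain g where g: "g \<in> carrier G" "y = h g" using surj by (auto simp: centralizer_def)
      have "g \<otimes>\<^bsub>G\<^esub> x = x \<otimes>\<^bsub>G\<^esub> g" if "x \<in> H" for x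
      proof -
        have "h (g \<otimes>\<^bsub>G\<^esub> x) = h (x \<otimes>\<^bsub>G\<^esub> g)" using y g that Hc by (auto simp: centralizer_def)
        then show ?thesis using inj g(1) that Hc by (auto dest: inj_onD)
      qed
      then show "y \<in> h ` centralizer G H" using g by (auto simp: centralizer_def)
    qed
  qed
  moreover have "card (h ` S) = card S" if "S \<subseteq> carrier G" for S
    using inj that by (metis card_image inj_on_subset)
  ultimately show "cd_measure K (h ` H) = cd_measure G H"
    using Hc G.centralizer_subset by (simp add: cd_measure_def)
qed

lemma cd_defect_iso:
  assumes "finite_group G" "finite_group K" and "G \<cong> K"
  shows "cd_defect G = cd_defect K"
proof -
  obtain h where h: "h \<in> iso G K" using assms(3) by (auto simp: is_iso_def)
  note bij = iso_subgroups_cd_measure[OF assms(1,2) h]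
  have img: "(`) h ` subgroups_of G = subgroups_of K" using bij(1) by (simp add: bij_betw_def)
  have "cd_measure K ` subgroups_of K = cd_measure G ` subgroups_of G"
    unfolding img[symmetric] image_image using bij(2) by (intro image_cong) (auto simp: subgroups_of_def)
  then have "max_cd_measure K = max_cd_measure G" by (simp add: max_cd_measure_def)
  then have "cd_lattice K = (`) h ` cd_lattice G"
    unfolding cd_lattice_def img[symmetric] using bij(2) by (auto simp: subgroups_of_def)
  moreover have "inj_on ((`) h) (cd_lattice G)"
    using bij(1) by (auto simp: bij_betw_def cd_lattice_def intro: inj_on_subset)
  ultimately show ?thesis
    unfolding cd_defect_def using bij_betw_same_card[OF bij(1)] by (simp add: card_image)
qed

section \<open>Central elements modulo a normal subgroup\<close>

context p_group begin

lemma dvd_card_if_not_one: "k dvd p ^ n \<Longrightarrow> k \<noteq> 1 \<Longrightarrow> p dvd k"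
  using divides_primepow_nat[OF prime_p] by (metis dvd_power gr0I power_0)

lemma card_rcosets_Int:
  assumes "subgroup N G" "subgroup K G" "N \<subseteq> K"
  shows "card ((\<lambda>x. N #> x) ` K) * card N = card K"
proof -
  interpret K: finite_group "G\<lparr>carrier := K\<rparr>" by (rule finite_group_restrict[OF assms(2)])
  have "subgroup N (G\<lparr>carrier := K\<rparr>)" by (rule subgroup_incl[OF assms])
  from K.lagrange[OF this] show ?thesis
    by (simp add: order_def RCOSETS_def r_coset_def UNION_singleton_eq_range)
qed

text \<open>\<open>G\<close> acts by conjugation on the cosets of \<open>N\<close> in \<open>K\<close>, and \<open>N\<close> is not the only fixed one.\<close>

lemma ex_central_mod:
  assumes N: "N \<lhd> G" and K: "K \<lhd> G" and NK: "N \<subset> K"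
  shows "\<exists>x\<in>K - N. x [^] p \<in> N \<and> (\<forall>g\<in>carrier G. g \<otimes> x \<otimes> inv g \<otimes> inv x \<in> N)"
proof -
  have sN: "subgroup N G" and sK: "subgroup K G" using N K normal_imp_subgroup by auto
  have Nc: "N \<subseteq> carrier G" and Kc: "K \<subseteq> carrier G" using sN sK subgroup.subset by auto
  let ?S = "(\<lambda>x. N #> x) ` K"
  let ?f = "\<lambda>g C. (\<lambda>c. g \<otimes> c \<otimes> inv g) ` C"
  let ?F = "{C \<in> ?S. \<forall>g\<in>carrier G. ?f g C = C}"
  have finS: "finite ?S" using finite_subgroup[OF sK] by simp
  have sub: "C \<subseteq> carrier G" if "C \<in> ?S" for C
    using that Nc Kc r_coset_subset_G by blast
  have img: "?f g (N #> x) = N #> (g \<otimes> x \<otimes> inv g)" if g: "g \<in> carrier G" and x: "x \<in> carrier G" for g x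
  proof
    show "?f g (N #> x) \<subseteq> N #> (g \<otimes> x \<otimes> inv g)"
    proof clarify
      fix c assume "c \<in> N #> x"
      then obtain m where m: "m \<in> N" "c = m \<otimes> x" by (auto simp: r_coset_def)
      then have "g \<otimes> c \<otimes> inv g = (g \<otimes> m \<otimes> inv g) \<otimes> (g \<otimes> x \<otimes> inv g)"
        using g x Nc by (auto simp: group_normalize subset_iff)
      then show "g \<otimes> c \<otimes> inv g \<in> N #> (g \<otimes> x \<otimes> inv g)"
        using normal.inv_op_closed2[OF N g m(1)] by (auto simp: r_coset_def)
    qed
    show "N #> (g \<otimes> x \<otimes> inv g) \<subseteq> ?f g (N #> x)"
    proof
      fix c assume "c \<in> N #> (g \<otimes> x \<otimes> inv g)"
      then obtain m where m: "m \<in> N" "c = m \<otimes> (g \<otimes> x \<otimes> inv g)" by (auto simp: r_coset_def)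
      then have "c = g \<otimes> ((inv g \<otimes> m \<otimes> g) \<otimes> x) \<otimes> inv g"
        using g x Nc by (auto simp: group_normalize subset_iff)
      then show "c \<in> ?f g (N #> x)"
        using normal.inv_op_closed1[OF N g m(1)] by (auto simp: r_coset_def)
    qed
  qed
  have fixed: "[card ?F = card ?S] (mod p)"
  proof (rule card_fixed_points_mod[OF prime_p order_eq finS])
    fix g C assume g: "g \<in> carrier G" and "C \<in> ?S"
    then obtain x where x: "x \<in> K" "C = N #> x" by blast
    then show "?f g C \<in> ?S"
      using img[OF g, of x] normal.inv_op_closed2[OF K g x(1)] Kc by blast
  next
    fix C assume "C \<in> ?S"
    then show "?f \<one> C = C" using sub[of C] by (force simp: image_iff)
  next
    fix g h C assume "g \<in> carrier G" "h \<in> carrier G" "C \<in> ?S"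
    then show "?f (g \<otimes> h) C = ?f g (?f h C)"
      unfolding image_image using sub[of C] by (intro image_cong) (auto simp: group_normalize subset_iff)
  qed
  have cS: "card ?S * card N = card K" by (rule card_rcosets_Int[OF sN sK]) (use NK in blast)
  have "card K dvd p ^ n" using lagrange[OF sK] order_eq by (metis dvd_triv_right)
  then have "card ?S dvd p ^ n" using cS by (metis dvd_mult_left)
  moreover have "card ?S \<noteq> 1"
    using cS NK psubset_card_mono[OF finite_subgroup[OF sK] NK] by auto
  ultimately have "p dvd card ?F" using dvd_card_if_not_one fixed by (simp add: cong_dvd_iff)
  moreover have NF: "N \<in> ?F"
  proof -
    have "N = N #> \<one>" using Nc by simp
    moreover have "\<one> \<in> K" using subgroup.one_closed[OF sK] .
    moreover have "?f g N = N" if g: "g \<in> carrier G" for g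
      using img[OF g one_closed] g Nc by simp
    ultimately show ?thesis by blast
  qed
  moreover have "finite ?F" using finS by simp
  ultimately have "0 < card ?F" "p dvd card ?F" unfolding card_gt_0_iff by blast+
  then have "card ?F \<ge> p" by (rule dvd_imp_le[rotated])
  then have "\<not> ?F \<subseteq> {N}" using p_gt(2) card_mono[of "{N}" ?F] by auto
  then obtain C where C: "C \<in> ?F" "C \<noteq> N" by blast
  then obtain x where x: "x \<in> K" "C = N #> x" by blast
  have xc: "x \<in> carrier G" using x Kc by blast
  have xN: "x \<notin> N" using C(2) x(2) coset_join2[OF xc sN] by blast
  have conj: "g \<otimes> x \<otimes> inv g \<otimes> inv x \<in> N" if g: "g \<in> carrier G" for g
  proof -
    have "g \<otimes> x \<otimes> inv g \<in> N #> x"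
      using C(1) img[OF g xc] rcos_self[of "g \<otimes> x \<otimes> inv g" N] g xc sN x(2) by auto
    then obtain m where "m \<in> N" "g \<otimes> x \<otimes> inv g = m \<otimes> x" by (auto simp: r_coset_def)
    then show ?thesis using xc Nc by (auto simp: m_assoc)
  qed
  \<comment> \<open>Powers of x stay central modulo \<open>N\<close>, so x may be replaced by a
    power whose p-th power lies in \<open>N\<close>.\<close>
  have conj_pow: "g \<otimes> x [^] m \<otimes> inv g \<otimes> inv (x [^] m) \<in> N" if g: "g \<in> carrier G" for g and m :: nat
  proof (induction m)
    case (Suc m)
    have "g \<otimes> x [^] Suc m \<otimes> inv g \<otimes> inv (x [^] Suc m)
        = (g \<otimes> x [^] m \<otimes> inv g \<otimes> inv (x [^] m)) \<otimes>
          (x [^] m \<otimes> (g \<otimes> x \<otimes> inv g \<otimes> inv x) \<otimes> inv (x [^] m))"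
      using g xc by (simp add: group_normalize)
    then show ?case
      using subgroup.m_closed[OF sN Suc] normal.inv_op_closed2[OF N _ conj[OF g]] xc by simp
  qed (use g subgroup.one_closed[OF sN] in simp)
  obtain m :: nat where m: "x [^] m \<notin> N" "(x [^] m) [^] p \<in> N" using ex_pow_leaving[OF sN xc xN] by blast
  then show ?thesis using conj_pow subgroup_pow_closed[OF sK x(1)] by blast
qed

lemma center_iff: "x \<in> center \<longleftrightarrow> x \<in> carrier G \<and> (\<forall>g\<in>carrier G. x \<otimes> g = g \<otimes> x)"
  by (auto simp: centralizer_def)

text \<open>\<open>ex_central_mod\<close> for the trivial \<open>N\<close>: an element fixed modulo
  the identity is central.\<close>

lemma ex_central_order_p:
  assumes K: "K \<lhd> G" "K \<noteq> {\<one>}"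
  obtains z where "z \<in> center" "z \<in> K" "z \<noteq> \<one>" "z [^] p = \<one>"
proof -
  have "\<one> \<in> K" using K(1) normal_imp_subgroup subgroup.one_closed by blast
  then have "{\<one>} \<subset> K" using K(2) by blast
  from ex_central_mod[OF one_is_normal K(1) this]
  obtain x where x: "x \<in> K" "x \<noteq> \<one>" "x [^] p = \<one>" "\<And>g. g \<in> carrier G \<Longrightarrow> g \<otimes> x \<otimes> inv g \<otimes> inv x = \<one>"
    by auto
  have xc: "x \<in> carrier G" using x(1) K(1) normal_imp_subgroup subgroup.mem_carrier by metis
  have "x \<otimes> g = g \<otimes> x" if g: "g \<in> carrier G" for g
    using x(4)[OF g] xc g conj_eq_iff(2)[of g x x] inv_solve_right'[of \<one> "g \<otimes> x \<otimes> inv g" x] by simp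
  then have "x \<in> center" using xc by (simp add: center_iff)
  then show ?thesis using that x by blast
qed

lemma normalI_conj:
  assumes "subgroup N G" "\<And>g m. \<lbrakk>g \<in> carrier G; m \<in> N\<rbrakk> \<Longrightarrow> inv g \<otimes> m \<otimes> g \<in> N"
  shows "N \<lhd> G"
proof (rule normal_invI[OF assms(1)])
  fix x h assume "x \<in> carrier G" "h \<in> N"
  then show "x \<otimes> h \<otimes> inv x \<in> N" using assms(2)[of "inv x" h] by simp
qed

lemma index_p_is_normal: "subgroup M G \<Longrightarrow> order G = p * card M \<Longrightarrow> M \<lhd> G"
  using normalI_conj index_p_normal by metis

lemma ord_prime: "\<lbrakk>x \<in> carrier G; x \<noteq> \<one>; x [^] p = \<one>\<rbrakk> \<Longrightarrow> ord x = p"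
  using pow_eq_id ord_eq_1 prime_p by (metis prime_nat_iff)

lemma commute_if_central_index_le_p: \<comment> \<open>a group that is cyclic modulo its center is abelian\<close>
  assumes H: "subgroup H G" "H \<subseteq> centralizer G H'" and H': "subgroup H' G" "H \<subseteq> H'" "card H' \<le> p * card H"
    and x: "x \<in> H'" "y \<in> H'"
  shows "x \<otimes> y = y \<otimes> x"
proof (cases "x \<in> H")
  case True
  then show ?thesis using H(2) x centralizerD by blast
next
  case False
  have c: "a \<in> carrier G" if "a \<in> H'" for a using subgroup.mem_carrier[OF H'(1) that] .
  have norm: "inv x \<otimes> h \<otimes> x \<in> H" if h: "h \<in> H" for h
  proof -
    have "h \<otimes> x = x \<otimes> h" using h H(2) x(1) centralizerD by blast
    then have "inv x \<otimes> h \<otimes> x = h" using conj_eq_iff(1)[of x h h] h H' x c by blast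
    then show ?thesis using h by simp
  qed
  obtain m :: nat where m: "x [^] m \<notin> H" "(x [^] m) [^] p \<in> H"
    using ex_pow_leaving[OF H(1) c[OF x(1)] False] by blast
  let ?x = "x [^] m"
  have xm: "?x \<in> H'" "?x \<in> carrier G" using subgroup_pow_closed[OF H'(1) x(1)] c x by auto
  have J: "subgroup (adjoin H ?x) G" "card (adjoin H ?x) = p * card H"
    using subgroup_adjoin[OF H(1) xm(2)] card_adjoin[OF H(1) xm(2) m prime_p] conj_pow_mem[OF H(1) c[OF x(1)] norm]
    by auto
  have "adjoin H ?x \<subseteq> H'" using xm H'(2) subgroup_pow_closed[OF H'(1)] subgroup.m_closed[OF H'(1)]
    by (auto simp: adjoin_def)
  then have "adjoin H ?x = H'" using H'(3) J(2) card_seteq[OF finite_subgroup[OF H'(1)]] by simp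
  then have "y \<in> adjoin H ?x" using x(2) by simp
  then obtain j :: nat and h where j: "y = ?x [^] j \<otimes> h" "h \<in> H" by (auto simp: adjoin_def)
  have hx: "h \<otimes> x = x \<otimes> h" using j(2) H(2) x(1) centralizerD by blast
  have hc: "h \<in> carrier G" using j(2) H'(2) c by blast
  have "x \<otimes> ?x [^] j = ?x [^] j \<otimes> x"
    using c[OF x(1)] by (simp add: nat_pow_pow) (metis nat_pow_Suc nat_pow_Suc2)
  then show ?thesis unfolding j(1) using hx hc c[OF x(1)] xm(2) by (metis m_assoc nat_pow_closed)
qed

end

section \<open>Subgroups of groups with a cyclic subgroup of prime index\<close>

lemma (in group) pow_eq_pow_iff:
  assumes "x \<in> carrier G"
  shows "x [^] (i::nat) = x [^] (j::nat) \<longleftrightarrow> [i = j] (mod ord x)"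
  using int_pow_eq[OF assms, of "int i" "int j"]
  by (simp add: int_pow_int cong_iff_dvd_diff dvd_diff_commute flip: cong_int_iff)

section \<open>Subgroups of a cyclic group\<close>

context finite_group begin

lemma pow_in_cyc_pow_iff:
  assumes a: "a \<in> carrier G" "d dvd ord a"
  shows "a [^] m \<in> cyc G (a [^] d) \<longleftrightarrow> d dvd (m::nat)"
proof
  assume "d dvd m"
  then obtain i where "m = d * i" by auto
  then have "a [^] m = (a [^] d) [^] i" using a by (simp add: nat_pow_pow)
  then show "a [^] m \<in> cyc G (a [^] d)" by simp
next
  assume "a [^] m \<in> cyc G (a [^] d)"
  then obtain i :: nat where "a [^] m = (a [^] d) [^] i" by (auto simp: cyc_def)
  then have "a [^] m = a [^] (d * i)" using a by (simp add: nat_pow_pow)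
  then have "[m = d * i] (mod ord a)" using pow_eq_pow_iff[OF a(1)] by blast
  then have "[m = d * i] (mod d)" by (rule cong_dvd_modulus_nat) (rule a(2))
  then show "d dvd m" by (simp add: cong_dvd_iff)
qed

lemma card_cyc_pow:
  assumes "a \<in> carrier G" "d dvd ord a"
  shows "card (cyc G (a [^] d)) = ord a div d"
proof -
  have "d \<noteq> 0" using assms ord_pos[of a] by (intro notI) simp
  then show ?thesis using assms ord_pow card_cyc by simp
qed

lemma subgroup_of_cyc:
  assumes a: "a \<in> carrier G" and H: "subgroup H G" "H \<subseteq> cyc G a"
  shows "\<exists>d. d dvd ord a \<and> H = cyc G (a [^] d)"
proof -
  interpret A: finite_group "G\<lparr>carrier := cyc G a\<rparr>" by (rule finite_group_restrict[OF subgroup_cyc[OF a]])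
  have "subgroup H (G\<lparr>carrier := cyc G a\<rparr>)" by (rule subgroup_incl[OF H(1) subgroup_cyc[OF a] H(2)])
  from A.lagrange[OF this] have "card (rcosets\<^bsub>G\<lparr>carrier := cyc G a\<rparr>\<^esub> H) * card H = ord a"
    using card_cyc[OF a] by (simp add: order_def)
  then have "card H dvd ord a" by (metis dvd_triv_right)
  \<comment> \<open>d is the index of \<open>H\<close> in <a>. An element a^m of \<open>H\<close> is
    killed by |H|, so d divides m.\<close>
  then obtain d where d: "ord a = card H * d" by auto
  have "H \<subseteq> cyc G (a [^] d)"
  proof
    fix h assume h: "h \<in> H"
    then obtain m :: nat where m: "h = a [^] m" using H(2) by (auto simp: cyc_def)
    interpret H: finite_group "G\<lparr>carrier := H\<rparr>" by (rule finite_group_restrict[OF H(1)])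
    have "h [^] card H = \<one>"
      using H.pow_order_eq_1[of h] h unfolding nat_pow_consistent[of h _ H] by (simp add: order_def)
    then have "a [^] (m * card H) = \<one>" using m a by (simp add: nat_pow_pow)
    then have "ord a dvd m * card H" using pow_eq_id[OF a] by blast
    then have "d dvd m" using d card_subgroup_pos[OF H(1)] by (simp add: mult.commute)
    then show "h \<in> cyc G (a [^] d)" using m pow_in_cyc_pow_iff[OF a, of d] d by simp
  qed
  moreover have "card (cyc G (a [^] d)) = card H"
    using card_cyc_pow[OF a, of d] d ord_pos[OF a] by simp
  ultimately have "H = cyc G (a [^] d)"
    using finite_subgroup[OF subgroup_cyc] a by (metis card_subset_eq nat_pow_closed)
  then show ?thesis using d by (intro exI[of _ d]) auto
qed

text \<open>The maximal measure may therefore be looked for among the subgroups that contain the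
  center.\<close>

lemma cd_measure_le_over_center:
  assumes H: "subgroup H G"
  obtains J where "subgroup J G" "center \<subseteq> J" "cd_measure G H \<le> cd_measure G J"
proof
  have Jc: "H \<union> center \<subseteq> carrier G" using subgroup.subset[OF H] centralizer_subset by blast
  let ?J = "generate G (H \<union> center)"
  show J: "subgroup ?J G" by (rule generate_is_subgroup[OF Jc])
  have "H \<union> center \<subseteq> ?J" by (auto intro: generate.incl)
  then show "center \<subseteq> ?J" by blast
  have "centralizer G center = carrier G" by (auto simp: centralizer_def)
  then have "centralizer G ?J = centralizer G H"
    using centralizer_generate[OF Jc] centralizer_subset by (auto simp: centralizer_Un)
  moreover have "card H \<le> card ?J"
    using \<open>H \<union> center \<subseteq> ?J\<close> finite_subgroup[OF J] by (intro card_mono) auto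
  ultimately show "cd_measure G H \<le> cd_measure G ?J" by (simp add: cd_measure_def)
qed

end

context p_group begin

lemma subgroup_of_cyc_p:
  assumes a: "a \<in> carrier G" "ord a = p ^ k" and H: "subgroup H G" "H \<subseteq> cyc G a"
  shows "\<exists>s\<le>k. H = cyc G (a [^] (p ^ s))"
  using subgroup_of_cyc[OF a(1) H] a(2) divides_primepow_nat[OF prime_p] by auto

lemma cyc_p_pow_inj:
  assumes a: "a \<in> carrier G" "ord a = p ^ k" and st: "s \<le> k" "t \<le> k"
    "cyc G (a [^] (p ^ s)) = cyc G (a [^] (p ^ t))"
  shows "s = t"
proof -
  have "p ^ k div p ^ s = p ^ k div p ^ t"
    using st card_cyc_pow[OF a(1)] a(2) le_imp_power_dvd by metis
  then have "p ^ (k - s) = p ^ (k - t)" using st p_gt by (simp add: power_diff)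
  then have "k - s = k - t" using p_gt(2) power_inject_exp by blast
  then show ?thesis using st by simp
qed

lemma cyclic_defect:
  assumes a: "a \<in> carrier G" "cyc G a = carrier G"
  shows "cd_defect G = n"
proof -
  have o: "ord a = p ^ n" using card_cyc[OF a(1)] a(2) order_eq by (simp add: order_def)
  have ab: "x \<otimes> y = y \<otimes> x" if xy: "x \<in> carrier G" "y \<in> carrier G" for x y
  proof -
    have "x \<in> cyc G a" "y \<in> cyc G a" using xy a(2) by auto
    then obtain i j :: nat where "x = a [^] i" "y = a [^] j" by (auto simp: cyc_def)
    then show ?thesis using a(1) nat_pow_comm by blast
  qed
  have "subgroups_of G = (\<lambda>s. cyc G (a [^] (p ^ s))) ` {..n}"
  proof (intro equalityI subsetI)
    fix H assume "H \<in> subgroups_of G"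
    then have H: "subgroup H G" by (simp add: subgroups_of_def)
    then show "H \<in> (\<lambda>s. cyc G (a [^] (p ^ s))) ` {..n}"
      using subgroup_of_cyc_p[OF a(1) o H] a(2) subgroup.subset[OF H] by auto
  next
    fix H assume "H \<in> (\<lambda>s. cyc G (a [^] (p ^ s))) ` {..n}"
    then show "H \<in> subgroups_of G" using a subgroup_cyc by (auto simp: subgroups_of_def)
  qed
  moreover have "inj_on (\<lambda>s. cyc G (a [^] (p ^ s))) {..n}"
    using cyc_p_pow_inj[OF a(1) o] by (intro inj_onI) auto
  ultimately have "card (subgroups_of G) = n + 1" by (simp add: card_image)
  then show ?thesis using cd_lattice_abelian[OF ab] by (simp add: cd_defect_def)
qed

text \<open>All subgroups over Z have measure |Z| |G|. For Z and G this is immediate; a subgroup H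
  strictly between is cyclic modulo Z, hence abelian but not central, which forces |C(H)| = |H| = p
  |Z|.\<close>

lemma cd_lattice_center_index_p2:
  assumes ord: "order G = p\<^sup>2 * card center"
  shows "cd_lattice G = {H. subgroup H G \<and> center \<subseteq> H}"
proof -
  let ?Z = "center"
  let ?z = "card ?Z"
  have zpos: "0 < ?z" by (rule card_subgroup_pos[OF subgroup_center])
  have m: "cd_measure G H = ?z * order G" if H: "subgroup H G" "?Z \<subseteq> H" for H
  proof -
    obtain j c where jc: "card H = p ^ j" "?z = p ^ c"
      using card_subgroup[OF H(1)] card_subgroup[OF subgroup_center] by auto
    have "?z \<le> card H" "card H \<le> order G"
      using H card_mono finite_subgroup subgroup.subset[OF H(1)] by (auto simp: order_def)
    moreover have "order G = p ^ (c + 2)" using ord jc by (simp add: power2_eq_square)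
    ultimately have "c \<le> j" "j \<le> c + 2"
      using jc p_gt(2) by (auto simp del: add_2_eq_Suc')
    then consider "j = c" | "j = c + 1" | "j = c + 2" by linarith
    then show ?thesis
    proof cases
      case 1
      then have "H = ?Z" using jc H card_subset_eq[OF finite_subgroup[OF H(1)]] by metis
      then show ?thesis using cd_measure_carrier_center by simp
    next
      case 3
      then have "card H = card (carrier G)"
        using jc ord by (simp add: order_def power2_eq_square)
      then have "H = carrier G" using card_subset_eq[OF fin subgroup.subset[OF H(1)]] by blast
      then show ?thesis using cd_measure_carrier_center by simp
    next
      case 2
      let ?C = "centralizer G H"
      have C: "subgroup ?C G" by (rule subgroup_centralizer[OF subgroup.subset[OF H(1)]])
      have "x \<otimes> y = y \<otimes> x" if "x \<in> H" "y \<in> H" for x y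
      proof (rule commute_if_central_index_le_p[OF subgroup_center _ H(1,2) _ that])
        show "?Z \<subseteq> centralizer G H" by (rule centralizer_antimono[OF subgroup.subset[OF H(1)]])
        show "card H \<le> p * ?z" using jc 2 by simp
      qed
      then have HC: "H \<subseteq> ?C"
        using commutative_imp_subset_centralizer[OF subgroup.subset[OF H(1)]] by blast
      obtain d where d: "card ?C = p ^ d" using card_subgroup[OF C] by auto
      have "p ^ j \<le> p ^ d" using card_mono[OF finite_subgroup[OF C] HC] d jc by simp
      then have "j \<le> d" using p_gt(2) by simp
      moreover have "?C \<noteq> carrier G"
      proof
        assume "?C = carrier G"
        then have "h \<otimes> g = g \<otimes> h" if "h \<in> H" "g \<in> carrier G" for h g
          using centralizerD[of g H h] that by simp
        then have "H \<subseteq> ?Z" using subgroup.subset[OF H(1)] by (auto simp: centralizer_def)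
        then have "p ^ j \<le> p ^ c" using card_mono[OF finite_subgroup[OF subgroup_center]] jc by metis
        then show False using 2 p_gt(2) by simp
      qed
      then have "card ?C < order G" unfolding order_def
        using centralizer_subset[of H] by (intro psubset_card_mono fin) auto
      then have "p ^ d < p ^ (c + 2)" using d ord jc by (simp add: power2_eq_square mult.assoc)
      then have "d < c + 2" using p_gt(2) by (metis power_less_imp_less_exp)
      ultimately have "d = j" using 2 by simp
      then have "cd_measure G H = p ^ (c + 1) * p ^ (c + 1)" using d jc 2 by (simp add: cd_measure_def)
      also have "\<dots> = p ^ c * (p\<^sup>2 * p ^ c)" by (simp add: power2_eq_square)
      finally show ?thesis using ord jc by simp
    qed
  qed
  have le: "cd_measure G K \<le> ?z * order G" if K: "subgroup K G" for K
    using cd_measure_le_over_center[OF K] m by metis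
  show ?thesis
  proof (intro equalityI subsetI)
    fix H assume "H \<in> cd_lattice G"
    then show "H \<in> {H. subgroup H G \<and> ?Z \<subseteq> H}"
      using cd_lattice_subgroup center_subset_cd by simp
  next
    fix H assume "H \<in> {H. subgroup H G \<and> ?Z \<subseteq> H}"
    then show "H \<in> cd_lattice G" using m[of H] le by (simp add: mem_cd_lattice_iff)
  qed
qed

end

text \<open><a> has index p and b is any element outside. No value of b^p is prescribed, so that the
  quaternion group is an instance along with the split extensions; \<open>b_pow_p\<close> shows that
  b^p lies in <a>. The groups \<open>sub_a s\<close> with s \<le> k are all subgroups of <a>, of
  index p^s.\<close>

locale cyclic_extension = p_group G p n for G (structure) and p n :: nat +
  fixes k r :: nat and a b
  assumes a_closed [simp]: "a \<in> carrier G" and b_closed [simp]: "b \<in> carrier G"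
    and ord_a: "ord a = p ^ k" and index_a: "n = Suc k"
    and b_notin: "b \<notin> cyc G a" and conj_a: "inv b \<otimes> a \<otimes> b = a [^] r"
begin

abbreviation sub_a :: "nat \<Rightarrow> 'a set" where
  "sub_a s \<equiv> cyc G (a [^] (p ^ s))"

lemma conj_a_pow: "inv b \<otimes> a [^] (i::nat) \<otimes> b = a [^] (r * i)"
  using pow_conj[of b a i] conj_a by (simp add: nat_pow_pow)

lemma pow_commute_b: "a [^] (i::nat) \<otimes> b = b \<otimes> a [^] (r * i)"
  using conj_a_pow[of i] conj_eq_iff(1)[of b "a [^] i"] by simp

lemma pow_in_sub_a_iff: "s \<le> k \<Longrightarrow> a [^] m \<in> sub_a s \<longleftrightarrow> p ^ s dvd (m::nat)"
  using pow_in_cyc_pow_iff[OF a_closed, of "p ^ s"] ord_a le_imp_power_dvd by metis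

lemma card_sub_a: "s \<le> k \<Longrightarrow> card (sub_a s) = p ^ (k - s)"
  using card_cyc_pow[OF a_closed, of "p ^ s"] ord_a le_imp_power_dvd[of s k p] p_gt
  by (simp add: power_diff)

lemma subgroup_sub_a: "subgroup (sub_a s) G"
  by (simp add: subgroup_cyc)

lemma sub_a_subset: "sub_a s \<subseteq> cyc G a"
  by (rule cyc_subset[OF subgroup_cyc]) auto

lemma sub_a_elem: "m \<in> sub_a s \<Longrightarrow> \<exists>i::nat. m = a [^] (p ^ s * i)"
  by (auto simp: cyc_def nat_pow_pow)

lemma conj_sub_a:
  assumes "m \<in> sub_a s"
  shows "inv (b \<otimes> a [^] (i::nat)) \<otimes> m \<otimes> (b \<otimes> a [^] i) \<in> sub_a s"
proof -
  obtain j :: nat where j: "m = a [^] (p ^ s * j)" using sub_a_elem[OF assms] by blast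
  have "inv (b \<otimes> a [^] i) \<otimes> m \<otimes> (b \<otimes> a [^] i)
      = inv (a [^] i) \<otimes> (inv b \<otimes> a [^] (p ^ s * j) \<otimes> b) \<otimes> a [^] i"
    unfolding j by (simp add: group_normalize)
  also have "\<dots> = a [^] (r * (p ^ s * j))"
    unfolding conj_a_pow by (subst conj_eq_iff(1)) (auto simp: nat_pow_mult add.commute)
  also have "\<dots> = (a [^] (p ^ s)) [^] (r * j)" by (simp add: nat_pow_pow ac_simps)
  finally show ?thesis by simp
qed

lemma ba_pow: "\<exists>l::nat. (b \<otimes> a [^] (i::nat)) [^] (j::nat) = b [^] j \<otimes> a [^] l"
proof (induction j)
  case (Suc j)
  then obtain l :: nat where l: "(b \<otimes> a [^] i) [^] j = b [^] j \<otimes> a [^] l" by blast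
  have "(b \<otimes> a [^] i) [^] Suc j = b [^] j \<otimes> (a [^] l \<otimes> b) \<otimes> a [^] i"
    using l by (simp add: m_assoc)
  also have "\<dots> = b [^] Suc j \<otimes> a [^] (r * l + i)"
    unfolding pow_commute_b by (simp add: m_assoc nat_pow_mult)
  finally show ?case by blast
qed (auto intro: exI[of _ "0::nat"])

lemma b_conj: "m \<in> cyc G a \<Longrightarrow> inv b \<otimes> m \<otimes> b \<in> cyc G a"
  using conj_sub_a[of m 0 0] by simp

lemma adjoin_b: "adjoin (cyc G a) b = carrier G" and b_pow_p: "b [^] p \<in> cyc G a"
proof -
  obtain m :: nat where m: "b [^] m \<notin> cyc G a" "(b [^] m) [^] p \<in> cyc G a"
    using ex_pow_leaving[OF subgroup_cyc b_closed b_notin] by auto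
  have S: "subgroup (adjoin (cyc G a) (b [^] m)) G"
    "card (adjoin (cyc G a) (b [^] m)) = p * card (cyc G a)"
    using subgroup_adjoin[OF subgroup_cyc[OF a_closed], of "b [^] m"] card_adjoin[OF subgroup_cyc[OF a_closed] _ m prime_p]
      conj_pow_mem[OF subgroup_cyc[OF a_closed] b_closed b_conj] by auto
  then have eq: "adjoin (cyc G a) (b [^] m) = carrier G"
    using card_cyc[OF a_closed] ord_a order_eq index_a card_subset_eq[OF fin subgroup.subset[OF S(1)]]
    by (simp add: order_def)
  have "\<not> p dvd m" if "b [^] p \<in> cyc G a"
    using m(1) pow_mem_subgroup_iff[OF subgroup_cyc b_closed b_notin that prime_p] by auto
  have "b \<in> adjoin (cyc G a) (b [^] m)" using eq by simp
  then obtain j :: nat and c where j: "b = (b [^] m) [^] j \<otimes> c" "c \<in> cyc G a" by (auto simp: adjoin_def)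
  obtain i :: nat where i: "c = a [^] i" using j(2) by (auto simp: cyc_def)
  \<comment> \<open>b commutes with b^m, so in a power of b = (b^m)^j c the factors from <a> can be
    collected on the right. For q = p the remaining factor falls into <a>.\<close>
  have "\<exists>l::nat. b [^] q = (b [^] m) [^] (j * q) \<otimes> a [^] l" for q :: nat
  proof (induction q)
    case (Suc q)
    then obtain l :: nat where l: "b [^] q = (b [^] m) [^] (j * q) \<otimes> a [^] l" by blast
    have comm: "b [^] q \<otimes> (b [^] m) [^] j = (b [^] m) [^] j \<otimes> b [^] q"
      by (simp add: nat_pow_pow nat_pow_comm)
    have "b [^] Suc q = b [^] q \<otimes> ((b [^] m) [^] j \<otimes> c)" using j(1) by simp
    also have "\<dots> = (b [^] m) [^] j \<otimes> b [^] q \<otimes> c"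
      using comm i by (simp flip: m_assoc)
    also have "\<dots> = (b [^] m) [^] (j * Suc q) \<otimes> a [^] (l + i)"
      unfolding l i by (simp add: m_assoc nat_pow_mult) (simp add: nat_pow_mult flip: m_assoc)
    finally show ?case by blast
  qed (auto intro: exI[of _ "0::nat"])
  from this[of p] obtain l :: nat where l: "b [^] p = (b [^] m) [^] (j * p) \<otimes> a [^] l" by blast
  have "(b [^] m) [^] (j * p) = ((b [^] m) [^] p) [^] j" by (simp add: nat_pow_pow ac_simps)
  then show bp: "b [^] p \<in> cyc G a"
    using l subgroup.m_closed[OF subgroup_cyc[OF a_closed] subgroup_pow_closed[OF subgroup_cyc[OF a_closed] m(2)]]
    by simp
  have "card (adjoin (cyc G a) b) = card (carrier G)"
    using card_adjoin[OF subgroup_cyc[OF a_closed] b_closed b_notin bp prime_p]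
      card_cyc[OF a_closed] ord_a order_eq index_a by (simp add: order_def)
  then show "adjoin (cyc G a) b = carrier G"
    using card_subset_eq[OF fin subgroup.subset[OF subgroup_adjoin[OF subgroup_cyc[OF a_closed] b_closed b_conj]]]
    by blast
qed

lemma elem_cases:
  assumes "x \<in> carrier G"
  obtains i j :: nat where "x = b [^] j \<otimes> a [^] i"
proof -
  have "x \<in> adjoin (cyc G a) b" using assms adjoin_b by simp
  then show ?thesis using that by (auto simp: adjoin_def cyc_def)
qed

lemma ba_notin: "b \<otimes> a [^] (i::nat) \<notin> cyc G a"
  using subgroup_cancel(2)[OF subgroup_cyc[OF a_closed] _ b_closed, of "a [^] i"] b_notin by simp

lemma ba_pow_p: "(b \<otimes> a [^] (i::nat)) [^] p \<in> cyc G a"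
proof -
  obtain l :: nat where "(b \<otimes> a [^] i) [^] p = b [^] p \<otimes> a [^] l" using ba_pow by blast
  then show ?thesis using subgroup.m_closed[OF subgroup_cyc[OF a_closed] b_pow_p] by simp
qed

text \<open>A subgroup \<open>H\<close> not contained in \<open>\<langle>a\<rangle>\<close> meets the coset \<open>b \<langle>a\<rangle>\<close>; it is generated by
  \<open>H \<inter> \<langle>a\<rangle>\<close> and any element \<open>b a\<^sup>i\<close> of this intersection.\<close>

lemma subgroup_eq_adjoin:
  assumes H: "subgroup H G" "\<not> H \<subseteq> cyc G a" "H \<inter> cyc G a = sub_a s" and s: "s \<le> k"
  shows "\<exists>i<p ^ s. (b \<otimes> a [^] i) [^] p \<in> sub_a s \<and> H = adjoin (sub_a s) (b \<otimes> a [^] i)"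
proof -
  note A = subgroup_cyc[OF a_closed]
  have Hc: "x \<in> carrier G" if "x \<in> H" for x using subgroup.mem_carrier[OF H(1) that] .
  obtain h where h: "h \<in> H" "h \<notin> cyc G a" using H(2) by blast
  obtain j l :: nat where jl: "h = b [^] j \<otimes> a [^] l" using elem_cases[OF Hc[OF h(1)]] .
  have "b [^] j \<notin> cyc G a" using h(2) jl subgroup.m_closed[OF A] by auto
  then have pj: "\<not> p dvd j" using pow_mem_subgroup_iff[OF A b_closed b_notin b_pow_p prime_p] by blast
  then have "coprime j p" using prime_p by (metis coprime_commute prime_imp_coprime)
  moreover have "j \<noteq> 0" using pj by (metis dvd_0_right)
  \<comment> \<open>The power h^u of h = b^j a^l lies in the coset b <a>.\<close>
  ultimately obtain u v where uv: "j * u = p * v + 1" using bezout_nat[of j p] by auto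
  have "\<exists>l'::nat. h [^] q = b [^] (j * q) \<otimes> a [^] l'" for q :: nat
  proof (induction q)
    case (Suc q)
    then obtain l' :: nat where l': "h [^] q = b [^] (j * q) \<otimes> a [^] l'" by blast
    have "inv (b [^] j) \<otimes> a [^] l' \<otimes> b [^] j \<in> cyc G a"
      by (rule conj_pow_mem[OF A b_closed b_conj]) auto
    then obtain l'' :: nat where "inv (b [^] j) \<otimes> a [^] l' \<otimes> b [^] j = a [^] l''"
      by (auto simp: cyc_def)
    then have "a [^] l' \<otimes> b [^] j = b [^] j \<otimes> a [^] l''"
      using conj_eq_iff(1)[of "b [^] j" "a [^] l'" "a [^] l''"] by simp
    then have "h [^] Suc q = b [^] (j * q) \<otimes> (b [^] j \<otimes> a [^] l'') \<otimes> a [^] l"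
      using l' jl by (simp add: m_assoc) (simp flip: m_assoc)
    also have "\<dots> = b [^] (j * Suc q) \<otimes> a [^] (l'' + l)"
      by (simp add: m_assoc nat_pow_mult) (simp add: nat_pow_mult add.commute flip: m_assoc)
    finally show ?case by blast
  qed (auto intro: exI[of _ "0::nat"])
  from this[of u] obtain l' :: nat where l': "h [^] u = b [^] (p * v + 1) \<otimes> a [^] l'" using uv by metis
  obtain c :: nat where c: "(b [^] p) [^] v = a [^] c"
    using subgroup_pow_closed[OF A b_pow_p] by (auto simp: cyc_def)
  have "b [^] (p * v + 1) = b \<otimes> a [^] c"
    using c by (metis Suc_eq_plus1 b_closed nat_pow_Suc2 nat_pow_pow)
  then have hu: "h [^] u = b \<otimes> a [^] (c + l')" using l' by (simp add: m_assoc nat_pow_mult)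
  \<comment> \<open>Since a^(p^s) is in \<open>H\<close>, the exponent matters only modulo
    p^s.\<close>
  define i where "i = (c + l') mod p ^ s"
  have "a [^] (c + l') = a [^] i \<otimes> a [^] (p ^ s * ((c + l') div p ^ s))"
    unfolding i_def by (simp add: nat_pow_mult)
  then have hu2: "h [^] u = (b \<otimes> a [^] i) \<otimes> a [^] (p ^ s * ((c + l') div p ^ s))"
    using hu by (simp add: m_assoc)
  have "a [^] (p ^ s * ((c + l') div p ^ s)) \<in> sub_a s" using pow_in_sub_a_iff[OF s] by simp
  then have inH: "a [^] (p ^ s * ((c + l') div p ^ s)) \<in> H" using H(3) by blast
  let ?x = "b \<otimes> a [^] i"
  have xH: "?x \<in> H"
    using subgroup_pow_closed[OF H(1) h(1), of u] hu2 subgroup_cancel(2)[OF H(1) inH, of ?x] by simp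
  have xp: "?x [^] p \<in> sub_a s" using subgroup_pow_closed[OF H(1) xH] ba_pow_p H(3) by blast
  have "adjoin (sub_a s) ?x \<subseteq> H"
    using subgroup_pow_closed[OF H(1) xH] H(3) subgroup.m_closed[OF H(1)] by (fastforce simp: adjoin_def)
  moreover have "H \<subseteq> adjoin (sub_a s) ?x"
  proof
    fix y assume y: "y \<in> H"
    obtain j l :: nat where jl: "y = b [^] j \<otimes> a [^] l" using elem_cases[OF Hc[OF y]] .
    obtain l' :: nat where "?x [^] j = b [^] j \<otimes> a [^] l'" using ba_pow by blast
    then have "inv (?x [^] j) \<otimes> y = inv (a [^] l') \<otimes> a [^] l" using jl by (simp add: group_normalize)
    then have "inv (?x [^] j) \<otimes> y \<in> cyc G a"
      using subgroup.m_closed[OF A subgroup.m_inv_closed[OF A]] by simp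
    moreover have "inv (?x [^] j) \<otimes> y \<in> H"
      using y subgroup_pow_closed[OF H(1) xH] subgroup.m_closed[OF H(1)] subgroup.m_inv_closed[OF H(1)] by simp
    ultimately have "inv (?x [^] j) \<otimes> y \<in> sub_a s" using H(3) by blast
    moreover have "y = ?x [^] j \<otimes> (inv (?x [^] j) \<otimes> y)" using Hc[OF y] by simp
    ultimately show "y \<in> adjoin (sub_a s) ?x" unfolding adjoin_def by blast
  qed
  ultimately have "H = adjoin (sub_a s) ?x" by blast
  moreover have "i < p ^ s" unfolding i_def using p_gt by simp
  ultimately show ?thesis using xp by blast
qed

text \<open>i runs through the cosets of \<open>sub_a s\<close> in b <a>. For s \<le> k this is the
  number of subgroups that meet <a> exactly in \<open>sub_a s\<close> without being contained in
  <a>.\<close>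

definition num_ext :: "nat \<Rightarrow> nat" where
  "num_ext s = card {i. i < p ^ s \<and> (b \<otimes> a [^] i) [^] p \<in> sub_a s}"

text \<open>The summand 1 stands for \<open>sub_a s\<close> itself. If b a^i and b a^j lie in the
  same subgroup, then a^(j-i) is in \<open>sub_a s\<close>; so different i < p^s give different
  subgroups.\<close>

lemma card_subgroups_meeting:
  assumes s: "s \<le> k"
  shows "card {H. subgroup H G \<and> H \<inter> cyc G a = sub_a s} = 1 + num_ext s"
proof -
  note A = subgroup_cyc[OF a_closed]
  let ?I = "{i. i < p ^ s \<and> (b \<otimes> a [^] i) [^] p \<in> sub_a s}"
  let ?f = "\<lambda>i. adjoin (sub_a s) (b \<otimes> a [^] i)"
  have f: "subgroup (?f i) G" "?f i \<inter> cyc G a = sub_a s" "b \<otimes> a [^] i \<in> ?f i" "\<not> ?f i \<subseteq> cyc G a" if "i \<in> ?I" for i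
  proof -
    show 1: "subgroup (?f i) G" by (rule subgroup_adjoin[OF subgroup_sub_a _ conj_sub_a]) auto
    show "?f i \<inter> cyc G a = sub_a s"
      by (rule adjoin_Int[OF subgroup_sub_a A sub_a_subset _ ba_notin _ prime_p]) (use that in auto)
    show 2: "b \<otimes> a [^] i \<in> ?f i" by (rule adjoin_self[OF subgroup_sub_a]) simp
    show "\<not> ?f i \<subseteq> cyc G a" using 2 ba_notin by blast
  qed
  have inj: "inj_on ?f ?I"
  proof (rule inj_onI)
    have key: "i = j" if ij: "i \<in> ?I" "j \<in> ?I" "?f i = ?f j" "i \<le> j" for i j
    proof -
      have m: "b \<otimes> a [^] i \<in> ?f i" "b \<otimes> a [^] j \<in> ?f i"
        using f(3)[OF ij(1)] f(3)[OF ij(2)] unfolding ij(3) by simp_all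
      have "b \<otimes> a [^] j = (b \<otimes> a [^] i) \<otimes> a [^] (j - i)" using ij(4) by (simp add: m_assoc nat_pow_mult)
      then have "a [^] (j - i) \<in> ?f i" using m subgroup_cancel(1)[OF f(1)[OF ij(1)] m(1), of "a [^] (j - i)"] by simp
      then have "a [^] (j - i) \<in> sub_a s" using f(2)[OF ij(1)] by blast
      then have "p ^ s dvd j - i" using pow_in_sub_a_iff[OF s] by blast
      then have "j - i = 0" using ij(2) by (metis (no_types, lifting) less_imp_diff_less mem_Collect_eq nat_dvd_not_less neq0_conv)
      then show ?thesis using ij(4) by simp
    qed
    fix i j assume "i \<in> ?I" "j \<in> ?I" "?f i = ?f j"
    then show "i = j" using key[of i j] key[of j i] by (metis nat_le_linear)
  qed
  have "{H. subgroup H G \<and> H \<inter> cyc G a = sub_a s} = insert (sub_a s) (?f ` ?I)"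
  proof (intro equalityI subsetI)
    fix H assume "H \<in> {H. subgroup H G \<and> H \<inter> cyc G a = sub_a s}"
    then show "H \<in> insert (sub_a s) (?f ` ?I)"
      using subgroup_eq_adjoin[OF _ _ _ s, of H] by (cases "H \<subseteq> cyc G a") auto
  next
    fix H assume "H \<in> insert (sub_a s) (?f ` ?I)"
    then show "H \<in> {H. subgroup H G \<and> H \<inter> cyc G a = sub_a s}"
      using f sub_a_subset[of s] subgroup_sub_a by blast
  qed
  moreover have "sub_a s \<notin> ?f ` ?I" using f(4) sub_a_subset[of s] by blast
  moreover have "finite ?I" by simp
  ultimately show ?thesis using inj by (simp add: card_image num_ext_def)
qed

lemma card_subgroups_meeting_sum:
  assumes S: "S \<subseteq> {..k}"
  shows "card {H. subgroup H G \<and> (\<exists>s\<in>S. H \<inter> cyc G a = sub_a s)} = (\<Sum>s\<in>S. 1 + num_ext s)"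
proof -
  have "{H. subgroup H G \<and> (\<exists>s\<in>S. H \<inter> cyc G a = sub_a s)} = (\<Union>s\<in>S. {H. subgroup H G \<and> H \<inter> cyc G a = sub_a s})"
    by blast
  moreover have "finite {H. subgroup H G \<and> H \<inter> cyc G a = sub_a s}" for s
    by (rule finite_subset[OF _ finite_subgroups_of]) (auto simp: subgroups_of_def)
  moreover have "{H. subgroup H G \<and> H \<inter> cyc G a = sub_a s} \<inter> {H. subgroup H G \<and> H \<inter> cyc G a = sub_a t} = {}"
    if "s \<in> S" "t \<in> S" "s \<noteq> t" for s t
    using cyc_p_pow_inj[OF a_closed ord_a, of s t] that S by auto
  ultimately have "card {H. subgroup H G \<and> (\<exists>s\<in>S. H \<inter> cyc G a = sub_a s)}
      = (\<Sum>s\<in>S. card {H. subgroup H G \<and> H \<inter> cyc G a = sub_a s})"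
    using finite_subset[OF S] by (simp add: card_UN_disjoint)
  also have "\<dots> = (\<Sum>s\<in>S. 1 + num_ext s)"
    using card_subgroups_meeting S by (intro sum.cong) auto
  finally show ?thesis .
qed

lemma meet_sub_a: "subgroup H G \<Longrightarrow> \<exists>s\<le>k. H \<inter> cyc G a = sub_a s"
  using subgroup_of_cyc_p[OF a_closed ord_a subgroups_Inter_pair[OF _ subgroup_cyc[OF a_closed]]] by blast

lemma card_subgroups: "card (subgroups_of G) = (\<Sum>s\<le>k. 1 + num_ext s)"
proof -
  have "subgroups_of G = {H. subgroup H G \<and> (\<exists>s\<in>{..k}. H \<inter> cyc G a = sub_a s)}"
    using meet_sub_a by (auto simp: subgroups_of_def)
  then show ?thesis using card_subgroups_meeting_sum[of "{..k}"] by simp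
qed

lemma commute_all:
  assumes x: "x \<in> carrier G" "x \<otimes> a = a \<otimes> x" "x \<otimes> b = b \<otimes> x" and g: "g \<in> carrier G"
  shows "x \<otimes> g = g \<otimes> x"
proof -
  obtain i j :: nat where g: "g = b [^] j \<otimes> a [^] i" by (rule elem_cases[OF g])
  have 1: "b [^] j \<otimes> x = x \<otimes> b [^] j" by (rule group_commutes_pow) (use x in simp_all)
  have 2: "a [^] i \<otimes> x = x \<otimes> a [^] i" by (rule group_commutes_pow) (use x in simp_all)
  have "x \<otimes> g = x \<otimes> b [^] j \<otimes> a [^] i" unfolding g using x(1) by (simp add: m_assoc)
  also have "\<dots> = b [^] j \<otimes> (x \<otimes> a [^] i)" unfolding 1[symmetric] using x(1) by (simp add: m_assoc)
  also have "\<dots> = g \<otimes> x" unfolding g 2[symmetric] using x(1) by (simp add: m_assoc)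
  finally show ?thesis .
qed

lemma defect_abelian:
  assumes "a \<otimes> b = b \<otimes> a"
  shows "cd_defect G = (\<Sum>s\<le>k. 1 + num_ext s) - 1"
proof -
  have 1: "a \<otimes> g = g \<otimes> a" "b \<otimes> g = g \<otimes> b" if "g \<in> carrier G" for g
    using commute_all[OF _ _ _ that] assms by simp_all
  have "x \<otimes> y = y \<otimes> x" if "x \<in> carrier G" "y \<in> carrier G" for x y
    using commute_all[OF that(1) _ _ that(2)] 1[OF that(1)] by simp
  then show ?thesis using cd_lattice_abelian card_subgroups by (simp add: cd_defect_def)
qed

text \<open>By \<open>commute_all\<close> the subgroup \<open>sub_a 1\<close>, of index p^2, is
  central, and the center of a nonabelian p-group cannot have index p or less.\<close>

lemma center_eq:
  assumes ne: "a \<otimes> b \<noteq> b \<otimes> a" and comm: "a [^] p \<otimes> b = b \<otimes> a [^] p" and k: "k \<ge> 1"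
  shows "center = sub_a 1" "order G = p\<^sup>2 * card center"
proof -
  have Nc: "subgroup (sub_a 1) G" by (rule subgroup_sub_a)
  have sub: "sub_a 1 \<subseteq> center"
  proof
    fix x assume "x \<in> sub_a 1"
    then obtain i :: nat where x: "x = (a [^] p) [^] i" by (auto simp: cyc_def)
    have xb: "x \<otimes> b = b \<otimes> x" unfolding x by (rule group_commutes_pow) (use comm in simp_all)
    have xa: "x \<otimes> a = a \<otimes> x" unfolding x
      by (rule group_commutes_pow, rule group_commutes_pow) simp_all
    have xc: "x \<in> carrier G" unfolding x by simp
    have "x \<otimes> g = g \<otimes> x" if "g \<in> carrier G" for g
      using commute_all[OF xc xa xb that] .
    then show "x \<in> center" using xc by (simp add: center_iff)
  qed
  have cN: "card (sub_a 1) = p ^ (k - 1)" by (rule card_sub_a[OF k])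
  have "\<not> order G \<le> p * card center"
  proof
    assume "order G \<le> p * card center"
    then have "a \<otimes> b = b \<otimes> a"
      by (intro commute_if_central_index_le_p[OF subgroup_center _ subgroup_self]) (auto simp: order_def centralizer_def)
    then show False using ne by simp
  qed
  moreover obtain c where c: "card center = p ^ c" using card_subgroup[OF subgroup_center] by auto
  ultimately have "\<not> p ^ Suc k \<le> p ^ Suc c" using order_eq index_a by simp
  then have "c < k" using p_gt(2) by (metis Suc_le_mono not_le power_increasing_iff)
  then have "card center \<le> card (sub_a 1)" unfolding cN c using p_gt by (intro power_increasing) auto
  then show Z: "center = sub_a 1"
    using sub card_seteq[OF finite_subgroup[OF subgroup_center] sub] by simp
  have "p\<^sup>2 * p ^ (k - 1) = p ^ Suc k" using k by (simp flip: power_add)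
  then show "order G = p\<^sup>2 * card center" unfolding Z cN using order_eq index_a by simp
qed

text \<open>The center is \<open>sub_a 1\<close>, of index p^2. So the lattice consists of the
  subgroups containing it, that is, of those meeting <a> in \<open>sub_a 0\<close> or
  \<open>sub_a 1\<close>; the sum counts the others.\<close>

lemma defect_nonabelian:
  assumes "a \<otimes> b \<noteq> b \<otimes> a" and "a [^] p \<otimes> b = b \<otimes> a [^] p" and k: "k \<ge> 1"
  shows "cd_defect G = (\<Sum>s\<in>{2..k}. 1 + num_ext s)"
proof -
  note Z = center_eq[OF assms]
  have "H \<notin> cd_lattice G \<longleftrightarrow> (\<exists>s\<in>{2..k}. H \<inter> cyc G a = sub_a s)" if H: "subgroup H G" for H
  proof -
    obtain s where s: "s \<le> k" "H \<inter> cyc G a = sub_a s" using meet_sub_a[OF H] by blast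
    have "H \<in> cd_lattice G \<longleftrightarrow> sub_a 1 \<subseteq> H" using cd_lattice_center_index_p2[OF Z(2)] Z(1) H by auto
    also have "\<dots> \<longleftrightarrow> sub_a 1 \<subseteq> sub_a s" using s(2) sub_a_subset[of 1] by blast
    also have "\<dots> \<longleftrightarrow> a [^] p \<in> sub_a s"
      using cyc_subset[OF subgroup_sub_a[of s], of "a [^] p"] self_in_cyc[of "a [^] p"] by auto
    also have "\<dots> \<longleftrightarrow> p ^ s dvd p ^ 1" using pow_in_sub_a_iff[OF s(1), of p] by simp
    also have "\<dots> \<longleftrightarrow> s \<le> 1" using p_gt(2) by (intro dvd_power_iff_le) auto
    finally have "H \<notin> cd_lattice G \<longleftrightarrow> s \<in> {2..k}" using s(1) by auto
    moreover have "(\<exists>t\<in>{2..k}. H \<inter> cyc G a = sub_a t) \<longleftrightarrow> s \<in> {2..k}"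
      using s cyc_p_pow_inj[OF a_closed ord_a] by (metis atLeastAtMost_iff)
    ultimately show ?thesis by simp
  qed
  then have "subgroups_of G - cd_lattice G = {H. subgroup H G \<and> (\<exists>s\<in>{2..k}. H \<inter> cyc G a = sub_a s)}"
    by (auto simp: subgroups_of_def)
  then show ?thesis unfolding cd_defect_eq using card_subgroups_meeting_sum[of "{2..k}"] by simp
qed

lemma num_ext_0: "num_ext 0 = 1"
proof -
  have "{i. i < p ^ 0 \<and> (b \<otimes> a [^] i) [^] p \<in> sub_a 0} = {0}" using b_pow_p by auto
  then show ?thesis unfolding num_ext_def by (simp only: card.empty card.insert) simp
qed

text \<open>As u is a unit, (b a^i)^p lies in \<open>sub_a s\<close> iff p^(s-1) divides i. This
  leaves p values below p^s.\<close>

lemma num_ext_regular: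
  assumes u: "\<And>i::nat. (b \<otimes> a [^] i) [^] p = a [^] (p * u * i)" "coprime u p" and s: "1 \<le> s" "s \<le> k"
  shows "num_ext s = p"
proof -
  obtain t where t: "s = Suc t" using s(1) by (metis Suc_le_D One_nat_def)
  have "(b \<otimes> a [^] i) [^] p \<in> sub_a s \<longleftrightarrow> p ^ t dvd i" for i
  proof -
    have "(b \<otimes> a [^] i) [^] p \<in> sub_a s \<longleftrightarrow> p ^ s dvd p * u * i"
      unfolding u(1) by (rule pow_in_sub_a_iff[OF s(2)])
    also have "\<dots> \<longleftrightarrow> p ^ t dvd u * i" unfolding t using p_gt by (simp add: mult.assoc)
    also have "\<dots> \<longleftrightarrow> p ^ t dvd i" using u(2)
      by (metis coprime_commute coprime_dvd_mult_right_iff coprime_power_right_iff coprime_power_left_iff)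
    finally show ?thesis .
  qed
  note iff = this
  have "{i. i < p ^ s \<and> (b \<otimes> a [^] i) [^] p \<in> sub_a s} = (\<lambda>j. p ^ t * j) ` {..<p}"
  proof (intro equalityI subsetI)
    fix i assume "i \<in> {i. i < p ^ s \<and> (b \<otimes> a [^] i) [^] p \<in> sub_a s}"
    then have "i < p ^ t * p" "p ^ t dvd i" using iff t by (auto simp: mult.commute)
    then obtain j where "i = p ^ t * j" "p ^ t * j < p ^ t * p" by auto
    then show "i \<in> (\<lambda>j. p ^ t * j) ` {..<p}" by auto
  next
    fix i assume "i \<in> (\<lambda>j. p ^ t * j) ` {..<p}"
    then obtain j where j: "i = p ^ t * j" "j < p" by auto
    then have "i < p ^ s" using p_gt unfolding t by (simp add: mult.commute)
    moreover have "p ^ t dvd i" using j by simp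
    ultimately show "i \<in> {i. i < p ^ s \<and> (b \<otimes> a [^] i) [^] p \<in> sub_a s}" using iff by blast
  qed
  moreover have "inj_on (\<lambda>j. p ^ t * j) {..<p}" using p_gt by (auto intro: inj_onI)
  ultimately show ?thesis unfolding num_ext_def by (simp add: card_image)
qed

text \<open>s = 0 accounts for <a> and G, every other s for p + 1 subgroups. In the abelian case
  only G is in the lattice; in the nonabelian case exactly s = 0 and s = 1 drop out.\<close>

lemma defect_regular:
  assumes u: "\<And>i::nat. (b \<otimes> a [^] i) [^] p = a [^] (p * u * i)" "coprime u p" and k: "k \<ge> 1"
  shows "a \<otimes> b = b \<otimes> a \<Longrightarrow> cd_defect G = k * (p + 1) + 1"
    and "a \<otimes> b \<noteq> b \<otimes> a \<Longrightarrow> a [^] p \<otimes> b = b \<otimes> a [^] p \<Longrightarrow> cd_defect G = (k - 1) * (p + 1)"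
proof -
  assume "a \<otimes> b = b \<otimes> a"
  moreover have "(\<Sum>s\<le>k. 1 + num_ext s) = (1 + num_ext 0) + (\<Sum>s\<in>{1..k}. 1 + num_ext s)"
    by (simp add: sum.atLeast1_atMost_eq sum.atMost_shift)
  moreover have "(\<Sum>s\<in>{1..k}. 1 + num_ext s) = (\<Sum>s\<in>{1..k}. 1 + p)"
    using num_ext_regular[OF u] by (intro sum.cong) auto
  ultimately show "cd_defect G = k * (p + 1) + 1"
    using defect_abelian num_ext_0 by simp
next
  assume "a \<otimes> b \<noteq> b \<otimes> a" "a [^] p \<otimes> b = b \<otimes> a [^] p"
  moreover have "(\<Sum>s\<in>{2..k}. 1 + num_ext s) = (\<Sum>s\<in>{2..k}. 1 + p)"
    using num_ext_regular[OF u] by (intro sum.cong) auto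
  ultimately show "cd_defect G = (k - 1) * (p + 1)"
    using defect_nonabelian k by simp
qed

end

subsection \<open>Twisted power sums\<close>

text \<open>With r = 1 + p s modulo p^2 the sum is p + p s * p (p - 1) / 2, and for odd p the second
  term vanishes modulo p^2. For p = 2 the sum is 1 + r, which for odd r is twice an odd number
  exactly if r = 1 modulo 4.\<close>

lemma sum_powers_prime:
  fixes p r :: nat
  assumes p: "Factorial_Ring.prime p" and r: "[r = 1] (mod p)" "p = 2 \<Longrightarrow> [r = 1] (mod 4)"
  shows "\<exists>u. (\<Sum>j<p. r ^ j) = p * u \<and> coprime u p"
proof (cases "p = 2")
  case True
  then have "r mod 4 = 1" using r(2) by (simp add: cong_def)
  then have "r = 4 * (r div 4) + 1" by presburger
  then have "(\<Sum>j<p. r ^ j) = p * (2 * (r div 4) + 1)"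
    using True by (simp add: numeral_2_eq_2)
  moreover have "coprime (2 * (r div 4) + 1) p" using True by simp
  ultimately show ?thesis by blast
next
  case False
  then have odd: "odd p" using p primes_dvd_imp_eq two_is_prime_nat by blast
  have p1: "p > 1" using p prime_gt_1_nat by blast
  obtain s where s: "[r = 1 + p * s] (mod p\<^sup>2)"
  proof -
    have "[r mod p\<^sup>2 = 1] (mod p)" using r(1) by (simp add: cong_def mod_mod_cancel)
    then have "r mod p\<^sup>2 mod p = 1" using p1 by (simp add: cong_def)
    then have "r mod p\<^sup>2 = 1 + p * (r mod p\<^sup>2 div p)" by (metis add.commute mult_div_mod_eq)
    then show ?thesis using that[of "r mod p\<^sup>2 div p"] by (simp add: cong_def)
  qed
  have pw: "[r ^ j = 1 + j * (p * s)] (mod p\<^sup>2)" for j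
  proof (induction j)
    case (Suc j)
    have "[r ^ Suc j = (1 + p * s) * (1 + j * (p * s))] (mod p\<^sup>2)"
      using cong_mult[OF s Suc] by simp
    also have "(1 + p * s) * (1 + j * (p * s)) = 1 + Suc j * (p * s) + p\<^sup>2 * (s * s * j)"
      by (simp add: algebra_simps power2_eq_square)
    also have "[\<dots> = 1 + Suc j * (p * s)] (mod p\<^sup>2)" by (simp add: cong_def)
    finally show ?case .
  qed simp
  have "[(\<Sum>j<p. r ^ j) = (\<Sum>j<p. 1 + j * (p * s))] (mod p\<^sup>2)"
    by (rule cong_sum) (rule pw)
  also have "(\<Sum>j<p. 1 + j * (p * s)) = p + (\<Sum>j<p. j) * (p * s)"
    by (simp only: sum.distrib sum_distrib_right sum_constant card_lessThan mult_1_right of_nat_id)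
  also have "(\<Sum>j<p. j) = p * ((p - 1) div 2)"
  proof -
    have "(\<Sum>j<p. j) = p * (p - 1) div 2" using Sum_Ico_nat[of 0 p] by (simp add: atLeast0LessThan)
    then show ?thesis using odd by (simp add: div_mult_swap)
  qed
  also have "p + p * ((p - 1) div 2) * (p * s) = p + p\<^sup>2 * ((p - 1) div 2 * s)"
    by (simp only: power2_eq_square ac_simps)
  also have "[p + p\<^sup>2 * ((p - 1) div 2 * s) = p] (mod p\<^sup>2)"
    by (simp only: cong_def mod_mult_self2)
  finally have S: "[(\<Sum>j<p. r ^ j) = p] (mod p\<^sup>2)" .
  then have "[(\<Sum>j<p. r ^ j) = p] (mod p)" by (rule cong_dvd_modulus_nat) simp
  then obtain u where u: "(\<Sum>j<p. r ^ j) = p * u" by (metis cong_dvd_iff dvd_def dvd_refl)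
  then have "[p * u = p * 1] (mod (p * p))" using S by (simp add: power2_eq_square)
  then have "[u = 1] (mod p)" using p1 by (simp add: cong_def)
  then have "coprime u p" using cong_imp_coprime[of 1 u p] cong_sym by auto
  then show ?thesis using u by blast
qed

text \<open>By Fermat, r^p = r modulo p.\<close>

lemma cong_1_of_power_prime:
  fixes p r :: nat
  assumes p: "Factorial_Ring.prime p" and r: "[r ^ p = 1] (mod p)"
  shows "[r = 1] (mod p)"
proof -
  have "\<not> p dvd r"
  proof
    assume "p dvd r"
    then have "p dvd r ^ p" using p prime_gt_0_nat by (metis dvd_power dvd_trans prime_dvd_power_iff)
    then have "p dvd 1" using r cong_dvd_iff by blast
    then show False using p by simp
  qed
  then have "[r ^ (p - 1) = 1] (mod p)" using p fermat_theorem by blast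
  then have "[r * r ^ (p - 1) = r * 1] (mod p)" by (rule cong_scalar_left)
  moreover have "r * r ^ (p - 1) = r ^ p" using p prime_gt_0_nat by (metis power_eq_if less_irrefl)
  ultimately show ?thesis using r by (metis cong_sym cong_trans mult_1_right)
qed

text \<open>r^p - 1 = (r - 1) p u with a unit u, so p^k divides p (r - 1). For an element a of order
  p^k this says that a^p is fixed by a -> a^r.\<close>

lemma cong_1_lift:
  fixes p r :: nat
  assumes p: "Factorial_Ring.prime p" and r: "[r = 1] (mod p)" "p = 2 \<Longrightarrow> [r = 1] (mod 4)"
    and k: "[r ^ p = 1] (mod p ^ k)"
  shows "[p * r = p] (mod p ^ k)"
proof -
  obtain u where u: "(\<Sum>j<p. r ^ j) = p * u" "coprime u p" using sum_powers_prime[OF p r] by blast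
  have "int r ^ p - 1 = (int r - 1) * (\<Sum>j<p. int r ^ j)" by (rule power_diff_1_eq)
  also have "(\<Sum>j<p. int r ^ j) = int (p * u)" unfolding u(1)[symmetric] by simp
  finally have "int (p ^ k) dvd (int r - 1) * int (p * u)"
    using k by (metis cong_iff_dvd_diff cong_int_iff of_nat_1 of_nat_power)
  then have "int (p ^ k) dvd (int p * (int r - 1)) * int u" by (simp add: ac_simps)
  moreover have "coprime (int (p ^ k)) (int u)" using u(2) by (simp add: coprime_commute)
  ultimately have "int (p ^ k) dvd int p * (int r - 1)" by (metis coprime_dvd_mult_left_iff)
  then have "int (p ^ k) dvd int (p * r) - int p" by (simp add: algebra_simps)
  then show ?thesis by (metis cong_iff_dvd_diff cong_int_iff)
qed

section \<open>Powers of x a^i when x acts on a by a -> a^r\<close>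

context group begin

lemma twisted_commute:
  assumes "a \<in> carrier G" "x \<in> carrier G" "a \<otimes> x = x \<otimes> a [^] (r::nat)"
  shows "a [^] (l::nat) \<otimes> x = x \<otimes> a [^] (r * l)"
proof -
  have "inv x \<otimes> a \<otimes> x = a [^] r" using assms conj_eq_iff(1)[of x a "a [^] r"] by simp
  then have "inv x \<otimes> a [^] l \<otimes> x = a [^] (r * l)"
    using pow_conj[of x a l] assms by (simp add: nat_pow_pow)
  then show ?thesis using assms conj_eq_iff(1)[of x "a [^] l"] by simp
qed

lemma twisted_commute_pow:
  assumes "a \<in> carrier G" "x \<in> carrier G" "a \<otimes> x = x \<otimes> a [^] (r::nat)"
  shows "a [^] (l::nat) \<otimes> x [^] (j::nat) = x [^] j \<otimes> a [^] (r ^ j * l)"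
proof (induction j)
  case (Suc j)
  have "a [^] l \<otimes> x [^] Suc j = x [^] j \<otimes> (a [^] (r ^ j * l) \<otimes> x)"
    using assms Suc by (simp flip: m_assoc)
  also have "\<dots> = x [^] Suc j \<otimes> a [^] (r ^ Suc j * l)"
    unfolding twisted_commute[OF assms] using assms by (simp add: m_assoc ac_simps)
  finally show ?case .
qed (use assms in simp)

text \<open>Every passage of a power of a to the right of an x multiplies its exponent by r, hence
  the geometric sum.\<close>

lemma twisted_power:
  assumes "a \<in> carrier G" "x \<in> carrier G" "a \<otimes> x = x \<otimes> a [^] (r::nat)"
  shows "(x \<otimes> a [^] (i::nat)) [^] (m::nat) = x [^] m \<otimes> a [^] (i * (\<Sum>j<m. r ^ j))"
proof (induction m)
  case (Suc m)
  have "(x \<otimes> a [^] i) [^] Suc m = x [^] m \<otimes> (a [^] (i * (\<Sum>j<m. r ^ j)) \<otimes> x) \<otimes> a [^] i"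
    using assms Suc by (simp add: m_assoc)
  also have "\<dots> = x [^] Suc m \<otimes> a [^] (r * (i * (\<Sum>j<m. r ^ j)) + i)"
    unfolding twisted_commute[OF assms] using assms by (simp add: m_assoc nat_pow_mult)
  also have "r * (i * (\<Sum>j<m. r ^ j)) + i = i * (\<Sum>j<Suc m. r ^ j)"
    unfolding sum.lessThan_Suc_shift by (simp add: algebra_simps sum_distrib_left)
  finally show ?case .
qed (use assms in simp)

end

context p_group begin

text \<open>x^p is a power of a and commutes with a, whereas conjugation by x^p raises a to the
  power r^p.\<close>

lemma twisted_exponent:
  assumes a: "a \<in> carrier G" "ord a = p ^ k" "k \<ge> 1"
    and x: "x \<in> carrier G" "a \<otimes> x = x \<otimes> a [^] r" "x [^] p \<in> cyc G a"
  shows "[r ^ p = 1] (mod p ^ k)" "[r = 1] (mod p)"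
proof -
  obtain j :: nat where j: "x [^] p = a [^] j" using x(3) by (auto simp: cyc_def)
  have "a \<otimes> x [^] p = x [^] p \<otimes> a [^] (r ^ p)"
    using twisted_commute_pow[OF a(1) x(1,2), of 1 p] a(1) by simp
  moreover have "a \<otimes> x [^] p = x [^] p \<otimes> a" unfolding j using a(1) nat_pow_comm[of a 1 j] by simp
  ultimately have "a [^] (r ^ p) = a [^] (1::nat)" using a(1) x(1) by simp
  then show 1: "[r ^ p = 1] (mod p ^ k)" using pow_eq_pow_iff[OF a(1)] a(2) by metis
  then have "[r ^ p = 1] (mod p)" by (rule cong_dvd_modulus_nat) (use a(3) in simp)
  then show "[r = 1] (mod p)" by (rule cong_1_of_power_prime[OF prime_p])
qed

text \<open>The geometric sum of length \<open>p\<close> in \<open>r\<close> is \<open>p\<close> times a unit, so some \<open>x a\<^sup>i\<close> has trivial \<open>p\<close>-th power.\<close>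

lemma ex_order_p_in_coset:
  assumes a: "a \<in> carrier G" "ord a = p ^ k" "k \<ge> 1"
    and x: "x \<in> carrier G" "a \<otimes> x = x \<otimes> a [^] r" "x [^] p = a [^] (p * j)"
    and two: "p = 2 \<Longrightarrow> [r = 1] (mod 4)"
  shows "\<exists>i. (x \<otimes> a [^] (i::nat)) [^] p = \<one>" "[p * r = p] (mod p ^ k)"
proof -
  have r: "[r ^ p = 1] (mod p ^ k)" "[r = 1] (mod p)"
    using twisted_exponent[OF a x(1,2)] x(3) by simp_all
  show "[p * r = p] (mod p ^ k)" by (rule cong_1_lift[OF prime_p r(2) two r(1)])
  obtain u where u: "(\<Sum>j<p. r ^ j) = p * u" "coprime u p"
    using sum_powers_prime[OF prime_p r(2) two] by blast
  have "coprime u (p ^ k)" using u(2) by simp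
  then obtain v where v: "[u * v = 1] (mod p ^ k)"
    using cong_solve_coprime_nat[of u "p ^ k"] unfolding One_nat_def by blast
  \<comment> \<open>v inverts u, and p^k - 1 stands for -1; so i u = -j modulo p^k, which cancels
    x^p = a^(p j).\<close>
  define i where "i = (p ^ k - 1) * j * v"
  have "(x \<otimes> a [^] i) [^] p = a [^] (p * j) \<otimes> a [^] (i * (p * u))"
    using twisted_power[OF a(1) x(1,2)] x(3) u(1) by simp
  also have "\<dots> = a [^] (p * (j + (p ^ k - 1) * j * (u * v)))"
    unfolding i_def using a(1) by (simp add: nat_pow_mult algebra_simps)
  also have "\<dots> = a [^] (0::nat)"
  proof -
    have "[j + (p ^ k - 1) * j * (u * v) = j + (p ^ k - 1) * j * 1] (mod p ^ k)"
      by (intro cong_add cong_mult v) simp_all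
    moreover have "j + (p ^ k - 1) * j * 1 = p ^ k * j" using p_gt by (simp add: algebra_simps)
    ultimately have "[p * (j + (p ^ k - 1) * j * (u * v)) = p * (p ^ k * j)] (mod p ^ k)"
      by (metis cong_scalar_left)
    then show ?thesis unfolding pow_eq_pow_iff[OF a(1)] a(2) by (simp add: cong_def)
  qed
  finally show "\<exists>i. (x \<otimes> a [^] (i::nat)) [^] p = \<one>" by auto
qed

end

text \<open>With b^p = 1 the element b a^i has p-th power a^(p u i) for a unit u, as
  \<open>defect_regular\<close> requires. \<open>ex_order_p_in_coset\<close> with j = 0 yields that
  a^p commutes with b.\<close>

lemma (in cyclic_extension) defect_split:
  assumes b: "b [^] p = \<one>" and k: "k \<ge> 1" and r: "p = 2 \<Longrightarrow> [r = 1] (mod 4)"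
  shows "a \<otimes> b = b \<otimes> a \<Longrightarrow> cd_defect G = k * (p + 1) + 1"
    and "a \<otimes> b \<noteq> b \<otimes> a \<Longrightarrow> cd_defect G = (k - 1) * (p + 1)"
    and "a [^] p \<otimes> b = b \<otimes> a [^] p"
proof -
  have tw: "a \<otimes> b = b \<otimes> a [^] r" using pow_commute_b[of 1] by simp
  have r1: "[r = 1] (mod p)" using twisted_exponent[OF a_closed ord_a k b_closed tw b_pow_p] by blast
  obtain u where u: "(\<Sum>j<p. r ^ j) = p * u" "coprime u p" using sum_powers_prime[OF prime_p r1 r] by blast
  have reg: "(b \<otimes> a [^] i) [^] p = a [^] (p * u * i)" for i :: nat
    using twisted_power[OF a_closed b_closed tw, of i p] u(1) b by (simp add: ac_simps)
  have "[p * r = p] (mod p ^ k)"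
    by (rule ex_order_p_in_coset(2)[OF a_closed ord_a k b_closed tw _ r, of 0]) (use b in simp)
  then have "a [^] (p * r) = a [^] p" using pow_eq_pow_iff[OF a_closed] ord_a by metis
  then show ab: "a [^] p \<otimes> b = b \<otimes> a [^] p" using pow_commute_b[of p] by (simp add: mult.commute)
  show "a \<otimes> b = b \<otimes> a \<Longrightarrow> cd_defect G = k * (p + 1) + 1" by (rule defect_regular(1)[OF reg u(2) k])
  show "a \<otimes> b \<noteq> b \<otimes> a \<Longrightarrow> cd_defect G = (k - 1) * (p + 1)" by (rule defect_regular(2)[OF reg u(2) k _ ab])
qed

section \<open>The groups of the classification\<close>

text \<open>Stated with an upper bound for the order of \<open>K\<close>, because this is what
  reducing words in a presentation provides.\<close>

lemma (in group) iso_of_surj_hom: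
  assumes "group K" "finite (carrier K)" "h \<in> hom K G" "carrier G \<subseteq> h ` carrier K" "order K \<le> order G"
  shows "h \<in> iso K G"
proof -
  have "h ` carrier K = carrier G" using assms by (auto simp: hom_def)
  moreover then have "card (h ` carrier K) = card (carrier K)"
    using assms card_image_le[OF assms(2), of h] by (simp add: order_def)
  ultimately show ?thesis using assms eq_card_imp_inj_on[OF assms(2), of h] by (auto simp: iso_def bij_betw_def)
qed

section \<open>Cyclic groups\<close>

lemma order_integer_mod_group: "0 < N \<Longrightarrow> order (integer_mod_group N) = N"
  by (simp add: order_def carrier_integer_mod_group)

lemma p_group_integer_mod_group:
  "Factorial_Ring.prime p \<Longrightarrow> p_group (integer_mod_group (p ^ k)) p k"
  using prime_gt_0_nat[of p]
  by (simp add: p_group_def p_group_axioms_def finite_group_def finite_group_axioms_def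
      order_integer_mod_group carrier_integer_mod_group)

lemma pow_integer_mod_group_1:
  "(1::int) [^]\<^bsub>integer_mod_group N\<^esub> (i::nat) = int i mod int N"
  by (simp add: pow_integer_mod_group)

lemma cd_defect_integer_mod_group:
  assumes "Factorial_Ring.prime p" "k \<ge> 1"
  shows "cd_defect (integer_mod_group (p ^ k)) = k"
proof -
  interpret p_group "integer_mod_group (p ^ k)" p k by (rule p_group_integer_mod_group[OF assms(1)])
  have N: "1 < p ^ k" using p_gt(2) assms(2) by (intro one_less_power) auto
  have c: "carrier (integer_mod_group (p ^ k)) = {0..<int (p ^ k)}"
    using p_gt by (simp add: carrier_integer_mod_group)
  show ?thesis
  proof (rule cyclic_defect)
    show one: "1 \<in> carrier (integer_mod_group (p ^ k))" unfolding integer_mod_group_1 using N by linarith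
    show "cyc (integer_mod_group (p ^ k)) 1 = carrier (integer_mod_group (p ^ k))"
    proof
      show "cyc (integer_mod_group (p ^ k)) 1 \<subseteq> carrier (integer_mod_group (p ^ k))"
        using subgroup.subset[OF subgroup_cyc[OF one]] .
      show "carrier (integer_mod_group (p ^ k)) \<subseteq> cyc (integer_mod_group (p ^ k)) 1"
      proof
        fix x assume "x \<in> carrier (integer_mod_group (p ^ k))"
        then have "x = (1::int) [^]\<^bsub>integer_mod_group (p ^ k)\<^esub> nat x"
          unfolding pow_integer_mod_group_1 c by simp
        then show "x \<in> cyc (integer_mod_group (p ^ k)) 1" by (metis pow_in_cyc)
      qed
    qed
  qed
qed

context p_group begin

lemma pow_nat_mod:
  assumes "a \<in> carrier G" "ord a dvd N" "N > 0" "x \<ge> 0" "y \<ge> 0"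
  shows "a [^] nat ((x + y) mod int N) = a [^] nat x \<otimes> a [^] nat y"
proof -
  have "[nat ((x + y) mod int N) = nat x + nat y] (mod N)"
    using assms by (simp add: cong_def nat_mod_distrib nat_add_distrib)
  then have "[nat ((x + y) mod int N) = nat x + nat y] (mod ord a)"
    using assms(2) by (rule cong_dvd_modulus_nat)
  then show ?thesis using assms(1) pow_eq_pow_iff by (simp add: nat_pow_mult)
qed

lemma cyclic_iso_integer_mod_group:
  assumes a: "a \<in> carrier G" "cyc G a = carrier G"
  shows "G \<cong> integer_mod_group (p ^ n)"
proof -
  let ?K = "integer_mod_group (p ^ n)"
  interpret K: p_group ?K p n by (rule p_group_integer_mod_group[OF prime_p])
  have c: "carrier ?K = {0..<int (p ^ n)}" using p_gt by (simp add: carrier_integer_mod_group)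
  have o: "ord a = p ^ n" using card_cyc[OF a(1)] a(2) order_eq by (simp add: order_def)
  have "(\<lambda>i. a [^] nat i) \<in> iso ?K G"
  proof (rule iso_of_surj_hom[OF K.group_axioms K.fin])
    show "(\<lambda>i. a [^] nat i) \<in> hom ?K G"
      using a(1) o p_gt pow_nat_mod[OF a(1), of "p ^ n"] by (intro homI) (auto simp: c)
    show "carrier G \<subseteq> (\<lambda>i. a [^] nat i) ` carrier ?K"
    proof
      fix x assume "x \<in> carrier G"
      then have "x \<in> cyc G a" using a(2) by simp
      then obtain i :: nat where "x = a [^] i" by (auto simp: cyc_def)
      also have "\<dots> = a [^] (i mod p ^ n)" using pow_eq_pow_iff[OF a(1)] o by simp
      finally have "x = a [^] nat (int (i mod p ^ n))" by simp
      moreover have "int (i mod p ^ n) \<in> carrier ?K" using c p_gt by (simp flip: of_nat_mod)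
      ultimately show "x \<in> (\<lambda>i. a [^] nat i) ` carrier ?K" by blast
    qed
  qed (simp add: order_eq K.order_eq)
  then show ?thesis using K.iso_sym is_isoI by blast
qed

end

section \<open>Direct products of a cyclic p-group with the group of order p\<close>

lemma p_group_integer_mod_prod:
  assumes p: "Factorial_Ring.prime p"
  shows "p_group (integer_mod_group (p ^ t) \<times>\<times> integer_mod_group p) p (Suc t)"
proof -
  have "card (carrier (integer_mod_group (p ^ t) \<times>\<times> integer_mod_group p)) = p ^ Suc t"
    using prime_gt_0_nat[OF p] by (simp add: DirProd_def carrier_integer_mod_group card_cartesian_product nat_power_eq)
  then show ?thesis using p prime_gt_0_nat[OF p]
    by (simp add: p_group_def p_group_axioms_def finite_group_def finite_group_axioms_def
      order_def DirProd_group carrier_integer_mod_group)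
qed

lemma pow_integer_mod_prod:
  "(x, y) [^]\<^bsub>integer_mod_group M \<times>\<times> integer_mod_group N\<^esub> (i::nat)
    = (x [^]\<^bsub>integer_mod_group M\<^esub> i, y [^]\<^bsub>integer_mod_group N\<^esub> i)"
  by (induction i) (simp_all add: DirProd_def nat_pow_def)

lemma cyclic_extension_integer_mod_prod:
  assumes p: "Factorial_Ring.prime p" and t: "t \<ge> 1"
  shows "cyclic_extension (integer_mod_group (p ^ t) \<times>\<times> integer_mod_group p) p (Suc t) t 1 (1, 0) (0, 1)"
proof -
  let ?K = "integer_mod_group (p ^ t) \<times>\<times> integer_mod_group p"
  interpret p_group ?K p "Suc t" by (rule p_group_integer_mod_prod[OF p])
  have N: "1 < p ^ t" using p_gt(2) t by (intro one_less_power) auto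
  have c: "(1, 0) \<in> carrier ?K" "(0, 1) \<in> carrier ?K"
    using N t p_gt integer_mod_group_1[of "p ^ t"] integer_mod_group_1[of p] by (simp_all add: DirProd_def del: integer_mod_group_1)
  have pw: "(1, 0) [^]\<^bsub>?K\<^esub> (i::nat) = (int i mod int (p ^ t), 0)" for i
    by (simp add: pow_integer_mod_prod)
  have "ord (1, 0) = p ^ t"
    using N unfolding ord_unique[OF c(1)] pw
    by (auto simp: DirProd_def mod_eq_0_iff_dvd simp flip: of_nat_power of_nat_mod)
  moreover have "(0, 1) \<notin> cyc ?K (1, 0)" unfolding cyc_def pw by auto
  moreover have "inv\<^bsub>?K\<^esub> (0, 1) \<otimes>\<^bsub>?K\<^esub> (1, 0) \<otimes>\<^bsub>?K\<^esub> (0, 1) = (1, 0) [^]\<^bsub>?K\<^esub> (1::nat)"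
    using c N p_gt(2) by (subst conj_eq_iff(1)) (simp_all add: DirProd_def)
  ultimately show ?thesis using c by unfold_locales auto
qed

lemma cd_defect_integer_mod_prod:
  assumes p: "Factorial_Ring.prime p" and t: "t \<ge> 1"
  shows "cd_defect (integer_mod_group (p ^ t) \<times>\<times> integer_mod_group p) = t * (p + 1) + 1"
proof -
  let ?K = "integer_mod_group (p ^ t) \<times>\<times> integer_mod_group p"
  interpret cyclic_extension ?K p "Suc t" t 1 "(1, 0)" "(0, 1)"
    by (rule cyclic_extension_integer_mod_prod[OF assms])
  have "(0, 1) [^]\<^bsub>?K\<^esub> p = \<one>\<^bsub>?K\<^esub>"
    by (simp add: pow_integer_mod_prod)
  moreover have "(1, 0) \<otimes>\<^bsub>?K\<^esub> (0, 1) = (0, 1) \<otimes>\<^bsub>?K\<^esub> (1, 0)" by (simp add: DirProd_def)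
  ultimately show ?thesis using defect_split(1) t by simp
qed

lemma (in cyclic_extension) iso_integer_mod_prod:
  assumes b: "b [^] p = \<one>" and ab: "a \<otimes> b = b \<otimes> a"
  shows "G \<cong> integer_mod_group (p ^ k) \<times>\<times> integer_mod_group p"
proof -
  let ?K = "integer_mod_group (p ^ k) \<times>\<times> integer_mod_group p"
  interpret K: p_group ?K p "Suc k" by (rule p_group_integer_mod_prod[OF prime_p])
  let ?h = "\<lambda>(i, j). b [^] nat j \<otimes> a [^] nat i"
  have cp: "a [^] (i::nat) \<otimes> b [^] (j::nat) = b [^] j \<otimes> a [^] i" for i j
    using twisted_commute_pow[of a b 1 i j] ab by simp
  have c: "carrier ?K = {0..<int (p ^ k)} \<times> {0..<int p}"
    using p_gt by (simp add: DirProd_def carrier_integer_mod_group)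
  have ob: "ord b dvd p" using b pow_eq_id by simp
  have "?h \<in> iso ?K G"
  proof (rule iso_of_surj_hom[OF K.group_axioms K.fin])
    show "?h \<in> hom ?K G"
    proof (rule homI)
      fix x y assume xy: "x \<in> carrier ?K" "y \<in> carrier ?K"
      obtain i j i' j' where e: "x = (i, j)" "y = (i', j')" by (metis surj_pair)
      then have pos: "i \<ge> 0" "j \<ge> 0" "i' \<ge> 0" "j' \<ge> 0" using xy unfolding c by auto
      have "?h (x \<otimes>\<^bsub>?K\<^esub> y) = (b [^] nat j \<otimes> b [^] nat j') \<otimes> (a [^] nat i \<otimes> a [^] nat i')"
        using pow_nat_mod[OF a_closed, of "p ^ k"] pow_nat_mod[OF b_closed ob] ord_a p_gt pos
        unfolding e by (simp add: DirProd_def)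
      also have "\<dots> = b [^] nat j \<otimes> (b [^] nat j' \<otimes> a [^] nat i) \<otimes> a [^] nat i'" by (simp add: m_assoc)
      also have "\<dots> = b [^] nat j \<otimes> (a [^] nat i \<otimes> b [^] nat j') \<otimes> a [^] nat i'" by (simp only: cp)
      also have "\<dots> = ?h x \<otimes> ?h y" unfolding e by (simp add: m_assoc)
      finally show "?h (x \<otimes>\<^bsub>?K\<^esub> y) = ?h x \<otimes> ?h y" .
    qed auto
    show "carrier G \<subseteq> ?h ` carrier ?K"
    proof
      fix x assume "x \<in> carrier G"
      then obtain i j :: nat where "x = b [^] j \<otimes> a [^] i" by (rule elem_cases)
      moreover have "b [^] j = b [^] (j mod p)"
        using pow_eq_pow_iff[of b j "j mod p"] ob cong_dvd_modulus_nat[of j "j mod p" p] by simp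
      moreover have "a [^] i = a [^] (i mod p ^ k)" using pow_eq_pow_iff[of a] ord_a by simp
      ultimately have "x = ?h (int (i mod p ^ k), int (j mod p))" by simp
      moreover have "(int (i mod p ^ k), int (j mod p)) \<in> carrier ?K"
        using c p_gt by (simp flip: of_nat_mod of_nat_power)
      ultimately show "x \<in> ?h ` carrier ?K" by blast
    qed
  qed (simp add: order_eq K.order_eq index_a)
  then show ?thesis using K.iso_sym is_isoI by blast
qed

section \<open>The modular groups: a model, the order of the presented group, and the defect\<close>

text \<open>A concrete model of \<open>modular_p_group\<close>: the pair \<open>(j, i)\<close> stands for \<open>b\<^sup>j a\<^sup>i\<close>.\<close>

definition metacyclic :: "nat \<Rightarrow> nat \<Rightarrow> nat \<Rightarrow> (nat \<times> nat) monoid" where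
  "metacyclic p N r =
     \<lparr>carrier = {..<p} \<times> {..<N},
      monoid.mult = (\<lambda>(j, i) (j', i'). ((j + j') mod p, (i * r ^ j' + i') mod N)),
      one = (0, 0)\<rparr>"

lemma power_mod_exponent:
  fixes r :: nat
  assumes "[r ^ p = 1] (mod N)"
  shows "[r ^ (m mod p) = r ^ m] (mod N)"
proof -
  have "[(r ^ p) ^ (m div p) * r ^ (m mod p) = 1 ^ (m div p) * r ^ (m mod p)] (mod N)"
    by (intro cong_mult cong_pow assms) simp
  moreover have "(r ^ p) ^ (m div p) * r ^ (m mod p) = r ^ m"
    by (simp flip: power_mult power_add)
  ultimately show ?thesis using cong_sym by simp
qed

text \<open>r^p = 1 modulo N makes r^j depend on j only modulo p, so that the twist is compatible
  with reducing exponents of b.\<close>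

lemma group_metacyclic:
  assumes pN: "0 < p" "0 < N" and r: "[r ^ p = 1] (mod N)"
  shows "group (metacyclic p N r)"
proof (rule groupI)
  show "\<one>\<^bsub>metacyclic p N r\<^esub> \<in> carrier (metacyclic p N r)" using pN by (simp add: metacyclic_def)
next
  fix x y assume "x \<in> carrier (metacyclic p N r)" "y \<in> carrier (metacyclic p N r)"
  then show "x \<otimes>\<^bsub>metacyclic p N r\<^esub> y \<in> carrier (metacyclic p N r)" using pN by (auto simp: metacyclic_def)
next
  fix x y z :: "nat \<times> nat"
  obtain j i j' i' j'' i'' where e: "x = (j, i)" "y = (j', i')" "z = (j'', i'')" by (metis surj_pair)
  have "[(i * r ^ j' + i') mod N * r ^ j'' + i'' = (i * r ^ j' + i') * r ^ j'' + i''] (mod N)"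
    by (intro cong_add cong_mult) simp_all
  also have "(i * r ^ j' + i') * r ^ j'' + i'' = i * r ^ (j' + j'') + (i' * r ^ j'' + i'')"
    by (simp add: algebra_simps power_add)
  also have "[\<dots> = i * r ^ ((j' + j'') mod p) + (i' * r ^ j'' + i'') mod N] (mod N)"
    by (intro cong_add cong_mult cong_sym[OF power_mod_exponent[OF r]]) simp_all
  finally show "x \<otimes>\<^bsub>metacyclic p N r\<^esub> y \<otimes>\<^bsub>metacyclic p N r\<^esub> z
      = x \<otimes>\<^bsub>metacyclic p N r\<^esub> (y \<otimes>\<^bsub>metacyclic p N r\<^esub> z)"
    unfolding e by (simp add: metacyclic_def cong_def mod_simps add.assoc)
next
  fix x assume x: "x \<in> carrier (metacyclic p N r)"
  then show "\<one>\<^bsub>metacyclic p N r\<^esub> \<otimes>\<^bsub>metacyclic p N r\<^esub> x = x" by (auto simp: metacyclic_def)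
  obtain j i where e: "x = (j, i)" "j < p" "i < N" using x by (auto simp: metacyclic_def)
  \<comment> \<open>The inverse of b^j a^i is b^(-j) a^(-i r^(-j)). Here N - 1 stands for -1 and
    r^(p-1) for the inverse of r.\<close>
  let ?y = "((p - j) mod p, ((N - 1) * i * r ^ ((p - 1) * j)) mod N)"
  have "[((N - 1) * i * r ^ ((p - 1) * j)) mod N * r ^ j + i = (N - 1) * i * r ^ ((p - 1) * j) * r ^ j + i] (mod N)"
    by (intro cong_add cong_mult) simp_all
  also have "(N - 1) * i * r ^ ((p - 1) * j) * r ^ j + i = (N - 1) * i * (r ^ p) ^ j + i"
  proof -
    have "(p - 1) * j + j = p * j" using pN by (simp add: algebra_simps)
    then show ?thesis by (metis mult.assoc power_add power_mult)
  qed
  also have "[\<dots> = (N - 1) * i * 1 ^ j + i] (mod N)"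
    by (intro cong_add cong_mult cong_pow r) simp_all
  also have "(N - 1) * i * 1 ^ j + i = N * i" using pN by (simp add: algebra_simps)
  finally have "(((N - 1) * i * r ^ ((p - 1) * j)) mod N * r ^ j + i) mod N = 0" by (simp add: cong_def)
  then have "?y \<otimes>\<^bsub>metacyclic p N r\<^esub> x = \<one>\<^bsub>metacyclic p N r\<^esub>"
    unfolding e using e by (simp add: metacyclic_def mod_simps)
  moreover have "?y \<in> carrier (metacyclic p N r)" using pN by (simp add: metacyclic_def)
  ultimately show "\<exists>y\<in>carrier (metacyclic p N r). y \<otimes>\<^bsub>metacyclic p N r\<^esub> x = \<one>\<^bsub>metacyclic p N r\<^esub>" by blast
qed

lemma metacyclic_pow:
  "(0, 1) [^]\<^bsub>metacyclic p N r\<^esub> (i::nat) = (0, i mod N)"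
  "(1, 0) [^]\<^bsub>metacyclic p N r\<^esub> (i::nat) = (i mod p, 0)"
  by (induction i) (simp_all add: metacyclic_def nat_pow_def mod_simps)

lemma p_group_metacyclic:
  assumes p: "Factorial_Ring.prime p" and r: "[r ^ p = 1] (mod p ^ k)"
  shows "p_group (metacyclic p (p ^ k) r) p (Suc k)"
  using p prime_gt_0_nat[OF p] group_metacyclic[OF _ _ r]
  by (simp add: p_group_def p_group_axioms_def finite_group_def finite_group_axioms_def
      order_def metacyclic_def card_cartesian_product)

lemma cyclic_extension_metacyclic:
  assumes p: "Factorial_Ring.prime p" and k: "k \<ge> 1" and r: "[r ^ p = 1] (mod p ^ k)"
  shows "cyclic_extension (metacyclic p (p ^ k) r) p (Suc k) k r (0, 1) (1, 0)"
proof -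
  let ?K = "metacyclic p (p ^ k) r"
  interpret p_group ?K p "Suc k" by (rule p_group_metacyclic[OF p r])
  have N: "1 < p ^ k" using p_gt(2) k by (intro one_less_power) auto
  have c: "(0, 1) \<in> carrier ?K" "(1, 0) \<in> carrier ?K" using N p_gt by (auto simp: metacyclic_def)
  have "ord (0, 1) = p ^ k"
    unfolding ord_unique[OF c(1)] metacyclic_pow by (auto simp: metacyclic_def)
  moreover have "(1, 0) \<notin> cyc ?K (0, 1)" unfolding cyc_def metacyclic_pow by auto
  moreover have "(0, 1) \<otimes>\<^bsub>?K\<^esub> (1, 0) = (1, 0) \<otimes>\<^bsub>?K\<^esub> (0, 1) [^]\<^bsub>?K\<^esub> r"
    unfolding metacyclic_pow using p_gt by (simp add: metacyclic_def)
  then have "inv\<^bsub>?K\<^esub> (1, 0) \<otimes>\<^bsub>?K\<^esub> (0, 1) \<otimes>\<^bsub>?K\<^esub> (1, 0) = (0, 1) [^]\<^bsub>?K\<^esub> r"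
    using c conj_eq_iff(1)[OF c(2,1) nat_pow_closed[OF c(1), of r]] by blast
  ultimately show ?thesis using c by unfold_locales auto
qed

text \<open>By the relations every word reduces to B^j A^i with j < p and i < p^k, so the presented
  group has at most p^(k+1) elements. The homomorphism from \<open>von_dyck\<close> onto a group of
  exactly this order is therefore injective.\<close>

lemma (in group) modular_p_group_iso:
  assumes p: "0 < p" "0 < k" and fin: "finite (carrier G)" and o: "order G = p ^ Suc k"
    and ab: "a \<in> carrier G" "b \<in> carrier G" and rel: "a [^] (p ^ k) = \<one>" "b [^] p = \<one>"
      "a \<otimes> b = b \<otimes> a [^] (1 + p ^ (k - 1))"
    and gen: "\<And>x. x \<in> carrier G \<Longrightarrow> \<exists>(j::nat) (i::nat). x = b [^] j \<otimes> a [^] i"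
  shows "modular_p_group p k \<cong> G"
proof -
  define R where "R = {(replicate (p ^ k) (GenA, True), []), (replicate p (GenB, True), []),
      ([(GenB, False), (GenA, True), (GenB, True)], replicate (1 + p ^ (k - 1)) (GenA, True))}"
  have M: "modular_p_group p k = presented_group R" by (simp add: modular_p_group_def R_def)
  interpret K: group "presented_group R" by (rule group_presented_group)
  let ?K = "presented_group R"
  let ?r = "1 + p ^ (k - 1)"
  define A B where "A = pres_class R [(GenA, True)]" and "B = pres_class R [(GenB, True)]"
  have c: "pres_class R u \<in> carrier ?K" for u by (simp add: presented_group_carrier)
  have AB: "A \<in> carrier ?K" "B \<in> carrier ?K" unfolding A_def B_def by (rule c)+
  have pw: "pres_class R [(x, True)] [^]\<^bsub>?K\<^esub> (i::nat) = pres_class R (replicate i (x, True))" for x i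
    by (induction i) (simp_all add: presented_group_one presented_group_mult replicate_append_same)
  have relK: "pres_class R u = pres_class R v" if "(u, v) \<in> R" for u v
    using that by (simp only: pres_class_eq_iff pres_eq.rel)
  have A1: "A [^]\<^bsub>?K\<^esub> (p ^ k) = \<one>\<^bsub>?K\<^esub>" unfolding A_def pw presented_group_one
    by (rule relK) (simp add: R_def)
  have B1: "B [^]\<^bsub>?K\<^esub> p = \<one>\<^bsub>?K\<^esub>" unfolding B_def pw presented_group_one
    by (rule relK) (simp add: R_def)
  have invx: "inv\<^bsub>?K\<^esub> (pres_class R [(x, True)]) = pres_class R [(x, False)]" for x
  proof (rule K.inv_equality[OF _ c c])
    show "pres_class R [(x, False)] \<otimes>\<^bsub>?K\<^esub> pres_class R [(x, True)] = \<one>\<^bsub>?K\<^esub>"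
      using pres_eq.cancel[of R x False] by (simp add: presented_group_mult presented_group_one pres_class_eq_iff)
  qed
  have "inv\<^bsub>?K\<^esub> B \<otimes>\<^bsub>?K\<^esub> A \<otimes>\<^bsub>?K\<^esub> B = A [^]\<^bsub>?K\<^esub> ?r"
    unfolding A_def B_def pw invx presented_group_mult by (rule relK) (simp add: R_def)
  then have tw: "A \<otimes>\<^bsub>?K\<^esub> B = B \<otimes>\<^bsub>?K\<^esub> A [^]\<^bsub>?K\<^esub> ?r"
    using K.conj_eq_iff(1)[OF AB(2,1)] AB by simp
  \<comment> \<open>All words lie in \<open>?S\<close> once it is closed under left multiplication
    by the generators, as the inverse of a generator is one of its nonnegative powers by the first
    two relations.\<close>
  let ?S = "{B [^]\<^bsub>?K\<^esub> j \<otimes>\<^bsub>?K\<^esub> A [^]\<^bsub>?K\<^esub> i | (i::nat) (j::nat). True}"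
  have mulB: "B \<otimes>\<^bsub>?K\<^esub> x \<in> ?S" if x: "x \<in> ?S" for x
  proof -
    obtain i j :: nat where "x = B [^]\<^bsub>?K\<^esub> j \<otimes>\<^bsub>?K\<^esub> A [^]\<^bsub>?K\<^esub> i" using x by blast
    then have "B \<otimes>\<^bsub>?K\<^esub> x = B [^]\<^bsub>?K\<^esub> Suc j \<otimes>\<^bsub>?K\<^esub> A [^]\<^bsub>?K\<^esub> i"
      using AB K.nat_pow_Suc2[of B j] by (simp add: K.m_assoc del: K.nat_pow_Suc)
    then show ?thesis by blast
  qed
  have mulA: "A \<otimes>\<^bsub>?K\<^esub> x \<in> ?S" if x: "x \<in> ?S" for x
  proof -
    obtain i j :: nat where "x = B [^]\<^bsub>?K\<^esub> j \<otimes>\<^bsub>?K\<^esub> A [^]\<^bsub>?K\<^esub> i" using x by blast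
    then have "A \<otimes>\<^bsub>?K\<^esub> x = (A [^]\<^bsub>?K\<^esub> (1::nat) \<otimes>\<^bsub>?K\<^esub> B [^]\<^bsub>?K\<^esub> j) \<otimes>\<^bsub>?K\<^esub> A [^]\<^bsub>?K\<^esub> i"
      using AB by (simp add: K.m_assoc)
    also have "\<dots> = B [^]\<^bsub>?K\<^esub> j \<otimes>\<^bsub>?K\<^esub> A [^]\<^bsub>?K\<^esub> (?r ^ j * 1 + i)"
      unfolding K.twisted_commute_pow[OF AB tw] using AB by (simp add: K.m_assoc K.nat_pow_mult)
    finally show ?thesis by blast
  qed
  have mul_pow: "x [^]\<^bsub>?K\<^esub> (m::nat) \<otimes>\<^bsub>?K\<^esub> y \<in> ?S"
    if x: "x \<in> carrier ?K" "\<And>y. y \<in> ?S \<Longrightarrow> x \<otimes>\<^bsub>?K\<^esub> y \<in> ?S" and y: "y \<in> ?S" for x y m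
  proof (induction m)
    case (Suc m)
    have yc: "y \<in> carrier ?K" using y AB by auto
    have "x [^]\<^bsub>?K\<^esub> Suc m \<otimes>\<^bsub>?K\<^esub> y = x \<otimes>\<^bsub>?K\<^esub> (x [^]\<^bsub>?K\<^esub> m \<otimes>\<^bsub>?K\<^esub> y)"
      using x(1) yc K.nat_pow_Suc2[of x m] by (simp add: K.m_assoc del: K.nat_pow_Suc)
    then show ?case using x(2)[OF Suc] by simp
  next
    case 0
    have yc: "y \<in> carrier ?K" using y AB by auto
    then show ?case using y by simp
  qed
  have invA: "pres_class R [(GenA, False)] = A [^]\<^bsub>?K\<^esub> (p ^ k - 1)"
  proof -
    have "A [^]\<^bsub>?K\<^esub> (p ^ k - 1) \<otimes>\<^bsub>?K\<^esub> A = \<one>\<^bsub>?K\<^esub>"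
      using A1 AB p K.nat_pow_Suc[of A "p ^ k - 1"] by (simp del: K.nat_pow_Suc)
    then show ?thesis unfolding invx[symmetric] using AB K.inv_equality[of _ A] by (simp add: A_def)
  qed
  have invB: "pres_class R [(GenB, False)] = B [^]\<^bsub>?K\<^esub> (p - 1)"
  proof -
    have "B [^]\<^bsub>?K\<^esub> (p - 1) \<otimes>\<^bsub>?K\<^esub> B = \<one>\<^bsub>?K\<^esub>"
      using B1 AB p K.nat_pow_Suc[of B "p - 1"] by (simp del: K.nat_pow_Suc)
    then show ?thesis unfolding invx[symmetric] using AB K.inv_equality[of _ B] by (simp add: B_def)
  qed
  have S: "pres_class R u \<in> ?S" for u
  proof (induction u)
    case Nil
    have "pres_class R [] = B [^]\<^bsub>?K\<^esub> (0::nat) \<otimes>\<^bsub>?K\<^esub> A [^]\<^bsub>?K\<^esub> (0::nat)"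
      by (simp flip: presented_group_one)
    then show ?case by blast
  next
    case (Cons xe u)
    obtain x e where xe: "xe = (x, e)" by (metis surj_pair)
    have "pres_class R (xe # u) = pres_class R [(x, e)] \<otimes>\<^bsub>?K\<^esub> pres_class R u"
      by (simp add: presented_group_mult xe)
    moreover have "pres_class R [(x, e)] \<otimes>\<^bsub>?K\<^esub> pres_class R u \<in> ?S"
    proof (cases x)
      case GenA
      then show ?thesis
        using mul_pow[OF AB(1) mulA Cons] mulA[OF Cons] invA by (cases e) (simp_all add: A_def)
    next
      case GenB
      then show ?thesis
        using mul_pow[OF AB(2) mulB Cons] mulB[OF Cons] invB by (cases e) (simp_all add: B_def)
    qed
    ultimately show ?case by simp
  qed
  let ?f = "\<lambda>(j, i). B [^]\<^bsub>?K\<^esub> (j::nat) \<otimes>\<^bsub>?K\<^esub> A [^]\<^bsub>?K\<^esub> (i::nat)"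
  have red: "x [^]\<^bsub>?K\<^esub> (m mod N) = x [^]\<^bsub>?K\<^esub> m" if "x \<in> carrier ?K" "x [^]\<^bsub>?K\<^esub> N = \<one>\<^bsub>?K\<^esub>" for x and m N :: nat
  proof -
    have "x [^]\<^bsub>?K\<^esub> m = (x [^]\<^bsub>?K\<^esub> N) [^]\<^bsub>?K\<^esub> (m div N) \<otimes>\<^bsub>?K\<^esub> x [^]\<^bsub>?K\<^esub> (m mod N)"
      using that(1) by (simp add: K.nat_pow_pow K.nat_pow_mult)
    then show ?thesis using that by simp
  qed
  have sub: "carrier ?K \<subseteq> ?f ` ({..<p} \<times> {..<p ^ k})"
  proof
    fix x assume "x \<in> carrier ?K"
    then have "x \<in> ?S" using S by (auto simp: presented_group_carrier)
    then obtain i j :: nat where "x = B [^]\<^bsub>?K\<^esub> j \<otimes>\<^bsub>?K\<^esub> A [^]\<^bsub>?K\<^esub> i" by blast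
    then have "x = ?f (j mod p, i mod p ^ k)" using red[OF AB(1) A1] red[OF AB(2) B1] by simp
    moreover have "(j mod p, i mod p ^ k) \<in> {..<p} \<times> {..<p ^ k}" using p by simp
    ultimately show "x \<in> ?f ` ({..<p} \<times> {..<p ^ k})" by blast
  qed
  then have finK: "finite (carrier ?K)" by (rule finite_subset) simp
  have "card (carrier ?K) \<le> card ({..<p} \<times> {..<p ^ k})"
    by (rule order_trans[OF card_mono[OF _ sub] card_image_le]) auto
  then have cardK: "order ?K \<le> order G" using o by (simp add: order_def card_cartesian_product)
  let ?g = "\<lambda>x. case x of GenA \<Rightarrow> a | GenB \<Rightarrow> b"
  have g: "?g x \<in> carrier G" for x using ab by (cases x) auto
  have ev: "eval_word G ?g (replicate m (x, True)) = ?g x [^] m" for m x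
    by (induction m) (use g nat_pow_Suc2 in \<open>auto simp del: nat_pow_Suc\<close>)
  have "inv b \<otimes> a \<otimes> b = a [^] ?r" using rel(3) conj_eq_iff(1)[OF ab(2,1)] ab by simp
  then have "eval_word G ?g u = eval_word G ?g v" if "(u, v) \<in> R" for u v
    using that rel(1,2) ab unfolding R_def by (auto simp: ev m_assoc simp del: replicate.simps replicate_Suc)
  from von_dyck[OF g this] obtain h where h: "h \<in> hom ?K G" "\<And>x. h (pres_class R [(x, True)]) = ?g x" by blast
  interpret h: group_hom ?K G h using h(1) by unfold_locales
  have hAB: "h A = a" "h B = b" using h(2)[of GenA] h(2)[of GenB] by (simp_all add: A_def B_def)
  have "carrier G \<subseteq> h ` carrier ?K"
  proof
    fix x assume "x \<in> carrier G"
    then obtain i j :: nat where "x = b [^] j \<otimes> a [^] i" using gen by blast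
    then have "x = h (B [^]\<^bsub>?K\<^esub> j \<otimes>\<^bsub>?K\<^esub> A [^]\<^bsub>?K\<^esub> i)" using AB hAB by (simp add: h.hom_nat_pow)
    then show "x \<in> h ` carrier ?K" using AB by blast
  qed
  then show ?thesis unfolding M
    using iso_of_surj_hom[OF K.group_axioms finK h(1) _ cardK] is_isoI by blast
qed

text \<open>Since a^p commutes with b, r = 1 + p^(k-1) u, and p does not divide u because a and b do
  not commute. Replacing b by b^v with u v = 1 modulo p turns r into the exponent of the
  presentation.\<close>

lemma (in cyclic_extension) iso_modular:
  assumes b: "b [^] p = \<one>" and ab: "a \<otimes> b \<noteq> b \<otimes> a" and comm: "a [^] p \<otimes> b = b \<otimes> a [^] p"
  shows "k \<ge> 2" "modular_p_group p k \<cong> G"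
proof -
  have tw: "a \<otimes> b = b \<otimes> a [^] r" using pow_commute_b[of 1] by simp
  have pr: "[p * r = p] (mod p ^ k)"
    using comm pow_commute_b[of p] pow_eq_pow_iff[OF a_closed, of "p * r" p] ord_a by (simp add: mult.commute)
  have nr: "\<not> [r = 1] (mod p ^ k)"
    using ab tw pow_eq_pow_iff[OF a_closed, of r 1] ord_a by auto
  then have "k \<noteq> 0" by (intro notI) simp
  moreover have "k \<noteq> 1" using twisted_exponent(2)[OF a_closed ord_a _ b_closed tw b_pow_p] nr by auto
  ultimately show k: "k \<ge> 2" by simp
  have pk: "p ^ k = p * p ^ (k - 1)" using k by (metis Suc_1 Suc_le_D diff_Suc_1 power_Suc)
  have r1: "[r = 1] (mod p ^ (k - 1))"
    using pr p_gt unfolding pk by (simp add: cong_def)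
  have rpos: "r \<ge> 1"
  proof (rule ccontr)
    assume "\<not> r \<ge> 1"
    then have "r = 0" by simp
    then have "[p = 0] (mod p ^ k)" using cong_sym[OF pr] by simp
    then have "p ^ k dvd p ^ 1" by (simp add: cong_0_iff)
    then have "k \<le> 1" using p_gt(2) by (rule power_dvd_imp_le)
    then show False using k by simp
  qed
  then obtain u where u: "r = 1 + p ^ (k - 1) * u"
    using r1 by (metis cong_altdef_nat cong_sym dvd_def le_add_diff_inverse)
  have "\<not> p dvd u"
  proof
    assume "p dvd u"
    then have "p ^ k dvd p ^ (k - 1) * u" unfolding pk by (auto simp: mult.commute)
    then show False using nr u by (simp add: cong_altdef_nat)
  qed
  then have "coprime u p" using prime_p by (metis coprime_commute prime_imp_coprime)
  then obtain v where v: "[u * v = 1] (mod p)"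
    using cong_solve_coprime_nat[of u p] unfolding One_nat_def by blast
  have rj: "[r ^ j = 1 + p ^ (k - 1) * (u * j)] (mod p ^ k)" for j
  proof (induction j)
    case (Suc j)
    \<comment> \<open>The quadratic term vanishes modulo p^k because 2 (k - 1) >= k.\<close>
    have sq: "p ^ k dvd p ^ (k - 1) * p ^ (k - 1)"
      unfolding power_add[symmetric] by (rule le_imp_power_dvd) (use k in simp)
    have "[r ^ Suc j = (1 + p ^ (k - 1) * u) * (1 + p ^ (k - 1) * (u * j))] (mod p ^ k)"
      using cong_mult[OF cong_refl Suc, of r] u by simp
    also have "(1 + p ^ (k - 1) * u) * (1 + p ^ (k - 1) * (u * j))
        = 1 + p ^ (k - 1) * (u * Suc j) + (p ^ (k - 1) * p ^ (k - 1)) * (u * u * j)"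
      by (simp add: algebra_simps)
    also have "[\<dots> = 1 + p ^ (k - 1) * (u * Suc j)] (mod p ^ k)"
      using dvd_mult2[OF sq, of "u * u * j"] by (simp add: cong_altdef_nat)
    finally show ?case .
  qed simp
  have rv: "[r ^ v = 1 + p ^ (k - 1)] (mod p ^ k)"
  proof -
    have "[p ^ (k - 1) * (u * v) = p ^ (k - 1) * 1] (mod p ^ k)"
      using v p_gt unfolding pk by (simp add: cong_def mult.commute[of p])
    then have "[1 + p ^ (k - 1) * (u * v) = 1 + p ^ (k - 1) * 1] (mod p ^ k)" by (intro cong_add) simp_all
    then show ?thesis using rj[of v] cong_trans by fastforce
  qed
  \<comment> \<open>By means of w the element b is recovered as a power of b^v, so a and b^v still
    generate G.\<close>
  obtain w where w: "[v * w = 1] (mod p)"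
    using v by (metis cong_sym mult.commute)
  let ?b = "b [^] v"
  have red: "b [^] (j::nat) = b [^] (j' :: nat)" if "[j = j'] (mod p)" for j j'
  proof -
    have "ord b dvd p" using b pow_eq_id by simp
    then show ?thesis using that pow_eq_pow_iff[of b] cong_dvd_modulus_nat by auto
  qed
  show "modular_p_group p k \<cong> G"
  proof (rule modular_p_group_iso)
    show "?b [^] p = \<one>" using b by (simp add: nat_pow_pow mult.commute[of v]) (simp flip: nat_pow_pow)
    show "a [^] (p ^ k) = \<one>" using ord_a pow_eq_id by simp
    have "a \<otimes> ?b = ?b \<otimes> a [^] (r ^ v)" using twisted_commute_pow[OF a_closed b_closed tw, of 1 v] by simp
    then show "a \<otimes> ?b = ?b \<otimes> a [^] (1 + p ^ (k - 1))"
      using pow_eq_pow_iff[OF a_closed] ord_a rv by metis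
    fix x assume "x \<in> carrier G"
    then obtain i j :: nat where "x = b [^] j \<otimes> a [^] i" by (rule elem_cases)
    moreover have "b [^] j = ?b [^] (w * j)"
    proof -
      have "[1 * j = (v * w) * j] (mod p)" by (rule cong_mult[OF cong_sym[OF w] cong_refl])
      then show ?thesis using red by (simp add: nat_pow_pow mult.assoc)
    qed
    ultimately show "\<exists>(j::nat) (i::nat). x = ?b [^] j \<otimes> a [^] i"
      by (intro exI[of _ "w * j"] exI[of _ i]) simp
  qed (use p_gt k order_eq index_a in auto)
qed

lemma cd_defect_modular_p_group:
  assumes p: "Factorial_Ring.prime p" and k: "k \<ge> 2"
  shows "p_group (modular_p_group p k) p (Suc k)"
    and "cd_defect (modular_p_group p k) = (if p = 2 \<and> k = 2 then 5 else (k - 1) * (p + 1))"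
proof -
  let ?r = "1 + p ^ (k - 1)"
  have p0: "p > 1" "p > 0" using p prime_gt_1_nat prime_gt_0_nat by auto
  have pk: "p ^ k = p * p ^ (k - 1)" using k by (metis Suc_1 Suc_le_D diff_Suc_1 power_Suc)
  have "p dvd p ^ (k - 1)" using k by (intro dvd_power) auto
  have pk1: "1 < p ^ (k - 1)" using p0 k by (intro one_less_power) auto
  have rp: "[?r ^ p = 1] (mod p ^ k)"
  proof -
    have "[?r ^ j = 1 + p ^ (k - 1) * j] (mod p ^ k)" for j
    proof (induction j)
      case (Suc j)
      obtain q where q: "p ^ (k - 1) = p * q" using \<open>p dvd p ^ (k - 1)\<close> by auto
      have "[?r ^ Suc j = ?r * (1 + p ^ (k - 1) * j)] (mod p ^ k)"
        using cong_mult[OF cong_refl Suc, of ?r] by simp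
      also have "?r * (1 + p ^ (k - 1) * j) = 1 + p ^ (k - 1) * Suc j + p ^ (k - 1) * p ^ (k - 1) * j"
        by (simp add: algebra_simps)
      also have "\<dots> = 1 + p ^ (k - 1) * Suc j + p ^ k * (q * j)"
        unfolding pk by (subst (2) q) (simp add: ac_simps)
      also have "[\<dots> = 1 + p ^ (k - 1) * Suc j] (mod p ^ k)" by (simp only: cong_def mod_mult_self2)
      finally show ?case .
    qed simp
    from this[of p] have "[?r ^ p = 1 + p ^ k * 1] (mod p ^ k)" unfolding pk by (simp add: mult.commute)
    also have "[1 + p ^ k * 1 = 1] (mod p ^ k)" by (simp only: cong_def mod_mult_self2)
    finally show ?thesis .
  qed
  define r where "r = ?r"
  let ?M = "metacyclic p (p ^ k) r"
  define a b :: "nat \<times> nat" where "a = (0, 1)" and "b = (1, 0)"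
  interpret cyclic_extension ?M p "Suc k" k r a b
    unfolding a_def b_def by (rule cyclic_extension_metacyclic[OF p]) (use k rp in \<open>simp_all add: r_def\<close>)
  have tw: "a \<otimes>\<^bsub>?M\<^esub> b = b \<otimes>\<^bsub>?M\<^esub> a [^]\<^bsub>?M\<^esub> r" using pow_commute_b[of 1] by simp
  have bp: "b [^]\<^bsub>?M\<^esub> p = \<one>\<^bsub>?M\<^esub>" unfolding b_def metacyclic_pow by (simp add: metacyclic_def)
  have iso: "modular_p_group p k \<cong> ?M"
  proof (rule modular_p_group_iso[OF _ _ fin order_eq a_closed b_closed _ bp])
    show "a \<otimes>\<^bsub>?M\<^esub> b = b \<otimes>\<^bsub>?M\<^esub> a [^]\<^bsub>?M\<^esub> (1 + p ^ (k - 1))" using tw unfolding r_def[symmetric] .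
    show "a [^]\<^bsub>?M\<^esub> (p ^ k) = \<one>\<^bsub>?M\<^esub>" using pow_eq_id[OF a_closed] ord_a by simp
    fix x assume "x \<in> carrier ?M"
    then show "\<exists>(j::nat) (i::nat). x = b [^]\<^bsub>?M\<^esub> j \<otimes>\<^bsub>?M\<^esub> a [^]\<^bsub>?M\<^esub> i" using elem_cases by metis
  qed (use p0 k in auto)
  then obtain h where h: "h \<in> iso (modular_p_group p k) ?M" by (auto simp: is_iso_def)
  have grp: "group (modular_p_group p k)" unfolding modular_p_group_def by (rule group_presented_group)
  have bij: "bij_betw h (carrier (modular_p_group p k)) (carrier ?M)" using h by (simp add: iso_def)
  show pg: "p_group (modular_p_group p k) p (Suc k)"
    using grp p bij_betw_finite[OF bij] bij_betw_same_card[OF bij] order_eq fin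
    by (simp add: p_group_def p_group_axioms_def finite_group_def finite_group_axioms_def order_def)
  have defect: "cd_defect (modular_p_group p k) = cd_defect ?M"
    by (rule cd_defect_iso[OF _ finite_group_axioms iso]) (use pg in \<open>simp add: p_group_def\<close>)
  have ne: "a \<otimes>\<^bsub>?M\<^esub> b \<noteq> b \<otimes>\<^bsub>?M\<^esub> a"
  proof
    assume "a \<otimes>\<^bsub>?M\<^esub> b = b \<otimes>\<^bsub>?M\<^esub> a"
    then have "b \<otimes>\<^bsub>?M\<^esub> a [^]\<^bsub>?M\<^esub> r = b \<otimes>\<^bsub>?M\<^esub> a [^]\<^bsub>?M\<^esub> (1::nat)" unfolding tw by simp
    then have "a [^]\<^bsub>?M\<^esub> r = a [^]\<^bsub>?M\<^esub> (1::nat)" using l_cancel[of b] by (metis a_closed b_closed nat_pow_closed)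
    then have "[r = 1] (mod p ^ k)" using pow_eq_pow_iff[OF a_closed, of r 1] ord_a by simp
    then have "p ^ k dvd p ^ (k - 1)" by (simp add: cong_altdef_nat r_def)
    then have "k \<le> k - 1" using p0(1) by (rule power_dvd_imp_le)
    then show False using k by simp
  qed
  show "cd_defect (modular_p_group p k) = (if p = 2 \<and> k = 2 then 5 else (k - 1) * (p + 1))"
  proof (cases "p = 2 \<and> k = 2")
    case False
    have "[r = 1] (mod 4)" if "p = 2"
    proof -
      have "(2::nat) ^ 2 dvd 2 ^ (k - 1)" using False that k by (intro le_imp_power_dvd) auto
      then show ?thesis using that by (simp add: cong_altdef_nat r_def)
    qed
    then show ?thesis using defect_split(2)[OF bp _ _ ne] k defect False by auto
  next
    case True
    \<comment> \<open>Here 1 + r = 4 = ord a, so all four elements b a^i are involutions. The case s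
      = 2 contributes 1 + 4 subgroups instead of 1 + p = 3.\<close>
    have sq: "(b \<otimes>\<^bsub>?M\<^esub> a [^]\<^bsub>?M\<^esub> (i::nat)) [^]\<^bsub>?M\<^esub> p = \<one>\<^bsub>?M\<^esub>" for i
    proof -
      have "(b \<otimes>\<^bsub>?M\<^esub> a [^]\<^bsub>?M\<^esub> i) [^]\<^bsub>?M\<^esub> p = b [^]\<^bsub>?M\<^esub> p \<otimes>\<^bsub>?M\<^esub> a [^]\<^bsub>?M\<^esub> (i * (\<Sum>j<p. r ^ j))"
        by (rule twisted_power[OF a_closed b_closed tw])
      moreover have "(\<Sum>j<p. r ^ j) = p ^ k" using True by (simp add: numeral_2_eq_2 r_def)
      moreover have "a [^]\<^bsub>?M\<^esub> (i * p ^ k) = \<one>\<^bsub>?M\<^esub>" using pow_eq_id[OF a_closed] ord_a by simp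
      ultimately show ?thesis unfolding bp by simp
    qed
    have "{i. i < p ^ 2 \<and> (b \<otimes>\<^bsub>?M\<^esub> a [^]\<^bsub>?M\<^esub> i) [^]\<^bsub>?M\<^esub> p \<in> sub_a 2} = {..<4}"
      unfolding sq using True subgroup.one_closed[OF subgroup_sub_a[of 2]] by auto
    then have "num_ext 2 = 4" unfolding num_ext_def by simp
    moreover have "a [^]\<^bsub>?M\<^esub> p \<otimes>\<^bsub>?M\<^esub> b = b \<otimes>\<^bsub>?M\<^esub> a [^]\<^bsub>?M\<^esub> p"
    proof -
      have "[r * p = p] (mod ord a)" using True ord_a by (simp add: cong_def r_def)
      then show ?thesis using pow_commute_b[of p] pow_eq_pow_iff[OF a_closed, of "r * p" p] by simp
    qed
    ultimately have "cd_defect ?M = 5" using defect_nonabelian[OF ne] True by simp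
    then show ?thesis using True defect by simp
  qed
qed

subsection \<open>The quaternion group\<close>

lemma quaternion_simps:
  "x \<otimes>\<^bsub>quaternion_group\<^esub> y = (fst x * fst y * fst (quat_mult (snd x) (snd y)), snd (quat_mult (snd x) (snd y)))"
  "\<one>\<^bsub>quaternion_group\<^esub> = (1, Q1)"
  "carrier quaternion_group = {1, -1} \<times> UNIV"
  by (simp_all add: quaternion_group_def split: prod.splits)

lemma p_group_quaternion: "p_group quaternion_group 2 3"
proof -
  have "finite (carrier quaternion_group)"
    using order_quaternion_group by (metis order_def card_ge_0_finite zero_less_numeral)
  then show ?thesis
    using group_quaternion_group order_quaternion_group
    by (simp add: p_group_def p_group_axioms_def finite_group_def finite_group_axioms_def)
qed

text \<open>Q8 is a cyclic extension with k = 2 and r = 3 in which every b a^i has square -1. So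
  only the trivial subgroup meets <a> trivially, and it is the only one outside the lattice.\<close>

lemma cd_defect_quaternion: "cd_defect quaternion_group = 1"
proof -
  let ?Q = quaternion_group
  interpret p_group ?Q 2 3 by (rule p_group_quaternion)
  let ?a = "(1, QI) :: int \<times> quat_unit" and ?b = "(1, QJ) :: int \<times> quat_unit"
  have c: "?a \<in> carrier ?Q" "?b \<in> carrier ?Q" by (simp_all add: quaternion_simps)
  have a2: "?a [^]\<^bsub>?Q\<^esub> (2::nat) = (-1, Q1)" and b2: "?b [^]\<^bsub>?Q\<^esub> (2::nat) = (-1, Q1)"
    by (simp_all add: numeral_2_eq_2 quaternion_simps)
  have "?a [^]\<^bsub>?Q\<^esub> (4::nat) = \<one>\<^bsub>?Q\<^esub>" by (simp add: numeral_eq_Suc quaternion_simps)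
  then have "ord ?a dvd 2 ^ 2" using pow_eq_id[OF c(1)] by simp
  then obtain j where j: "j \<le> 2" "ord ?a = 2 ^ j" using divides_primepow_nat[OF two_is_prime_nat] by blast
  have "\<not> j \<le> 1"
  proof
    assume "j \<le> 1"
    then have "ord ?a dvd 2" using j(2) by (metis le_imp_power_dvd power_one_right)
    then show False using pow_eq_id[OF c(1), of 2] a2 by (simp add: quaternion_simps)
  qed
  then have o: "ord ?a = 2 ^ 2" using j by (metis One_nat_def Suc_1 le_SucE)
  have pw: "snd (?a [^]\<^bsub>?Q\<^esub> (i::nat)) \<in> {Q1, QI}" for i
    by (induction i) (auto simp: quaternion_simps)
  have nb: "?b \<notin> cyc ?Q ?a"
  proof
    assume "?b \<in> cyc ?Q ?a"
    then obtain i :: nat where "?b = ?a [^]\<^bsub>?Q\<^esub> i" by (auto simp: cyc_def)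
    then have "snd ?b \<in> {Q1, QI}" using pw[of i] by metis
    then show False by simp
  qed
  have "?a \<otimes>\<^bsub>?Q\<^esub> ?b = ?b \<otimes>\<^bsub>?Q\<^esub> ?a [^]\<^bsub>?Q\<^esub> (3::nat)"
    by (simp add: numeral_eq_Suc quaternion_simps)
  then have "inv\<^bsub>?Q\<^esub> ?b \<otimes>\<^bsub>?Q\<^esub> ?a \<otimes>\<^bsub>?Q\<^esub> ?b = ?a [^]\<^bsub>?Q\<^esub> (3::nat)"
    using c conj_eq_iff(1)[OF c(2,1) nat_pow_closed[OF c(1)]] by blast
  then interpret cyclic_extension ?Q 2 3 2 3 ?a ?b
    using c o nb by unfold_locales auto
  have tw: "?a \<otimes>\<^bsub>?Q\<^esub> ?b = ?b \<otimes>\<^bsub>?Q\<^esub> ?a [^]\<^bsub>?Q\<^esub> (3::nat)" using pow_commute_b[of 1] by simp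
  have ne: "?a \<otimes>\<^bsub>?Q\<^esub> ?b \<noteq> ?b \<otimes>\<^bsub>?Q\<^esub> ?a" by (simp add: quaternion_simps)
  have sq: "(?b \<otimes>\<^bsub>?Q\<^esub> ?a [^]\<^bsub>?Q\<^esub> (i::nat)) [^]\<^bsub>?Q\<^esub> (2::nat) = ?a [^]\<^bsub>?Q\<^esub> (2::nat)" for i
  proof -
    have "(?b \<otimes>\<^bsub>?Q\<^esub> ?a [^]\<^bsub>?Q\<^esub> i) [^]\<^bsub>?Q\<^esub> (2::nat) = ?b [^]\<^bsub>?Q\<^esub> (2::nat) \<otimes>\<^bsub>?Q\<^esub> ?a [^]\<^bsub>?Q\<^esub> (i * (\<Sum>j<2. 3 ^ j))"
      by (rule twisted_power[OF a_closed b_closed tw])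
    moreover have "?a [^]\<^bsub>?Q\<^esub> (i * (\<Sum>j<2. 3 ^ j)) = \<one>\<^bsub>?Q\<^esub>"
    proof -
      have "(\<Sum>j<2. 3 ^ j) = (4::nat)" by (simp add: numeral_2_eq_2)
      then have "ord ?a dvd i * (\<Sum>j<2. 3 ^ j)" using ord_a by simp
      then show ?thesis using pow_eq_id[OF a_closed] by blast
    qed
    ultimately show ?thesis using a2 b2 r_one[OF nat_pow_closed[OF a_closed, of 2]] by simp
  qed
  have "num_ext 2 = 0" unfolding num_ext_def sq using pow_in_sub_a_iff[of 2 2] by simp
  moreover have "?a [^]\<^bsub>?Q\<^esub> (2::nat) \<otimes>\<^bsub>?Q\<^esub> ?b = ?b \<otimes>\<^bsub>?Q\<^esub> ?a [^]\<^bsub>?Q\<^esub> (2::nat)"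
    unfolding a2 by (simp add: quaternion_simps)
  ultimately show ?thesis using defect_nonabelian[OF ne] by simp
qed

text \<open>The central element z = a^2 = b^2 plays the role of -1, and a, b, a b those of i, j,
  k.\<close>

lemma (in p_group) iso_quaternion:
  assumes a: "a \<in> carrier G" "a [^] (2::nat) \<otimes> a [^] (2::nat) = \<one>"
    and b: "b \<in> carrier G" "b [^] (2::nat) = a [^] (2::nat)"
    and ab: "a \<otimes> b = b \<otimes> inv a" and o: "order G = 8"
    and gen: "\<And>x. x \<in> carrier G \<Longrightarrow> \<exists>(j::nat) (i::nat). x = b [^] j \<otimes> a [^] i"
  shows "G \<cong> quaternion_group"
proof -
  interpret Q: p_group quaternion_group 2 3 by (rule p_group_quaternion)
  define z where "z = a [^] (2::nat)"
  have z: "z \<in> carrier G" "z \<otimes> z = \<one>" "a \<otimes> a = z" "b \<otimes> b = z"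
    using a b by (simp_all add: z_def numeral_2_eq_2)
  have za: "a \<otimes> z = z \<otimes> a" "b \<otimes> z = z \<otimes> b"
    using a(1) b(1) z(3)[symmetric] z(4)[symmetric] by (simp add: m_assoc) (metis b(1) m_assoc z(4))
  have "a \<otimes> (z \<otimes> a) = z \<otimes> (a \<otimes> a)" using za(1) a(1) z(1) by (simp flip: m_assoc)
  then have "a \<otimes> (z \<otimes> a) = \<one>" using z by simp
  then have inva: "inv a = z \<otimes> a" using a(1) z(1) inv_equality inv_comm m_closed by metis
  have ab': "a \<otimes> b = z \<otimes> (b \<otimes> a)"
    using ab a(1) b(1) z(1) za(2) unfolding inva by (simp flip: m_assoc)
  have R: "b \<otimes> a = z \<otimes> (a \<otimes> b)" unfolding ab' using z a b by (simp flip: m_assoc)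
  \<comment> \<open>Together with \<open>za\<close> and \<open>R\<close>, these rules bring products
    into the normal form z, a, b from left to right, which settles the sixteen products of units in
    \<open>ee\<close>.\<close>
  have RR: "a \<otimes> (a \<otimes> w) = z \<otimes> w" "b \<otimes> (b \<otimes> w) = z \<otimes> w" "z \<otimes> (z \<otimes> w) = w"
    "a \<otimes> (z \<otimes> w) = z \<otimes> (a \<otimes> w)" "b \<otimes> (z \<otimes> w) = z \<otimes> (b \<otimes> w)" "b \<otimes> (a \<otimes> w) = z \<otimes> (a \<otimes> (b \<otimes> w))"
    if "w \<in> carrier G" for w
    using that z za R a b by (simp_all flip: m_assoc)
  define s where "s \<epsilon> = (if \<epsilon> = (1::int) then \<one> else z)" for \<epsilon>
  define e where "e x = (case x of Q1 \<Rightarrow> \<one> | QI \<Rightarrow> a | QJ \<Rightarrow> b | QK \<Rightarrow> a \<otimes> b)" for x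
  define h where "h = (\<lambda>(\<epsilon>, x). s \<epsilon> \<otimes> e x)"
  have "h \<in> iso quaternion_group G"
  proof (rule iso_of_surj_hom[OF Q.group_axioms Q.fin])
    show "h \<in> hom quaternion_group G"
    proof (rule homI)
      show "h x \<in> carrier G" if "x \<in> carrier quaternion_group" for x
        using a b z by (cases x; cases "snd x") (auto simp: h_def s_def e_def)
      fix x y assume xy: "x \<in> carrier quaternion_group" "y \<in> carrier quaternion_group"
      obtain \<epsilon> u \<eta> v where xyv: "x = (\<epsilon>, u)" "y = (\<eta>, v)" by (metis surj_pair)
      with xy have sg: "\<epsilon> = 1 \<or> \<epsilon> = -1" "\<eta> = 1 \<or> \<eta> = -1" by (auto simp: quaternion_simps)
      have smult: "s (\<gamma> * \<delta>) = s \<gamma> \<otimes> s \<delta>" if "\<gamma> = 1 \<or> \<gamma> = -1" "\<delta> = 1 \<or> \<delta> = -1" for \<gamma> \<delta>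
        using that z by (auto simp: s_def)
      have sc: "s \<gamma> \<in> carrier G" "s \<gamma> \<otimes> w = w \<otimes> s \<gamma>" if "w \<in> {\<one>, a, b, a \<otimes> b}" for \<gamma> w
        using that a(1) b(1) z(1) za RR(4)[OF b(1)] by (auto simp: s_def m_assoc)
      have ec: "e u \<in> {\<one>, a, b, a \<otimes> b}" "e u \<in> carrier G" for u
        using a(1) b(1) by (cases u; simp add: e_def)+
      have ee: "e u \<otimes> e v = s (fst (quat_mult u v)) \<otimes> e (snd (quat_mult u v))"
        by (cases u; cases v) (simp_all add: s_def e_def m_assoc z za R RR a(1) b(1))
      have q: "fst (quat_mult u v) = 1 \<or> fst (quat_mult u v) = -1"
        using quat_mult_sign[of u v] by simp
      have c: "s \<gamma> \<in> carrier G" "e w \<in> carrier G" "e w \<otimes> s \<gamma> = s \<gamma> \<otimes> e w" for \<gamma> w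
        using sc[OF ec(1)[of w], of \<gamma>] ec(2)[of w] by simp_all
      have "h x \<otimes> h y = s \<epsilon> \<otimes> (e u \<otimes> s \<eta>) \<otimes> e v"
        unfolding xyv h_def using c(1,2) by (simp add: m_assoc)
      also have "\<dots> = s \<epsilon> \<otimes> s \<eta> \<otimes> (e u \<otimes> e v)"
        unfolding c(3) using c(1,2) by (simp add: m_assoc)
      also have "\<dots> = s \<epsilon> \<otimes> s \<eta> \<otimes> s (fst (quat_mult u v)) \<otimes> e (snd (quat_mult u v))"
        unfolding ee using c(1,2) by (simp add: m_assoc)
      also have "s \<epsilon> \<otimes> s \<eta> \<otimes> s (fst (quat_mult u v)) = s (\<epsilon> * \<eta> * fst (quat_mult u v))"
        using smult[of "\<epsilon> * \<eta>" "fst (quat_mult u v)"] smult[OF sg] sg q by auto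
      finally have "h x \<otimes> h y = s (\<epsilon> * \<eta> * fst (quat_mult u v)) \<otimes> e (snd (quat_mult u v))" .
      then show "h (x \<otimes>\<^bsub>quaternion_group\<^esub> y) = h x \<otimes> h y"
        unfolding xyv by (simp add: h_def quaternion_simps)
    qed
    show "carrier G \<subseteq> h ` carrier quaternion_group"
    proof
      let ?I = "h ` carrier quaternion_group"
      interpret h: group_hom quaternion_group G h
        using \<open>h \<in> hom quaternion_group G\<close> by unfold_locales
      have I: "subgroup ?I G" by (rule h.img_is_subgroup)
      have "h (1, QI) = a" "h (1, QJ) = b" using a b by (simp_all add: h_def s_def e_def)
      moreover have "(1, u) \<in> carrier quaternion_group" for u by (simp add: quaternion_simps)
      ultimately have "a \<in> ?I" "b \<in> ?I" by (metis imageI)+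
      fix x assume "x \<in> carrier G"
      then obtain i j :: nat where "x = b [^] j \<otimes> a [^] i" using gen by blast
      then show "x \<in> ?I"
        using subgroup.m_closed[OF I] subgroup_pow_closed[OF I] \<open>a \<in> ?I\<close> \<open>b \<in> ?I\<close> by simp
    qed
  qed (simp add: o order_quaternion_group)
  then show ?thesis using Q.iso_sym is_isoI by blast
qed

section \<open>Groups with a unique subgroup of order p\<close>

text \<open>In a 2-group let a x = x a^r and x^2 = a^(2 j); then \<open>no\<close> says that no x
  a^i has trivial square. As (r - 1) / 2 is odd, 2^(k-1) divides both r + 1 and 2 j. Taking i = 0
  shows that 2 j is an odd multiple, and i = 1 that r + 1 is an even one. So x inverts a, and x^2 is
  the involution of <a>.\<close>

lemma inverting_exponent:
  fixes j k r :: nat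
  assumes k: "k \<ge> 2" and r: "r mod 4 = 3" and sq: "2 ^ k dvd r\<^sup>2 - 1" and j: "2 ^ k dvd 2 * j * (r - 1)"
    and no: "\<And>i. \<not> 2 ^ k dvd 2 * j + i * (r + 1)"
  shows "2 ^ k dvd r + 1" "[2 * j = 2 ^ (k - 1)] (mod 2 ^ k)"
proof -
  define m where "m = r div 2"
  have m: "r - 1 = 2 * m" "odd m" using r unfolding m_def by presburger+
  have pk: "(2::nat) ^ k = 2 * 2 ^ (k - 1)" using k by (metis Suc_1 Suc_le_D diff_Suc_1 power_Suc)
  have odd_cancel: "(2::nat) ^ l dvd m * x \<longleftrightarrow> 2 ^ l dvd x" for l x
    using m(2) by (intro coprime_dvd_mult_right_iff) simp
  have "r\<^sup>2 - 1 = (r - 1) * (r + 1)" by (simp add: power2_eq_square algebra_simps)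
  then have "2 * 2 ^ (k - 1) dvd 2 * (m * (r + 1))" using sq unfolding m(1) pk by (simp only: mult.assoc)
  then have "2 ^ (k - 1) dvd r + 1" using odd_cancel by (metis dvd_mult_cancel_left zero_neq_numeral dvd_times_left_cancel_iff)
  then obtain t where t: "r + 1 = 2 ^ (k - 1) * t" by blast
  have "2 * 2 ^ (k - 1) dvd 2 * (m * (2 * j))" using j unfolding m(1) pk by (simp only: ac_simps)
  then have "2 ^ (k - 1) dvd 2 * j" using odd_cancel by (metis dvd_times_left_cancel_iff zero_neq_numeral)
  then obtain s where s: "2 * j = 2 ^ (k - 1) * s" by blast
  have "odd s"
  proof
    assume "even s"
    then have "2 ^ k dvd 2 * j + 0 * (r + 1)" unfolding s pk by auto
    then show False using no by blast
  qed
  have "even t"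
  proof (rule ccontr)
    assume "odd t"
    then have "even (s + t)" using \<open>odd s\<close> by simp
    then have "2 * 2 ^ (k - 1) dvd 2 ^ (k - 1) * (s + t)" by auto
    then have "2 ^ k dvd 2 * j + 1 * (r + 1)" unfolding s t pk by (simp add: distrib_left)
    then show False using no by blast
  qed
  then show "2 ^ k dvd r + 1" unfolding t pk by auto
  obtain q where "s = 2 * q + 1" using \<open>odd s\<close> by (elim oddE)
  then have "2 * j = 2 ^ (k - 1) + 2 ^ k * q" unfolding s pk by (simp add: algebra_simps)
  then show "[2 * j = 2 ^ (k - 1)] (mod 2 ^ k)" by (simp add: cong_def)
qed

context p_group begin

text \<open>As the index is p, x is the product of a power of x^m, whose p-th power lies in
  \<open>M\<close>, and an element h of \<open>M\<close> that commutes with x.\<close>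

lemma index_p_pow:
  assumes M: "subgroup M G" "order G = p * card M" and x: "x \<in> carrier G"
  shows "x [^] p \<in> M"
proof (cases "x \<in> M")
  case False
  obtain m :: nat where m: "x [^] m \<notin> M" "(x [^] m) [^] p \<in> M" using ex_pow_leaving[OF M(1) x False] by blast
  have norm: "inv (x [^] m) \<otimes> h \<otimes> x [^] m \<in> M" if "h \<in> M" for h
    using index_p_normal[OF M _ that] x by simp
  have "card (adjoin M (x [^] m)) = card (carrier G)"
    using card_adjoin[OF M(1) _ m prime_p] x M(2) by (simp add: order_def)
  then have "adjoin M (x [^] m) = carrier G"
    using card_subset_eq[OF fin subgroup.subset[OF subgroup_adjoin[OF M(1) _ norm]]] x by blast
  then have "x \<in> adjoin M (x [^] m)" using x by simp
  then obtain j :: nat and h where jh: "x = (x [^] m) [^] j \<otimes> h" "h \<in> M" by (auto simp: adjoin_def)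
  have h: "h = inv ((x [^] m) [^] j) \<otimes> x"
    using jh x subgroup.mem_carrier[OF M(1) jh(2)] by (metis inv_cancel_left(2) nat_pow_closed)
  have "h [^] p = inv ((x [^] m) [^] j) [^] p \<otimes> x [^] p"
    unfolding h using x commute_inv[of "(x [^] m) [^] j" x] nat_pow_comm[of x "m * j" 1]
    by (intro pow_mult_distrib) (simp_all add: nat_pow_pow)
  moreover have "inv ((x [^] m) [^] j) [^] p \<in> M"
  proof -
    have "inv ((x [^] m) [^] j) [^] p = inv (((x [^] m) [^] p) [^] j)"
      using x by (simp add: nat_pow_inv nat_pow_pow ac_simps)
    then show ?thesis using subgroup_pow_closed[OF M(1) m(2)] subgroup.m_inv_closed[OF M(1)] by simp
  qed
  moreover have "h [^] p \<in> M" by (rule subgroup_pow_closed[OF M(1) jh(2)])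
  ultimately show ?thesis using subgroup_cancel(1)[OF M(1)] x by (metis nat_pow_closed)
qed (rule subgroup_pow_closed[OF M(1)])

lemma cyc_normalI:
  assumes a: "a \<in> carrier G" and conj: "\<And>g. g \<in> carrier G \<Longrightarrow> g \<otimes> a \<otimes> inv g \<in> cyc G a"
  shows "cyc G a \<lhd> G"
proof (rule normal_invI[OF subgroup_cyc[OF a]])
  fix g h assume g: "g \<in> carrier G" and "h \<in> cyc G a"
  then obtain i :: nat where "h = a [^] i" by (auto simp: cyc_def)
  then have "g \<otimes> h \<otimes> inv g = (g \<otimes> a \<otimes> inv g) [^] i"
    using pow_conj[of "inv g" a i] g a by simp
  then show "g \<otimes> h \<otimes> inv g \<in> cyc G a" using subgroup_pow_closed[OF subgroup_cyc[OF a] conj[OF g]] by simp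
qed

lemma mem_cyc_of_pow:
  assumes a: "a \<in> carrier G" "ord a = p ^ k" and j: "\<not> p dvd j"
  shows "a \<in> cyc G (a [^] (j::nat))"
proof -
  have "coprime j p" using prime_p j by (metis coprime_commute prime_imp_coprime)
  then have "coprime j (p ^ k)" by simp
  then obtain u where "[j * u = 1] (mod p ^ k)"
    using cong_solve_coprime_nat[of j "p ^ k"] unfolding One_nat_def by blast
  then have "(a [^] j) [^] u = a [^] (1::nat)" using pow_eq_pow_iff[OF a(1), of "j * u" 1] a by (simp add: nat_pow_pow)
  then show ?thesis using a by (metis nat_pow_eone pow_in_cyc)
qed

text \<open>\<open>a\<close> generates a maximal normal cyclic subgroup, which turns out to be self-centralizing.\<close>

theorem unique_order_p:
  assumes n: "n \<ge> 1"
    and uniq: "\<And>x y. \<lbrakk>x \<in> carrier G; y \<in> carrier G; x \<noteq> \<one>; x [^] p = \<one>; y [^] p = \<one>\<rbrakk> \<Longrightarrow> y \<in> cyc G x"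
  shows "\<exists>a\<in>carrier G. cyc G a = carrier G \<or>
    (p = 2 \<and> (\<exists>k\<ge>2. ord a = 2 ^ k \<and> order G = 2 * 2 ^ k \<and>
      (\<forall>x\<in>carrier G - cyc G a. a \<otimes> x = x \<otimes> inv a \<and> x [^] (2::nat) = a [^] ((2::nat) ^ (k - 1)))))"
proof -
  let ?S = "{a \<in> carrier G. cyc G a \<lhd> G}"
  have "cyc G \<one> = {\<one>}" by (auto simp: cyc_def)
  then have "?S \<noteq> {}" using one_is_normal by (metis (mono_tags, lifting) empty_Collect_eq one_closed)
  moreover have "finite ?S" by (rule finite_subset[OF _ fin]) blast
  ultimately have "Max (ord ` ?S) \<in> ord ` ?S" by (intro Max_in) auto
  then obtain a where "a \<in> ?S" "ord a = Max (ord ` ?S)" by (metis (no_types, lifting) imageE)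
  then have a: "a \<in> carrier G" "cyc G a \<lhd> G" and
    amax: "\<And>b. \<lbrakk>b \<in> carrier G; cyc G b \<lhd> G\<rbrakk> \<Longrightarrow> ord b \<le> ord a"
    using \<open>finite ?S\<close> by auto
  let ?A = "cyc G a"
  have A: "subgroup ?A G" by (rule subgroup_cyc[OF a(1)])
  obtain k where k: "ord a = p ^ k" using ord_eq_pow[OF a(1)] by blast
  have "1 < p ^ n" using n p_gt by (intro one_less_power) auto
  then have "order G \<noteq> 1" using order_eq by linarith
  then have "carrier G \<noteq> {\<one>}" by (auto simp: order_def)
  from ex_central_order_p[OF normal_self this]
  obtain z where z: "z \<in> center" "z \<noteq> \<one>" "z [^] p = \<one>" by blast
  have zc: "z \<in> carrier G" using z(1) by (simp add: center_iff)
  have "cyc G z \<lhd> G"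
  proof (rule cyc_normalI[OF zc])
    fix g assume g: "g \<in> carrier G"
    then have "g \<otimes> z \<otimes> inv g = z" using z(1) conj_eq_iff(2)[OF g zc zc] by (simp add: center_iff)
    then show "g \<otimes> z \<otimes> inv g \<in> cyc G z" using self_in_cyc[OF zc] by simp
  qed
  then have "p \<le> p ^ k" using amax[OF zc] ord_prime[OF zc z(2,3)] k by simp
  then have k1: "k \<ge> 1" using p_gt(2) by (cases k) auto
  \<comment> \<open>The only subgroup of order p lies in <a>.\<close>
  have omega: "y \<in> ?A" if y: "y \<in> carrier G" "y [^] p = \<one>" for y
  proof -
    let ?x = "a [^] (p ^ (k - 1))"
    have "?x \<noteq> \<one>" using pow_eq_id[OF a(1)] k k1 p_gt(2)
      by (metis One_nat_def diff_less le_less_trans lessI less_eq_Suc_le nat_dvd_not_less power_strict_increasing_iff zero_less_power p_gt(1))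
    moreover have "?x [^] p = \<one>"
    proof -
      have "p ^ (k - 1) * p = p ^ k" using k1 by (intro power_minus_mult) simp
      then show ?thesis using pow_eq_id[OF a(1), of "p ^ k"] k a(1) by (simp add: nat_pow_pow)
    qed
    ultimately have "y \<in> cyc G ?x" using uniq[of ?x y] y a(1) by simp
    then show ?thesis using cyc_subset[OF A, of ?x] by auto
  qed
  \<comment> \<open>If p did not divide j, then a would be a power of x^p and hence of x.\<close>
  have div_p: "p dvd j" if x: "x \<in> carrier G" "x [^] p = a [^] (j::nat)" "a \<notin> cyc G x" for x j
    using mem_cyc_of_pow[OF a(1) k, of j] cyc_subset[OF subgroup_cyc[OF x(1)], of "x [^] p"]
      pow_in_cyc[of G x p] x by auto
  \<comment> \<open>Otherwise choose x outside <a> centralizing <a> and central modulo <a>. If a is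
    a power of x, then <x> is normal and larger than <a>, against the choice of a. If not, x^p =
    a^(p i), and x a^(-i) has trivial p-th power without lying in <a>.\<close>
  have CA: "centralizer G ?A = ?A"
  proof (rule ccontr)
    assume ne: "centralizer G ?A \<noteq> ?A"
    have "?A \<subseteq> centralizer G ?A"
      using subgroup.subset[OF A] nat_pow_comm[OF a(1)]
      by (intro commutative_imp_subset_centralizer) (auto simp: cyc_def)
    then have "?A \<subset> centralizer G ?A" using ne by blast
    from ex_central_mod[OF a(2) normal_centralizer[OF a(2)] this]
    obtain x where x: "x \<in> centralizer G ?A" "x \<notin> ?A" "x [^] p \<in> ?A"
      "\<And>g. g \<in> carrier G \<Longrightarrow> g \<otimes> x \<otimes> inv g \<otimes> inv x \<in> ?A" by auto
    have xc: "x \<in> carrier G" using x(1) by (simp add: centralizer_def)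
    obtain j :: nat where j: "x [^] p = a [^] j" using x(3) by (auto simp: cyc_def)
    show False
    proof (cases "a \<in> cyc G x")
      case True
      have AX: "?A \<subseteq> cyc G x" by (rule cyc_subset[OF subgroup_cyc[OF xc] True])
      have "cyc G x \<lhd> G"
      proof (rule cyc_normalI[OF xc])
        fix g assume g: "g \<in> carrier G"
        have "g \<otimes> x \<otimes> inv g \<otimes> inv x \<otimes> x \<in> cyc G x"
          using subgroup.m_closed[OF subgroup_cyc[OF xc]] x(4)[OF g] AX self_in_cyc[OF xc] by blast
        then show "g \<otimes> x \<otimes> inv g \<in> cyc G x" using g xc by (simp add: m_assoc)
      qed
      then have "card (cyc G x) \<le> card ?A" using amax[OF xc] card_cyc a(1) xc by simp
      then have "?A = cyc G x" using AX card_seteq[OF finite_subgroup[OF subgroup_cyc[OF xc]]] by blast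
      then show False using x(2) self_in_cyc[OF xc] by simp
    next
      case False
      then obtain i where i: "j = p * i" using div_p[OF xc j] by blast
      have comm: "x \<otimes> inv (a [^] i) = inv (a [^] i) \<otimes> x"
        using commute_inv[of "a [^] i" x] a(1) xc centralizerD[OF x(1), of "a [^] i"] by simp
      have "(x \<otimes> inv (a [^] i)) [^] p = x [^] p \<otimes> inv (a [^] i) [^] p"
        using a(1) xc comm by (intro pow_mult_distrib) auto
      also have "\<dots> = \<one>" unfolding j i using a(1) by (simp add: nat_pow_inv nat_pow_pow mult.commute)
      finally have "x \<otimes> inv (a [^] i) \<in> ?A" using omega a(1) xc by simp
      then show False
        using subgroup_cancel(2)[OF A subgroup.m_inv_closed[OF A] xc, of "a [^] i"] x(2) by auto
    qed
  qed
  have commA: "x \<in> ?A" if "x \<in> carrier G" "x \<otimes> a = a \<otimes> x" for x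
  proof -
    have "x \<otimes> a [^] i = a [^] i \<otimes> x" for i :: nat
      using group_commutes_pow[of a x i] that a(1) by simp
    then have "x \<in> centralizer G ?A" using that(1) by (auto simp: centralizer_def cyc_def)
    then show ?thesis using CA by simp
  qed
  have conjA: "\<exists>r::nat. a \<otimes> x = x \<otimes> a [^] r" if x: "x \<in> carrier G" for x
  proof -
    have "inv x \<otimes> a \<otimes> x \<in> ?A" using normal.inv_op_closed1[OF a(2) x self_in_cyc[OF a(1)]] .
    then obtain r :: nat where "inv x \<otimes> a \<otimes> x = a [^] r" by (auto simp: cyc_def)
    then show ?thesis using conj_eq_iff(1)[OF x a(1), of "a [^] r"] a(1) by auto
  qed
  \<comment> \<open>No x a^l has trivial p-th power, so \<open>ex_order_p_in_coset\<close> must not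
    apply. This forces p = 2 and r = 3 modulo 4, the situation of
    \<open>inverting_exponent\<close>.\<close>
  have main: "p = 2 \<and> k \<ge> 2 \<and> a \<otimes> x = x \<otimes> inv a \<and> x [^] (2::nat) = a [^] ((2::nat) ^ (k - 1))"
    if x: "x \<in> carrier G" "x \<notin> ?A" "x [^] p \<in> ?A" for x
  proof -
    obtain j :: nat where j: "x [^] p = a [^] j" using x(3) by (auto simp: cyc_def)
    have "a \<notin> cyc G x"
    proof
      assume "a \<in> cyc G x"
      then obtain i :: nat where "a = x [^] i" by (auto simp: cyc_def)
      then have "x \<otimes> a = a \<otimes> x" using nat_pow_comm[OF x(1), of 1 i] x(1) by simp
      then show False using commA x by blast
    qed
    then obtain i where i: "j = p * i" using div_p[OF x(1) j] by blast
    obtain r :: nat where r: "a \<otimes> x = x \<otimes> a [^] r" using conjA[OF x(1)] by blast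
    have no: "(x \<otimes> a [^] (l::nat)) [^] p \<noteq> \<one>" for l
    proof
      assume "(x \<otimes> a [^] l) [^] p = \<one>"
      then have "x \<otimes> a [^] l \<in> ?A" using omega a(1) x(1) by simp
      then show False using subgroup_cancel(2)[OF A _ x(1), of "a [^] l"] x(2) by simp
    qed
    have "\<not> (p = 2 \<longrightarrow> [r = 1] (mod 4))"
      using ex_order_p_in_coset(1)[OF a(1) k k1 x(1) r, of i] j i no by auto
    then have p2: "p = 2" "\<not> [r = 1] (mod 4)" by auto
    have re: "[r ^ 2 = 1] (mod 2 ^ k)" "[r = 1] (mod 2)" using twisted_exponent[OF a(1) k k1 x(1) r x(3)] p2(1) by auto
    have r4: "r mod 4 = 3" using re(2) p2(2) unfolding cong_def by presburger
    have k2: "k \<ge> 2"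
    proof (rule ccontr)
      assume "\<not> k \<ge> 2"
      then have "k = 1" using k1 by simp
      then have "a [^] r = a [^] (1::nat)" using pow_eq_pow_iff[OF a(1), of r 1] k re(2) p2(1) by simp
      then have "x \<otimes> a = a \<otimes> x" using r a(1) by simp
      then show False using commA x by blast
    qed
    have "r \<ge> 1" using r4 by (cases r) auto
    then have sq: "2 ^ k dvd r\<^sup>2 - 1" using re(1) by (simp add: cong_altdef_nat)
    have "x \<otimes> x [^] p = x [^] p \<otimes> x" using nat_pow_comm[OF x(1), of 1 p] x(1) by simp
    then have "x \<otimes> a [^] j = x \<otimes> a [^] (r * j)"
      unfolding j twisted_commute[OF a(1) x(1) r] .
    then have "a [^] j = a [^] (r * j)" using a(1) x(1) by simp
    then have "[j = r * j] (mod 2 ^ k)" using pow_eq_pow_iff[OF a(1)] k p2(1) by simp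
    then have "2 ^ k dvd r * j - j" using \<open>r \<ge> 1\<close> cong_sym[of j "r * j"] by (simp add: cong_altdef_nat)
    moreover have "r * j - j = j * (r - 1)" by (simp add: diff_mult_distrib2 mult.commute)
    ultimately have jj: "2 ^ k dvd 2 * i * (r - 1)" using i p2(1) by simp
    have nn: "\<not> 2 ^ k dvd 2 * i + l * (r + 1)" for l
    proof
      assume d: "2 ^ k dvd 2 * i + l * (r + 1)"
      have "(x \<otimes> a [^] l) [^] p = a [^] (2 * i) \<otimes> a [^] (l * (r + 1))"
        using twisted_power[OF a(1) x(1) r, of l p] j i p2(1) by (simp add: numeral_2_eq_2 add.commute)
      also have "\<dots> = \<one>" using d pow_eq_id[OF a(1)] a(1) k p2(1) by (simp add: nat_pow_mult)
      finally show False using no by blast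
    qed
    note NT = inverting_exponent[OF k2 r4 sq jj nn]
    have "a [^] r \<otimes> a = \<one>"
      using NT(1) pow_eq_id[OF a(1), of "Suc r"] k p2(1) by simp
    then have "a [^] r = inv a" using inv_equality[of "a [^] r" a] a(1) by simp
    moreover have "x [^] (2::nat) = a [^] ((2::nat) ^ (k - 1))"
      using NT(2) j i p2(1) pow_eq_pow_iff[OF a(1)] k by simp
    ultimately show ?thesis using r k2 p2(1) by simp
  qed
  show ?thesis
  proof (cases "?A = carrier G")
    case True
    then show ?thesis using a(1) by blast
  next
    case False
    then obtain y where "y \<in> carrier G" "y \<notin> ?A" using subgroup.subset[OF A] by blast
    then obtain m :: nat where "y [^] m \<notin> ?A" "(y [^] m) [^] p \<in> ?A" using ex_pow_leaving[OF A] by blast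
    then obtain x where x: "x \<in> carrier G" "x \<notin> ?A" "x [^] p \<in> ?A" using \<open>y \<in> carrier G\<close> by blast
    note X = main[OF x]
    let ?M = "adjoin ?A x"
    have norm: "inv x \<otimes> h \<otimes> x \<in> ?A" if "h \<in> ?A" for h using normal.inv_op_closed1[OF a(2) x(1) that] .
    have M: "subgroup ?M G" "card ?M = p * card ?A" "?A \<subseteq> ?M" "x \<in> ?M"
      using subgroup_adjoin[OF A x(1) norm] card_adjoin[OF A x prime_p] adjoin_superset[OF A] adjoin_self[OF A x(1)]
      by auto
    have "?M = carrier G"
    proof (rule ccontr)
      assume "?M \<noteq> carrier G"
      then obtain y where y: "y \<in> carrier G" "y \<notin> ?M" using subgroup.subset[OF M(1)] by blast
      obtain m :: nat where m: "y [^] m \<notin> ?M" "(y [^] m) [^] p \<in> ?M" using ex_pow_leaving[OF M(1) y] by blast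
      define w where "w = y [^] m"
      have w: "w \<in> carrier G" "w \<notin> ?M" "w [^] p \<in> ?M" using m y(1) by (simp_all add: w_def)
      show False
      \<comment> \<open>A further element w either inverts a like x does, so that x w centralizes a,
        or its square inverts a, which would make -1 a square modulo 4.\<close>
      proof (cases "w [^] p \<in> ?A")
        case True
        have W: "a \<otimes> w = w \<otimes> inv a" using main[OF w(1) _ True] w(2) M(3) by blast
        have xi: "inv a \<otimes> w = w \<otimes> a"
        proof -
          have "a \<otimes> w \<otimes> a = w" using W w(1) a(1) by (simp add: m_assoc)
          then have "inv a \<otimes> w = inv a \<otimes> (a \<otimes> (w \<otimes> a))" using w(1) a(1) by (simp add: m_assoc)
          then show ?thesis using w(1) a(1) by simp
        qed
        have "a \<otimes> (x \<otimes> w) = x \<otimes> (inv a \<otimes> w)" using X x(1) w(1) a(1) by (simp flip: m_assoc)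
        then have "(x \<otimes> w) \<otimes> a = a \<otimes> (x \<otimes> w)" unfolding xi using x(1) w(1) a(1) by (simp add: m_assoc)
        then have "x \<otimes> w \<in> ?A" using commA x(1) w(1) by simp
        then have "x \<otimes> w \<in> ?M" using M(3) by blast
        then show False using subgroup_cancel(1)[OF M(1,4) w(1)] w(2) by blast
      next
        case False
        obtain j where j: "card ?M = p ^ j" using card_subgroup[OF M(1)] by blast
        interpret M: p_group "G\<lparr>carrier := ?M\<rparr>" p j by (rule p_group_restrict[OF M(1) j])
        have "subgroup ?A (G\<lparr>carrier := ?M\<rparr>)" by (rule subgroup_incl[OF A M(1,3)])
        then have wpp: "(w [^] p) [^] p \<in> ?A"
          using M.index_p_pow[of ?A "w [^] p"] w(3) M(2) nat_pow_consistent[of "w [^] p" p ?M]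
          by (simp add: order_def)
        have inv: "a \<otimes> w [^] p = w [^] p \<otimes> inv a"
          using main[OF nat_pow_closed[OF w(1)] False wpp] by blast
        obtain s :: nat where s: "a \<otimes> w = w \<otimes> a [^] s" using conjA[OF w(1)] by blast
        have "a \<otimes> w [^] p = w [^] p \<otimes> a [^] (s ^ p)"
          using twisted_commute_pow[OF a(1) w(1) s, of 1 p] a(1) by simp
        then have "a [^] (s ^ p) = inv a" using inv w(1) a(1) by simp
        then have "a [^] Suc (s ^ p) = \<one>" using a(1) by simp
        then have "ord a dvd Suc (s ^ p)" using pow_eq_id[OF a(1)] by blast
        then have "2 ^ k dvd Suc (s ^ 2)" using k X by simp
        moreover have "(2::nat) ^ 2 dvd 2 ^ k" using X by (intro le_imp_power_dvd) simp
        ultimately have "(2::nat) ^ 2 dvd Suc (s ^ 2)" by (rule dvd_trans[rotated])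
        then have "Suc (s * s) mod 4 = 0" by (simp add: power2_eq_square mod_eq_0_iff_dvd)
        moreover have "s mod 4 \<in> {0, 1, 2, 3}" by auto
        then have "(s * s) mod 4 \<in> {0, 1}" by (auto simp: mod_mult_eq[of s 4 s, symmetric])
        ultimately show False by (auto simp: mod_Suc)
      qed
    qed
    then have o: "order G = p * card ?A" using M(2) by (simp add: order_def)
    have "x [^] p \<in> ?A" if "x \<in> carrier G" for x using index_p_pow[OF A o that] .
    then have "a \<otimes> x = x \<otimes> inv a \<and> x [^] (2::nat) = a [^] ((2::nat) ^ (k - 1))" if "x \<in> carrier G - ?A" for x
      using main that by blast
    moreover have "order G = 2 * 2 ^ k" using o card_cyc[OF a(1)] k X by simp
    ultimately show ?thesis using a(1) k X by (intro bexI[of _ a]) auto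
  qed
qed

end

section \<open>Counting cyclic subgroups\<close>

lemma card_le_card_image_mult:
  assumes "finite S" "\<And>x. x \<in> S \<Longrightarrow> card {y \<in> S. f y = f x} \<le> m"
  shows "card S \<le> card (f ` S) * m"
proof -
  have "S = (\<Union>v\<in>f ` S. {y \<in> S. f y = v})" by blast
  then have "card S \<le> (\<Sum>v\<in>f ` S. card {y \<in> S. f y = v})"
    using card_UN_le[of "f ` S" "\<lambda>v. {y \<in> S. f y = v}"] assms(1) by simp
  also have "\<dots> \<le> (\<Sum>v\<in>f ` S. m)" using assms(2) by (intro sum_mono) auto
  finally show ?thesis by simp
qed

context group begin

text \<open>c is a commutator of x and w that commutes with both. Moving x past w^m costs c^m, in
  total 0 + 1 + ... + (m - 1) factors c.\<close>

lemma class2_power: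
  assumes x: "x \<in> carrier G" "w \<in> carrier G" "c \<in> carrier G"
    and c: "x \<otimes> c = c \<otimes> x" "w \<otimes> c = c \<otimes> w" and xw: "w \<otimes> x = x \<otimes> w \<otimes> c"
  shows "(x \<otimes> w) [^] (m::nat) = x [^] m \<otimes> w [^] m \<otimes> c [^] (\<Sum>{..<m})"
proof -
  have c2: "c [^] (i::nat) \<otimes> x = x \<otimes> c [^] i" "c [^] i \<otimes> w = w \<otimes> c [^] i" for i
    using group_commutes_pow[of c x i] group_commutes_pow[of c w i] x c by simp_all
  have wx: "w [^] m \<otimes> x = x \<otimes> w [^] m \<otimes> c [^] m" for m :: nat
  proof (induction m)
    case (Suc m)
    have "w [^] Suc m \<otimes> x = w [^] m \<otimes> x \<otimes> w \<otimes> c" using x xw by (simp add: m_assoc)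
    also have "\<dots> = x \<otimes> w [^] m \<otimes> (c [^] m \<otimes> w) \<otimes> c" using x Suc by (simp add: m_assoc)
    also have "\<dots> = x \<otimes> w [^] Suc m \<otimes> c [^] Suc m" unfolding c2 using x by (simp add: m_assoc)
    finally show ?case .
  qed (use x in simp)
  show ?thesis
  proof (induction m)
    case (Suc m)
    let ?s = "\<Sum>{..<m}"
    have "(x \<otimes> w) [^] Suc m = x [^] m \<otimes> w [^] m \<otimes> (c [^] ?s \<otimes> x) \<otimes> w" using x Suc by (simp add: m_assoc)
    also have "\<dots> = x [^] m \<otimes> (w [^] m \<otimes> x) \<otimes> (c [^] ?s \<otimes> w)" unfolding c2(1) using x by (simp add: m_assoc)
    also have "\<dots> = x [^] Suc m \<otimes> w [^] m \<otimes> (c [^] (m + ?s) \<otimes> w)"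
      unfolding wx using x by (simp add: m_assoc flip: nat_pow_mult)
    also have "\<dots> = x [^] Suc m \<otimes> w [^] Suc m \<otimes> c [^] (m + ?s)" unfolding c2 using x by (simp add: m_assoc)
    finally show ?case by (simp add: add.commute)
  qed (use x in simp)
qed

text \<open>For odd p the exponent p (p - 1) / 2 of c is a multiple of p.\<close>

lemma class2_power_odd_prime:
  assumes x: "x \<in> carrier G" "w \<in> carrier G" "c \<in> carrier G"
    and c: "x \<otimes> c = c \<otimes> x" "w \<otimes> c = c \<otimes> w" and xw: "w \<otimes> x = x \<otimes> w \<otimes> c"
    and p: "odd (p::nat)" "c [^] p = \<one>"
  shows "(x \<otimes> w) [^] p = x [^] p \<otimes> w [^] p"
proof -
  have "\<Sum>{..<p} = p * ((p - 1) div 2)"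
    using Sum_Ico_nat[of 0 p] p(1) by (simp add: atLeast0LessThan div_mult_swap)
  then have "c [^] \<Sum>{..<p} = (c [^] p) [^] ((p - 1) div 2)" using x by (simp add: nat_pow_pow)
  then show ?thesis using class2_power[OF x c xw, of p] p(2) x by simp
qed

end

section \<open>Subgroups of order p and the defect\<close>

context p_group begin

text \<open>A cyclic group of order p^k has p^k - p^(k-1) generators, so no more elements of
  \<open>S\<close> generate the same subgroup.\<close>

lemma card_le_cyclic_subgroups:
  assumes S: "S \<subseteq> carrier G" "\<And>x. x \<in> S \<Longrightarrow> ord x = p ^ k" and k: "k \<ge> 1"
  shows "card S \<le> card (cyc G ` S) * (p ^ k - p ^ (k - 1))"
proof (rule card_le_card_image_mult)
  show "finite S" using S(1) finite_subset by blast
  fix x assume x: "x \<in> S"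
  have xc: "x \<in> carrier G" using S x by blast
  have "p dvd ord x" using S(2)[OF x] k by simp
  have sub: "cyc G (x [^] p) \<subseteq> cyc G x" by (rule cyc_subset[OF subgroup_cyc[OF xc]]) simp
  have "{y \<in> S. cyc G y = cyc G x} \<subseteq> cyc G x - cyc G (x [^] p)"
  proof
    fix y assume y: "y \<in> {y \<in> S. cyc G y = cyc G x}"
    then have yc: "y \<in> carrier G" using S by blast
    have "y \<notin> cyc G (x [^] p)"
    proof
      assume "y \<in> cyc G (x [^] p)"
      then have "cyc G y \<subseteq> cyc G (x [^] p)" using xc by (intro cyc_subset subgroup_cyc) auto
      then have "x [^] (1::nat) \<in> cyc G (x [^] p)" using y self_in_cyc[OF xc] xc by auto
      then show False using pow_in_cyc_pow_iff[OF xc \<open>p dvd ord x\<close>, of 1] p_gt by simp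
    qed
    then show "y \<in> cyc G x - cyc G (x [^] p)" using y self_in_cyc[OF yc] by auto
  qed
  then have "card {y \<in> S. cyc G y = cyc G x} \<le> card (cyc G x - cyc G (x [^] p))"
    using finite_subgroup[OF subgroup_cyc[OF xc]] by (intro card_mono) auto
  also have "\<dots> = card (cyc G x) - card (cyc G (x [^] p))"
    using finite_subgroup[OF subgroup_cyc[of "x [^] p"]] xc sub by (intro card_Diff_subset) auto
  also have "\<dots> = p ^ k - p ^ (k - 1)"
    using card_cyc[OF xc] card_cyc_pow[OF xc \<open>p dvd ord x\<close>] S(2)[OF x] k p_gt
    by (metis One_nat_def diff_Suc_1 le_Suc_ex nonzero_mult_div_cancel_left plus_1_eq_Suc power_Suc less_irrefl)
  finally show "card {y \<in> S. cyc G y = cyc G x} \<le> p ^ k - p ^ (k - 1)" .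
qed

abbreviation subs_card :: "nat \<Rightarrow> 'a set set" where
  "subs_card m \<equiv> {H. subgroup H G \<and> card H = m}"

lemma finite_subs: "finite {H. subgroup H G \<and> P H}"
  by (rule finite_subset[OF _ finite_subgroups_of]) (auto simp: subgroups_of_def)

lemma center_nontrivial: "n \<ge> 1 \<Longrightarrow> center \<noteq> {\<one>}"
proof -
  assume "n \<ge> 1"
  then have "1 < p ^ n" using p_gt by (intro one_less_power) auto
  then have "order G \<noteq> 1" using order_eq by linarith
  then have "carrier G \<noteq> {\<one>}" by (auto simp: order_def)
  from ex_central_order_p[OF normal_self this] show ?thesis by blast
qed

lemma p_le_card_center: "n \<ge> 1 \<Longrightarrow> p \<le> card center"
proof -
  assume n: "n \<ge> 1"
  obtain c where c: "card center = p ^ c" using card_subgroup[OF subgroup_center] by blast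
  have "c \<noteq> 0"
  proof
    assume "c = 0"
    then have "card center = 1" using c by simp
    then have "center = {\<one>}" using subgroup.one_closed[OF subgroup_center] by (auto simp: card_1_singleton_iff)
    then show False using center_nontrivial[OF n] by simp
  qed
  then show ?thesis using c p_gt by (simp add: self_le_power)
qed

lemma trivial_notin_cd: "n \<ge> 1 \<Longrightarrow> {\<one>} \<notin> cd_lattice G"
  using center_nontrivial center_subset_cd subgroup.one_closed[OF subgroup_center] by blast

lemma order_p_in_cd:
  assumes n: "n \<ge> 1" and H: "H \<in> cd_lattice G" "card H = p"
  shows "H = center"
proof -
  have "center \<subseteq> H" by (rule center_subset_cd[OF H(1)])
  then show ?thesis
    using p_le_card_center[OF n] H card_seteq[OF finite_subgroup[OF cd_lattice_subgroup[OF H(1)]]] by metis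
qed

text \<open>A subgroup of order p in the lattice is the center, so at most one is lost, and the
  trivial subgroup makes up for it.\<close>

lemma defect_ge_order_p_p2:
  assumes n: "n \<ge> 1"
  shows "card (subs_card p) + card (subs_card (p\<^sup>2) - cd_lattice G) \<le> cd_defect G"
proof -
  let ?P = "subs_card p - {center}" and ?Q = "subs_card (p\<^sup>2) - cd_lattice G"
  have "p < p\<^sup>2" using p_gt(2) by (simp add: power2_eq_square)
  then have d: "{{\<one>}} \<inter> ?P = {}" "({{\<one>}} \<union> ?P) \<inter> ?Q = {}" using p_gt(2) by auto
  have f: "finite ?P" "finite ?Q" using finite_subs by auto
  have "card (subs_card p) \<le> Suc (card ?P)"
    using diff_card_le_card_Diff[of "{center}" "subs_card p"] by simp
  moreover have "card (({{\<one>}} \<union> ?P) \<union> ?Q) = 1 + card ?P + card ?Q"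
    using card_Un_disjoint[OF _ f(2) d(2)] card_Un_disjoint[OF _ f(1) d(1)] f by simp
  moreover have "card (({{\<one>}} \<union> ?P) \<union> ?Q) \<le> cd_defect G"
  proof (rule card_le_cd_defect)
    fix H assume H: "H \<in> ({{\<one>}} \<union> ?P) \<union> ?Q"
    then show "subgroup H G" using triv_subgroup by auto
    show "H \<notin> cd_lattice G" using H trivial_notin_cd[OF n] order_p_in_cd[OF n] by blast
  qed
  ultimately show ?thesis by linarith
qed

text \<open>The count is (p^3 - 1) / (p - 1) = p^2 + p + 1.\<close>

lemma card_subs_order_p:
  assumes "p ^ 3 \<le> card {x \<in> carrier G. x [^] p = \<one>}"
  shows "p\<^sup>2 + p + 1 \<le> card (subs_card p)"
proof -
  let ?S = "{x \<in> carrier G. x [^] p = \<one>} - {\<one>}"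
  have o: "ord x = p ^ 1" if "x \<in> ?S" for x using ord_prime[of x] that by simp
  have "p ^ 3 - 1 \<le> card ?S" using assms by simp
  also have "\<dots> \<le> card (cyc G ` ?S) * (p ^ 1 - p ^ (1 - 1))"
    by (rule card_le_cyclic_subgroups[OF _ o]) auto
  also have "card (cyc G ` ?S) \<le> card (subs_card p)"
    using subgroup_cyc card_cyc o by (intro card_mono finite_subs) auto
  finally have "p ^ 3 - 1 \<le> card (subs_card p) * (p - 1)" by simp
  moreover have "p ^ 3 - 1 = (p\<^sup>2 + p + 1) * (p - 1)"
    using p_gt by (cases p) (simp_all add: power3_eq_cube power2_eq_square algebra_simps)
  ultimately show ?thesis using p_gt(2) by (metis mult_le_cancel2 zero_less_diff)
qed

subsection \<open>Elementary abelian subgroups of order \<open>p\<^sup>2\<close>\<close>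

text \<open><z, y> is elementary abelian of order p^2. Any of its elements outside <z> can replace
  y, so two different groups of this kind meet exactly in <z>.\<close>

lemma adjoin_central:
  assumes z: "z \<in> center" "z \<noteq> \<one>" "z [^] p = \<one>" and y: "y \<in> carrier G" "y \<notin> cyc G z" "y [^] p = \<one>"
  shows "subgroup (adjoin (cyc G z) y) G" "card (adjoin (cyc G z) y) = p\<^sup>2"
    "\<And>x. x \<in> adjoin (cyc G z) y \<Longrightarrow> x [^] p = \<one>"
    "\<And>w x. \<lbrakk>w \<in> adjoin (cyc G z) y; x \<in> adjoin (cyc G z) y\<rbrakk> \<Longrightarrow> w \<otimes> x = x \<otimes> w"
    "\<And>y'. \<lbrakk>y' \<in> adjoin (cyc G z) y; y' \<notin> cyc G z\<rbrakk> \<Longrightarrow> adjoin (cyc G z) y' = adjoin (cyc G z) y"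
    "cyc G z \<subseteq> adjoin (cyc G z) y" "y \<in> adjoin (cyc G z) y"
proof -
  have zc: "z \<in> carrier G" using z(1) by (simp add: center_iff)
  have Z: "subgroup (cyc G z) G" by (rule subgroup_cyc[OF zc])
  have cen: "cyc G z \<subseteq> center" by (rule cyc_subset[OF subgroup_center z(1)])
  have norm: "inv y \<otimes> m \<otimes> y \<in> cyc G z" if "m \<in> cyc G z" "y \<in> carrier G" for m y
  proof -
    have "inv y \<otimes> m \<otimes> y = m" using conj_eq_iff(1)[of y m m] that cen by (auto simp: center_iff)
    then show ?thesis using that by simp
  qed
  show E: "subgroup (adjoin (cyc G z) y) G" by (rule subgroup_adjoin[OF Z y(1) norm[OF _ y(1)]])
  have "y [^] p \<in> cyc G z" using y(3) subgroup.one_closed[OF Z] by simp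
  then show cE: "card (adjoin (cyc G z) y) = p\<^sup>2"
    using card_adjoin[OF Z y(1,2) _ prime_p] card_cyc[OF zc] ord_prime[OF zc z(2,3)]
    by (simp add: power2_eq_square)
  have el: "\<exists>(i::nat) (j::nat). x = y [^] i \<otimes> z [^] j" if "x \<in> adjoin (cyc G z) y" for x
    using that by (auto simp: adjoin_def cyc_def)
  have zy: "z \<otimes> g = g \<otimes> z" if "g \<in> carrier G" for g using z(1) that by (simp add: center_iff)
  have zj: "z [^] (j::nat) \<otimes> g = g \<otimes> z [^] j" if "g \<in> carrier G" for g j
    using group_commutes_pow[OF zy[OF that] zc that] .
  show "x [^] p = \<one>" if x: "x \<in> adjoin (cyc G z) y" for x
  proof -
    obtain i j :: nat where x: "x = y [^] i \<otimes> z [^] j" using el[OF x] by blast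
    have "x [^] p = (y [^] i) [^] p \<otimes> (z [^] j) [^] p"
      unfolding x using y(1) zc zj[of "y [^] i"] by (intro pow_mult_distrib) auto
    also have "\<dots> = (y [^] p) [^] i \<otimes> (z [^] p) [^] j" using y(1) zc by (simp add: nat_pow_pow mult.commute)
    finally show ?thesis using y(3) z(3) by simp
  qed
  show "w \<otimes> x = x \<otimes> w" if w: "w \<in> adjoin (cyc G z) y" and x: "x \<in> adjoin (cyc G z) y" for w x
  proof -
    obtain i j i' j' :: nat where e: "w = y [^] i \<otimes> z [^] j" "x = y [^] i' \<otimes> z [^] j'" using el w x by metis
    have "w \<otimes> x = y [^] i \<otimes> (z [^] j \<otimes> y [^] i') \<otimes> z [^] j'" unfolding e using y(1) zc by (simp add: m_assoc)
    also have "\<dots> = y [^] (i + i') \<otimes> z [^] (j + j')"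
      using y(1) zc zj[of "y [^] i'" j] by (simp add: m_assoc flip: nat_pow_mult)
    also have "\<dots> = y [^] i' \<otimes> (y [^] i \<otimes> z [^] j') \<otimes> z [^] j"
      using y(1) zc by (simp add: m_assoc nat_pow_mult) (simp add: nat_pow_mult add.commute flip: m_assoc)
    also have "\<dots> = y [^] i' \<otimes> (z [^] j' \<otimes> y [^] i) \<otimes> z [^] j" using y(1) zj[of "y [^] i" j'] by simp
    also have "\<dots> = x \<otimes> w" unfolding e using y(1) zc by (simp add: m_assoc)
    finally show ?thesis .
  qed
  show sup: "cyc G z \<subseteq> adjoin (cyc G z) y" by (rule adjoin_superset[OF Z])
  show "y \<in> adjoin (cyc G z) y" by (rule adjoin_self[OF Z y(1)])
  show "adjoin (cyc G z) y' = adjoin (cyc G z) y" if y': "y' \<in> adjoin (cyc G z) y" "y' \<notin> cyc G z" for y'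
  proof (rule card_subset_eq[OF finite_subgroup[OF E]])
    have yc: "y' \<in> carrier G" using subgroup.mem_carrier[OF E y'(1)] .
    show "adjoin (cyc G z) y' \<subseteq> adjoin (cyc G z) y"
      using sup subgroup_pow_closed[OF E y'(1)] subgroup.m_closed[OF E] unfolding adjoin_def[of _ y'] by blast
    have "y' [^] p \<in> cyc G z" using \<open>\<And>x. x \<in> adjoin (cyc G z) y \<Longrightarrow> x [^] p = \<one>\<close> y'(1)
        subgroup.one_closed[OF Z] by simp
    then show "card (adjoin (cyc G z) y') = card (adjoin (cyc G z) y)"
      using card_adjoin[OF Z yc y'(2) _ prime_p] cE card_cyc[OF zc] ord_prime[OF zc z(2,3)]
      by (simp add: power2_eq_square)
  qed
qed

text \<open>Otherwise <z> is the only subgroup of order p, and for odd p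
  \<open>unique_order_p\<close> makes G cyclic.\<close>

lemma ex_noncentral_order_p:
  assumes "p \<noteq> 2" "n \<ge> 1" "\<And>g. g \<in> carrier G \<Longrightarrow> cyc G g \<noteq> carrier G"
    and z: "z \<in> center" "z \<noteq> \<one>" "z [^] p = \<one>"
  shows "\<exists>y\<in>carrier G. y \<notin> cyc G z \<and> y [^] p = \<one>"
proof (rule ccontr)
  assume no: "\<not> ?thesis"
  have zc: "z \<in> carrier G" using z(1) by (simp add: center_iff)
  have oz: "ord z = p ^ 1" using ord_prime[OF zc z(2,3)] by simp
  have "y \<in> cyc G x" if xy: "x \<in> carrier G" "y \<in> carrier G" "x \<noteq> \<one>" "x [^] p = \<one>" "y [^] p = \<one>" for x y
  proof -
    have "x \<in> cyc G z" "y \<in> cyc G z" using no xy by auto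
    then obtain i :: nat where i: "x = z [^] i" by (auto simp: cyc_def)
    have "\<not> p dvd i"
    proof
      assume "p dvd i"
      then have "x = \<one>" using pow_eq_id[OF zc] oz unfolding i by simp
      then show False using xy by simp
    qed
    then have "z \<in> cyc G x" using mem_cyc_of_pow[OF zc oz] i by blast
    then have "cyc G z \<subseteq> cyc G x" by (rule cyc_subset[OF subgroup_cyc[OF xy(1)]])
    then show ?thesis using \<open>y \<in> cyc G z\<close> by blast
  qed
  then show False using unique_order_p[OF assms(2)] assms(1,3) by metis
qed

lemma ex_central_prime:
  assumes "n \<ge> 1"
  obtains z where "z \<in> center" "z \<noteq> \<one>" "z [^] p = \<one>"
proof -
  have "carrier G \<noteq> {\<one>}" using center_nontrivial[OF assms] subgroup.subset[OF subgroup_center]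
      subgroup.one_closed[OF subgroup_center] by blast
  from ex_central_order_p[OF normal_self this] that show ?thesis by blast
qed

text \<open>Adjoining u to E = <z, y> gives a group L of order p^3, and some v in E outside <z> is
  central modulo <z> in L. The commutator of u and v lies in <z>, so L has class at most 2 and, p
  being odd, satisfies x^p = 1.\<close>

lemma card_omega_of_normalized:
  assumes p: "p \<noteq> 2" and z: "z \<in> center" "z \<noteq> \<one>" "z [^] p = \<one>"
    and y: "y \<in> carrier G" "y \<notin> cyc G z" "y [^] p = \<one>"
    and u: "u \<in> carrier G" "u \<notin> adjoin (cyc G z) y" "u [^] p = \<one>"
    and norm: "\<And>e. e \<in> adjoin (cyc G z) y \<Longrightarrow> inv u \<otimes> e \<otimes> u \<in> adjoin (cyc G z) y"
  shows "p ^ 3 \<le> card {x \<in> carrier G. x [^] p = \<one>}"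
proof -
  let ?E = "adjoin (cyc G z) y"
  note E = adjoin_central[OF z y]
  have zc: "z \<in> carrier G" using z(1) by (simp add: center_iff)
  have uE: "u [^] p \<in> ?E" using u(3) subgroup.one_closed[OF E(1)] by simp
  let ?L = "adjoin ?E u"
  have L: "subgroup ?L G" by (rule subgroup_adjoin[OF E(1) u(1) norm])
  have cL: "card ?L = p ^ 3"
    using card_adjoin[OF E(1) u(1,2) uE prime_p] E(2) by (simp add: power2_eq_square power3_eq_cube)
  have EL: "?E \<subseteq> ?L" and uL: "u \<in> ?L" using adjoin_superset[OF E(1)] adjoin_self[OF E(1) u(1)] by auto
  interpret L: p_group "G\<lparr>carrier := ?L\<rparr>" p 3 by (rule p_group_restrict[OF L cL])
  have invL: "inv\<^bsub>G\<lparr>carrier := ?L\<rparr>\<^esub> g = inv g" if "g \<in> ?L" for g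
    using m_inv_consistent[OF L that] by simp
  have "?E \<lhd> G\<lparr>carrier := ?L\<rparr>"
  proof (rule L.index_p_is_normal)
    show "subgroup ?E (G\<lparr>carrier := ?L\<rparr>)" by (rule subgroup_incl[OF E(1) L EL])
    show "order (G\<lparr>carrier := ?L\<rparr>) = p * card ?E" using cL E(2) by (simp add: order_def power2_eq_square power3_eq_cube)
  qed
  moreover have "cyc G z \<lhd> G\<lparr>carrier := ?L\<rparr>"
  proof (rule L.normalI_conj)
    show "subgroup (cyc G z) (G\<lparr>carrier := ?L\<rparr>)"
      using subgroup_incl[OF subgroup_cyc[OF zc] L] E(6) EL by blast
    fix g m assume g: "g \<in> carrier (G\<lparr>carrier := ?L\<rparr>)" and m: "m \<in> cyc G z"
    have gc: "g \<in> carrier G" using g subgroup.mem_carrier[OF L] by simp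
    have "m \<in> center" using m cyc_subset[OF subgroup_center z(1)] by blast
    then have "inv g \<otimes> m \<otimes> g = m" using conj_eq_iff(1)[OF gc, of m m] gc by (simp add: center_iff)
    then show "inv\<^bsub>G\<lparr>carrier := ?L\<rparr>\<^esub> g \<otimes>\<^bsub>G\<lparr>carrier := ?L\<rparr>\<^esub> m \<otimes>\<^bsub>G\<lparr>carrier := ?L\<rparr>\<^esub> g \<in> cyc G z"
      using m g invL by simp
  qed
  moreover have "cyc G z \<subset> ?E" using E(6,7) y(2) by blast
  ultimately have "\<exists>v\<in>?E - cyc G z. v [^]\<^bsub>G\<lparr>carrier := ?L\<rparr>\<^esub> p \<in> cyc G z \<and> (\<forall>g\<in>carrier (G\<lparr>carrier := ?L\<rparr>).
      g \<otimes>\<^bsub>G\<lparr>carrier := ?L\<rparr>\<^esub> v \<otimes>\<^bsub>G\<lparr>carrier := ?L\<rparr>\<^esub> inv\<^bsub>G\<lparr>carrier := ?L\<rparr>\<^esub> g \<otimes>\<^bsub>G\<lparr>carrier := ?L\<rparr>\<^esub> inv\<^bsub>G\<lparr>carrier := ?L\<rparr>\<^esub> v \<in> cyc G z)"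
    using L.ex_central_mod[of "cyc G z" ?E] by blast
  then obtain v where v: "v \<in> ?E" "v \<notin> cyc G z" and v3: "\<forall>g\<in>?L. g \<otimes> v \<otimes>
      inv\<^bsub>G\<lparr>carrier := ?L\<rparr>\<^esub> g \<otimes> inv\<^bsub>G\<lparr>carrier := ?L\<rparr>\<^esub> v \<in> cyc G z" by auto
  have v3: "g \<otimes> v \<otimes> inv g \<otimes> inv v \<in> cyc G z" if "g \<in> ?L" for g
  proof -
    have "v \<in> ?L" using v(1) EL by blast
    then show ?thesis using bspec[OF v3 that] invL[OF that] invL[of v] by simp
  qed
  have vc: "v \<in> carrier G" using subgroup.mem_carrier[OF E(1) v(1)] .
  have vp: "v [^] p = \<one>" by (rule E(3)[OF v(1)])
  define c where "c = inv u \<otimes> v \<otimes> u \<otimes> inv v"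
  have iu: "inv u \<in> ?L" using subgroup.m_inv_closed[OF L uL] .
  have cz: "c \<in> cyc G z" using v3[OF iu] u(1) by (simp add: c_def)
  have ccen: "c \<in> center" using cz cyc_subset[OF subgroup_center z(1)] by blast
  have cc: "c \<in> carrier G" and ccomm: "\<And>g. g \<in> carrier G \<Longrightarrow> g \<otimes> c = c \<otimes> g" using ccen by (auto simp: center_iff)
  have cp: "c [^] p = \<one>" using cz E(3,6) by blast
  have vu: "v \<otimes> u = u \<otimes> v \<otimes> c"
  proof -
    have "u \<otimes> (c \<otimes> v) = v \<otimes> u" unfolding c_def using u(1) vc by (simp add: m_assoc)
    then show ?thesis using ccomm[OF vc] u(1) vc cc by (simp add: m_assoc)
  qed
  have "x [^] p = \<one>" if "x \<in> ?L" for x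
  proof -
    have "x \<in> adjoin (adjoin (cyc G z) v) u" using E(5)[OF v(1,2)] that by simp
    then obtain i j l :: nat where x: "x = u [^] i \<otimes> (v [^] j \<otimes> z [^] l)" by (auto simp: adjoin_def cyc_def)
    have cpow: "c [^] (l::nat) \<otimes> g = g \<otimes> c [^] l" if "g \<in> carrier G" for g l
      by (rule group_commutes_pow) (use ccomm[OF that] cc that in simp_all)
    have 1: "v [^] j \<otimes> u = u \<otimes> v [^] j \<otimes> c [^] j" for j :: nat
    proof (induction j)
      case (Suc j)
      have "v [^] Suc j \<otimes> u = (v [^] j \<otimes> u) \<otimes> v \<otimes> c" using vu vc u(1) cc by (simp add: m_assoc)
      also have "\<dots> = u \<otimes> v [^] j \<otimes> (c [^] j \<otimes> v) \<otimes> c" unfolding Suc using vc u(1) cc by (simp add: m_assoc)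
      also have "\<dots> = u \<otimes> v [^] Suc j \<otimes> c [^] Suc j" unfolding cpow[OF vc] using vc u(1) cc by (simp add: m_assoc)
      finally show ?case .
    qed (use u(1) in simp)
    have 2: "v [^] j \<otimes> u [^] i = u [^] i \<otimes> v [^] j \<otimes> c [^] (i * j)" for i j :: nat
    proof (induction i)
      case (Suc i)
      have "v [^] j \<otimes> u [^] Suc i = u [^] i \<otimes> v [^] j \<otimes> (c [^] (i * j) \<otimes> u)"
        using Suc vc u(1) cc by (simp flip: m_assoc)
      also have "\<dots> = u [^] i \<otimes> (v [^] j \<otimes> u) \<otimes> c [^] (i * j)" unfolding cpow[OF u(1)] using vc u(1) cc by (simp add: m_assoc)
      also have "\<dots> = u [^] Suc i \<otimes> v [^] j \<otimes> c [^] (Suc i * j)" unfolding 1 using vc u(1) cc by (simp add: m_assoc nat_pow_mult)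
      finally show ?case .
    qed (use vc in simp)
    have zg: "z [^] l \<otimes> g = g \<otimes> z [^] l" if "g \<in> carrier G" for g
      by (rule group_commutes_pow) (use z(1) zc that in \<open>simp_all add: center_iff\<close>)
    have odd: "odd p" using p prime_p primes_dvd_imp_eq two_is_prime_nat by blast
    have "(u [^] i \<otimes> v [^] j) [^] p = (u [^] i) [^] p \<otimes> (v [^] j) [^] p"
    proof (rule class2_power_odd_prime[OF _ _ _ _ _ 2 odd])
      show "(c [^] (i * j)) [^] p = \<one>" using cp cc by (metis nat_pow_one nat_pow_pow mult.commute)
    qed (use u(1) vc cc cpow in auto)
    also have "\<dots> = (u [^] p) [^] i \<otimes> (v [^] p) [^] j" using u(1) vc by (simp add: nat_pow_pow mult.commute)
    finally have 3: "(u [^] i \<otimes> v [^] j) [^] p = \<one>" using u(3) vp by simp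
    have "x [^] p = ((u [^] i \<otimes> v [^] j) \<otimes> z [^] l) [^] p" unfolding x using u(1) vc zc by (simp add: m_assoc)
    also have "\<dots> = (u [^] i \<otimes> v [^] j) [^] p \<otimes> (z [^] l) [^] p"
      using zg u(1) vc zc by (intro pow_mult_distrib) auto
    also have "(z [^] l) [^] p = \<one>" using z(3) zc by (metis nat_pow_one nat_pow_pow mult.commute)
    finally show ?thesis using 3 by simp
  qed
  then have "?L \<subseteq> {x \<in> carrier G. x [^] p = \<one>}" using subgroup.subset[OF L] by blast
  then have "card ?L \<le> card {x \<in> carrier G. x [^] p = \<one>}" by (intro card_mono) auto
  then show ?thesis using cL by simp
qed

text \<open>\<open>u\<close> acts by conjugation on the elementary abelian subgroups of order \<open>p\<^sup>2\<close> containing \<open>z\<close>.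
  Either it normalizes one not containing \<open>u\<close>, or there are at least \<open>p + 1\<close> of them.\<close>

lemma card_omega_large:
  assumes p: "p \<noteq> 2" and z: "z \<in> center" "z \<noteq> \<one>" "z [^] p = \<one>"
    and y: "y \<in> carrier G" "y \<notin> cyc G z" "y [^] p = \<one>"
    and u: "u \<in> carrier G" "u \<notin> adjoin (cyc G z) y" "u [^] p = \<one>"
  shows "p ^ 3 \<le> card {x \<in> carrier G. x [^] p = \<one>}"
proof (rule ccontr)
  assume small: "\<not> ?thesis"
  have zc: "z \<in> carrier G" using z(1) by (simp add: center_iff)
  let ?Z = "cyc G z"
  let ?O = "{x \<in> carrier G. x [^] p = \<one>}"
  let ?X = "adjoin ?Z ` (?O - ?Z)"
  have uZ: "u \<notin> ?Z" using u(2) adjoin_central(6)[OF z y] by blast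
  have uO: "u \<in> ?O - ?Z" and yO: "y \<in> ?O - ?Z" using u y uZ by auto
  have ac: "subgroup (adjoin ?Z x) G" "card (adjoin ?Z x) = p\<^sup>2"
    "\<And>w. w \<in> adjoin ?Z x \<Longrightarrow> w [^] p = \<one>" "x \<in> adjoin ?Z x" "?Z \<subseteq> adjoin ?Z x"
    "\<And>w. w \<in> adjoin ?Z x \<Longrightarrow> w \<notin> ?Z \<Longrightarrow> adjoin ?Z w = adjoin ?Z x" if "x \<in> ?O - ?Z" for x
  proof -
    have "x \<in> carrier G" "x \<notin> ?Z" "x [^] p = \<one>" using that by auto
    note A = adjoin_central[OF z this]
    show "subgroup (adjoin ?Z x) G" "card (adjoin ?Z x) = p\<^sup>2" "x \<in> adjoin ?Z x" "?Z \<subseteq> adjoin ?Z x"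
      by (rule A)+
    show "w [^] p = \<one>" if "w \<in> adjoin ?Z x" for w by (rule A(3)[OF that])
    show "adjoin ?Z w = adjoin ?Z x" if "w \<in> adjoin ?Z x" "w \<notin> ?Z" for w by (rule A(5)[OF that])
  qed
  have conj_img: "(\<lambda>e. g \<otimes> e \<otimes> inv g) ` adjoin ?Z x = adjoin ?Z (g \<otimes> x \<otimes> inv g) \<and> g \<otimes> x \<otimes> inv g \<in> ?O - ?Z"
    if g: "g \<in> carrier G" and x: "x \<in> ?O - ?Z" for g x
  proof
    have xc: "x \<in> carrier G" using x by blast
    have zg: "g \<otimes> m \<otimes> inv g = m" if "m \<in> ?Z" for m
    proof -
      have "m \<in> center" using that cyc_subset[OF subgroup_center z(1)] by blast
      then show ?thesis using conj_eq_iff(2)[OF g, of m m] g by (simp add: center_iff)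
    qed
    have pw: "(g \<otimes> x \<otimes> inv g) [^] (i::nat) = g \<otimes> x [^] i \<otimes> inv g" for i
      using pow_conj[of "inv g" x i] g xc by simp
    have cj: "g \<otimes> (x [^] i \<otimes> m) \<otimes> inv g = (g \<otimes> x \<otimes> inv g) [^] i \<otimes> m" if "m \<in> ?Z" for i :: nat and m
    proof -
      have mc: "m \<in> carrier G" using subgroup.mem_carrier[OF subgroup_cyc[OF zc] that] .
      have "g \<otimes> (x [^] i \<otimes> m) \<otimes> inv g = (g \<otimes> x [^] i \<otimes> inv g) \<otimes> (g \<otimes> m \<otimes> inv g)"
        using g xc mc by (simp add: m_assoc)
      then show ?thesis using zg[OF that] pw by simp
    qed
    show "(\<lambda>e. g \<otimes> e \<otimes> inv g) ` adjoin ?Z x = adjoin ?Z (g \<otimes> x \<otimes> inv g)"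
    proof (intro equalityI subsetI)
      fix e assume "e \<in> (\<lambda>e. g \<otimes> e \<otimes> inv g) ` adjoin ?Z x"
      then obtain e0 where e0: "e = g \<otimes> e0 \<otimes> inv g" "e0 \<in> adjoin ?Z x" by blast
      then obtain i :: nat and m where "e0 = x [^] i \<otimes> m" "m \<in> ?Z" by (auto simp: adjoin_def)
      then have "e = (g \<otimes> x \<otimes> inv g) [^] i \<otimes> m" "m \<in> ?Z" using cj e0(1) by simp_all
      then show "e \<in> adjoin ?Z (g \<otimes> x \<otimes> inv g)" unfolding adjoin_def by blast
    next
      fix e assume "e \<in> adjoin ?Z (g \<otimes> x \<otimes> inv g)"
      then obtain i :: nat and m where "e = (g \<otimes> x \<otimes> inv g) [^] i \<otimes> m" "m \<in> ?Z" by (auto simp: adjoin_def)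
      then have "e = g \<otimes> (x [^] i \<otimes> m) \<otimes> inv g" "x [^] i \<otimes> m \<in> adjoin ?Z x"
        unfolding adjoin_def using cj by auto
      then show "e \<in> (\<lambda>e. g \<otimes> e \<otimes> inv g) ` adjoin ?Z x" by blast
    qed
    have "g \<otimes> x \<otimes> inv g \<notin> ?Z"
    proof
      assume m: "g \<otimes> x \<otimes> inv g \<in> ?Z"
      then have "g \<otimes> x = (g \<otimes> x \<otimes> inv g) \<otimes> g" using g xc by (simp add: m_assoc)
      also have "\<dots> = g \<otimes> (g \<otimes> x \<otimes> inv g)"
        using m cyc_subset[OF subgroup_center z(1)] g by (auto simp: center_iff)
      finally have "x = g \<otimes> x \<otimes> inv g" using g xc by simp
      then show False using m x by simp
    qed
    then show "g \<otimes> x \<otimes> inv g \<in> ?O - ?Z" using pw[of p] x g by auto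
  qed
  have U: "subgroup (cyc G u) G" by (rule subgroup_cyc[OF u(1)])
  have u1: "u \<noteq> \<one>" using uZ subgroup.one_closed[OF subgroup_cyc[OF zc]] by blast
  have cU: "card (cyc G u) = p ^ 1" using card_cyc[OF u(1)] ord_prime[OF u(1) u1 u(3)] by simp
  interpret U: p_group "G\<lparr>carrier := cyc G u\<rparr>" p 1 by (rule p_group_restrict[OF U cU])
  have Uc: "g \<in> carrier G" if "g \<in> cyc G u" for g using subgroup.mem_carrier[OF U that] .
  let ?f = "\<lambda>g E. (\<lambda>e. g \<otimes> e \<otimes> inv g) ` E"
  let ?F = "{E \<in> ?X. \<forall>g\<in>carrier (G\<lparr>carrier := cyc G u\<rparr>). ?f g E = E}"
  have Xsub: "E \<subseteq> carrier G" if "E \<in> ?X" for E using that ac(1) subgroup.subset by blast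
  have finX: "finite ?X" by simp
  have fixed: "[card ?F = card ?X] (mod p)"
  proof (rule U.card_fixed_points_mod[OF prime_p U.order_eq finX])
    fix g E assume g: "g \<in> carrier (G\<lparr>carrier := cyc G u\<rparr>)" and "E \<in> ?X"
    then obtain x where "x \<in> ?O - ?Z" "E = adjoin ?Z x" by blast
    then show "?f g E \<in> ?X" using conj_img[of g x] Uc g by auto
  next
    fix E assume "E \<in> ?X"
    then show "?f \<one>\<^bsub>G\<lparr>carrier := cyc G u\<rparr>\<^esub> E = E" using Xsub[of E] by (force simp: image_iff)
  next
    fix g h E assume gh: "g \<in> carrier (G\<lparr>carrier := cyc G u\<rparr>)" "h \<in> carrier (G\<lparr>carrier := cyc G u\<rparr>)" and E: "E \<in> ?X"
    have "g \<in> carrier G" "h \<in> carrier G" using gh Uc by auto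
    then show "?f (g \<otimes>\<^bsub>G\<lparr>carrier := cyc G u\<rparr>\<^esub> h) E = ?f g (?f h E)"
      unfolding image_image using Xsub[OF E] by (intro image_cong) (auto simp: group_normalize subset_iff)
  qed
  \<comment> \<open>A fixed E without u would satisfy \<open>card_omega_of_normalized\<close>,
    against \<open>small\<close>.\<close>
  have F: "?F = {adjoin ?Z u}"
  proof (intro equalityI subsetI)
    fix E assume E: "E \<in> ?F"
    then obtain x where x: "x \<in> ?O - ?Z" "E = adjoin ?Z x" by blast
    have "inv u \<in> cyc G u" using subgroup.m_inv_closed[OF U self_in_cyc[OF u(1)]] .
    then have "?f (inv u) E = E" using E by simp
    then have nn: "inv u \<otimes> e \<otimes> u \<in> E" if "e \<in> E" for e using that u(1) by (force simp: image_iff)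
    have "u \<in> E"
    proof (rule ccontr)
      assume "u \<notin> E"
      then have "p ^ 3 \<le> card ?O"
        using card_omega_of_normalized[OF p z _ _ _ u(1) _ u(3), of x] x nn by auto
      then show False using small by simp
    qed
    then show "E \<in> {adjoin ?Z u}" using ac(6)[OF x(1)] x(2) uZ by simp
  next
    fix E assume "E \<in> {adjoin ?Z u}"
    then have E: "E = adjoin ?Z u" by simp
    have "?f g E = E" if g: "g \<in> cyc G u" for g
    proof -
      obtain i :: nat where i: "g = u [^] i" using g by (auto simp: cyc_def)
      have "g \<otimes> u = u \<otimes> g" unfolding i using nat_pow_comm[OF u(1), of i 1] u(1) by simp
      then have "g \<otimes> u \<otimes> inv g = u" using conj_eq_iff(2)[OF Uc[OF g] u(1) u(1)] by simp
      then show ?thesis using conj_img[OF Uc[OF g] uO] E by simp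
    qed
    then show "E \<in> ?F" using uO E by auto
  qed
  have "adjoin ?Z u \<noteq> adjoin ?Z y" using ac(4)[OF uO] u(2) by auto
  then have "2 = card {adjoin ?Z u, adjoin ?Z y}" by simp
  also have "\<dots> \<le> card ?X" using uO yO by (intro card_mono[OF finX]) blast
  finally have X2: "2 \<le> card ?X" .
  \<comment> \<open>With \<open>adjoin ?Z y\<close> as a second member, \<open>?X\<close> has at
    least p + 1 members. Outside <z> they are disjoint with p^2 - p elements each, and (p + 1) (p^2
    - p) + p = p^3.\<close>
  have "[card ?X = 1] (mod p)" using fixed unfolding F by (simp add: cong_sym_eq)
  then have "p dvd card ?X - 1" using X2 by (simp add: cong_altdef_nat)
  then have X: "p + 1 \<le> card ?X" using X2 dvd_imp_le[of p "card ?X - 1"] by linarith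
  have "card (\<Union> ((\<lambda>E. E - ?Z) ` ?X)) = (\<Sum>E\<in>?X. card (E - ?Z))"
  proof (rule card_UN_disjoint[OF finX])
    show "\<forall>E\<in>?X. finite (E - ?Z)" using ac(1) finite_subgroup by blast
    show "\<forall>E\<in>?X. \<forall>E'\<in>?X. E \<noteq> E' \<longrightarrow> (E - ?Z) \<inter> (E' - ?Z) = {}"
      using ac(6) by blast
  qed
  also have "\<dots> = (\<Sum>E\<in>?X. p\<^sup>2 - p)"
  proof (rule sum.cong[OF HOL.refl])
    fix E assume "E \<in> ?X"
    then obtain x where x: "x \<in> ?O - ?Z" "E = adjoin ?Z x" by blast
    then show "card (E - ?Z) = p\<^sup>2 - p"
      using ac(2,5)[OF x(1)] card_cyc[OF zc] ord_prime[OF zc z(2,3)] finite_subgroup[OF subgroup_cyc[OF zc]]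
      by (simp add: card_Diff_subset)
  qed
  also have "\<dots> = card ?X * (p\<^sup>2 - p)" by simp
  finally have "(p + 1) * (p\<^sup>2 - p) \<le> card (\<Union> ((\<lambda>E. E - ?Z) ` ?X))" using X by (simp only: mult_le_mono1)
  also have "\<dots> \<le> card (?O - ?Z)"
    by (intro card_mono) (use ac(3) Xsub in auto)
  also have "?Z \<subseteq> ?O"
  proof -
    have "?Z \<subseteq> adjoin ?Z y" using ac(5)[OF yO] .
    then show ?thesis using ac(3)[OF yO] subgroup.subset[OF subgroup_cyc[OF zc]] by blast
  qed
  then have "card (?O - ?Z) = card ?O - p"
    using card_cyc[OF zc] ord_prime[OF zc z(2,3)] finite_subgroup[OF subgroup_cyc[OF zc]]
    by (simp add: card_Diff_subset)
  finally have "(p + 1) * (p\<^sup>2 - p) \<le> card ?O - p" .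
  moreover have "(p + 1) * (p\<^sup>2 - p) + p = p ^ 3"
    using p_gt(2) by (cases p) (simp_all add: power2_eq_square power3_eq_cube algebra_simps)
  moreover have "p < p\<^sup>2" using p_gt(2) by (simp add: power2_eq_square)
  then have "0 < (p + 1) * (p\<^sup>2 - p)" by simp
  ultimately show False using small by linarith
qed

end

section \<open>Groups of odd prime power order\<close>

context p_group begin

lemma p_group_FactGroup:
  assumes N: "N \<lhd> G" and c: "card N = p ^ m"
  shows "p_group (G Mod N) p (n - m)"
proof -
  have sN: "subgroup N G" using N normal_imp_subgroup by blast
  have "card (rcosets N) * p ^ m = p ^ n" using lagrange[OF sN] order_eq c by simp
  moreover have "m \<le> n" using card_subgroup[OF sN] c p_gt(2) by (metis power_inject_exp)
  ultimately have "card (rcosets N) * p ^ m = p ^ (n - m) * p ^ m" by (simp flip: power_add)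
  then have o: "order (G Mod N) = p ^ (n - m)" using p_gt by (simp add: order_def FactGroup_def)
  then have "finite (carrier (G Mod N))"
    using p_gt by (metis card_ge_0_finite order_def zero_less_power)
  then show ?thesis using o prime_p normal.factorgroup_is_group[OF N]
    by (simp add: p_group_def p_group_axioms_def finite_group_def finite_group_axioms_def)
qed

lemma coset_eq_one_iff:
  assumes "N \<lhd> G" "x \<in> carrier G"
  shows "N #> x = N \<longleftrightarrow> x \<in> N"
  using assms coset_join1[OF _ _ normal_imp_subgroup] coset_join2[OF _ normal_imp_subgroup]
    subgroup.subset[OF normal_imp_subgroup] by metis

lemma mem_coset_iff:
  assumes N: "N \<lhd> G" and g: "g \<in> carrier G" and x: "x \<in> N #> g"
  shows "x \<in> carrier G" "N #> x = N #> g"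
proof -
  have s: "subgroup N G" using N normal_imp_subgroup by blast
  show "x \<in> carrier G" using x g r_coset_subset_G[OF subgroup.subset[OF s] g] by blast
  show "N #> x = N #> g" using repr_independence[OF x g s] by simp
qed

lemma card_preimage:
  assumes N: "N \<lhd> G" and K: "K \<subseteq> carrier (G Mod N)"
  shows "card {x \<in> carrier G. N #> x \<in> K} = card K * card N"
proof -
  have s: "subgroup N G" using N normal_imp_subgroup by blast
  have Kr: "C \<in> rcosets N" if "C \<in> K" for C using K that by (auto simp: FactGroup_def)
  have eq: "{x \<in> carrier G. N #> x \<in> K} = \<Union> K"
  proof (intro equalityI subsetI)
    fix x assume "x \<in> {x \<in> carrier G. N #> x \<in> K}"
    then show "x \<in> \<Union> K" using rcos_self[OF _ s, of x] by blast
  next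
    fix x assume "x \<in> \<Union> K"
    then obtain C where C: "C \<in> K" "x \<in> C" by blast
    then obtain g where "g \<in> carrier G" "C = N #> g" using Kr by (auto simp: RCOSETS_def)
    then show "x \<in> {x \<in> carrier G. N #> x \<in> K}" using mem_coset_iff[OF N, of g x] C by simp
  qed
  have "pairwise disjnt K" using rcos_disjoint[OF s] Kr by (auto simp: pairwise_def)
  moreover have "finite C" if "C \<in> K" for C
    using Kr[OF that] cosets_finite[OF _ subgroup.subset[OF s]] by blast
  ultimately have "card (\<Union> K) = (\<Sum>C\<in>K. card C)" by (rule card_Union_disjoint)
  also have "\<dots> = (\<Sum>C\<in>K. card N)"
    using card_rcosets_equal[OF Kr subgroup.subset[OF s]] by (intro sum.cong) auto
  finally show ?thesis unfolding eq by simp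
qed

text \<open>G/E is not cyclic and thus contains an elementary abelian subgroup of order p^2. Its
  preimage has p^4 elements, and those outside E have order p^2. They generate at least (p^4 - p^2)
  / (p^2 - p) = p^2 + p cyclic subgroups; E is one more.\<close>

lemma card_subs_order_p2:
  assumes p: "p \<noteq> 2" and n: "n \<ge> 3"
    and E: "E \<lhd> G" "E = {x \<in> carrier G. x [^] p = \<one>}" "card E = p\<^sup>2"
    and big: "\<And>g. g \<in> carrier G \<Longrightarrow> ord g < p ^ (n - 1)"
  shows "p\<^sup>2 + p + 1 \<le> card (subs_card (p\<^sup>2))"
proof -
  have sE: "subgroup E G" using E(1) normal_imp_subgroup by blast
  let ?Q = "G Mod E"
  interpret Q: p_group ?Q p "n - 2" by (rule p_group_FactGroup[OF E(1)]) (use E(3) in simp)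
  have Qpow: "(E #> x) [^]\<^bsub>?Q\<^esub> (m::nat) = E #> x [^] m" if "x \<in> carrier G" for x m
    by (rule normal.FactGroup_pow[OF E(1) that])
  have Qone: "\<one>\<^bsub>?Q\<^esub> = E" by simp
  \<comment> \<open>If the coset of g generated the quotient, then g would have order at least
    p^(n-1), because g^(ord g / p) lies in E.\<close>
  have nc: "cyc ?Q C \<noteq> carrier ?Q" if C: "C \<in> carrier ?Q" for C
  proof
    assume cyc: "cyc ?Q C = carrier ?Q"
    obtain g where g: "g \<in> carrier G" "C = E #> g" using C by (auto simp: carrier_FactGroup)
    have oC: "Q.ord C = p ^ (n - 2)" using Q.card_cyc[OF C] cyc Q.order_eq by (simp add: order_def)
    have iff: "g [^] m \<in> E \<longleftrightarrow> p ^ (n - 2) dvd m" for m :: nat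
      using Q.pow_eq_id[OF C, of m] oC coset_eq_one_iff[OF E(1)] g Qpow by simp
    obtain j where j: "ord g = p ^ j" using ord_eq_pow[OF g(1)] by blast
    have "j \<noteq> 0"
    proof
      assume "j = 0"
      then have "g = \<one>" using j ord_eq_1[OF g(1)] by simp
      then have "p ^ (n - 2) dvd 1" using iff[of 1] subgroup.one_closed[OF sE] by simp
      then show False using n p_gt(2) by simp
    qed
    then have pj: "p ^ (j - 1) * p = p ^ j" by (intro power_minus_mult) simp
    have "(g [^] (p ^ (j - 1))) [^] p = \<one>"
      using pow_eq_id[OF g(1), of "p ^ j"] j g(1) pj by (simp add: nat_pow_pow)
    then have "g [^] (p ^ (j - 1)) \<in> E" using g(1) E(2) by simp
    then have "p ^ (n - 2) dvd p ^ (j - 1)" using iff by blast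
    then have "n - 2 \<le> j - 1" using p_gt(2) by (rule power_dvd_imp_le)
    then have "n - 1 \<le> j" using \<open>j \<noteq> 0\<close> n by linarith
    then have "p ^ (n - 1) \<le> ord g" unfolding j using p_gt by (intro power_increasing) auto
    then show False using big[OF g(1)] by simp
  qed
  have n2: "n - 2 \<ge> 1" using n by simp
  obtain z where z: "z \<in> Q.center" "z \<noteq> \<one>\<^bsub>?Q\<^esub>" "z [^]\<^bsub>?Q\<^esub> p = \<one>\<^bsub>?Q\<^esub>" by (rule Q.ex_central_prime[OF n2])
  obtain y where y: "y \<in> carrier ?Q" "y \<notin> cyc ?Q z" "y [^]\<^bsub>?Q\<^esub> p = \<one>\<^bsub>?Q\<^esub>"
    using Q.ex_noncentral_order_p[OF p n2 nc z] by blast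
  define K where "K = Q.adjoin (cyc ?Q z) y"
  note K = Q.adjoin_central[OF z y, folded K_def]
  have Kc: "K \<subseteq> carrier ?Q" by (rule subgroup.subset[OF K(1)])
  let ?P = "{x \<in> carrier G. E #> x \<in> K}"
  have cP: "card ?P = p\<^sup>2 * p\<^sup>2" using card_preimage[OF E(1) Kc] K(2) E(3) by simp
  have o: "ord x = p ^ 2" if x: "x \<in> ?P - E" for x
  proof -
    have xc: "x \<in> carrier G" using x by simp
    have "E #> x [^] p = E" using K(3)[of "E #> x"] x Qpow[OF xc] by simp
    then have "x [^] p \<in> E" using coset_eq_one_iff[OF E(1)] xc by simp
    then have "(x [^] p) [^] p = \<one>" using E(2) by simp
    then have d: "ord x dvd p ^ 2" using pow_eq_id[OF xc] xc by (simp add: nat_pow_pow power2_eq_square)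
    then obtain j where j: "j \<le> 2" "ord x = p ^ j" using divides_primepow_nat[OF prime_p] by blast
    have "\<not> ord x dvd p" using x E(2) pow_eq_id[OF xc] by simp
    then have "\<not> j \<le> 1" using j(2) le_imp_power_dvd[of j 1 p] by auto
    then have "j = 2" using j(1) by linarith
    then show ?thesis using j(2) by simp
  qed
  let ?S = "cyc G ` (?P - E)"
  have pp: "p < p\<^sup>2" using p_gt(2) by (simp add: power2_eq_square)
  have "p\<^sup>2 * p\<^sup>2 - p\<^sup>2 \<le> card (?P - E)"
    using cP E(3) diff_card_le_card_Diff[OF finite_subgroup[OF sE], of ?P] by simp
  also have "\<dots> \<le> card ?S * (p ^ 2 - p ^ (2 - 1))"
    by (rule card_le_cyclic_subgroups[OF _ o]) auto
  finally have "p\<^sup>2 * p\<^sup>2 - p\<^sup>2 \<le> card ?S * (p\<^sup>2 - p)" by simp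
  moreover have "p\<^sup>2 * p\<^sup>2 - p\<^sup>2 = (p\<^sup>2 + p) * (p\<^sup>2 - p)"
    by (simp add: algebra_simps diff_mult_distrib2 power2_eq_square)
  ultimately have "(p\<^sup>2 + p) * (p\<^sup>2 - p) \<le> card ?S * (p\<^sup>2 - p)" by simp
  then have cS: "p\<^sup>2 + p \<le> card ?S" by (rule mult_right_le_imp_le) (use pp in simp)
  have "E \<notin> ?S"
  proof
    assume "E \<in> ?S"
    then obtain x where "x \<in> ?P - E" "E = cyc G x" by blast
    then show False using self_in_cyc[of x] by simp
  qed
  then have "card (insert E ?S) = Suc (card ?S)" by simp
  moreover have "card (insert E ?S) \<le> card (subs_card (p\<^sup>2))"
    using sE E(3) subgroup_cyc card_cyc o by (intro card_mono finite_subs) auto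
  ultimately show ?thesis using cS by simp
qed

text \<open>If two members of the Chermak-Delgado lattice have order \<open>p\<^sup>2\<close>, all of them lie in the set
  \<open>D\<close> below, on which taking \<open>p\<close>-th powers is multiplicative with values in the center.\<close>

lemma card_cd_order_p2:
  assumes p: "p \<noteq> 2" and n: "n \<ge> 1" and om: "card {x \<in> carrier G. x [^] p = \<one>} \<le> p\<^sup>2"
  shows "card {H \<in> cd_lattice G. card H = p\<^sup>2} \<le> p + 1"
proof (cases "card {H \<in> cd_lattice G. card H = p\<^sup>2} \<le> 1")
  case False
  let ?D = "{H \<in> cd_lattice G. card H = p\<^sup>2}"
  let ?Z = center
  have finD: "finite ?D" by (rule finite_subset[OF _ finite_subgroups_of]) (auto simp: cd_lattice_def)
  have sub: "subgroup H G" if "H \<in> ?D" for H using that cd_lattice_subgroup by blast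
  \<comment> \<open>Both contain the center, which has at least p elements, and two different
    subgroups of order p^2 share at most p elements.\<close>
  have meet: "H \<inter> K = ?Z \<and> card ?Z = p" if HK: "H \<in> ?D" "K \<in> ?D" "H \<noteq> K" for H K
  proof -
    have I: "subgroup (H \<inter> K) G" by (rule subgroups_Inter_pair[OF sub[OF HK(1)] sub[OF HK(2)]])
    have Z: "?Z \<subseteq> H \<inter> K" using HK center_subset_cd by blast
    have "H \<inter> K \<noteq> H"
    proof
      assume "H \<inter> K = H"
      then have "H \<subseteq> K" by blast
      then have "H = K" using HK card_subset_eq[OF finite_subgroup[OF sub[OF HK(2)]]] by auto
      then show False using HK(3) by simp
    qed
    then have "card (H \<inter> K) < p ^ 2" using HK psubset_card_mono[OF finite_subgroup[OF sub[OF HK(1)]], of "H \<inter> K"] by auto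
    moreover obtain j where j: "card (H \<inter> K) = p ^ j" using card_subgroup[OF I] by blast
    ultimately have "j \<le> 1" using p_gt(2) by (metis less_Suc_eq_le one_add_one plus_1_eq_Suc power_less_imp_less_exp)
    then have "card (H \<inter> K) \<le> p" using j p_gt by (metis power_increasing power_one_right Suc_leI One_nat_def)
    then have "card (H \<inter> K) \<le> card ?Z" using p_le_card_center[OF n] by simp
    then have "?Z = H \<inter> K" using Z card_seteq[OF finite_subgroup[OF I]] by simp
    then show ?thesis using \<open>card (H \<inter> K) \<le> p\<close> p_le_card_center[OF n] by simp
  qed
  obtain H1 H2 where H12: "H1 \<in> ?D" "H2 \<in> ?D" "H1 \<noteq> H2"
    using False finD by (metis (no_types, lifting) card_le_Suc0_iff_eq One_nat_def)
  have cZ: "card ?Z = p" using meet[OF H12] by blast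
  have Zcd: "?Z \<in> cd_lattice G" using meet[OF H12] cd_lattice_join_meet(2) H12 by (metis (no_types, lifting) mem_Collect_eq)
  define D where "D = {x \<in> carrier G. x [^] p \<in> ?Z \<and> (\<forall>g\<in>carrier G. g \<otimes> x \<otimes> inv g \<otimes> inv x \<in> ?Z)}"
  have zp: "c [^] p = \<one>" if c: "c \<in> ?Z" for c
  proof -
    have cc: "c \<in> carrier G" using c by (simp add: center_iff)
    have "card (cyc G c) dvd card ?Z"
    proof -
      interpret Z: p_group "G\<lparr>carrier := ?Z\<rparr>" p 1 by (rule p_group_restrict[OF subgroup_center]) (use cZ in simp)
      have "subgroup (cyc G c) (G\<lparr>carrier := ?Z\<rparr>)"
        by (rule subgroup_incl[OF subgroup_cyc[OF cc] subgroup_center cyc_subset[OF subgroup_center c]])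
      from Z.lagrange[OF this] show ?thesis by (simp add: order_def) (metis dvd_triv_right)
    qed
    then show ?thesis using card_cyc[OF cc] cZ pow_eq_id[OF cc] by simp
  qed
  have comm: "x \<otimes> y = y \<otimes> x \<otimes> (inv x \<otimes> inv y \<otimes> x \<otimes> y)" if "x \<in> carrier G" "y \<in> carrier G" for x y
    using that by (simp add: m_assoc)
  have Dmul: "(x \<otimes> y) [^] p = x [^] p \<otimes> y [^] p" if "x \<in> D" "y \<in> carrier G" for x y
  proof -
    have c: "x \<in> carrier G" "y \<in> carrier G" using that by (auto simp: D_def)
    let ?c = "inv x \<otimes> (inv y \<otimes> x \<otimes> y)"
    have "inv y \<otimes> x \<otimes> inv (inv y) \<otimes> inv x \<in> ?Z" using that c unfolding D_def by blast
    then have "inv y \<otimes> x \<otimes> y \<otimes> inv x \<in> ?Z" using c by simp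
    then have dZ: "inv (inv y \<otimes> x \<otimes> y \<otimes> inv x) \<in> ?Z" by (rule subgroup.m_inv_closed[OF subgroup_center])
    define d where "d = inv (inv y \<otimes> x \<otimes> y \<otimes> inv x)"
    have d: "d \<in> ?Z" using dZ d_def by simp
    have dc: "d \<in> carrier G" "\<And>g. g \<in> carrier G \<Longrightarrow> g \<otimes> d = d \<otimes> g" using d by (auto simp: center_iff)
    have "y \<otimes> x = (y \<otimes> x \<otimes> inv y) \<otimes> y" using c by (simp add: m_assoc)
    have yx: "y \<otimes> (inv y \<otimes> x \<otimes> y \<otimes> inv x) \<otimes> x = x \<otimes> y" using c by (simp add: m_assoc)
    have inv_d: "inv d = inv y \<otimes> x \<otimes> y \<otimes> inv x" unfolding d_def using c by simp
    have "y \<otimes> inv d \<otimes> x = x \<otimes> y" unfolding inv_d by (rule yx)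
    moreover have "y \<otimes> inv d = inv d \<otimes> y" using commute_inv[OF dc(1) c(2)] dc(2)[OF c(2)] by simp
    ultimately have "inv d \<otimes> (y \<otimes> x) = x \<otimes> y" using c dc(1) by (simp add: m_assoc)
    then have "y \<otimes> x = d \<otimes> (x \<otimes> y)" using c dc(1) inv_solve_left'[of "x \<otimes> y" d "y \<otimes> x"] by simp
    then have "y \<otimes> x = x \<otimes> y \<otimes> d" using dc(2)[of "x \<otimes> y"] c by simp
    moreover have "odd p" using p prime_p primes_dvd_imp_eq two_is_prime_nat by blast
    ultimately show ?thesis using class2_power_odd_prime[OF c dc(1) dc(2)[OF c(1)] dc(2)[OF c(2)] _ _ zp[OF d]] by blast
  qed
  have HD: "H \<subseteq> D" if H: "H \<in> ?D" for H
  proof -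
    have sH: "subgroup H G" by (rule sub[OF H])
    have Hc: "H \<subseteq> carrier G" by (rule subgroup.subset[OF sH])
    have Hcd: "H \<in> cd_lattice G" using H by blast
    let ?C = "centralizer G H"
    have C: "subgroup ?C G" by (rule subgroup_centralizer[OF Hc])
    \<comment> \<open>Comparing with the measure of the center gives C(H) index p. So C(H) is
      normal, and with it H = C(C(H)).\<close>
    have "cd_measure G H = p * order G"
      using cd_measure_cd_lattice[OF Hcd Zcd] cd_measure_carrier_center(2) cZ by simp
    then have "p * (p * card ?C) = p * order G" using H by (auto simp: cd_measure_def power2_eq_square)
    then have "order G = p * card ?C" using p_gt by auto
    then have "?C \<lhd> G" by (rule index_p_is_normal[OF C])
    then have HN: "H \<lhd> G" using normal_centralizer cd_centralizer(2)[OF Hcd] by metis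
    have Zs: "?Z \<subset> H" using center_subset_cd[OF Hcd] cZ H p_gt(2) by (auto simp: power2_eq_square)
    have "?Z \<lhd> G"
    proof (rule normalI_conj[OF subgroup_center])
      fix g m assume "g \<in> carrier G" "m \<in> ?Z"
      then have "inv g \<otimes> m \<otimes> g = m" using conj_eq_iff(1)[of g m m] by (simp add: center_iff)
      then show "inv g \<otimes> m \<otimes> g \<in> ?Z" using \<open>m \<in> ?Z\<close> by simp
    qed
    from ex_central_mod[OF this HN Zs] obtain x where x: "x \<in> H" "x \<notin> ?Z" "x [^] p \<in> ?Z"
      "\<forall>g\<in>carrier G. g \<otimes> x \<otimes> inv g \<otimes> inv x \<in> ?Z" by auto
    have xc: "x \<in> carrier G" using x Hc by blast
    have norm: "inv x \<otimes> m \<otimes> x \<in> ?Z" if "m \<in> ?Z" for m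
    proof -
      have "inv x \<otimes> m \<otimes> x = m" using conj_eq_iff(1)[of x m m] that xc by (simp add: center_iff)
      then show ?thesis using that by simp
    qed
    have "card (adjoin ?Z x) = p\<^sup>2" using card_adjoin[OF subgroup_center xc x(2,3) prime_p] cZ by (simp add: power2_eq_square)
    moreover have "adjoin ?Z x \<subseteq> H"
      using subgroup_pow_closed[OF sH x(1)] Zs subgroup.m_closed[OF sH] unfolding adjoin_def by blast
    ultimately have HA: "adjoin ?Z x = H" using H card_subset_eq[OF finite_subgroup[OF sH]] by simp
    show ?thesis
    proof
      fix h assume "h \<in> H"
      then have "h \<in> adjoin ?Z x" using HA by simp
      then obtain i :: nat and m where h: "h = x [^] i \<otimes> m" "m \<in> ?Z" by (auto simp: adjoin_def)
      have mc: "m \<in> carrier G" "\<And>g. g \<in> carrier G \<Longrightarrow> m \<otimes> g = g \<otimes> m" using h(2) by (auto simp: center_iff)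
      have "h [^] p = (x [^] p) [^] i \<otimes> m [^] p"
        unfolding h(1) using xc mc(1) mc(2)[of "x [^] i"] by (subst pow_mult_distrib) (auto simp: nat_pow_pow mult.commute)
      then have 1: "h [^] p \<in> ?Z"
        using subgroup.m_closed[OF subgroup_center] subgroup_pow_closed[OF subgroup_center] x(3) h(2) by simp
      have 2: "g \<otimes> x [^] i \<otimes> inv g \<otimes> inv (x [^] i) \<in> ?Z" if g: "g \<in> carrier G" for g and i :: nat
      proof (induction i)
        case (Suc i)
        define c where "c = g \<otimes> x \<otimes> inv g \<otimes> inv x"
        have c: "c \<in> ?Z" unfolding c_def using x(4) g by blast
        have cc: "c \<in> carrier G" "x [^] i \<otimes> c = c \<otimes> x [^] i" using c xc by (auto simp: center_iff)
        have "g \<otimes> x [^] Suc i \<otimes> inv g \<otimes> inv (x [^] Suc i)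
            = (g \<otimes> x [^] i \<otimes> inv g \<otimes> inv (x [^] i)) \<otimes> (x [^] i \<otimes> c \<otimes> inv (x [^] i))"
          unfolding c_def using g xc by (simp add: group_normalize)
        also have "x [^] i \<otimes> c \<otimes> inv (x [^] i) = c" using conj_eq_iff(2)[of "x [^] i" c c] cc xc by simp
        finally show ?case using subgroup.m_closed[OF subgroup_center Suc c] by simp
      qed (use g subgroup.one_closed[OF subgroup_center] in simp)
      have "g \<otimes> h \<otimes> inv g \<otimes> inv h \<in> ?Z" if g: "g \<in> carrier G" for g
      proof -
        have "g \<otimes> h \<otimes> inv g \<otimes> inv h = g \<otimes> x [^] i \<otimes> (m \<otimes> inv g) \<otimes> inv h"
          unfolding h(1) using g xc mc(1) by (simp add: m_assoc)
        also have "\<dots> = g \<otimes> x [^] i \<otimes> inv g \<otimes> inv (x [^] i)"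
          unfolding mc(2)[OF inv_closed[OF g]] h(1) using g xc mc(1) by (simp add: group_normalize)
        finally show ?thesis using 2[OF g] by simp
      qed
      then show "h \<in> D" using 1 xc mc(1) h(1) by (auto simp: D_def)
    qed
  qed
  have finDD: "finite D" by (rule finite_subset[OF _ fin]) (auto simp: D_def)
  \<comment> \<open>The p-th power map on \<open>D\<close> takes at most p values, and by
    \<open>Dmul\<close> each of its fibers is contained in a translate of the solutions of e^p = 1,
    which number at most p^2.\<close>
  have cD: "card D \<le> p * p\<^sup>2"
  proof -
    have "card D \<le> card ((\<lambda>x. x [^] p) ` D) * p\<^sup>2"
    proof (rule card_le_card_image_mult[OF finDD])
      fix x assume x: "x \<in> D"
      have xc: "x \<in> carrier G" using x by (simp add: D_def)
      have "{y \<in> D. y [^] p = x [^] p} \<subseteq> (\<lambda>e. e \<otimes> x) ` {e \<in> carrier G. e [^] p = \<one>}"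
      proof
        fix y assume y: "y \<in> {y \<in> D. y [^] p = x [^] p}"
        then have yc: "y \<in> carrier G" by (simp add: D_def)
        have "(y \<otimes> inv x) [^] p = y [^] p \<otimes> inv x [^] p" using Dmul[of y "inv x"] y xc by simp
        also have "\<dots> = \<one>" using y xc by (simp add: nat_pow_inv)
        finally have "y \<otimes> inv x \<in> {e \<in> carrier G. e [^] p = \<one>}" using yc xc by simp
        moreover have "y = (y \<otimes> inv x) \<otimes> x" using yc xc by (simp add: m_assoc)
        ultimately show "y \<in> (\<lambda>e. e \<otimes> x) ` {e \<in> carrier G. e [^] p = \<one>}" by blast
      qed
      then have "card {y \<in> D. y [^] p = x [^] p} \<le> card ((\<lambda>e. e \<otimes> x) ` {e \<in> carrier G. e [^] p = \<one>})"
        by (intro card_mono) auto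
      also have "\<dots> \<le> card {e \<in> carrier G. e [^] p = \<one>}" by (rule card_image_le) simp
      finally show "card {y \<in> D. y [^] p = x [^] p} \<le> p\<^sup>2" using om by simp
    qed
    also have "card ((\<lambda>x. x [^] p) ` D) \<le> p"
    proof -
      have "card ((\<lambda>x. x [^] p) ` D) \<le> card ?Z"
        by (intro card_mono finite_subgroup[OF subgroup_center]) (auto simp: D_def)
      then show ?thesis using cZ by simp
    qed
    finally show ?thesis by simp
  qed
  have pp: "p < p\<^sup>2" using p_gt(2) by (simp add: power2_eq_square)
  have ZH: "?Z \<subseteq> H" if "H \<in> ?D" for H using that center_subset_cd by blast
  have "card ?D * (p\<^sup>2 - p) = (\<Sum>H\<in>?D. card (H - ?Z))"
  proof -
    have "card (H - ?Z) = p\<^sup>2 - p" if "H \<in> ?D" for H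
      using that ZH[OF that] cZ finite_subgroup[OF subgroup_center] by (simp add: card_Diff_subset)
    then show ?thesis by simp
  qed
  also have "\<dots> = card (\<Union> ((\<lambda>H. H - ?Z) ` ?D))"
  proof (rule card_UN_disjoint[OF finD, symmetric])
    show "\<forall>H\<in>?D. finite (H - ?Z)" using sub finite_subgroup by blast
    show "\<forall>H\<in>?D. \<forall>K\<in>?D. H \<noteq> K \<longrightarrow> (H - ?Z) \<inter> (K - ?Z) = {}" using meet by blast
  qed
  also have "\<dots> \<le> card (D - ?Z)" using HD finDD by (intro card_mono) blast+
  also have "\<dots> = card D - p"
    using ZH[OF H12(1)] HD[OF H12(1)] cZ finite_subgroup[OF subgroup_center] by (subst card_Diff_subset) auto
  also have "\<dots> \<le> p * p\<^sup>2 - p" using cD by simp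
  also have "\<dots> = (p + 1) * (p\<^sup>2 - p)"
    by (simp add: algebra_simps diff_mult_distrib2 power2_eq_square)
  finally show ?thesis using pp by (metis mult_le_cancel2 zero_less_diff)
qed simp

text \<open>When the solutions of x^p = 1 form a group of order p^2, there are at least p + 1
  subgroups of order p. Of at least p^2 + p + 1 subgroups of order p^2, at most p + 1 lie in the
  lattice. This gives p + 1 + p^2 subgroups outside, just above the bound.\<close>

theorem defect_odd_large:
  assumes p: "p \<noteq> 2" and n: "n \<ge> 1" and nc: "\<And>g. g \<in> carrier G \<Longrightarrow> cyc G g \<noteq> carrier G"
    and big: "\<And>g. g \<in> carrier G \<Longrightarrow> ord g < p ^ (n - 1)"
  shows "p\<^sup>2 + p < cd_defect G"
proof -
  obtain z where z: "z \<in> center" "z \<noteq> \<one>" "z [^] p = \<one>" by (rule ex_central_prime[OF n])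
  obtain y where y: "y \<in> carrier G" "y \<notin> cyc G z" "y [^] p = \<one>"
    using ex_noncentral_order_p[OF p n nc z] by blast
  let ?E = "adjoin (cyc G z) y" and ?O = "{x \<in> carrier G. x [^] p = \<one>}"
  note E = adjoin_central[OF z y]
  have Ec: "?E \<subseteq> carrier G" by (rule subgroup.subset[OF E(1)])
  show ?thesis
  proof (cases "?O \<subseteq> ?E")
    case False
    then have "p ^ 3 \<le> card ?O" using card_omega_large[OF p z y] by blast
    then have "p\<^sup>2 + p + 1 \<le> card (subs_card p)" by (rule card_subs_order_p)
    then show ?thesis using defect_ge_order_p_p2[OF n] by linarith
  next
    case True
    then have EO: "?E = ?O" using E(3) Ec by blast
    have EN: "?E \<lhd> G"
    proof (rule normalI_conj[OF E(1)])
      fix g m assume g: "g \<in> carrier G" and m: "m \<in> ?E"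
      have "(inv g \<otimes> m \<otimes> g) [^] p = \<one>" using pow_conj[of g m p] g m EO by simp
      then show "inv g \<otimes> m \<otimes> g \<in> ?E" using g m EO by simp
    qed
    have "p ^ 2 \<le> p ^ n" using card_mono[OF fin Ec] E(2) order_eq by (simp add: order_def)
    then have "2 \<le> n" using p_gt(2) by (metis power_le_imp_le_exp)
    moreover have "n \<noteq> 2"
    proof
      assume "n = 2"
      moreover have "y \<noteq> \<one>" using y(2) pow_in_cyc[of G z 0] by auto
      ultimately show False using big[OF y(1)] ord_prime[OF y(1) _ y(3)] by simp
    qed
    ultimately have n3: "n \<ge> 3" by simp
    have s2: "p\<^sup>2 + p + 1 \<le> card (subs_card (p\<^sup>2))"
      by (rule card_subs_order_p2[OF p n3 EN EO E(2) big])
    have "card {H \<in> cd_lattice G. card H = p\<^sup>2} \<le> p + 1"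
      using card_cd_order_p2[OF p n] E(2) unfolding EO by simp
    moreover have "{H \<in> cd_lattice G. card H = p\<^sup>2} = subs_card (p\<^sup>2) \<inter> cd_lattice G"
      using cd_lattice_subgroup by blast
    ultimately have "card (subs_card (p\<^sup>2) \<inter> cd_lattice G) \<le> p + 1" by simp
    moreover have "card (subs_card (p\<^sup>2)) - card (subs_card (p\<^sup>2) \<inter> cd_lattice G) \<le> card (subs_card (p\<^sup>2) - cd_lattice G)"
      using finite_subs by (simp add: card_Diff_subset_Int)
    ultimately have d2: "p\<^sup>2 \<le> card (subs_card (p\<^sup>2) - cd_lattice G)" using s2 by linarith
    let ?S = "?O - {\<one>}"
    have o: "ord x = p ^ 1" if "x \<in> ?S" for x using ord_prime[of x] that by simp
    have "p\<^sup>2 - 1 \<le> card ?S" using E(2) unfolding EO by simp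
    also have "\<dots> \<le> card (cyc G ` ?S) * (p ^ 1 - p ^ (1 - 1))"
      by (rule card_le_cyclic_subgroups[OF _ o]) auto
    also have "card (cyc G ` ?S) \<le> card (subs_card p)"
      using subgroup_cyc card_cyc o by (intro card_mono finite_subs) auto
    finally have "p\<^sup>2 - 1 \<le> card (subs_card p) * (p - 1)" by simp
    moreover have "p\<^sup>2 - 1 = (p + 1) * (p - 1)"
      using p_gt by (cases p) (simp_all add: power2_eq_square algebra_simps)
    ultimately have "p + 1 \<le> card (subs_card p)" using p_gt(2) by (metis mult_le_cancel2 zero_less_diff)
    then show ?thesis using d2 defect_ge_order_p_p2[OF n] by linarith
  qed
qed

text \<open>If x^p = a^j with p not dividing j, then x would generate G. So the coset x <a> contains
  some b with b^p = 1, where \<open>two\<close> enters for p = 2. The two outcomes are that b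
  commutes with a or not.\<close>

lemma almost_cyclic_classification:
  assumes a: "a \<in> carrier G" "ord a = p ^ k" and k: "k \<ge> 1" "n = Suc k"
    and nc: "\<And>g. g \<in> carrier G \<Longrightarrow> cyc G g \<noteq> carrier G"
    and x: "x \<in> carrier G" "x \<notin> cyc G a" "a \<otimes> x = x \<otimes> a [^] r" and two: "p = 2 \<Longrightarrow> [r = (1::nat)] (mod 4)"
  shows "(G \<cong> integer_mod_group (p ^ k) \<times>\<times> integer_mod_group p \<and> cd_defect G = k * (p + 1) + 1) \<or>
    (k \<ge> 2 \<and> G \<cong> modular_p_group p k \<and> cd_defect G = (k - 1) * (p + 1))"
proof -
  have A: "subgroup (cyc G a) G" by (rule subgroup_cyc[OF a(1)])
  have o: "order G = p * card (cyc G a)" using order_eq k a card_cyc[OF a(1)] by simp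
  have xp: "x [^] p \<in> cyc G a" by (rule index_p_pow[OF A o x(1)])
  then obtain j :: nat where j: "x [^] p = a [^] j" by (auto simp: cyc_def)
  have "p dvd j"
  proof (rule ccontr)
    assume "\<not> p dvd j"
    then have "a \<in> cyc G (x [^] p)" using mem_cyc_of_pow[OF a] j by metis
    then have "a \<in> cyc G x" using cyc_subset[OF subgroup_cyc[OF x(1)], of "x [^] p"] by auto
    then have "cyc G a \<subset> cyc G x" using cyc_subset[OF subgroup_cyc[OF x(1)]] self_in_cyc[OF x(1)] x(2) by blast
    then have lt: "p ^ k < card (cyc G x)"
      using psubset_card_mono[OF finite_subgroup[OF subgroup_cyc[OF x(1)]]] card_cyc[OF a(1)] a(2) by metis
    obtain i where i: "i \<le> n" "card (cyc G x) = p ^ i" using card_subgroup[OF subgroup_cyc[OF x(1)]] by blast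
    then have "k < i" using lt p_gt(2) by (metis power_less_imp_less_exp)
    then have "i = n" using i(1) k(2) by linarith
    then have "card (cyc G x) = card (carrier G)" using i(2) order_eq by (simp add: order_def)
    then show False using nc[OF x(1)] card_subset_eq[OF fin subgroup.subset[OF subgroup_cyc[OF x(1)]]] by blast
  qed
  then obtain j' where "x [^] p = a [^] (p * j')" using j by auto
  from ex_order_p_in_coset(1)[OF a k(1) x(1,3) this two]
  obtain i :: nat where i: "(x \<otimes> a [^] i) [^] p = \<one>" by blast
  define b where "b = x \<otimes> a [^] i"
  have b: "b \<in> carrier G" "b [^] p = \<one>" using i a x by (simp_all add: b_def)
  have bn: "b \<notin> cyc G a" unfolding b_def using subgroup_cancel(2)[OF A _ x(1), of "a [^] i"] x(2) by simp
  have tw: "a \<otimes> b = b \<otimes> a [^] r"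
  proof -
    have "a \<otimes> b = x \<otimes> (a [^] r \<otimes> a [^] i)" unfolding b_def using a x by (simp flip: m_assoc)
    also have "\<dots> = b \<otimes> a [^] r" unfolding b_def using a x by (simp add: m_assoc nat_pow_mult add.commute)
    finally show ?thesis .
  qed
  interpret cyclic_extension G p n k r a b
    using a b bn k tw conj_eq_iff(1)[OF b(1) a(1) nat_pow_closed[OF a(1), of r]] by unfold_locales auto
  show ?thesis
  proof (cases "a \<otimes> b = b \<otimes> a")
    case True
    then show ?thesis using iso_integer_mod_prod[OF b(2) True] defect_split(1)[OF b(2) k(1) two True] by blast
  next
    case False
    note comm = defect_split(3)[OF b(2) k(1) two]
    have "group (modular_p_group p k)" unfolding modular_p_group_def by (rule group_presented_group)
    then have "G \<cong> modular_p_group p k" using iso_modular(2)[OF b(2) False comm] group.iso_sym by blast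
    then show ?thesis using iso_modular(1)[OF b(2) False comm] defect_split(2)[OF b(2) k(1) two False] by blast
  qed
qed

theorem odd_classification:
  assumes p: "p \<noteq> 2" and n: "n \<ge> 1" and nc: "\<And>g. g \<in> carrier G \<Longrightarrow> cyc G g \<noteq> carrier G"
    and le: "cd_defect G \<le> p\<^sup>2 + p"
  shows "(\<exists>t\<in>{1..p - 1}. G \<cong> integer_mod_group (p ^ t) \<times>\<times> integer_mod_group p) \<or>
    (\<exists>k\<in>{2..p + 1}. G \<cong> modular_p_group p k)"
proof -
  obtain a where a: "a \<in> carrier G" "p ^ (n - 1) \<le> ord a"
    using defect_odd_large[OF p n nc] le by (meson leD leI)
  obtain j where j: "j \<le> n" "ord a = p ^ j" using ord_eq_pow[OF a(1)] by blast
  have "j \<noteq> n"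
  proof
    assume "j = n"
    then have "card (cyc G a) = card (carrier G)" using card_cyc[OF a(1)] j order_eq by (simp add: order_def)
    then show False using nc[OF a(1)] card_subset_eq[OF fin subgroup.subset[OF subgroup_cyc[OF a(1)]]] by blast
  qed
  moreover have "n - 1 \<le> j" using a(2) j p_gt(2) by (metis power_le_imp_le_exp)
  ultimately have nk: "n = Suc j" using j(1) n by linarith
  obtain x where x: "x \<in> carrier G" "x \<notin> cyc G a"
    using nc[OF a(1)] subgroup.subset[OF subgroup_cyc[OF a(1)]] by blast
  have k: "j \<ge> 1"
  proof (rule ccontr)
    assume "\<not> j \<ge> 1"
    then have "order G = p" using nk order_eq by simp
    moreover have "x \<noteq> \<one>" using x(2) pow_in_cyc[of G a 0] by auto
    moreover have "x [^] p = \<one>" using pow_order_eq_1[OF x(1)] \<open>order G = p\<close> by simp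
    ultimately have "card (cyc G x) = card (carrier G)"
      using ord_prime[OF x(1)] card_cyc[OF x(1)] by (simp add: order_def)
    then show False using nc[OF x(1)] card_subset_eq[OF fin subgroup.subset[OF subgroup_cyc[OF x(1)]]] by blast
  qed
  have o: "order G = p * card (cyc G a)" using order_eq nk j card_cyc[OF a(1)] by simp
  have "inv x \<otimes> a \<otimes> x \<in> cyc G a"
    by (rule index_p_normal[OF subgroup_cyc[OF a(1)] o x(1) self_in_cyc[OF a(1)]])
  then obtain r :: nat where "inv x \<otimes> a \<otimes> x = a [^] r" by (auto simp: cyc_def)
  then have "a \<otimes> x = x \<otimes> a [^] r" using conj_eq_iff(1)[OF x(1) a(1), of "a [^] r"] a(1) by simp
  from almost_cyclic_classification[OF a(1) j(2) k nk nc x this] p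
  consider "G \<cong> integer_mod_group (p ^ j) \<times>\<times> integer_mod_group p" "cd_defect G = j * (p + 1) + 1"
    | "j \<ge> 2" "G \<cong> modular_p_group p j" "cd_defect G = (j - 1) * (p + 1)" by blast
  then show ?thesis
  proof cases
    case 1
    \<comment> \<open>The summand 1 in the defect makes the inequality strict. Hence t stops at p -
      1, whereas in the other case j - 1 may reach p.\<close>
    have "j * (p + 1) < p * (p + 1)" using 1(2) le by (simp add: power2_eq_square)
    then have "j < p" by (metis mult_less_cancel2)
    then show ?thesis using 1(1) k by (intro disjI1 bexI[of _ j]) auto
  next
    case 2
    have "(j - 1) * (p + 1) \<le> p * (p + 1)" using 2(3) le by (simp add: power2_eq_square)
    then have "j - 1 \<le> p" by (metis mult_le_cancel2 zero_less_Suc Suc_eq_plus1)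
    then show ?thesis using 2(1,2) by (intro disjI2 bexI[of _ j]) auto
  qed
qed

end

section \<open>Groups of order a power of two\<close>

locale two_group = p_group G 2 n for G (structure) and n :: nat
begin

lemma center_comm: "\<lbrakk>c \<in> center; g \<in> carrier G\<rbrakk> \<Longrightarrow> c \<otimes> g = g \<otimes> c"
  unfolding center_iff by blast

lemma center_closed: "c \<in> center \<Longrightarrow> c \<in> carrier G"
  unfolding center_iff by blast

lemma carrier_nontrivial: "n \<ge> 1 \<Longrightarrow> {\<one>} \<noteq> carrier G"
  using center_nontrivial center_closed subgroup.one_closed[OF subgroup_center] by blast

abbreviation involutions :: "'a set" where
  "involutions \<equiv> {x \<in> carrier G. x \<noteq> \<one> \<and> x \<otimes> x = \<one>}"

lemma pow2: "x \<in> carrier G \<Longrightarrow> x [^] (2::nat) = x \<otimes> x"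
  by (simp add: numeral_2_eq_2)

lemma involution_ord: "x \<in> involutions \<Longrightarrow> ord x = 2"
  using ord_prime[of x] pow2 by simp

lemma cyc_involution:
  assumes x: "x \<in> involutions"
  shows "cyc G x = {\<one>, x}"
proof (rule HOL.sym, rule card_subset_eq[OF finite_subgroup[OF subgroup_cyc]])
  show "x \<in> carrier G" using x by simp
  show "{\<one>, x} \<subseteq> cyc G x" using x self_in_cyc pow_in_cyc[of G x 0] by auto
  show "card {\<one>, x} = card (cyc G x)" using x card_cyc[of x] involution_ord[OF x] by auto
qed

lemma inj_cyc_involutions: "inj_on (cyc G) involutions"
  by (rule inj_onI) (auto simp: cyc_involution doubleton_eq_iff)

text \<open>Membership in a subgroup of index 2 is a homomorphism to the group of order 2.\<close>

lemma index2_mult_iff: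
  assumes M: "subgroup M G" "order G = 2 * card M" and xy: "x \<in> carrier G" "y \<in> carrier G"
  shows "x \<otimes> y \<in> M \<longleftrightarrow> (x \<in> M \<longleftrightarrow> y \<in> M)"
proof (cases "x \<in> M \<or> y \<in> M")
  case True
  then show ?thesis using subgroup_cancel[OF M(1)] xy by blast
next
  case False
  have "x [^] (2::nat) \<in> M" by (rule index_p_pow[OF M xy(1)])
  then have "x \<otimes> x \<in> M" using pow2 xy by simp
  then have "\<exists>z\<in>carrier G. z \<notin> M \<and> x \<otimes> z \<in> M" using False xy by blast
  have card: "card (carrier G - M) = card M"
    using M(2) card_Diff_subset[OF finite_subgroup[OF M(1)] subgroup.subset[OF M(1)]] by (simp add: order_def)
  have "(\<lambda>m. inv x \<otimes> m) ` M \<subseteq> carrier G - M"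
  proof clarify
    fix m assume m: "m \<in> M"
    have mc: "m \<in> carrier G" using subgroup.mem_carrier[OF M(1) m] .
    have "inv x \<notin> M"
    proof
      assume "inv x \<in> M"
      then have "inv (inv x) \<in> M" by (rule subgroup.m_inv_closed[OF M(1)])
      then show False using False xy by simp
    qed
    then show "inv x \<otimes> m \<in> carrier G - M"
      using subgroup_cancel(2)[OF M(1) m, of "inv x"] mc xy by simp
  qed
  moreover have "card ((\<lambda>m. inv x \<otimes> m) ` M) = card M"
    using xy subgroup.mem_carrier[OF M(1)] by (intro card_image inj_onI) simp
  ultimately have "(\<lambda>m. inv x \<otimes> m) ` M = carrier G - M" using card by (intro card_subset_eq) auto
  then obtain m where "m \<in> M" "y = inv x \<otimes> m" using False xy by blast
  then have "x \<otimes> y \<in> M" using xy subgroup.mem_carrier[OF M(1)] by simp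
  then show ?thesis using False by simp
qed

text \<open>\<open>L\<close> is the kernel of the product of the two homomorphisms to the group of
  order 2 with kernels \<open>M\<close> and \<open>N\<close>.\<close>

lemma index2_third:
  assumes M: "subgroup M G" "order G = 2 * card M" and N: "subgroup N G" "order G = 2 * card N" and ne: "M \<noteq> N"
  defines "L \<equiv> {x \<in> carrier G. x \<in> M \<longleftrightarrow> x \<in> N}"
  shows "subgroup L G" "order G = 2 * card L" "L \<noteq> M" "L \<noteq> N" "M \<inter> N \<subseteq> L"
proof -
  have card_eq: "card M = card N" using M N by simp
  have "\<not> M \<subseteq> N" "\<not> N \<subseteq> M"
    using ne card_eq card_subset_eq[OF finite_subgroup[OF N(1)]] card_subset_eq[OF finite_subgroup[OF M(1)]] by metis+
  then obtain w v where w: "w \<in> M" "w \<notin> N" and v: "v \<in> N" "v \<notin> M" by blast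
  have wc: "w \<in> carrier G" using subgroup.mem_carrier[OF M(1) w(1)] .
  have one: "\<one> \<in> M" "\<one> \<in> N" using M N subgroup.one_closed by auto
  show L: "subgroup L G"
    by (rule subgroup_finiteI) (auto simp: L_def one index2_mult_iff[OF M] index2_mult_iff[OF N])
  have "carrier G - L = (\<lambda>x. w \<otimes> x) ` L"
  proof (intro equalityI subsetI)
    fix x assume x: "x \<in> carrier G - L"
    have "inv w \<otimes> x \<in> L"
    proof -
      have "inv w \<in> M" using subgroup.m_inv_closed[OF M(1) w(1)] .
      moreover have "inv w \<notin> N"
      proof
        assume "inv w \<in> N"
        then have "inv (inv w) \<in> N" by (rule subgroup.m_inv_closed[OF N(1)])
        then show False using w wc by simp
      qed
      ultimately show ?thesis using x wc by (auto simp: L_def index2_mult_iff[OF M] index2_mult_iff[OF N])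
    qed
    moreover have "x = w \<otimes> (inv w \<otimes> x)" using x wc by simp
    ultimately show "x \<in> (\<lambda>x. w \<otimes> x) ` L" by blast
  next
    fix x assume "x \<in> (\<lambda>x. w \<otimes> x) ` L"
    then show "x \<in> carrier G - L" using w wc by (auto simp: L_def index2_mult_iff[OF M] index2_mult_iff[OF N])
  qed
  moreover have "card ((\<lambda>x. w \<otimes> x) ` L) = card L"
    using wc by (intro card_image inj_onI) (auto simp: L_def)
  ultimately have "card (carrier G) - card L = card L"
    using card_Diff_subset[OF finite_subgroup[OF L] subgroup.subset[OF L]] by metis
  then show "order G = 2 * card L"
    using card_mono[OF fin subgroup.subset[OF L]] by (simp add: order_def)
  show "L \<noteq> M" using w wc by (auto simp: L_def)
  show "L \<noteq> N" using v subgroup.mem_carrier[OF N(1)] by (auto simp: L_def)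
  show "M \<inter> N \<subseteq> L" using subgroup.subset[OF M(1)] by (auto simp: L_def)
qed

text \<open>\<open>cover\<close> says that \<open>H\<close> and a single element never generate G,
  so a second maximal subgroup over \<open>H\<close> exists; \<open>index2_third\<close> provides
  the third one.\<close>

lemma three_index2_subgroups:
  assumes H: "subgroup H G" "H \<noteq> carrier G"
    and cover: "\<And>g. g \<in> carrier G \<Longrightarrow> \<exists>K. subgroup K G \<and> K \<noteq> carrier G \<and> H \<subseteq> K \<and> g \<in> K"
  shows "\<exists>M1 M2 M3. M1 \<noteq> M2 \<and> M1 \<noteq> M3 \<and> M2 \<noteq> M3 \<and>
    (\<forall>M\<in>{M1, M2, M3}. subgroup M G \<and> order G = 2 * card M \<and> H \<subseteq> M)"
proof -
  obtain M where M: "subgroup M G" "H \<subseteq> M" "order G = 2 * card M" using ex_maximal_supergroup[OF H] by blast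
  have "M \<noteq> carrier G" using M(3) order_pos by (auto simp: order_def)
  then obtain g where g: "g \<in> carrier G" "g \<notin> M" using subgroup.subset[OF M(1)] by blast
  obtain K where K: "subgroup K G" "K \<noteq> carrier G" "H \<subseteq> K" "g \<in> K" using cover[OF g(1)] by blast
  obtain N where N: "subgroup N G" "K \<subseteq> N" "order G = 2 * card N" using ex_maximal_supergroup[OF K(1,2)] by blast
  have ne: "M \<noteq> N" using g K N by blast
  note L = index2_third[OF M(1,3) N(1,3) ne]
  have "H \<subseteq> M \<inter> N" using M K N by blast
  then have "\<forall>K\<in>{M, N, {x \<in> carrier G. x \<in> M \<longleftrightarrow> x \<in> N}}. subgroup K G \<and> order G = 2 * card K \<and> H \<subseteq> K"
    using M N L(1,2,5) by auto
  moreover have "M \<noteq> {x \<in> carrier G. x \<in> M \<longleftrightarrow> x \<in> N}" "N \<noteq> {x \<in> carrier G. x \<in> M \<longleftrightarrow> x \<in> N}"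
    using L(3,4) by metis+
  ultimately show ?thesis using ne by (intro exI conjI)
qed

lemma three_index2_subgroups_noncyclic:
  assumes n: "n \<ge> 1" and nc: "\<And>g. g \<in> carrier G \<Longrightarrow> cyc G g \<noteq> carrier G"
  shows "3 \<le> card (subs_card (2 ^ (n - 1)))"
proof -
  have "\<exists>K. subgroup K G \<and> K \<noteq> carrier G \<and> {\<one>} \<subseteq> K \<and> g \<in> K" if "g \<in> carrier G" for g
    using nc[OF that] subgroup_cyc[OF that] self_in_cyc[OF that] subgroup.one_closed[OF subgroup_cyc[OF that]] by blast
  then have "\<exists>M1 M2 M3. M1 \<noteq> M2 \<and> M1 \<noteq> M3 \<and> M2 \<noteq> M3 \<and>
    (\<forall>M\<in>{M1, M2, M3}. subgroup M G \<and> order G = 2 * card M \<and> {\<one>} \<subseteq> M)"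
    by (rule three_index2_subgroups[OF triv_subgroup carrier_nontrivial[OF n]])
  then obtain M1 M2 M3 where M: "M1 \<noteq> M2" "M1 \<noteq> M3" "M2 \<noteq> M3"
    "\<forall>M\<in>{M1, M2, M3}. subgroup M G \<and> order G = 2 * card M \<and> {\<one>} \<subseteq> M" by (elim exE conjE)
  have "2 ^ n = 2 * (2::nat) ^ (n - 1)" using n by (simp flip: power_Suc)
  then have "{M1, M2, M3} \<subseteq> subs_card (2 ^ (n - 1))" using M(4) order_eq by auto
  then have "card {M1, M2, M3} \<le> card (subs_card (2 ^ (n - 1)))" by (rule card_mono[OF finite_subs])
  then show ?thesis using M by simp
qed

lemma unique_involution_cases:
  assumes n: "n \<ge> 1"
  obtains (unique) "\<And>x y. \<lbrakk>x \<in> carrier G; y \<in> carrier G; x \<noteq> \<one>; x [^] (2::nat) = \<one>; y [^] (2::nat) = \<one>\<rbrakk> \<Longrightarrow> y \<in> cyc G x"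
  | (many) z t where "z \<in> center" "z \<in> involutions" "t \<in> involutions" "t \<noteq> z"
proof -
  obtain z where z: "z \<in> center" "z \<noteq> \<one>" "z [^] (2::nat) = \<one>" by (rule ex_central_prime[OF n])
  then have zI: "z \<in> involutions" using pow2[of z] center_closed[OF z(1)] by simp
  show ?thesis
  proof (cases "\<exists>t\<in>involutions. t \<noteq> z")
    case True
    then show ?thesis using many z zI by blast
  next
    case False
    have "y \<in> cyc G x" if xy: "x \<in> carrier G" "y \<in> carrier G" "x \<noteq> \<one>" "x [^] (2::nat) = \<one>" "y [^] (2::nat) = \<one>" for x y
    proof -
      have "x \<in> involutions" "y = \<one> \<or> y \<in> involutions" using xy pow2 by auto
      then have "x = z" "y = \<one> \<or> y = z" using False by auto
      then show ?thesis using cyc_involution[OF zI] by auto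
    qed
    then show ?thesis using unique by blast
  qed
qed

lemma klein:
  assumes zt: "z \<in> involutions" "t \<in> involutions" "t \<noteq> z" "z \<otimes> t = t \<otimes> z"
  shows "t \<otimes> z \<in> involutions" "t \<otimes> z \<noteq> t" "t \<otimes> z \<noteq> z"
    "subgroup {\<one>, z, t, t \<otimes> z} G" "card {\<one>, z, t, t \<otimes> z} = 4"
proof -
  have c: "z \<in> carrier G" "t \<in> carrier G" "z \<otimes> z = \<one>" "t \<otimes> t = \<one>" "z \<noteq> \<one>" "t \<noteq> \<one>" using zt by auto
  have tz1: "t \<otimes> z \<noteq> \<one>"
  proof
    assume "t \<otimes> z = \<one>"
    then have "t \<otimes> z = z \<otimes> z" using c by simp
    then show False using zt(3) right_cancel[OF c(1,2,1)] by blast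
  qed
  have a1: "z \<otimes> (t \<otimes> w) = t \<otimes> (z \<otimes> w)" "z \<otimes> (z \<otimes> w) = w" "t \<otimes> (t \<otimes> w) = w" if "w \<in> carrier G" for w
    using zt(4) c that by (simp_all flip: m_assoc)
  show "t \<otimes> z \<in> involutions" using c tz1 a1 by (simp add: m_assoc)
  show "t \<otimes> z \<noteq> t" "t \<otimes> z \<noteq> z" using c by auto
  then show "card {\<one>, z, t, t \<otimes> z} = 4" using c tz1 zt(3) by auto
  show "subgroup {\<one>, z, t, t \<otimes> z} G"
    by (rule subgroup_finiteI) (use c a1 zt(4) in \<open>auto simp: m_assoc\<close>)
qed

lemma three_subs_order_2:
  assumes zt: "z \<in> center" "z \<in> involutions" "t \<in> involutions" "t \<noteq> z"
  shows "3 \<le> card (subs_card 2)"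
proof -
  have "z \<otimes> t = t \<otimes> z" using center_comm[OF zt(1), of t] zt(3) by blast
  note K = klein[OF zt(2,3,4) this]
  have "card {z, t, t \<otimes> z} = 3" using K zt(4) by auto
  moreover have sub: "{z, t, t \<otimes> z} \<subseteq> involutions"
    by (intro insert_subsetI empty_subsetI zt(2,3) K(1))
  then have "card (cyc G ` {z, t, t \<otimes> z}) = card {z, t, t \<otimes> z}"
    by (intro card_image inj_on_subset[OF inj_cyc_involutions])
  ultimately have "card (cyc G ` {z, t, t \<otimes> z}) = 3" by simp
  moreover have "cyc G x \<in> subs_card 2" if "x \<in> involutions" for x
    using that subgroup_cyc card_cyc involution_ord[OF that] by simp
  then have "cyc G ` {z, t, t \<otimes> z} \<subseteq> subs_card 2" using sub by blast
  then have "card (cyc G ` {z, t, t \<otimes> z}) \<le> card (subs_card 2)" by (rule card_mono[OF finite_subs])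
  ultimately show ?thesis by linarith
qed

text \<open>The four-group of z and t lies in a subgroup of order 8, which is not cyclic because it
  contains two involutions. Its subgroups of index 2 are the required ones.\<close>

lemma three_subs_order_4:
  assumes zt: "z \<in> center" "z \<in> involutions" "t \<in> involutions" "t \<noteq> z" and n: "n \<ge> 3"
  shows "3 \<le> card (subs_card 4)"
proof -
  have "z \<otimes> t = t \<otimes> z" using center_comm[OF zt(1), of t] zt(3) by blast
  note K = klein[OF zt(2,3,4) this]
  let ?E = "{\<one>, z, t, t \<otimes> z}"
  have "(2::nat) ^ 3 \<le> 2 ^ n" using n by (intro power_increasing) auto
  then have "card ?E < card (carrier G)" unfolding K(5) using order_eq by (simp add: order_def)
  then have "?E \<noteq> carrier G" by (metis less_irrefl)
  then obtain x where x: "subgroup (adjoin ?E x) G" "card (adjoin ?E x) = 2 * card ?E" "?E \<subseteq> adjoin ?E x"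
    using adjoin_normalizing[OF K(4)] by metis
  let ?L = "adjoin ?E x"
  have cL: "card ?L = 2 ^ 3" using x(2) K(5) by simp
  interpret L: p_group "G\<lparr>carrier := ?L\<rparr>" 2 3 by (rule p_group_restrict[OF x(1) cL])
  interpret L: two_group "G\<lparr>carrier := ?L\<rparr>" 3 by unfold_locales
  have nc: "cyc (G\<lparr>carrier := ?L\<rparr>) g \<noteq> carrier (G\<lparr>carrier := ?L\<rparr>)" if g: "g \<in> carrier (G\<lparr>carrier := ?L\<rparr>)" for g
  proof
    assume "cyc (G\<lparr>carrier := ?L\<rparr>) g = carrier (G\<lparr>carrier := ?L\<rparr>)"
    then have cg: "cyc G g = ?L" by simp
    have gc: "g \<in> carrier G" using g subgroup.mem_carrier[OF x(1)] by simp
    have og: "ord g = 8" using card_cyc[OF gc] cg cL by simp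
    have "w = g [^] (4::nat)" if w: "w \<in> involutions" "w \<in> ?L" for w
    proof -
      obtain i :: nat where i: "w = g [^] i" using w(2) cg by (auto simp: cyc_def)
      have "g [^] (i + i) = \<one>" using w(1) i gc by (simp flip: nat_pow_mult)
      then have "8 dvd i + i" using pow_eq_id[OF gc] og by simp
      moreover have "\<not> 8 dvd i" using w(1) i pow_eq_id[OF gc, of i] og by auto
      ultimately have "[i = 4] (mod 8)" unfolding cong_def by presburger
      then show ?thesis using i pow_eq_pow_iff[OF gc] og by simp
    qed
    then have "z = t" using zt x(3) by blast
    then show False using zt(4) by simp
  qed
  have "3 \<le> card (L.subs_card (2 ^ (3 - 1)))" by (rule L.three_index2_subgroups_noncyclic[OF _ nc]) simp
  also have "L.subs_card (2 ^ (3 - 1)) \<subseteq> subs_card 4" using incl_subgroup[OF x(1)] by auto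
  then have "card (L.subs_card (2 ^ (3 - 1))) \<le> card (subs_card 4)" by (rule card_mono[OF finite_subs])
  finally show ?thesis .
qed

lemma card_Un3:
  assumes "finite A" "finite B" "finite C" "A \<inter> B = {}" "A \<inter> C = {}" "B \<inter> C = {}"
  shows "card (A \<union> B \<union> C) = card A + card B + card C"
proof -
  have "(A \<union> B) \<inter> C = {}" using assms by blast
  then show ?thesis using assms by (simp add: card_Un_disjoint)
qed

text \<open>Only G is in the lattice, so one trivial subgroup, three subgroups of order 2 and three
  of index 2 are outside. With a single involution, an element inverting a and commuting with it
  would force a^2 = 1.\<close>

lemma defect_abelian_large:
  assumes n: "n \<ge> 3" and nc: "\<And>g. g \<in> carrier G \<Longrightarrow> cyc G g \<noteq> carrier G"
    and ab: "\<And>x y. \<lbrakk>x \<in> carrier G; y \<in> carrier G\<rbrakk> \<Longrightarrow> x \<otimes> y = y \<otimes> x"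
  shows "7 \<le> cd_defect G"
proof -
  have n1: "n \<ge> 1" using n by simp
  have s2: "3 \<le> card (subs_card 2)"
  proof (rule unique_involution_cases[OF n1])
    assume uniq: "\<And>x y. \<lbrakk>x \<in> carrier G; y \<in> carrier G; x \<noteq> \<one>; x [^] (2::nat) = \<one>; y [^] (2::nat) = \<one>\<rbrakk> \<Longrightarrow> y \<in> cyc G x"
    from unique_order_p[OF n1 uniq] nc obtain a k where a: "a \<in> carrier G" "k \<ge> 2" "ord a = 2 ^ k"
      "\<forall>x\<in>carrier G - cyc G a. a \<otimes> x = x \<otimes> inv a" by blast
    obtain x where x: "x \<in> carrier G" "x \<notin> cyc G a" using nc[OF a(1)] subgroup.subset[OF subgroup_cyc[OF a(1)]] by blast
    have "x \<otimes> a = x \<otimes> inv a" using a(4) x ab[OF a(1) x(1)] by simp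
    then have "a = inv a" using a(1) x(1) by simp
    then have "a \<otimes> a = \<one>" using a(1) r_inv by metis
    then have "ord a dvd 2" using pow_eq_id[OF a(1), of 2] pow2[OF a(1)] by simp
    then have "(2::nat) ^ k \<le> 2 ^ 1" using a(3) by (simp add: dvd_imp_le)
    then have "k \<le> 1" by (metis one_less_numeral_iff power_le_imp_le_exp semiring_norm(76))
    then show ?thesis using a(2) by simp
  qed (rule three_subs_order_2)
  have s3: "3 \<le> card (subs_card (2 ^ (n - 1)))" by (rule three_index2_subgroups_noncyclic[OF n1 nc])
  have p1: "2 < (2::nat) ^ (n - 1)" using n power_strict_increasing[of 1 "n - 1" "2::nat"] by simp
  have p2: "(2::nat) ^ (n - 1) < 2 ^ n" using n by (intro power_strict_increasing) auto
  let ?S = "{{\<one>}} \<union> subs_card 2 \<union> subs_card (2 ^ (n - 1))"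
  have "card ?S = 1 + card (subs_card 2) + card (subs_card (2 ^ (n - 1)))"
    using p1 finite_subs by (subst card_Un3) auto
  moreover have "card ?S \<le> cd_defect G"
  proof (rule card_le_cd_defect)
    fix H assume H: "H \<in> ?S"
    then show "subgroup H G" using triv_subgroup by auto
    have "card H = 1 \<or> card H = 2 \<or> card H = 2 ^ (n - 1)" using H by auto
    then have "card H < order G" unfolding order_eq using p1 p2 by linarith
    then show "H \<notin> cd_lattice G" using cd_lattice_abelian[OF ab] by (auto simp: order_def)
  qed
  ultimately show ?thesis using s2 s3 by linarith
qed

text \<open>Used to bound the order of abelian subgroups once a member of the lattice is
  known.\<close>

lemma card_sq_commutative_le:
  assumes A: "subgroup A G" "\<And>x y. \<lbrakk>x \<in> A; y \<in> A\<rbrakk> \<Longrightarrow> x \<otimes> y = y \<otimes> x" and H: "H \<in> cd_lattice G"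
  shows "card A * card A \<le> cd_measure G H"
proof -
  have "card A \<le> card (centralizer G A)"
    using commutative_imp_subset_centralizer[OF subgroup.subset[OF A(1)] A(2)] by (intro card_mono finite_centralizer)
  then have "card A * card A \<le> cd_measure G A" by (simp add: cd_measure_def)
  also have "\<dots> \<le> cd_measure G H" using H A(1) by (simp add: mem_cd_lattice_iff)
  finally show ?thesis .
qed

text \<open>\<open>unique_order_p\<close> leaves generalized quaternion groups of order 2^(k+1). For
  k >= 3 the subgroup <a> has measure at least 4^k. This keeps the trivial subgroup, the center, G
  and four subgroups <b a^i> of order 4 out of the lattice, seven in all.\<close>

lemma unique_involution_classification:
  assumes n: "n \<ge> 1" and nc: "\<And>g. g \<in> carrier G \<Longrightarrow> cyc G g \<noteq> carrier G"
    and uniq: "\<And>x y. \<lbrakk>x \<in> carrier G; y \<in> carrier G; x \<noteq> \<one>; x [^] (2::nat) = \<one>; y [^] (2::nat) = \<one>\<rbrakk> \<Longrightarrow> y \<in> cyc G x"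
    and le: "cd_defect G \<le> 6"
  shows "G \<cong> quaternion_group"
proof -
  from unique_order_p[OF n uniq] nc obtain a k where a: "a \<in> carrier G" "k \<ge> 2" "ord a = 2 ^ k" "order G = 2 * 2 ^ k"
    "\<forall>x\<in>carrier G - cyc G a. a \<otimes> x = x \<otimes> inv a \<and> x [^] (2::nat) = a [^] ((2::nat) ^ (k - 1))" by blast
  let ?A = "cyc G a"
  have A: "subgroup ?A G" "card ?A = 2 ^ k" using subgroup_cyc[OF a(1)] card_cyc[OF a(1)] a(3) by auto
  obtain b where b: "b \<in> carrier G" "b \<notin> ?A" using nc[OF a(1)] subgroup.subset[OF A(1)] by blast
  define z where "z = a [^] ((2::nat) ^ (k - 1))"
  have z: "z \<in> carrier G" "z \<in> ?A" using a(1) by (simp_all add: z_def)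
  have zz: "z \<otimes> z = \<one>"
  proof -
    have "(2::nat) ^ (k - 1) + 2 ^ (k - 1) = 2 ^ k" using a(2) by (simp flip: mult_2 power_Suc)
    then show ?thesis unfolding z_def using a(1,3) pow_eq_id[OF a(1), of "2 ^ k"] by (simp add: nat_pow_mult)
  qed
  have x2: "x \<otimes> x = z" if "x \<in> carrier G" "x \<notin> ?A" for x using a(5) that pow2 by (simp add: z_def)
  have tw: "a \<otimes> x = x \<otimes> inv a" if "x \<in> carrier G" "x \<notin> ?A" for x using a(5) that by blast
  have gen: "\<exists>(j::nat) (i::nat). x = b [^] j \<otimes> a [^] i" if x: "x \<in> carrier G" for x
  proof (cases "x \<in> ?A")
    case True
    then obtain i :: nat where "x = a [^] i" by (auto simp: cyc_def)
    then show ?thesis using a(1) by (intro exI[of _ 0] exI[of _ i]) simp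
  next
    case False
    have o: "order G = 2 * card ?A" using a(4) A(2) by simp
    have "inv b \<notin> ?A"
    proof
      assume "inv b \<in> ?A"
      then have "inv (inv b) \<in> ?A" by (rule subgroup.m_inv_closed[OF A(1)])
      then show False using b by simp
    qed
    then have "inv b \<otimes> x \<in> ?A" using index2_mult_iff[OF A(1) o, of "inv b" x] False b x by simp
    then obtain i :: nat where "inv b \<otimes> x = a [^] i" by (auto simp: cyc_def)
    then have "b \<otimes> a [^] i = b \<otimes> (inv b \<otimes> x)" by simp
    then have "x = b [^] (1::nat) \<otimes> a [^] i" using b x by simp
    then show ?thesis by blast
  qed
  show ?thesis
  proof (cases "k = 2")
    case True
    show ?thesis
    proof (rule iso_quaternion[OF a(1) _ b(1) _ tw[OF b] _ gen])
      show "a [^] (2::nat) \<otimes> a [^] (2::nat) = \<one>" using zz True by (simp add: z_def)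
      show "b [^] (2::nat) = a [^] (2::nat)" using x2[OF b] True pow2[OF b(1)] by (simp add: z_def)
      show "order G = 8" using a(4) True by simp
    qed
  next
    case False
    then have k3: "k \<ge> 3" using a(2) by simp
    have k4: "(4::nat) \<le> 2 ^ (k - 1)" using k3 power_increasing[of 2 "k - 1" "2::nat"] by simp
    \<comment> \<open>Elements outside <a> invert c, so commuting with one means that c equals its
      inverse.\<close>
    have comm_sq: "c \<otimes> c = \<one>" if c: "c \<in> ?A" and x: "x \<in> carrier G" "x \<notin> ?A" "c \<otimes> x = x \<otimes> c" for c x
    proof -
      obtain i :: nat where i: "c = a [^] i" using c by (auto simp: cyc_def)
      have "a \<otimes> x = x \<otimes> a [^] (2 ^ k - 1::nat)"
      proof -
        have "inv a = a [^] (2 ^ k - 1::nat)" using inv_eq_pow[OF a(1)] a(3) by simp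
        then show ?thesis using tw[OF x(1,2)] by simp
      qed
      then have "c \<otimes> x = x \<otimes> a [^] ((2 ^ k - 1) * i)" unfolding i by (rule twisted_commute[OF a(1) x(1)])
      then have "x \<otimes> a [^] i = x \<otimes> a [^] ((2 ^ k - 1) * i)" using x(3) i by simp
      then have "a [^] i = a [^] ((2 ^ k - 1) * i)" using a(1) x(1) by simp
      from arg_cong[OF this, of "\<lambda>w. w \<otimes> a [^] i"]
      have "c \<otimes> c = a [^] ((2 ^ k - 1) * i + i)" using a(1) unfolding i nat_pow_mult[OF a(1)] by simp
      also have "(2 ^ k - 1) * i + i = 2 ^ k * i" by (simp add: diff_mult_distrib)
      finally show ?thesis using pow_eq_id[OF a(1)] a(3) by simp
    qed
    have sq1: "c \<in> {\<one>, z}" if c: "c \<in> carrier G" "c \<otimes> c = \<one>" for c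
    proof -
      have "z \<noteq> \<one>"
      proof
        assume "z = \<one>"
        then have "2 ^ k dvd (2::nat) ^ (k - 1)" using pow_eq_id[OF a(1)] a(3) by (simp add: z_def)
        then have "k \<le> k - 1" by (rule power_dvd_imp_le) simp
        then show False using k3 by simp
      qed
      then have zI: "z \<in> involutions" using z zz by simp
      then have "c \<in> cyc G z" using uniq[of z c] pow2 z c zz by auto
      then show ?thesis using cyc_involution[OF zI] by simp
    qed
    have center2: "card center \<le> 2"
    proof -
      have "center \<subseteq> {\<one>, z}"
      proof
        fix c assume c: "c \<in> center"
        have cc: "c \<in> carrier G" and comm: "\<And>g. g \<in> carrier G \<Longrightarrow> c \<otimes> g = g \<otimes> c" using c by (auto simp: center_iff)
        have "c \<otimes> c = \<one>"
        proof (cases "c \<in> ?A")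
          case True
          then show ?thesis using comm_sq[OF _ b] comm[OF b(1)] by blast
        next
          case False
          have "a \<otimes> a = \<one>" using comm_sq[OF self_in_cyc[OF a(1)] cc False] comm[OF a(1)] by simp
          then have "2 ^ k dvd (2::nat)" using pow_eq_id[OF a(1), of 2] pow2[OF a(1)] a(3) by simp
          then have "(2::nat) ^ k \<le> 2 ^ 1" by (simp add: dvd_imp_le)
          then have "k \<le> 1" by (metis one_less_numeral_iff power_le_imp_le_exp semiring_norm(76))
          then show ?thesis using k3 by simp
        qed
        then show "c \<in> {\<one>, z}" using sq1 cc by blast
      qed
      then have "card center \<le> card {\<one>, z}" by (intro card_mono) auto
      also have "\<dots> \<le> 2" by (simp add: card_insert_if)
      finally show ?thesis .
    qed
    have "(2::nat) ^ (k + 3) \<le> 2 ^ (2 * k)" using k3 by (intro power_increasing) auto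
    then have big: "8 * 2 ^ k \<le> (2::nat) ^ k * 2 ^ k" by (simp add: power_add mult_2)
    have commA: "x \<otimes> y = y \<otimes> x" if "x \<in> ?A" "y \<in> ?A" for x y
      using that nat_pow_comm[OF a(1)] by (auto simp: cyc_def)
    have cd_big: "2 ^ k * 2 ^ k \<le> cd_measure G H" if "H \<in> cd_lattice G" for H
      using card_sq_commutative_le[OF A(1) commA that] A(2) by simp
    have kp: "(0::nat) < 2 ^ k" by simp
    have "cd_measure G (carrier G) < 8 * 2 ^ k"
    proof -
      have "2 * 2 ^ k * card center \<le> 2 * 2 ^ k * 2" using center2 by (intro mult_le_mono) auto
      moreover have "cd_measure G (carrier G) = 2 * 2 ^ k * card center"
        using cd_measure_carrier_center(1) a(4) by simp
      ultimately show ?thesis using kp by linarith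
    qed
    then have G_out: "carrier G \<notin> cd_lattice G" using cd_big[of "carrier G"] big by linarith
    have "center \<notin> cd_lattice G"
    proof
      assume "center \<in> cd_lattice G"
      then have "2 ^ k * 2 ^ k \<le> cd_measure G center" by (rule cd_big)
      then show False
        using \<open>cd_measure G (carrier G) < 8 * 2 ^ k\<close> big cd_measure_carrier_center by (simp add: mult.commute)
    qed
    then have two_out: "H \<notin> cd_lattice G" if "card H = 2" for H
      using order_p_in_cd[OF n _ that] by metis
    let ?x = "\<lambda>i::nat. b \<otimes> a [^] i"
    have xA: "?x i \<in> carrier G" "?x i \<notin> ?A" for i
      using b a(1) subgroup_cancel(2)[OF A(1) _ b(1), of "a [^] i"] by auto
    have x4: "?x i [^] (4::nat) = \<one>" for i
    proof -
      have "?x i [^] (4::nat) = (?x i [^] (2::nat)) [^] (2::nat)" using nat_pow_pow[OF xA(1)[of i], of 2 2] by simp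
      also have "?x i [^] (2::nat) = z" using x2[OF xA] pow2[OF xA(1)] by simp
      finally show ?thesis using zz pow2[OF z(1)] by simp
    qed
    have ox: "ord (?x i) = 4" for i
    proof -
      have d: "ord (?x i) dvd 2 ^ 2" using x4 pow_eq_id[OF xA(1)] by simp
      then obtain j where j: "j \<le> 2" "ord (?x i) = 2 ^ j" using divides_primepow_nat[OF two_is_prime_nat] by blast
      have "\<not> j \<le> 1"
      proof
        assume "j \<le> 1"
        then have "ord (?x i) dvd 2" using j(2) le_imp_power_dvd[of j 1 "2::nat"] by simp
        then have "?x i \<otimes> ?x i = \<one>" using pow_eq_id[OF xA(1)[of i], of 2] pow2[OF xA(1)[of i]] by simp
        then have "?x i \<in> {\<one>, z}" by (rule sq1[OF xA(1)])
        moreover have "{\<one>, z} \<subseteq> ?A" using z(2) subgroup.one_closed[OF A(1)] by simp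
        ultimately show False using xA(2)[of i] by blast
      qed
      then have "j = 2" using j(1) by linarith
      then show ?thesis using j(2) by simp
    qed
    have cx: "cyc G (?x i) = {\<one>, ?x i, z, ?x i \<otimes> z}" for i
    proof -
      have "y \<in> {\<one>, ?x i, z, ?x i \<otimes> z}" if y: "y \<in> cyc G (?x i)" for y
      proof -
        obtain j :: nat where "y = ?x i [^] j" using y by (auto simp: cyc_def)
        then have "y = ?x i [^] (j mod 4)" using pow_eq_pow_iff[OF xA(1)] ox by simp
        moreover have "j mod 4 \<in> {0, 1, 2, 3}" by auto
        moreover have "?x i [^] (3::nat) = ?x i \<otimes> z"
        proof -
          have "?x i [^] (3::nat) = ?x i \<otimes> (?x i \<otimes> ?x i)" using xA(1)[of i] by (simp add: numeral_3_eq_3 m_assoc)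
          then show ?thesis unfolding x2[OF xA] .
        qed
        moreover have "?x i [^] (2::nat) = z" using x2[OF xA] pow2[OF xA(1)] by simp
        ultimately show ?thesis using xA(1) by auto
      qed
      moreover have "z \<in> cyc G (?x i)" using pow_in_cyc[of G "?x i" 2] x2[OF xA] pow2[OF xA(1)] by simp
      ultimately show ?thesis
        using self_in_cyc[OF xA(1)] subgroup.one_closed[OF subgroup_cyc[OF xA(1)]]
          subgroup.m_closed[OF subgroup_cyc[OF xA(1)]] by blast
    qed
    \<comment> \<open>The only elements of b <a> in <b a^i> are b a^i and its product with z =
      a^(2^(k-1)). Exponents below 4 <= 2^(k-1) therefore give different subgroups.\<close>
    have inj: "inj_on (\<lambda>i. cyc G (?x i)) {..<4}"
    proof (rule inj_onI)
      fix i j assume ij: "i \<in> {..<4}" "j \<in> {..<4::nat}" "cyc G (?x i) = cyc G (?x j)"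
      then have "?x i \<in> {\<one>, ?x j, z, ?x j \<otimes> z}" using self_in_cyc[OF xA(1)[of i]] cx by simp
      then have "?x i = ?x j \<or> ?x i = ?x j \<otimes> z"
        using xA(2)[of i] z(2) subgroup.one_closed[OF A(1)] by auto
      then show "i = j"
      proof
        assume "?x i = ?x j"
        then have "a [^] i = a [^] j" using a(1) b(1) by simp
        then have "i mod 2 ^ k = j mod 2 ^ k" using pow_eq_pow_iff[OF a(1)] a(3) by (simp add: cong_def)
        moreover have "(4::nat) \<le> 2 ^ k" using k3 power_increasing[of 2 k "2::nat"] by simp
        ultimately show ?thesis using ij by simp
      next
        assume "?x i = ?x j \<otimes> z"
        then have "a [^] i = a [^] (j + 2 ^ (k - 1))" using a(1) b(1) by (simp add: z_def m_assoc nat_pow_mult)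
        then have "i mod 2 ^ k = (j + 2 ^ (k - 1)) mod 2 ^ k" using pow_eq_pow_iff[OF a(1)] a(3) by (simp add: cong_def)
        moreover have "(2::nat) ^ k = 2 * 2 ^ (k - 1)" using k3 by (simp flip: power_Suc)
        ultimately show ?thesis using ij k4 by simp
      qed
    qed
    have x_out: "cyc G (?x i) \<notin> cd_lattice G" for i
    proof
      assume cd: "cyc G (?x i) \<in> cd_lattice G"
      \<comment> \<open>Being its own centralizer, the subgroup has measure at most 16 < 64 <=
        4^k.\<close>
      have "centralizer G (cyc G (?x i)) \<subseteq> cyc G (?x i)"
      proof
        fix y assume y: "y \<in> centralizer G (cyc G (?x i))"
        then have yc: "y \<in> carrier G" by (simp add: centralizer_def)
        have comm: "y \<otimes> ?x i = ?x i \<otimes> y" by (rule centralizerD[OF y self_in_cyc[OF xA(1)]])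
        have key: "c \<in> cyc G (?x i)" if c: "c \<in> ?A" "c \<otimes> ?x i = ?x i \<otimes> c" for c
          using sq1[OF subgroup.mem_carrier[OF A(1) c(1)] comm_sq[OF c(1) xA c(2)]] cx by auto
        show "y \<in> cyc G (?x i)"
        proof (cases "y \<in> ?A")
          case False
          have o: "order G = 2 * card ?A" using a(4) A(2) by simp
          have "?x i \<otimes> y \<in> ?A" using index2_mult_iff[OF A(1) o xA(1) yc] False xA(2) by simp
          moreover have "(?x i \<otimes> y) \<otimes> ?x i = ?x i \<otimes> (?x i \<otimes> y)" using comm xA(1)[of i] yc by (metis m_assoc)
          ultimately have "?x i \<otimes> y \<in> cyc G (?x i)" by (rule key)
          then show ?thesis using subgroup_cancel(1)[OF subgroup_cyc[OF xA(1)] self_in_cyc[OF xA(1)] yc] by blast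
        qed (use key comm in blast)
      qed
      then have "card (centralizer G (cyc G (?x i))) \<le> 4"
        using card_mono[OF finite_subgroup[OF subgroup_cyc[OF xA(1)]]] card_cyc[OF xA(1)] ox by metis
      then have "cd_measure G (cyc G (?x i)) \<le> 4 * 4"
        unfolding cd_measure_def using card_cyc[OF xA(1)] ox by (intro mult_le_mono) simp_all
      moreover have "(8::nat) \<le> 2 ^ k" using k3 power_increasing[of 3 k "2::nat"] by simp
      then have "8 * 8 \<le> (2::nat) ^ k * 2 ^ k" by (intro mult_le_mono)
      ultimately show False using cd_big[OF cd] by linarith
    qed
    have zI: "z \<in> involutions"
    proof -
      have "z \<noteq> \<one>" using x2[OF xA(1,2)[of 0]] ox[of 0] pow_eq_id[OF xA(1)[of 0], of 2] pow2[OF xA(1)[of 0]]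
        by auto
      then show ?thesis using z zz by simp
    qed
    let ?S = "{{\<one>}, {\<one>, z}, carrier G} \<union> (\<lambda>i. cyc G (?x i)) ` {..<4}"
    have "card ?S = 7"
    proof -
      have "card ((\<lambda>i. cyc G (?x i)) ` {..<4}) = 4" using inj by (simp add: card_image)
      moreover have "card {{\<one>}, {\<one>, z}, carrier G} = 3"
      proof -
        have "{\<one>, z} \<subseteq> ?A" using z(2) subgroup.one_closed[OF A(1)] by simp
        then have "{\<one>, z} \<noteq> carrier G" using b by blast
        moreover note carrier_nontrivial[OF n]
        moreover have "{\<one>} \<noteq> {\<one>, z}" using zI by auto
        ultimately show ?thesis by simp
      qed
      moreover have "{{\<one>}, {\<one>, z}, carrier G} \<inter> (\<lambda>i. cyc G (?x i)) ` {..<4} = {}"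
      proof -
        have "cyc G (?x i) \<noteq> {\<one>}" "cyc G (?x i) \<noteq> {\<one>, z}" "cyc G (?x i) \<noteq> carrier G" for i
          using self_in_cyc[OF xA(1)[of i]] xA[of i] nc[OF xA(1)] z(2) subgroup.one_closed[OF A(1)] by auto
        then show ?thesis by auto
      qed
      ultimately show ?thesis by (subst card_Un_disjoint) auto
    qed
    moreover have "card ?S \<le> cd_defect G"
    proof (rule card_le_cd_defect)
      fix H assume H: "H \<in> ?S"
      show "subgroup H G"
        using H triv_subgroup subgroup_self subgroup_cyc[OF xA(1)] subgroup_cyc[OF z(1)] cyc_involution[OF zI] by auto
      have "card {\<one>, z} = 2" using zI by auto
      then show "H \<notin> cd_lattice G" using H trivial_notin_cd[OF n] G_out two_out x_out by auto
    qed
    ultimately show ?thesis using le by simp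
  qed
qed

end

section \<open>Involutions in 2-groups: centralizers, central quotients, and the first cases of
  small defect\<close>

context two_group begin

text \<open>A cyclic group has at most one subgroup of order 2.\<close>

lemma cyc_involution_unique:
  assumes g: "g \<in> carrier G" and w: "w \<in> involutions" "w \<in> cyc G g" and v: "v \<in> involutions" "v \<in> cyc G g"
  shows "w = v"
proof -
  have key: "\<exists>d. ord g = 2 * d \<and> cyc G w = cyc G (g [^] d)" if w: "w \<in> involutions" "w \<in> cyc G g" for w
  proof -
    have wc: "w \<in> carrier G" using w(1) by simp
    obtain d where d: "d dvd ord g" "cyc G w = cyc G (g [^] d)"
      using subgroup_of_cyc[OF g subgroup_cyc[OF wc] cyc_subset[OF subgroup_cyc[OF g] w(2)]] by blast
    then have "ord g div d = 2" using card_cyc[OF wc] involution_ord[OF w(1)] card_cyc_pow[OF g d(1)] by simp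
    then have "ord g = 2 * d" using dvd_div_mult_self[OF d(1)] by simp
    then show ?thesis using d(2) by blast
  qed
  obtain d e where "ord g = 2 * d" "cyc G w = cyc G (g [^] d)" "ord g = 2 * e" "cyc G v = cyc G (g [^] e)"
    using key[OF w] key[OF v] by blast
  then have "cyc G w = cyc G v" by simp
  then show ?thesis using inj_onD[OF inj_cyc_involutions _ w(1) v(1)] by blast
qed

lemma card_conj_class:
  assumes t: "t \<in> carrier G"
  shows "card ((\<lambda>g. g \<otimes> t \<otimes> inv g) ` carrier G) * card (centralizer G {t}) = order G"
proof -
  let ?c = "\<lambda>g. g \<otimes> t \<otimes> inv g" and ?C = "centralizer G {t}"
  have fiber: "card {g \<in> carrier G. ?c g = v} = card ?C" if v: "v \<in> ?c ` carrier G" for v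
  proof -
    obtain h where h: "h \<in> carrier G" "v = ?c h" using v by blast
    have "{g \<in> carrier G. ?c g = v} = (\<lambda>x. h \<otimes> x) ` ?C"
    proof (intro equalityI subsetI)
      fix g assume "g \<in> {g \<in> carrier G. ?c g = v}"
      then have g: "g \<in> carrier G" "g \<otimes> t \<otimes> inv g = h \<otimes> t \<otimes> inv h" using h by auto
      have "(inv h \<otimes> g) \<otimes> t = inv h \<otimes> (g \<otimes> t \<otimes> inv g) \<otimes> g" using g(1) h(1) t by (simp add: m_assoc)
      also have "\<dots> = t \<otimes> (inv h \<otimes> g)" unfolding g(2) using g(1) h(1) t by (simp add: m_assoc)
      finally have "inv h \<otimes> g \<in> ?C" using g h by (simp add: centralizer_def)
      moreover have "g = h \<otimes> (inv h \<otimes> g)" using g h by simp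
      ultimately show "g \<in> (\<lambda>x. h \<otimes> x) ` ?C" by blast
    next
      fix g assume "g \<in> (\<lambda>x. h \<otimes> x) ` ?C"
      then obtain x where x: "x \<in> carrier G" "x \<otimes> t = t \<otimes> x" "g = h \<otimes> x" by (auto simp: centralizer_def)
      have "?c g = h \<otimes> (x \<otimes> t) \<otimes> inv x \<otimes> inv h" using x(1,3) h t by (simp add: group_normalize)
      also have "\<dots> = v" unfolding x(2) using x(1) h t by (simp add: m_assoc)
      finally show "g \<in> {g \<in> carrier G. ?c g = v}" using x h by simp
    qed
    moreover have "card ((\<lambda>x. h \<otimes> x) ` ?C) = card ?C"
      using h(1) by (intro card_image inj_onI) (simp add: centralizer_def)
    ultimately show ?thesis by simp
  qed
  have "order G = card (\<Union>v\<in>?c ` carrier G. {g \<in> carrier G. ?c g = v})"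
    unfolding order_def by (rule arg_cong[where f = card]) blast
  also have "\<dots> = (\<Sum>v\<in>?c ` carrier G. card {g \<in> carrier G. ?c g = v})"
    by (rule card_UN_disjoint) auto
  also have "\<dots> = (\<Sum>v\<in>?c ` carrier G. card ?C)" by (rule sum.cong[OF HOL.refl fiber])
  finally show ?thesis by simp
qed

lemma centralizer_singleton_eq_carrier:
  "t \<in> carrier G \<Longrightarrow> centralizer G {t} = carrier G \<Longrightarrow> t \<in> center"
  using centralizerD[of _ "{t}" t] by (auto simp: center_iff)

text \<open>The following is \<open>unique_order_p\<close> for the quotient by the central involution \<open>t\<close>.\<close>

lemma unique_involution_mod_central:
  assumes n: "n \<ge> 2" and t: "t \<in> center" "t \<in> involutions" and z: "z \<in> carrier G"
    and E: "\<And>y. \<lbrakk>y \<in> carrier G; y \<otimes> y \<in> {\<one>, t}\<rbrakk> \<Longrightarrow> y \<in> {\<one>, z, t, t \<otimes> z}"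
  shows "\<exists>A. subgroup A G \<and> (\<forall>x\<in>A. \<forall>y\<in>A. x \<otimes> y = y \<otimes> x) \<and> (A = carrier G \<or>
    (order G = 2 * card A \<and> (\<forall>x\<in>carrier G - A. \<forall>a\<in>A. \<exists>s\<in>{\<one>, t}. a \<otimes> x = x \<otimes> inv a \<otimes> s)))"
proof -
  let ?T = "{\<one>, t}"
  have tc: "t \<in> carrier G" using t by simp
  have Tcyc: "?T = cyc G t" using cyc_involution[OF t(2)] by simp
  have sT: "subgroup ?T G" unfolding Tcyc by (rule subgroup_cyc[OF tc])
  have Tcen: "s \<in> center" if "s \<in> ?T" for s using that t(1) subgroup.one_closed[OF subgroup_center] by auto
  have cT: "card ?T = 2 ^ 1" using t(2) by auto
  have TN: "?T \<lhd> G"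
  proof (rule normalI_conj[OF sT])
    fix g m assume g: "g \<in> carrier G" and m: "m \<in> ?T"
    have "m \<otimes> g = g \<otimes> m" by (rule center_comm[OF Tcen[OF m] g])
    then have "inv g \<otimes> m \<otimes> g = m" using conj_eq_iff(1)[OF g, of m m] center_closed[OF Tcen[OF m]] by blast
    then show "inv g \<otimes> m \<otimes> g \<in> ?T" using m by simp
  qed
  let ?Q = "G Mod ?T"
  interpret Q: p_group ?Q 2 "n - 1" by (rule p_group_FactGroup[OF TN cT])
  have mulQ: "(?T #> x) \<otimes>\<^bsub>?Q\<^esub> (?T #> y) = ?T #> (x \<otimes> y)" if "x \<in> carrier G" "y \<in> carrier G" for x y
    using normal.rcos_sum[OF TN that] by simp
  have powQ: "(?T #> x) [^]\<^bsub>?Q\<^esub> (i::nat) = ?T #> x [^] i" if "x \<in> carrier G" for x i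
    by (rule normal.FactGroup_pow[OF TN that])
  have cQ: "?T #> x \<in> carrier ?Q" if "x \<in> carrier G" for x using that by (auto simp: carrier_FactGroup)
  have coset: "?T #> x = {x, t \<otimes> x}" if "x \<in> carrier G" for x using that by (auto simp: r_coset_def)
  have eqQ: "x = y \<or> x = t \<otimes> y" if "x \<in> carrier G" "y \<in> carrier G" "?T #> x = ?T #> y" for x y
    using that coset by blast
  \<comment> \<open>By \<open>E\<close>, the coset of z is the only possible involution of the
    quotient.\<close>
  have uniq: "y \<in> cyc ?Q x" if xy: "x \<in> carrier ?Q" "y \<in> carrier ?Q" "x \<noteq> \<one>\<^bsub>?Q\<^esub>"
    "x [^]\<^bsub>?Q\<^esub> (2::nat) = \<one>\<^bsub>?Q\<^esub>" "y [^]\<^bsub>?Q\<^esub> (2::nat) = \<one>\<^bsub>?Q\<^esub>" for x y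
  proof -
    have key: "v = \<one>\<^bsub>?Q\<^esub> \<or> v = ?T #> z" if v: "v \<in> carrier ?Q" "v [^]\<^bsub>?Q\<^esub> (2::nat) = \<one>\<^bsub>?Q\<^esub>" for v
    proof -
      obtain g where g: "g \<in> carrier G" "v = ?T #> g" using v(1) by (auto simp: carrier_FactGroup)
      have "?T #> (g \<otimes> g) = ?T" using v(2) powQ[OF g(1)] pow2[OF g(1)] g(2) by simp
      then have "g \<otimes> g \<in> ?T" using coset_eq_one_iff[OF TN, of "g \<otimes> g"] g(1) by simp
      then have "g \<in> {\<one>, z, t, t \<otimes> z}" by (rule E[OF g(1)])
      moreover have "?T #> g = ?T" if "g \<in> ?T" using coset_eq_one_iff[OF TN g(1)] that by blast
      moreover have "?T #> (t \<otimes> z) = ?T #> z" using mem_coset_iff(2)[OF TN z, of "t \<otimes> z"] coset[OF z] by blast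
      ultimately show ?thesis using g(2) by auto
    qed
    have "x = ?T #> z" using key[OF xy(1,4)] xy(3) by blast
    moreover have "y = \<one>\<^bsub>?Q\<^esub> \<or> y = ?T #> z" by (rule key[OF xy(2,5)])
    ultimately show ?thesis
      using Q.self_in_cyc[OF xy(1)] subgroup.one_closed[OF Q.subgroup_cyc[OF xy(1)]] by auto
  qed
  have n1: "n - 1 \<ge> 1" using n by simp
  from Q.unique_order_p[OF n1 uniq] obtain U where U: "U \<in> carrier ?Q" "cyc ?Q U = carrier ?Q \<or>
    (2 = (2::nat) \<and> (\<exists>k\<ge>2. Q.ord U = 2 ^ k \<and> order ?Q = 2 * 2 ^ k \<and>
      (\<forall>x\<in>carrier ?Q - cyc ?Q U. U \<otimes>\<^bsub>?Q\<^esub> x = x \<otimes>\<^bsub>?Q\<^esub> inv\<^bsub>?Q\<^esub> U \<and> x [^]\<^bsub>?Q\<^esub> (2::nat) = U [^]\<^bsub>?Q\<^esub> ((2::nat) ^ (k - 1)))))"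
    by blast
  obtain a where a: "a \<in> carrier G" "U = ?T #> a" using U(1) by (auto simp: carrier_FactGroup)
  \<comment> \<open>\<open>A\<close> is the preimage of the cyclic group <U>. It is abelian because
    it consists of products of powers of a with 1 or the central t. Lifting the inversion relation
    from the quotient leaves the ambiguous factor s in {1, t}.\<close>
  define A where "A = {x \<in> carrier G. ?T #> x \<in> cyc ?Q U}"
  have sU: "subgroup (cyc ?Q U) ?Q" by (rule Q.subgroup_cyc[OF U(1)])
  have A: "subgroup A G"
  proof (rule subgroup_finiteI)
    show "A \<subseteq> carrier G" by (auto simp: A_def)
    have "?T #> \<one> = \<one>\<^bsub>?Q\<^esub>" using coset_eq_one_iff[OF TN one_closed] by simp
    then show "\<one> \<in> A" using subgroup.one_closed[OF sU] by (simp add: A_def)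
    fix x y assume "x \<in> A" "y \<in> A"
    then have xy: "x \<in> carrier G" "y \<in> carrier G" "?T #> x \<in> cyc ?Q U" "?T #> y \<in> cyc ?Q U" by (auto simp: A_def)
    have "?T #> (x \<otimes> y) \<in> cyc ?Q U"
      using subgroup.m_closed[OF sU xy(3,4)] mulQ[OF xy(1,2)] by metis
    then show "x \<otimes> y \<in> A" using xy(1,2) by (simp add: A_def)
  qed
  have Ael: "\<exists>s\<in>?T. \<exists>i::nat. x = s \<otimes> a [^] i" if x: "x \<in> A" for x
  proof -
    have xc: "x \<in> carrier G" using x by (simp add: A_def)
    obtain i :: nat where "?T #> x = U [^]\<^bsub>?Q\<^esub> i" using x by (auto simp: A_def cyc_def)
    then have "?T #> x = ?T #> a [^] i" using powQ[OF a(1)] a(2) by simp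
    then have "x = \<one> \<otimes> a [^] i \<or> x = t \<otimes> a [^] i" using eqQ[OF xc, of "a [^] i"] a(1) by simp
    then show ?thesis by blast
  qed
  have Acomm: "x \<otimes> y = y \<otimes> x" if xy: "x \<in> A" "y \<in> A" for x y
  proof -
    obtain s s' i j where e: "s \<in> ?T" "x = s \<otimes> a [^] (i::nat)" "s' \<in> ?T" "y = s' \<otimes> a [^] (j::nat)"
      using Ael[OF xy(1)] Ael[OF xy(2)] by blast
    have sc: "s \<in> carrier G" "s' \<in> carrier G" using e(1,3) tc by auto
    have "x \<otimes> y = s \<otimes> (a [^] i \<otimes> s') \<otimes> a [^] j" unfolding e using a(1) sc by (simp add: m_assoc)
    also have "a [^] i \<otimes> s' = s' \<otimes> a [^] i" using center_comm[OF Tcen[OF e(3)], of "a [^] i"] a(1) by simp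
    also have "s \<otimes> (s' \<otimes> a [^] i) \<otimes> a [^] j = (s \<otimes> s') \<otimes> a [^] (i + j)" using a(1) sc by (simp add: m_assoc nat_pow_mult)
    also have "s \<otimes> s' = s' \<otimes> s" by (rule center_comm[OF Tcen[OF e(1)] sc(2)])
    also have "(s' \<otimes> s) \<otimes> a [^] (i + j) = s' \<otimes> (s \<otimes> a [^] j) \<otimes> a [^] i"
      using a(1) sc by (simp add: m_assoc nat_pow_mult add.commute)
    also have "s \<otimes> a [^] j = a [^] j \<otimes> s" using center_comm[OF Tcen[OF e(1)], of "a [^] j"] a(1) by simp
    also have "s' \<otimes> (a [^] j \<otimes> s) \<otimes> a [^] i = y \<otimes> x" unfolding e using a(1) sc by (simp add: m_assoc)
    finally show ?thesis .
  qed
  show ?thesis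
  proof (cases "cyc ?Q U = carrier ?Q")
    case True
    then have "A = carrier G" using cQ by (auto simp: A_def)
    then show ?thesis using A Acomm by blast
  next
    case False
    then obtain k where k: "Q.ord U = 2 ^ k" "order ?Q = 2 * 2 ^ k"
      "\<forall>x\<in>carrier ?Q - cyc ?Q U. U \<otimes>\<^bsub>?Q\<^esub> x = x \<otimes>\<^bsub>?Q\<^esub> inv\<^bsub>?Q\<^esub> U" using U(2) by blast
    have "card A = card (cyc ?Q U) * card ?T" unfolding A_def by (rule card_preimage[OF TN subgroup.subset[OF sU]])
    then have cA: "card A = 2 * 2 ^ k" using Q.card_cyc[OF U(1)] k(1) cT by simp
    have "order ?Q = 2 ^ (n - 1)" by (rule Q.order_eq)
    moreover have "(2::nat) ^ n = 2 * 2 ^ (n - 1)" using n by (simp flip: power_Suc)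
    ultimately have o: "order G = 2 * card A" using order_eq cA k(2) by simp
    have "\<exists>s\<in>?T. c \<otimes> x = x \<otimes> inv c \<otimes> s" if x: "x \<in> carrier G - A" and c: "c \<in> A" for x c
    proof -
      have xc: "x \<in> carrier G" "?T #> x \<in> carrier ?Q - cyc ?Q U" using x cQ by (auto simp: A_def)
      have cc: "c \<in> carrier G" using c by (simp add: A_def)
      let ?X = "?T #> x" and ?o = "Q.ord U - 1"
      have "U \<otimes>\<^bsub>?Q\<^esub> ?X = ?X \<otimes>\<^bsub>?Q\<^esub> U [^]\<^bsub>?Q\<^esub> ?o" using k(3) xc(2) Q.inv_eq_pow[OF U(1)] by simp
      note tw = Q.twisted_commute[OF U(1) cQ[OF xc(1)] this]
      obtain i :: nat where i: "?T #> c = U [^]\<^bsub>?Q\<^esub> i" using c by (auto simp: A_def cyc_def)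
      have "U [^]\<^bsub>?Q\<^esub> (?o * i) = inv\<^bsub>?Q\<^esub> (?T #> c)"
        unfolding i using U(1) Q.inv_eq_pow[OF U(1)] Q.nat_pow_inv[OF U(1), of i] by (simp add: Q.nat_pow_pow)
      then have "(?T #> c) \<otimes>\<^bsub>?Q\<^esub> ?X = ?X \<otimes>\<^bsub>?Q\<^esub> inv\<^bsub>?Q\<^esub> (?T #> c)" using tw[of i] i by simp
      also have "inv\<^bsub>?Q\<^esub> (?T #> c) = ?T #> inv c"
        using normal.inv_FactGroup[OF TN cQ[OF cc]] normal.rcos_inv[OF TN cc] by simp
      finally have "?T #> (c \<otimes> x) = ?T #> (x \<otimes> inv c)" using mulQ cc xc(1) by simp
      then have "c \<otimes> x = \<one> \<otimes> (x \<otimes> inv c) \<or> c \<otimes> x = t \<otimes> (x \<otimes> inv c)"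
        using eqQ[of "c \<otimes> x" "x \<otimes> inv c"] cc xc(1) by simp
      moreover have "s \<otimes> (x \<otimes> inv c) = x \<otimes> inv c \<otimes> s" if "s \<in> ?T" for s
        by (rule center_comm[OF Tcen[OF that]]) (use cc xc(1) in simp)
      ultimately show ?thesis by fastforce
    qed
    then show ?thesis using A Acomm o by blast
  qed
qed

text \<open>In a nonabelian group not all squares are trivial, so some a has order 4. At most one of
  z and t lies in <a>; the other one serves as b.\<close>

lemma order_8_classification:
  assumes n: "n = 3" and nc: "\<And>g. g \<in> carrier G \<Longrightarrow> cyc G g \<noteq> carrier G"
    and nab: "x \<in> carrier G" "y \<in> carrier G" "x \<otimes> y \<noteq> y \<otimes> x"
    and zt: "z \<in> center" "z \<in> involutions" "t \<in> involutions" "t \<noteq> z"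
  shows "G \<cong> modular_p_group 2 2"
proof -
  have "\<exists>a\<in>carrier G. a \<otimes> a \<noteq> \<one>"
  proof (rule ccontr)
    assume "\<not> ?thesis"
    then have sq: "g \<otimes> g = \<one>" if "g \<in> carrier G" for g using that by blast
    have "inv g = g" if "g \<in> carrier G" for g using inv_equality[OF sq[OF that] that that] .
    then have "x \<otimes> y = y \<otimes> x" using inv_mult_group[OF nab(1,2)] nab(1,2) by (metis m_closed)
    then show False using nab(3) by simp
  qed
  then obtain a where a: "a \<in> carrier G" "a \<otimes> a \<noteq> \<one>" by blast
  obtain j where j: "j \<le> n" "ord a = 2 ^ j" using ord_eq_pow[OF a(1)] by blast
  have "j \<noteq> 3"
  proof
    assume "j = 3"
    then have "card (cyc G a) = card (carrier G)" using j card_cyc[OF a(1)] order_eq n by (simp add: order_def)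
    then show False using nc[OF a(1)] card_subset_eq[OF fin subgroup.subset[OF subgroup_cyc[OF a(1)]]] by blast
  qed
  moreover have "\<not> j \<le> 1"
  proof
    assume "j \<le> 1"
    then have "ord a dvd 2" using j(2) le_imp_power_dvd[of j 1 "2::nat"] by simp
    then show False using pow_eq_id[OF a(1), of 2] pow2[OF a(1)] a(2) by simp
  qed
  ultimately have "j = 2" using j(1) n by linarith
  then have oa: "ord a = 2 ^ 2" using j by simp
  obtain b where b: "b \<in> involutions" "b \<notin> cyc G a"
  proof (cases "z \<in> cyc G a")
    case True
    then have "t \<notin> cyc G a" using cyc_involution_unique[OF a(1) zt(2) True zt(3)] zt(4) by blast
    then show ?thesis using that zt(3) by blast
  next
    case False
    then show ?thesis using that zt(2) by blast
  qed
  have bc: "b \<in> carrier G" using b(1) by simp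
  have o: "order G = 2 * card (cyc G a)" using order_eq n card_cyc[OF a(1)] oa by simp
  have "inv b \<otimes> a \<otimes> b \<in> cyc G a" by (rule index_p_normal[OF subgroup_cyc[OF a(1)] o bc self_in_cyc[OF a(1)]])
  then obtain r :: nat where r: "inv b \<otimes> a \<otimes> b = a [^] r" by (auto simp: cyc_def)
  interpret cyclic_extension G 2 n 2 r a b
    using a(1) bc oa n b(2) r by unfold_locales auto
  have tw: "a \<otimes> b = b \<otimes> a [^] r" using pow_commute_b[of 1] by simp
  have "[r = 1] (mod 2)" by (rule twisted_exponent(2)[OF a(1) oa _ bc tw b_pow_p]) simp
  then have "[r * 2 = 2] (mod 4)" unfolding cong_def by presburger
  then have "a [^] (r * 2) = a [^] (2::nat)" using pow_eq_pow_iff[OF a(1)] oa by simp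
  then have comm: "a [^] (2::nat) \<otimes> b = b \<otimes> a [^] (2::nat)" using pow_commute_b[of 2] by simp
  have ne: "a \<otimes> b \<noteq> b \<otimes> a"
  proof
    assume ab: "a \<otimes> b = b \<otimes> a"
    have "a \<otimes> g = g \<otimes> a" "b \<otimes> g = g \<otimes> b" if "g \<in> carrier G" for g
      using commute_all[OF a(1) HOL.refl ab that] commute_all[OF bc ab[symmetric] HOL.refl that] by auto
    then have "x \<otimes> y = y \<otimes> x" using commute_all[OF nab(1) _ _ nab(2)] nab(1) by metis
    then show False using nab(3) by simp
  qed
  have "b [^] (2::nat) = \<one>" using pow2 b(1) by simp
  then have "modular_p_group 2 2 \<cong> G" by (rule iso_modular(2)[OF _ ne comm])
  moreover have "group (modular_p_group 2 2)" unfolding modular_p_group_def by (rule group_presented_group)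
  ultimately show ?thesis using group.iso_sym by blast
qed

text \<open>G and the center have the same measure, so the center is outside as well, and with it
  every subgroup of order 2. Two maximal subgroups in the lattice would generate G, hence at most
  one is inside. The count is 1 + 1 + 3 + 2.\<close>

lemma defect_carrier_notin_cd:
  assumes n: "n \<ge> 3" and nc: "\<And>g. g \<in> carrier G \<Longrightarrow> cyc G g \<noteq> carrier G"
    and zt: "z \<in> center" "z \<in> involutions" "t \<in> involutions" "t \<noteq> z"
    and out: "carrier G \<notin> cd_lattice G"
  shows "7 \<le> cd_defect G"
proof -
  have n1: "n \<ge> 1" using n by simp
  have s2: "3 \<le> card (subs_card 2)" by (rule three_subs_order_2[OF zt])
  let ?M = "subs_card (2 ^ (n - 1))"
  have s3: "3 \<le> card ?M" by (rule three_index2_subgroups_noncyclic[OF n1 nc])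
  have p1: "2 < (2::nat) ^ (n - 1)" using n power_strict_increasing[of 1 "n - 1" "2::nat"] by simp
  have p2: "(2::nat) ^ n = 2 * 2 ^ (n - 1)" using n by (simp flip: power_Suc)
  have center_out: "center \<notin> cd_lattice G"
  proof
    assume c: "center \<in> cd_lattice G"
    have "cd_measure G (carrier G) = cd_measure G center" using cd_measure_carrier_center by simp
    then have "carrier G \<in> cd_lattice G" using c subgroup_self by (simp add: mem_cd_lattice_iff)
    then show False using out by simp
  qed
  have two_out: "H \<notin> cd_lattice G" if "card H = 2" for H using order_p_in_cd[OF n1 _ that] center_out by metis
  have "M = N" if MN: "M \<in> ?M \<inter> cd_lattice G" "N \<in> ?M \<inter> cd_lattice G" for M N
  proof (rule ccontr)
    assume ne: "M \<noteq> N"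
    let ?J = "generate G (M \<union> N)"
    have J: "?J \<in> cd_lattice G" using cd_lattice_join_meet(1) MN by blast
    then have sJ: "subgroup ?J G" by (rule cd_lattice_subgroup)
    have sub: "M \<subseteq> ?J" "N \<subseteq> ?J" by (auto intro: generate.incl)
    have "M \<noteq> ?J"
    proof
      assume "M = ?J"
      then have "N \<subseteq> M" using sub by simp
      then have "N = M" using MN card_subset_eq[OF finite_subgroup[of M]] by auto
      then show False using ne by simp
    qed
    then have lt: "card M < card ?J" using sub by (intro psubset_card_mono finite_subgroup[OF sJ]) blast
    obtain i where i: "i \<le> n" "card ?J = 2 ^ i" using card_subgroup[OF sJ] by blast
    have "(2::nat) ^ (n - 1) < 2 ^ i" using lt i MN by simp
    then have "n - 1 < i" by (metis power_less_imp_less_exp one_less_numeral_iff semiring_norm(76))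
    then have "i = n" using i(1) by linarith
    then have "card ?J = card (carrier G)" using i order_eq by (simp add: order_def)
    then have "?J = carrier G" by (rule card_subset_eq[OF fin subgroup.subset[OF sJ]])
    then show False using J out by simp
  qed
  then have "card (?M \<inter> cd_lattice G) \<le> 1"
    using finite_subs[of "\<lambda>H. card H = 2 ^ (n - 1)"] by (auto simp: card_le_Suc0_iff_eq)
  moreover have "card (?M - cd_lattice G) = card ?M - card (?M \<inter> cd_lattice G)"
    using finite_subs by (intro card_Diff_subset_Int) simp
  ultimately have m: "2 \<le> card (?M - cd_lattice G)" using s3 by linarith
  have d1: "{\<one>} \<noteq> carrier G" by (rule carrier_nontrivial[OF n1])
  have cc: "card (carrier G) = 2 * 2 ^ (n - 1)" using order_eq p2 by (simp add: order_def)
  let ?S = "{{\<one>}, carrier G} \<union> subs_card 2 \<union> (?M - cd_lattice G)"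
  have "card ?S = card {{\<one>}, carrier G} + card (subs_card 2) + card (?M - cd_lattice G)"
  proof (rule card_Un3)
    show "{{\<one>}, carrier G} \<inter> subs_card 2 = {}" using cc p1 by auto
    show "{{\<one>}, carrier G} \<inter> (?M - cd_lattice G) = {}" using cc p1 by auto
    show "subs_card 2 \<inter> (?M - cd_lattice G) = {}" using p1 by auto
  qed (use finite_subs in auto)
  moreover have "card {{\<one>}, carrier G} = 2" using d1 by simp
  moreover have "card ?S \<le> cd_defect G"
    by (rule card_le_cd_defect) (use triv_subgroup subgroup_self trivial_notin_cd[OF n1] out two_out in auto)
  ultimately show ?thesis using s2 m by linarith
qed

text \<open>Modulo its center G is not cyclic, so three maximal subgroups contain the center. If one
  of them is cyclic, \<open>almost_cyclic_classification\<close> applies. Otherwise each has at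
  least two subgroups of index 2 besides the center; these six and the trivial subgroup do not
  contain the center.\<close>

lemma center_index_4_classification:
  assumes n: "n \<ge> 4" and nc: "\<And>g. g \<in> carrier G \<Longrightarrow> cyc G g \<noteq> carrier G"
    and o: "order G = 4 * card center" and le: "cd_defect G \<le> 6"
  shows "\<exists>k\<in>{2..3}. G \<cong> modular_p_group 2 k"
proof -
  have cZ: "card center = 2 ^ (n - 2)"
  proof -
    have "2 + (n - 2) = n" using n by simp
    then have "(2::nat) ^ n = 2 ^ (2 + (n - 2))" by (simp only:)
    also have "\<dots> = 4 * 2 ^ (n - 2)" by (simp only: power_add) simp
    finally have "(2::nat) ^ n = 4 * 2 ^ (n - 2)" .
    then show ?thesis using o order_eq by simp
  qed
  have "(2::nat) ^ 2 \<le> 2 ^ (n - 2)" using n by (intro power_increasing) auto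
  then have cZ4: "4 \<le> card center" using cZ by simp
  have Zc: "center \<noteq> carrier G" using o order_pos by (auto simp: order_def)
  have "\<exists>K. subgroup K G \<and> K \<noteq> carrier G \<and> center \<subseteq> K \<and> g \<in> K" if g: "g \<in> carrier G" for g
  proof -
    \<comment> \<open>This double centralizer contains the center and g. For noncentral g it is
      proper, because its elements commute with g.\<close>
    let ?K = "centralizer G (centralizer G (center \<union> {g}))"
    have "g \<in> ?K" using g by (auto simp: centralizer_def)
    moreover have "center \<subseteq> ?K" by (auto simp: centralizer_def)
    moreover have "subgroup ?K G" by (rule subgroup_centralizer[OF centralizer_subset])
    moreover have "?K \<noteq> carrier G \<or> g \<in> center"
    proof (cases "g \<in> center")
      case False
      have "g \<in> centralizer G (center \<union> {g})"
        using g center_comm by (auto simp: centralizer_def)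
      then have "x \<otimes> g = g \<otimes> x" if "x \<in> ?K" for x using centralizerD[OF that] by blast
      then have "?K \<noteq> carrier G" using False g by (metis center_iff)
      then show ?thesis by blast
    qed simp
    ultimately show ?thesis using Zc subgroup_center by blast
  qed
  then obtain M1 M2 M3 where M: "M1 \<noteq> M2" "M1 \<noteq> M3" "M2 \<noteq> M3"
    "\<forall>M\<in>{M1, M2, M3}. subgroup M G \<and> order G = 2 * card M \<and> center \<subseteq> M"
    using three_index2_subgroups[OF subgroup_center Zc] by (metis (no_types, lifting))
  show ?thesis
  proof (cases "\<exists>M\<in>{M1, M2, M3}. \<exists>a\<in>M. cyc G a = M")
    case True
    then obtain a where a: "subgroup (cyc G a) G" "order G = 2 * card (cyc G a)" "center \<subseteq> cyc G a" "a \<in> cyc G a"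
      using M(4) by metis
    have ac: "a \<in> carrier G" using subgroup.mem_carrier[OF a(1,4)] .
    have oa: "ord a = 2 ^ (n - 1)"
    proof -
      have "(2::nat) ^ n = 2 * 2 ^ (n - 1)" using n by (simp flip: power_Suc)
      then show ?thesis using a(2) order_eq card_cyc[OF ac] by simp
    qed
    have a2: "a [^] (2::nat) \<in> center"
    proof -
      have c: "card (cyc G a) = 2 ^ (n - 1)" using card_cyc[OF ac] oa by simp
      interpret A: p_group "G\<lparr>carrier := cyc G a\<rparr>" 2 "n - 1" by (rule p_group_restrict[OF a(1) c])
      have "subgroup center (G\<lparr>carrier := cyc G a\<rparr>)" by (rule subgroup_incl[OF subgroup_center a(1,3)])
      then have "a [^]\<^bsub>G\<lparr>carrier := cyc G a\<rparr>\<^esub> (2::nat) \<in> center"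
        by (rule A.index_p_pow) (use a(2,4) o in \<open>simp_all add: order_def\<close>)
      then show ?thesis using nat_pow_consistent[of a 2 "cyc G a"] by simp
    qed
    obtain x where x: "x \<in> carrier G" "x \<notin> cyc G a" using nc[OF ac] subgroup.subset[OF a(1)] by blast
    have "inv x \<otimes> a \<otimes> x \<in> cyc G a" by (rule index_p_normal[OF a(1,2) x(1) a(4)])
    then obtain r :: nat where "inv x \<otimes> a \<otimes> x = a [^] r" by (auto simp: cyc_def)
    then have tw: "a \<otimes> x = x \<otimes> a [^] r" using conj_eq_iff(1)[OF x(1) ac, of "a [^] r"] ac by simp
    have "x \<otimes> a [^] (r * 2) = x \<otimes> a [^] (2::nat)"
      using twisted_commute[OF ac x(1) tw, of 2] center_comm[OF a2 x(1)] by simp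
    then have "a [^] (r * 2) = a [^] (2::nat)" using ac x(1) by simp
    \<comment> \<open>As a^2 is central, 2 r = 2 modulo 2^(n-1). For n >= 4 this holds modulo 8, so
      r = 1 modulo 4.\<close>
    then have "[r * 2 = 2] (mod 2 ^ (n - 1))" using pow_eq_pow_iff[OF ac] oa by simp
    moreover have "(2::nat) ^ 3 dvd 2 ^ (n - 1)" using n by (intro le_imp_power_dvd) simp
    ultimately have "[r * 2 = 2] (mod 2 ^ 3)" by (rule cong_dvd_modulus_nat)
    then have "[r * 2 = 1 * 2] (mod 4 * 2)" by simp
    then have r4: "[r = 1] (mod 4)" unfolding cong_def by presburger
    have k: "n - 1 \<ge> 1" "n = Suc (n - 1)" using n by auto
    from almost_cyclic_classification[OF ac oa k nc x tw r4]
    consider "cd_defect G = (n - 1) * (2 + 1) + 1"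
      | "n - 1 \<ge> 2" "G \<cong> modular_p_group 2 (n - 1)" "cd_defect G = (n - 1 - 1) * (2 + 1)" by blast
    then show ?thesis
    proof cases
      case 1
      then show ?thesis using le n by simp
    next
      case 2
      then show ?thesis using le by (intro bexI[of _ "n - 1"]) auto
    qed
  next
    case False
    let ?R = "\<lambda>M. {H. subgroup H G \<and> H \<subseteq> M \<and> card H = card center} - {center}"
    have R: "2 \<le> card (?R M)" if MM: "M \<in> {M1, M2, M3}" for M
    proof -
      have sM: "subgroup M G" "order G = 2 * card M" using M(4) MM by auto
      have cM: "card M = 2 ^ (n - 1)"
      proof -
        have "(2::nat) ^ n = 2 * 2 ^ (n - 1)" using n by (simp flip: power_Suc)
        then show ?thesis using sM(2) order_eq by simp
      qed
      interpret L: p_group "G\<lparr>carrier := M\<rparr>" 2 "n - 1" by (rule p_group_restrict[OF sM(1) cM])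
      interpret L: two_group "G\<lparr>carrier := M\<rparr>" "n - 1" by unfold_locales
      have "3 \<le> card (L.subs_card (2 ^ (n - 1 - 1)))"
        by (rule L.three_index2_subgroups_noncyclic) (use n False MM in auto)
      also have "L.subs_card (2 ^ (n - 1 - 1)) \<subseteq> {H. subgroup H G \<and> H \<subseteq> M \<and> card H = card center}"
        using incl_subgroup[OF sM(1)] subgroup.subset[of _ "G\<lparr>carrier := M\<rparr>"] cZ
        by (auto simp: numeral_2_eq_2)
      then have "card (L.subs_card (2 ^ (n - 1 - 1))) \<le> card {H. subgroup H G \<and> H \<subseteq> M \<and> card H = card center}"
        by (intro card_mono finite_subs)
      finally show ?thesis
        using diff_card_le_card_Diff[of "{center}" "{H. subgroup H G \<and> H \<subseteq> M \<and> card H = card center}"] by simp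
    qed
    \<comment> \<open>Two different maximal subgroups over the center meet in the center, as its
      index is 4.\<close>
    have disj: "?R M \<inter> ?R N = {}" if MN: "M \<in> {M1, M2, M3}" "N \<in> {M1, M2, M3}" "M \<noteq> N" for M N
    proof -
      have s: "subgroup M G" "subgroup N G" "order G = 2 * card M" "order G = 2 * card N" "center \<subseteq> M" "center \<subseteq> N"
        using M(4) MN by auto
      have I: "subgroup (M \<inter> N) G" by (rule subgroups_Inter_pair[OF s(1,2)])
      have "M \<inter> N \<noteq> M"
      proof
        assume "M \<inter> N = M"
        then have "M \<subseteq> N" by blast
        then have "M = N" using s card_subset_eq[OF finite_subgroup[OF s(2)]] by simp
        then show False using MN(3) by simp
      qed
      then have lt: "card (M \<inter> N) < card M" by (intro psubset_card_mono finite_subgroup[OF s(1)]) blast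
      obtain i where i: "card (M \<inter> N) = 2 ^ i" using card_subgroup[OF I] by blast
      have "(2::nat) ^ i < 2 * 2 ^ (n - 2)" using lt i s(3) o cZ by simp
      then have "(2::nat) ^ i < 2 ^ Suc (n - 2)" by simp
      then have "i < Suc (n - 2)" by (metis power_less_imp_less_exp one_less_numeral_iff semiring_norm(76))
      then have "card (M \<inter> N) \<le> card center" unfolding i cZ by (intro power_increasing) auto
      then have "center = M \<inter> N" using card_seteq[OF finite_subgroup[OF I]] s by simp
      then have "H = center" if "H \<subseteq> M" "H \<subseteq> N" "card H = card center" for H
        using that card_subset_eq[OF finite_subgroup[OF subgroup_center], of H] by blast
      then show ?thesis by blast
    qed
    have fin_R: "finite (?R M)" for M using finite_subs by auto
    have "card (?R M1 \<union> ?R M2 \<union> ?R M3) = card (?R M1) + card (?R M2) + card (?R M3)"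
      by (rule card_Un3[OF fin_R fin_R fin_R]) (use disj M(1-3) in auto)
    then have six: "6 \<le> card (?R M1 \<union> ?R M2 \<union> ?R M3)" using R[of M1] R[of M2] R[of M3] by simp
    have n1: "n \<ge> 1" using n by simp
    have "{\<one>} \<notin> ?R M1 \<union> ?R M2 \<union> ?R M3" using cZ4 by auto
    then have "7 \<le> card (insert {\<one>} (?R M1 \<union> ?R M2 \<union> ?R M3))" using six fin_R by simp
    also have "\<dots> \<le> cd_defect G"
    proof (rule card_le_cd_defect)
      fix H assume H: "H \<in> insert {\<one>} (?R M1 \<union> ?R M2 \<union> ?R M3)"
      then show "subgroup H G" using triv_subgroup by auto
      have "\<not> center \<subseteq> H" if "card H = card center" "H \<noteq> center" "subgroup H G"
        using that card_subset_eq[OF finite_subgroup[OF that(3)], of center] by auto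
      then have "H \<noteq> {\<one>} \<Longrightarrow> H \<notin> cd_lattice G" using H center_subset_cd[of H] by auto
      then show "H \<notin> cd_lattice G" using trivial_notin_cd[OF n1] by metis
    qed
    finally show ?thesis using le by simp
  qed
qed

text \<open>Subgroups of order at most 4 cannot contain the center, and there are at least 1 + 3 + 3
  of them.\<close>

lemma defect_center_ge_8:
  assumes n: "n \<ge> 3" and c: "8 \<le> card center"
    and zt: "z \<in> center" "z \<in> involutions" "t \<in> involutions" "t \<noteq> z"
  shows "7 \<le> cd_defect G"
proof -
  let ?S = "{{\<one>}} \<union> subs_card 2 \<union> subs_card 4"
  have "{{\<one>}} \<inter> subs_card 2 = {}" "{{\<one>}} \<inter> subs_card 4 = {}" "subs_card 2 \<inter> subs_card 4 = {}" by auto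
  then have "card ?S = 1 + card (subs_card 2) + card (subs_card 4)"
    using card_Un3[of "{{\<one>}}" "subs_card 2" "subs_card 4"] finite_subs[of "\<lambda>H. card H = 2"]
      finite_subs[of "\<lambda>H. card H = 4"] by simp
  then have "7 \<le> card ?S" using three_subs_order_2[OF zt] three_subs_order_4[OF zt n] by linarith
  also have "\<dots> \<le> cd_defect G"
  proof (rule card_le_cd_defect)
    fix H assume H: "H \<in> ?S"
    then show s: "subgroup H G" using triv_subgroup by auto
    have "card H \<le> 4" using H by auto
    then have "\<not> center \<subseteq> H" using c card_mono[OF finite_subgroup[OF s], of center] by auto
    then show "H \<notin> cd_lattice G" using center_subset_cd by blast
  qed
  finally show ?thesis .
qed

end

section \<open>G in the lattice, center of order 4\<close>

context two_group
begin

text \<open>\<open>unique_involution_mod_central\<close> is applied inside the centralizer of t,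
  where t is central.\<close>

lemma unique_involution_mod_in_centralizer:
  assumes n: "n \<ge> 3" and t: "t \<in> involutions" and o: "order G = 2 * card (centralizer G {t})" and z: "z \<in> center"
    and E: "\<And>y. \<lbrakk>y \<in> centralizer G {t}; y \<otimes> y \<in> {\<one>, t}\<rbrakk> \<Longrightarrow> y \<in> {\<one>, z, t, t \<otimes> z}"
  shows "\<exists>A. subgroup A G \<and> A \<subseteq> centralizer G {t} \<and> (\<forall>x\<in>A. \<forall>y\<in>A. x \<otimes> y = y \<otimes> x) \<and>
    (A = centralizer G {t} \<or> card (centralizer G {t}) = 2 * card A \<and> (\<forall>x\<in>centralizer G {t} - A. x \<otimes> x \<in> A \<and>
      (\<forall>a\<in>A. \<exists>s\<in>{\<one>, t}. a \<otimes> x = x \<otimes> inv a \<otimes> s)))"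
proof -
  let ?C = "centralizer G {t}"
  have tc: "t \<in> carrier G" using t by simp
  have sC: "subgroup ?C G" using tc by (intro subgroup_centralizer) simp
  have zC: "z \<in> ?C" using z center_closed[OF z] center_comm[OF z tc] by (simp add: centralizer_def)
  have tC: "t \<in> ?C" using tc by (simp add: centralizer_def)
  have "(2::nat) ^ n = 2 * 2 ^ (n - 1)" using n by (simp flip: power_Suc)
  then have cC: "card ?C = 2 ^ (n - 1)" using o order_eq by simp
  interpret L: p_group "G\<lparr>carrier := ?C\<rparr>" 2 "n - 1" by (rule p_group_restrict[OF sC cC])
  interpret L: two_group "G\<lparr>carrier := ?C\<rparr>" "n - 1" by unfold_locales
  have tL: "t \<in> L.center" unfolding L.center_iff using tC by (auto simp: centralizer_def)
  have tI: "t \<in> L.involutions" using t tC by simp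
  have "n - 1 \<ge> 2" using n by simp
  from L.unique_involution_mod_central[OF this tL tI, of z] zC E obtain A where
    A: "subgroup A (G\<lparr>carrier := ?C\<rparr>)" "\<forall>x\<in>A. \<forall>y\<in>A. x \<otimes> y = y \<otimes> x"
    "A = ?C \<or> (order (G\<lparr>carrier := ?C\<rparr>) = 2 * card A \<and>
      (\<forall>x\<in>?C - A. \<forall>a\<in>A. \<exists>s\<in>{\<one>, t}. a \<otimes> x = x \<otimes> inv\<^bsub>G\<lparr>carrier := ?C\<rparr>\<^esub> a \<otimes> s))"
    by auto
  have AC: "A \<subseteq> ?C" using subgroup.subset[OF A(1)] by simp
  show ?thesis
  proof (intro exI conjI)
    show "subgroup A G" by (rule incl_subgroup[OF sC A(1)])
    show "A \<subseteq> ?C" by (rule AC)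
    show "\<forall>x\<in>A. \<forall>y\<in>A. x \<otimes> y = y \<otimes> x" by (rule A(2))
    show "A = ?C \<or> card ?C = 2 * card A \<and> (\<forall>x\<in>?C - A. x \<otimes> x \<in> A \<and> (\<forall>a\<in>A. \<exists>s\<in>{\<one>, t}. a \<otimes> x = x \<otimes> inv a \<otimes> s))"
    proof (cases "A = ?C")
      case False
      then have o: "order (G\<lparr>carrier := ?C\<rparr>) = 2 * card A"
        and tw: "\<forall>x\<in>?C - A. \<forall>a\<in>A. \<exists>s\<in>{\<one>, t}. a \<otimes> x = x \<otimes> inv\<^bsub>G\<lparr>carrier := ?C\<rparr>\<^esub> a \<otimes> s" using A(3) by blast+
      have "x \<otimes> x \<in> A" if "x \<in> ?C - A" for x using L.index2_mult_iff[OF A(1) o, of x x] that by simp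
      moreover have "\<exists>s\<in>{\<one>, t}. a \<otimes> x = x \<otimes> inv a \<otimes> s" if "x \<in> ?C - A" "a \<in> A" for x a
        using bspec[OF bspec[OF tw that(1)] that(2)] m_inv_consistent[OF sC subsetD[OF AC that(2)]] by simp
      ultimately show ?thesis using o by (simp add: order_def)
    qed simp
  qed
qed

text \<open>The trivial subgroup, three subgroups of order 2 and two of order 4 besides the center
  already make six, so nothing else is outside the lattice. This determines the involutions, fixes
  the number of subgroups of order 4 and makes the center cyclic. The abelian subgroup found in the
  centralizer of t then contradicts |G| >= 32.\<close>

lemma defect_center_4:
  assumes n: "n \<ge> 5" and c: "card center = 4" and full: "carrier G \<in> cd_lattice G"
    and zt: "z \<in> center" "z \<in> involutions" "t \<in> involutions" "t \<noteq> z"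
  shows "7 \<le> cd_defect G"
proof (rule ccontr)
  assume "\<not> ?thesis"
  then have le: "cd_defect G \<le> 6" by simp
  have o32: "32 \<le> order G"
  proof -
    have "(2::nat) ^ 5 \<le> 2 ^ n" using n by (intro power_increasing) auto
    then show ?thesis using order_eq by simp
  qed
  have n3: "n \<ge> 3" using n by simp
  have s2: "3 \<le> card (subs_card 2)" by (rule three_subs_order_2[OF zt])
  have s4: "3 \<le> card (subs_card 4)" by (rule three_subs_order_4[OF zt n3])
  let ?Q = "subs_card 4 - {center}" and ?O = "subgroups_of G - cd_lattice G"
  let ?S = "{{\<one>}} \<union> subs_card 2 \<union> ?Q"
  have fO: "finite ?O" using finite_subgroups_of by blast
  have "{{\<one>}} \<inter> subs_card 2 = {}" "{{\<one>}} \<inter> ?Q = {}" "subs_card 2 \<inter> ?Q = {}" by auto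
  then have cS: "card ?S = 1 + card (subs_card 2) + card ?Q"
    using card_Un3[of "{{\<one>}}" "subs_card 2" ?Q] finite_subs[of "\<lambda>H. card H = 2"]
      finite_subs[of "\<lambda>H. card H = 4"] by simp
  have cQ: "card (subs_card 4) = card ?Q + 1"
    using card_Suc_Diff1[of "subs_card 4" center] finite_subs[of "\<lambda>H. card H = 4"] subgroup_center c by simp
  have SO: "?S \<subseteq> ?O"
  proof
    fix H assume H: "H \<in> ?S"
    then have s: "subgroup H G" "card H \<le> 4" using triv_subgroup by auto
    have "H \<noteq> center" using H c by auto
    note s = s this
    then have "\<not> center \<subseteq> H" using card_seteq[OF finite_subgroup[OF s(1)], of center] c by auto
    then show "H \<in> ?O" using s(1) center_subset_cd by (auto simp: subgroups_of_def)
  qed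
  have "card ?S \<le> card ?O" by (rule card_mono[OF fO SO])
  then have c2: "card (subs_card 2) = 3" and c4: "card (subs_card 4) = 3" and SO': "card ?O \<le> card ?S"
    using cS cQ s2 s4 le unfolding cd_defect_eq by linarith+
  have S_eq: "?S = ?O" by (rule card_seteq[OF fO SO SO'])
  \<comment> \<open>If the center is not cyclic, no cyclic subgroup contains it. Then G is covered
    by the six subgroups in \<open>?S\<close>, of order at most 4, and has at most 24
    elements.\<close>
  have "\<exists>x\<in>carrier G. center = cyc G x"
  proof (rule ccontr)
    assume no: "\<not> ?thesis"
    have "cyc G y \<in> ?S" if y: "y \<in> carrier G" for y
    proof -
      have "\<not> center \<subseteq> cyc G y"
      proof
        assume "center \<subseteq> cyc G y"
        then obtain d where "center = cyc G (y [^] (d::nat))"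
          using subgroup_of_cyc[OF y subgroup_center] by blast
        then show False using no nat_pow_closed[OF y] by blast
      qed
      then show ?thesis unfolding S_eq using subgroup_cyc[OF y] center_subset_cd by (auto simp: subgroups_of_def)
    qed
    then have cov: "carrier G \<subseteq> \<Union>?S" using self_in_cyc by blast
    have "card (\<Union>?S) \<le> (\<Sum>H\<in>?S. card H)" by (rule card_Union_le_sum_card)
    also have "\<dots> \<le> (\<Sum>H\<in>?S. 4)" by (rule sum_mono) auto
    also have "\<dots> = 4 * card ?S" by simp
    finally have "card (\<Union>?S) \<le> 24" using cS cQ c2 c4 by simp
    moreover have "finite (\<Union>?S)"
      using finite_subset[OF SO fO] finite_subgroup triv_subgroup by (intro finite_Union) auto
    ultimately have "order G \<le> 24" using card_mono[OF _ cov] by (simp add: order_def)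
    then show False using o32 by simp
  qed
  then obtain x0 where x0: "x0 \<in> carrier G" "center = cyc G x0" by blast
  have zx: "z \<in> cyc G x0" using zt(1) x0(2) by simp
  have tc: "t \<in> carrier G" using zt(3) by simp
  have zc: "z \<in> carrier G" using zt(2) by simp
  have zcomm: "z \<otimes> g = g \<otimes> z" if "g \<in> carrier G" for g by (rule center_comm[OF zt(1) that])
  have tZ: "t \<notin> center" using cyc_involution_unique[OF x0(1) zt(2) zx zt(3)] zt(4) x0(2) by blast
  note K = klein[OF zt(2,3,4) zcomm[OF tc]]
  have inv_eq: "w \<in> {z, t, t \<otimes> z}" if w: "w \<in> involutions" for w
  proof (rule ccontr)
    assume w': "w \<notin> {z, t, t \<otimes> z}"
    have sub: "{w, z, t, t \<otimes> z} \<subseteq> involutions" by (intro insert_subsetI empty_subsetI w zt K(1))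
    have "card {w, z, t, t \<otimes> z} = 4" using w' K(2,3) zt(4) by auto
    then have "card (cyc G ` {w, z, t, t \<otimes> z}) = 4"
      using card_image[OF inj_on_subset[OF inj_cyc_involutions sub]] by simp
    moreover have "cyc G x \<in> subs_card 2" if "x \<in> involutions" for x
      using that subgroup_cyc card_cyc involution_ord[OF that] by simp
    then have "cyc G ` {w, z, t, t \<otimes> z} \<subseteq> subs_card 2" using sub by blast
    then have "card (cyc G ` {w, z, t, t \<otimes> z}) \<le> card (subs_card 2)" by (rule card_mono[OF finite_subs])
    ultimately show False using c2 by simp
  qed
  let ?C = "centralizer G {t}"
  have sC: "subgroup ?C G" using tc by (intro subgroup_centralizer) simp
  \<comment> \<open>A conjugate of t is an involution other than the central z, which leaves t and t
    z.\<close>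
  have "(\<lambda>g. g \<otimes> t \<otimes> inv g) ` carrier G \<subseteq> {t, t \<otimes> z}"
  proof (rule image_subsetI)
    fix g assume g: "g \<in> carrier G"
    have "(g \<otimes> t \<otimes> inv g) \<otimes> (g \<otimes> t \<otimes> inv g) = g \<otimes> (t \<otimes> t) \<otimes> inv g" using g tc by (simp add: m_assoc)
    then have "(g \<otimes> t \<otimes> inv g) \<otimes> (g \<otimes> t \<otimes> inv g) = \<one>" using zt(3) g by simp
    moreover have "g \<otimes> t \<otimes> inv g \<noteq> \<one>" using conj_eq_iff(2)[OF g tc one_closed] g tc zt(3) by auto
    ultimately have "g \<otimes> t \<otimes> inv g \<in> involutions" using g tc by simp
    moreover have "g \<otimes> t \<otimes> inv g \<noteq> z" using conj_eq_iff(2)[OF g tc zc] zcomm[OF g] g tc zc zt(4) by simp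
    ultimately show "g \<otimes> t \<otimes> inv g \<in> {t, t \<otimes> z}" using inv_eq by blast
  qed
  then have "card ((\<lambda>g. g \<otimes> t \<otimes> inv g) ` carrier G) \<le> card {t, t \<otimes> z}" by (intro card_mono) auto
  also have "\<dots> \<le> 2" by (simp add: card_insert_if)
  finally have cl2: "card ((\<lambda>g. g \<otimes> t \<otimes> inv g) ` carrier G) \<le> 2" .
  have "?C \<noteq> carrier G" using centralizer_singleton_eq_carrier[OF tc] tZ by blast
  then have "card ?C \<noteq> order G"
    unfolding order_def using card_subset_eq[OF fin subgroup.subset[OF sC]] by blast
  then have "card ((\<lambda>g. g \<otimes> t \<otimes> inv g) ` carrier G) \<noteq> 1" using card_conj_class[OF tc] by auto
  moreover have "card ((\<lambda>g. g \<otimes> t \<otimes> inv g) ` carrier G) \<noteq> 0" using order_pos card_conj_class[OF tc] by auto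
  ultimately have "card ((\<lambda>g. g \<otimes> t \<otimes> inv g) ` carrier G) = 2" using cl2 by linarith
  then have o: "order G = 2 * card ?C" using card_conj_class[OF tc] by simp
  let ?E = "{\<one>, z, t, t \<otimes> z}"
  \<comment> \<open>A square root y of t would yield <y> and <y z>, both of order 4 and without z.
    With \<open>?E\<close> and the center these are four subgroups of order 4 instead of
    three.\<close>
  have E: "y \<in> ?E" if y: "y \<in> ?C" "y \<otimes> y \<in> {\<one>, t}" for y
  proof -
    have yc: "y \<in> carrier G" using y(1) by (simp add: centralizer_def)
    have "y \<otimes> y \<noteq> t"
    proof
      assume yt: "y \<otimes> y = t"
      have yzt: "(y \<otimes> z) \<otimes> (y \<otimes> z) = t"
      proof -
        have "(y \<otimes> z) \<otimes> (y \<otimes> z) = (y \<otimes> y) \<otimes> (z \<otimes> z)" using yc zc zcomm[OF yc] by (metis m_assoc m_closed)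
        then show ?thesis using yt zt(2) tc by simp
      qed
      have four: "card (cyc G u) = 4" "t \<in> cyc G u" "z \<notin> cyc G u" if u: "u \<in> carrier G" "u \<otimes> u = t" for u
      proof -
        show tu: "t \<in> cyc G u" using subgroup.m_closed[OF subgroup_cyc[OF u(1)] self_in_cyc[OF u(1)] self_in_cyc[OF u(1)]] u(2) by simp
        then show "z \<notin> cyc G u" using cyc_involution_unique[OF u(1) zt(3) tu zt(2)] zt(4) by blast
        have "ord u = 4"
        proof -
          obtain j where j: "ord u = 2 ^ j" using ord_eq_pow[OF u(1)] by blast
          have "u [^] (2 + 2::nat) = t \<otimes> t" using u pow2[OF u(1)] by (simp only: nat_pow_mult[OF u(1), symmetric])
          then have "ord u dvd 4" using pow_eq_id[OF u(1), of 4] zt(3) by simp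
          moreover have "\<not> ord u dvd 2" using pow_eq_id[OF u(1), of 2] pow2[OF u(1)] u(2) zt(3) by simp
          ultimately show ?thesis using j dvd_power_iff_le[of "2::nat" j 2] dvd_power_iff_le[of "2::nat" j 1] by (cases "j = 2") auto
        qed
        then show "card (cyc G u) = 4" using card_cyc[OF u(1)] by simp
      qed
      have yzc: "y \<otimes> z \<in> carrier G" using yc zc by simp
      have ne1: "cyc G y \<noteq> cyc G (y \<otimes> z)"
      proof
        assume "cyc G y = cyc G (y \<otimes> z)"
        then have "y \<otimes> z \<in> cyc G y" using self_in_cyc[OF yzc] by simp
        then have "z \<in> cyc G y" using subgroup_cancel(1)[OF subgroup_cyc[OF yc] self_in_cyc[OF yc] zc] by simp
        then show False using four(3)[OF yc yt] by simp
      qed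
      have "?E \<notin> {cyc G y, cyc G (y \<otimes> z)}" using four(3)[OF yc yt] four(3)[OF yzc yzt] by auto
      moreover have "center \<notin> {cyc G y, cyc G (y \<otimes> z)}" using four(3)[OF yc yt] four(3)[OF yzc yzt] zt(1) by auto
      moreover have "?E \<noteq> center" using tZ by auto
      moreover have "card {U, V, W, Y} = 4" if "U \<notin> {W, Y}" "V \<notin> {W, Y}" "U \<noteq> V" "W \<noteq> Y" for U V W Y :: "'a set"
        using that by auto
      ultimately have "card {?E, center, cyc G y, cyc G (y \<otimes> z)} = 4" using ne1 by (simp only: not_False_eq_True)
      moreover have "{?E, center, cyc G y, cyc G (y \<otimes> z)} \<subseteq> subs_card 4"
        using K(4,5) subgroup_center c subgroup_cyc[OF yc] subgroup_cyc[OF yzc] four(1)[OF yc yt] four(1)[OF yzc yzt]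
        by (simp del: insert_iff add: insert_subset)
      then have "card {?E, center, cyc G y, cyc G (y \<otimes> z)} \<le> card (subs_card 4)" by (rule card_mono[OF finite_subs])
      ultimately show False using c4 by simp
    qed
    then have "y \<otimes> y = \<one>" using y(2) by blast
    then show ?thesis using inv_eq[of y] yc by blast
  qed
  from unique_involution_mod_in_centralizer[OF n3 zt(3) o zt(1) E] obtain A where
    A: "subgroup A G" "A \<subseteq> ?C" "\<And>x y. \<lbrakk>x \<in> A; y \<in> A\<rbrakk> \<Longrightarrow> x \<otimes> y = y \<otimes> x"
    "A = ?C \<or> card ?C = 2 * card A \<and> (\<forall>x\<in>?C - A. x \<otimes> x \<in> A \<and> (\<forall>a\<in>A. \<exists>s\<in>{\<one>, t}. a \<otimes> x = x \<otimes> inv a \<otimes> s))"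
    by blast
  have sq: "card A * card A \<le> order G * 4"
    using card_sq_commutative_le[OF A(1,3) full] cd_measure_carrier_center(1) c by simp
  \<comment> \<open>|C|^2 <= 4 |G| = 8 |C| would give |G| <= 16.\<close>
  have "A \<noteq> ?C"
  proof
    assume "A = ?C"
    then have "card ?C * card ?C \<le> 8 * card ?C" using sq o by simp
    then have "card ?C \<le> 8" using card_subgroup_pos[OF sC] by simp
    then show False using o o32 by simp
  qed
  then have A2: "card ?C = 2 * card A" "\<And>x a. \<lbrakk>x \<in> ?C - A; a \<in> A\<rbrakk> \<Longrightarrow> \<exists>s\<in>{\<one>, t}. a \<otimes> x = x \<otimes> inv a \<otimes> s"
    using A(4) by blast+
  have xZ: "x0 \<in> center" using self_in_cyc[OF x0(1)] x0(2) by simp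
  have xcomm: "x0 \<otimes> g = g \<otimes> x0" if "g \<in> carrier G" for g by (rule center_comm[OF xZ that])
  \<comment> \<open>a x = x a^-1 s and a x = x a together give a^2 = s in {1, t}.\<close>
  have AE: "a \<in> ?E" if a: "a \<in> A" "x \<in> ?C - A" "a \<otimes> x = x \<otimes> a" for a x
  proof -
    have ac: "a \<in> carrier G" "x \<in> carrier G" using subgroup.mem_carrier[OF A(1) a(1)] a(2) by (auto simp: centralizer_def)
    obtain s where s: "s \<in> {\<one>, t}" "a \<otimes> x = x \<otimes> inv a \<otimes> s" using A2(2)[OF a(2,1)] by blast
    have sc: "s \<in> carrier G" using s(1) tc by auto
    have "x \<otimes> a = x \<otimes> (inv a \<otimes> s)" using s(2) a(3) ac sc by (simp add: m_assoc)
    then have "a = inv a \<otimes> s" using ac sc by simp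
    then have "a \<otimes> a = a \<otimes> (inv a \<otimes> s)" by simp
    also have "\<dots> = s" using ac sc by (simp flip: m_assoc)
    finally show ?thesis using E[of a] A(2) a(1) s(1) by auto
  qed
  have "A \<noteq> ?C" by fact
  then obtain x where x: "x \<in> ?C - A" using A(2) by blast
  show False
  \<comment> \<open>The generator x0 of the center commutes with everything. Inside \<open>A\<close>
    it would lie in \<open>?E\<close> and have order at most 2; outside it forces \<open>A\<close>
    into \<open>?E\<close>, so that |G| <= 16.\<close>
  proof (cases "x0 \<in> A")
    case True
    then have "x0 \<in> ?E" using AE[OF True x] xcomm x by (simp add: centralizer_def)
    then have "x0 \<otimes> x0 = \<one>" using zt(2,3) K(1) by auto
    then have "ord x0 dvd 2" using pow_eq_id[OF x0(1), of 2] pow2[OF x0(1)] by simp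
    then have "ord x0 \<le> 2" by (rule dvd_imp_le) simp
    then show False using c x0(2) card_cyc[OF x0(1)] by simp
  next
    case False
    have "x0 \<in> ?C" using x0(1) xcomm[OF tc] by (simp add: centralizer_def)
    then have "A \<subseteq> ?E" using AE[of _ x0] False xcomm subgroup.mem_carrier[OF A(1)] by fastforce
    then have "card A \<le> card ?E" by (rule card_mono[rotated]) simp
    then have "card A \<le> 4" using K(5) by simp
    then show False using A2(1) o o32 by simp
  qed
qed

end

section \<open>G in the lattice, center of order 2\<close>

locale two_group_center_two = two_group G n for G (structure) and n :: nat +
  fixes z :: 'a
  assumes center_eq: "center = {\<one>, z}" and z_ne: "z \<noteq> \<one>" and n4: "n \<ge> 4"
    and carrier_in_cd: "carrier G \<in> cd_lattice G"
begin

lemma z_center: "z \<in> center"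
  using center_eq by simp

lemma z_closed [simp]: "z \<in> carrier G"
  by (rule center_closed[OF z_center])

lemma z_comm: "g \<in> carrier G \<Longrightarrow> z \<otimes> g = g \<otimes> z"
  by (rule center_comm[OF z_center])

lemma z_sq [simp]: "z \<otimes> z = \<one>"
proof -
  have "z \<otimes> z \<in> {\<one>, z}" using subgroup.m_closed[OF subgroup_center z_center z_center] center_eq by simp
  then show ?thesis using z_ne by auto
qed

lemma z_cancel [simp]: "g \<in> carrier G \<Longrightarrow> g \<otimes> z \<otimes> z = g"
  by (simp add: m_assoc)

lemma z_involution: "z \<in> involutions"
  using z_ne by simp

lemma notin_cd: "z \<notin> H \<Longrightarrow> H \<notin> cd_lattice G"
  using center_subset_cd z_center by blast

lemma mult_z_involution: "\<lbrakk>x \<in> involutions; x \<noteq> z\<rbrakk> \<Longrightarrow> x \<otimes> z \<in> involutions" "\<lbrakk>x \<in> involutions; x \<noteq> z\<rbrakk> \<Longrightarrow> x \<otimes> z \<noteq> z"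
  using klein(1,3)[OF z_involution _ _ z_comm, of x] by auto

text \<open>The subgroups <s> with s in \<open>S\<close> do not contain z; the additional one is the
  trivial subgroup.\<close>

lemma involutions_defect:
  assumes S: "S \<subseteq> involutions - {z}"
  shows "card S + 1 \<le> cd_defect G"
proof -
  have fS: "finite S" using S by (intro finite_subset[OF _ fin]) auto
  have "inj_on (cyc G) S" using S by (intro inj_on_subset[OF inj_cyc_involutions]) blast
  then have "card (cyc G ` S) = card S" by (rule card_image)
  moreover have "{\<one>} \<notin> cyc G ` S"
  proof
    assume "{\<one>} \<in> cyc G ` S"
    then obtain s where "s \<in> S" "{\<one>} = cyc G s" by blast
    then show False using S cyc_involution[of s] by auto
  qed
  ultimately have "card S + 1 = card (insert {\<one>} (cyc G ` S))" using fS by simp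
  also have "\<dots> \<le> cd_defect G"
  proof (rule card_le_cd_defect)
    fix H assume H: "H \<in> insert {\<one>} (cyc G ` S)"
    then show "subgroup H G" using triv_subgroup S subgroup_cyc by auto
    have "z \<notin> cyc G s" if "s \<in> S" for s using that S cyc_involution[of s] z_ne by auto
    then show "H \<notin> cd_lattice G" using H notin_cd z_ne by auto
  qed
  finally show ?thesis .
qed

text \<open>Three noncentral involutions from different cosets of the center give six, since x z is
  an involution along with x; the trivial subgroup is the seventh.\<close>

lemma three_pairs_defect:
  assumes x: "x1 \<in> involutions" "x1 \<noteq> z" "x2 \<in> involutions" "x2 \<noteq> z" "x3 \<in> involutions" "x3 \<noteq> z"
    and ne: "x2 \<notin> {x1, x1 \<otimes> z}" "x3 \<notin> {x1, x1 \<otimes> z}" "x3 \<notin> {x2, x2 \<otimes> z}"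
  shows "7 \<le> cd_defect G"
proof -
  have disj: "{u, u \<otimes> z} \<inter> {v, v \<otimes> z} = {}" if "v \<notin> {u, u \<otimes> z}" "u \<in> involutions" "v \<in> involutions" for u v
  proof -
    have c: "u \<in> carrier G" "v \<in> carrier G" using that(2,3) by auto
    then have "u \<otimes> z \<noteq> v \<otimes> z" using that(1) by auto
    moreover have "u \<noteq> v \<otimes> z" using that(1) z_cancel[OF c(2)] by auto
    ultimately show ?thesis using that(1) by auto
  qed
  have card2: "card {u, u \<otimes> z} = 2" if "u \<in> involutions" for u using that z_ne by auto
  have "card ({x1, x1 \<otimes> z} \<union> {x2, x2 \<otimes> z} \<union> {x3, x3 \<otimes> z}) =
      card {x1, x1 \<otimes> z} + card {x2, x2 \<otimes> z} + card {x3, x3 \<otimes> z}"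
    by (rule card_Un3) (simp_all only: finite_insert finite.emptyI disj[OF ne(1) x(1,3)] disj[OF ne(2) x(1,5)] disj[OF ne(3) x(3,5)])
  then have "card ({x1, x1 \<otimes> z} \<union> {x2, x2 \<otimes> z} \<union> {x3, x3 \<otimes> z}) = 6"
    by (simp only: card2[OF x(1)] card2[OF x(3)] card2[OF x(5)])
  moreover have "{u, u \<otimes> z} \<subseteq> involutions - {z}" if "u \<in> involutions" "u \<noteq> z" for u
    by (intro insert_subsetI empty_subsetI DiffI mult_z_involution that) (use mult_z_involution that in simp_all)
  note pair = this
  have "{x1, x1 \<otimes> z} \<union> {x2, x2 \<otimes> z} \<union> {x3, x3 \<otimes> z} \<subseteq> involutions - {z}"
    by (intro Un_least pair x)
  note involutions_defect[OF this]
  ultimately show ?thesis by linarith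
qed

text \<open>x y is an involution in a third coset of the center.\<close>

lemma commuting_involutions_defect:
  assumes x: "x \<in> involutions" "x \<noteq> z" and y: "y \<in> involutions" "y \<noteq> z" "y \<notin> {x, x \<otimes> z}" and xy: "x \<otimes> y = y \<otimes> x"
  shows "7 \<le> cd_defect G"
proof (rule three_pairs_defect[OF x y(1,2)])
  have c: "x \<in> carrier G" "y \<in> carrier G" using x y by auto
  note K = klein[OF y(1) x(1) _ xy[symmetric]]
  have ne: "x \<noteq> y" using y(3) by blast
  show "y \<notin> {x, x \<otimes> z}" by (rule y(3))
  show "x \<otimes> y \<in> involutions" by (rule K(1)[OF ne])
  show "x \<otimes> y \<noteq> z"
  proof
    assume "x \<otimes> y = z"
    then have "x \<otimes> (x \<otimes> y) = x \<otimes> z" by simp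
    then have "y = x \<otimes> z" using c x(1) by (simp flip: m_assoc)
    then show False using y(3) by simp
  qed
  show "x \<otimes> y \<notin> {x, x \<otimes> z}" using c y by auto
  have "x \<otimes> y \<noteq> y \<otimes> z" unfolding xy using c x(2) by simp
  then show "x \<otimes> y \<notin> {y, y \<otimes> z}" using K(3)[OF ne] by simp
qed

lemma conj_involution:
  assumes g: "g \<in> carrier G" and x: "x \<in> involutions" "x \<noteq> z"
  shows "g \<otimes> x \<otimes> inv g \<in> involutions" "g \<otimes> x \<otimes> inv g \<noteq> z"
proof -
  have xc: "x \<in> carrier G" "x \<otimes> x = \<one>" "x \<noteq> \<one>" using x by auto
  have "(g \<otimes> x \<otimes> inv g) \<otimes> (g \<otimes> x \<otimes> inv g) = g \<otimes> (x \<otimes> x) \<otimes> inv g"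
    using g xc(1) by (simp add: m_assoc)
  then have "(g \<otimes> x \<otimes> inv g) \<otimes> (g \<otimes> x \<otimes> inv g) = \<one>" using g xc(2) by simp
  moreover have "g \<otimes> x \<otimes> inv g \<noteq> \<one>" using conj_eq_iff(2)[OF g xc(1) one_closed] g xc by auto
  ultimately show "g \<otimes> x \<otimes> inv g \<in> involutions" using g xc(1) by simp
  show "g \<otimes> x \<otimes> inv g \<noteq> z" using conj_eq_iff(2)[OF g xc(1) z_closed] z_comm[OF g] g xc(1) x(2) by simp
qed

abbreviation conj_class :: "'a \<Rightarrow> 'a set" where
  "conj_class y \<equiv> (\<lambda>g. g \<otimes> y \<otimes> inv g) ` carrier G"

text \<open>The maximal measure is 2 |G|, whereas |C(y)| <= |G| / 3 bounds the measure of
  \<open>H\<close> by 4 |G| / 3.\<close>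

lemma large_class_notin_cd:
  assumes H: "subgroup H G" "card H \<le> 4" "y \<in> H" and cl: "3 \<le> card (conj_class y)"
  shows "H \<notin> cd_lattice G"
proof (rule notin_cd_latticeI[OF subgroup_self])
  let ?C = "centralizer G {y}"
  have yc: "y \<in> carrier G" by (rule subgroup.mem_carrier[OF H(1,3)])
  have "subgroup ?C G" using yc by (intro subgroup_centralizer) simp
  then have pos: "0 < card ?C" by (rule card_subgroup_pos)
  have "card (centralizer G H) \<le> card ?C" using H(3) by (intro card_mono finite_centralizer centralizer_antimono) simp
  then have "cd_measure G H \<le> 4 * card ?C" unfolding cd_measure_def using H(2) by (intro mult_mono) auto
  also have "\<dots> < 2 * (3 * card ?C)" using pos by simp
  also have "3 * card ?C \<le> order G" unfolding card_conj_class[OF yc, symmetric] using cl by (rule mult_le_mono1)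
  also have "2 * order G = cd_measure G (carrier G)"
    using cd_measure_carrier_center(1) center_eq z_ne by simp
  finally show "cd_measure G H < cd_measure G (carrier G)" by simp
qed

text \<open>The size of the class is a power of 2, hence at least 4. Outside the lattice are the
  trivial subgroup, the at least four subgroups generated by conjugates of t, and two four-groups
  containing z, which \<open>large_class_notin_cd\<close> excludes.\<close>

lemma large_involution_class_defect:
  assumes t: "t \<in> involutions" "t \<noteq> z" and cl: "3 \<le> card (conj_class t)"
  shows "7 \<le> cd_defect G"
proof -
  let ?I = "conj_class t"
  have tc: "t \<in> carrier G" using t by simp
  have I: "?I \<subseteq> involutions - {z}"
    by (intro image_subsetI DiffI conj_involution(1)[OF _ t]) (simp_all only: singleton_iff conj_involution(2)[OF _ t] not_False_eq_True)
  have fI: "finite ?I" using fin by simp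
  have "card ?I dvd 2 ^ n" by (rule dvdI[of _ _ "card (centralizer G {t})"]) (simp only: card_conj_class[OF tc] order_eq)
  then obtain i where i: "card ?I = 2 ^ i" using divides_primepow_nat[OF prime_p] by blast
  have "\<not> i \<le> 1"
  proof
    assume "i \<le> 1"
    then have "(2::nat) ^ i \<le> 2 ^ 1" by (intro power_increasing) auto
    then show False using i cl by simp
  qed
  then have "(2::nat) ^ 2 \<le> 2 ^ i" by (intro power_increasing) auto
  then have c4: "4 \<le> card ?I" using i by simp
  define E where "E s = {\<one>, z, s, s \<otimes> z}" for s
  have sE: "subgroup (E s) G" "card (E s) = 4" if "s \<in> ?I" for s
    unfolding E_def using klein(4,5)[OF z_involution _ _ z_comm, of s] that I by auto
  have out: "E s \<notin> cd_lattice G" if s: "s \<in> ?I" for s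
  proof (rule large_class_notin_cd[OF sE(1)[OF s]])
    show "card (E s) \<le> 4" using sE(2)[OF s] by simp
    show "s \<in> E s" by (simp add: E_def)
    obtain h where h: "h \<in> carrier G" "s = h \<otimes> t \<otimes> inv h" using s by blast
    have "?I \<subseteq> conj_class s"
    proof (rule image_subsetI)
      fix g assume g: "g \<in> carrier G"
      have "g \<otimes> t \<otimes> inv g = (g \<otimes> inv h) \<otimes> s \<otimes> inv (g \<otimes> inv h)"
        unfolding h(2) using g h(1) tc by (simp add: m_assoc inv_mult_group)
      then show "g \<otimes> t \<otimes> inv g \<in> conj_class s" using g h(1) by blast
    qed
    then have "card ?I \<le> card (conj_class s)" using fin by (intro card_mono) auto
    then show "3 \<le> card (conj_class s)" using cl by linarith
  qed
  have tI: "t \<in> ?I" using tc by (auto intro!: image_eqI[of _ _ \<one>])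
  \<comment> \<open>A four-group \<open>E t\<close> contains at most two conjugates of t, so another
    conjugate gives a second four-group.\<close>
  have "card (?I \<inter> E t) \<le> card {t, t \<otimes> z}" using I by (intro card_mono) (auto simp: E_def)
  also have "\<dots> \<le> 2" by (simp add: card_insert_if)
  finally have "card (?I \<inter> E t) < card ?I" using c4 by linarith
  then have "?I \<noteq> ?I \<inter> E t" by (metis less_irrefl)
  then obtain s where s: "s \<in> ?I" "s \<notin> E t" by blast
  let ?F = "cyc G ` ?I"
  have "inj_on (cyc G) ?I" using I by (intro inj_on_subset[OF inj_cyc_involutions]) blast
  then have cF: "card ?F = card ?I" by (rule card_image)
  have F2: "card H = 2 \<and> subgroup H G \<and> z \<notin> H" if H: "H \<in> ?F" for H
  proof -
    obtain x where x: "x \<in> ?I" "H = cyc G x" using H by blast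
    then have "x \<in> involutions" "x \<noteq> z" using I by auto
    then show ?thesis using x(2) card_cyc[of x] involution_ord[of x] subgroup_cyc[of x] cyc_involution[of x] z_ne by auto
  qed
  have "card ({{\<one>}} \<union> ?F \<union> {E t, E s}) = card {{\<one>}} + card ?F + card {E t, E s}"
  proof (rule card_Un3)
    show "finite ?F" using fI by blast
    show "{{\<one>}} \<inter> ?F = {}" using F2[of "{\<one>}"] by auto
    show "{{\<one>}} \<inter> {E t, E s} = {}" using sE(2)[OF tI] sE(2)[OF s(1)] by auto
    show "?F \<inter> {E t, E s} = {}" using F2[of "E t"] F2[of "E s"] by (auto simp: E_def)
  qed auto
  moreover have "E t \<noteq> E s" using s(2) by (auto simp: E_def)
  moreover have "card ({{\<one>}} \<union> ?F \<union> {E t, E s}) \<le> cd_defect G"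
  proof (rule card_le_cd_defect)
    fix H assume H: "H \<in> {{\<one>}} \<union> ?F \<union> {E t, E s}"
    then consider "H = {\<one>}" | "H \<in> ?F" | "H = E t" | "H = E s" by blast
    then show "subgroup H G" by cases (use triv_subgroup F2 sE(1)[OF tI] sE(1)[OF s(1)] in blast)+
    from H consider "H = {\<one>}" | "H \<in> ?F" | "H = E t" | "H = E s" by blast
    then show "H \<notin> cd_lattice G"
    proof cases
      case 1
      then show ?thesis using notin_cd z_ne by simp
    next
      case 2
      then show ?thesis using notin_cd F2 by blast
    qed (simp_all only: out[OF tI] out[OF s(1)] not_False_eq_True)
  qed
  ultimately show ?thesis using cF c4 by simp
qed

text \<open>\<open>large_involution_class_defect\<close> leaves exactly two conjugates. The
  centralizer of t then has index 2 and is normal, so the second conjugate commutes with t, and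
  \<open>commuting_involutions_defect\<close> only admits t z.\<close>

lemma involution_class_cases:
  assumes t: "t \<in> involutions" "t \<noteq> z" and le: "cd_defect G \<le> 6"
  shows "conj_class t = {t, t \<otimes> z}" "order G = 2 * card (centralizer G {t})"
proof -
  let ?C = "centralizer G {t}"
  have tc: "t \<in> carrier G" using t by simp
  have tI: "t \<in> conj_class t" using tc by (auto intro!: image_eqI[of _ _ \<one>])
  have sC: "subgroup ?C G" using tc by (intro subgroup_centralizer) simp
  have c2: "card (conj_class t) \<le> 2" using large_involution_class_defect[OF t] le by linarith
  have "t \<notin> center" using center_eq t by auto
  then have "?C \<noteq> carrier G" using centralizer_singleton_eq_carrier[OF tc] by blast
  then have "card ?C \<noteq> order G"
    unfolding order_def using card_subset_eq[OF fin subgroup.subset[OF sC]] by blast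
  then have "card (conj_class t) \<noteq> 1" using card_conj_class[OF tc] by auto
  moreover have "card (conj_class t) \<noteq> 0" using order_pos card_conj_class[OF tc] by auto
  ultimately have c: "card (conj_class t) = 2" using c2 by linarith
  then show o: "order G = 2 * card ?C" using card_conj_class[OF tc] by simp
  have fI: "finite (conj_class t)" using fin by simp
  obtain s where s: "s \<in> conj_class t" "s \<noteq> t"
    using c by (metis card_2_iff insertCI)
  obtain h where h: "h \<in> carrier G" "s = h \<otimes> t \<otimes> inv h" using s(1) by blast
  have tC: "t \<in> ?C" using tc by (simp add: centralizer_def)
  have "s \<in> ?C" using index_p_normal[OF sC o inv_closed[OF h(1)] tC] h by simp
  then have "t \<otimes> s = s \<otimes> t" by (auto simp: centralizer_def)
  then have "s = t \<otimes> z"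
    using commuting_involutions_defect[OF t, of s] conj_involution[OF h(1) t] s(2) h(2) le by fastforce
  then have "{t, t \<otimes> z} \<subseteq> conj_class t" "card {t, t \<otimes> z} = 2" using s tI by auto
  then show "conj_class t = {t, t \<otimes> z}" using card_subset_eq[OF fI] c by metis
qed

end

context two_group_center_two
begin

text \<open>As t z is conjugate to t, a square root y of t has a conjugate y' with square t z. The
  elements 1, t, t z, y, y z, y', y' z generate seven different subgroups without z.\<close>

lemma square_not_involution:
  assumes t: "t \<in> involutions" "t \<noteq> z" and le: "cd_defect G \<le> 6" and y: "y \<in> carrier G"
  shows "y \<otimes> y \<noteq> t"
proof
  assume yt: "y \<otimes> y = t"
  have tc: "t \<in> carrier G" "t \<noteq> \<one>" "t \<otimes> t = \<one>" using t by auto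
  have "t \<otimes> z \<in> conj_class t" using involution_class_cases(1)[OF t le] by simp
  then obtain g where g: "g \<in> carrier G" "t \<otimes> z = g \<otimes> t \<otimes> inv g" by blast
  let ?y = "g \<otimes> y \<otimes> inv g"
  have y'c: "?y \<in> carrier G" using g y by simp
  have "?y \<otimes> ?y = g \<otimes> (y \<otimes> y) \<otimes> inv g" using g(1) y by (simp add: m_assoc)
  then have y't: "?y \<otimes> ?y = t \<otimes> z" using yt g(2) by simp
  have tz: "t \<otimes> z \<in> involutions" "t \<otimes> z \<noteq> z" by (rule mult_z_involution[OF t])+
  have root: "s \<in> cyc G u" "z \<notin> cyc G u" "r \<in> involutions \<Longrightarrow> r \<in> cyc G u \<Longrightarrow> r = s"
    if u: "u \<in> carrier G" "u \<otimes> u = s" and s: "s \<in> involutions" "s \<noteq> z" for u s r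
  proof -
    have uc: "u \<in> cyc G u" by (rule self_in_cyc[OF u(1)])
    show su: "s \<in> cyc G u" using subgroup.m_closed[OF subgroup_cyc[OF u(1)] uc uc] u(2) by simp
    show "z \<notin> cyc G u" using cyc_involution_unique[OF u(1) s(1) su z_involution] s(2) by blast
    show "r \<in> involutions \<Longrightarrow> r \<in> cyc G u \<Longrightarrow> r = s"
      by (rule cyc_involution_unique[OF u(1) _ _ s(1) su])
  qed
  have twin: "(u \<otimes> z) \<otimes> (u \<otimes> z) = u \<otimes> u" if u: "u \<in> carrier G" for u
  proof -
    have "(u \<otimes> z) \<otimes> (u \<otimes> z) = u \<otimes> (z \<otimes> u) \<otimes> z" using u by (simp add: m_assoc)
    also have "\<dots> = u \<otimes> u" unfolding z_comm[OF u] using u by (simp flip: m_assoc)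
    finally show ?thesis .
  qed
  have ne: "cyc G u \<noteq> cyc G (u \<otimes> z)" if u: "u \<in> carrier G" "u \<otimes> u = s" and s: "s \<in> involutions" "s \<noteq> z" for u s
  proof
    assume "cyc G u = cyc G (u \<otimes> z)"
    then have "u \<otimes> z \<in> cyc G u" using self_in_cyc[of "u \<otimes> z"] u(1) by simp
    then have "z \<in> cyc G u" using subgroup_cancel(1)[OF subgroup_cyc[OF u(1)] self_in_cyc[OF u(1)] z_closed] by simp
    then show False using root(2)[OF u s] by simp
  qed
  let ?A = "{{\<one>}, {\<one>, t}, {\<one>, t \<otimes> z}}"
  let ?B = "{cyc G y, cyc G (y \<otimes> z)}" and ?D = "{cyc G ?y, cyc G (?y \<otimes> z)}"
  have tne: "t \<noteq> t \<otimes> z" using tc z_ne by simp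
  have yz: "y \<otimes> z \<in> carrier G" "(y \<otimes> z) \<otimes> (y \<otimes> z) = t" using y twin[OF y] yt by simp_all
  have y'z: "?y \<otimes> z \<in> carrier G" "(?y \<otimes> z) \<otimes> (?y \<otimes> z) = t \<otimes> z" using y'c twin[OF y'c] y't by simp_all
  have sqA: "u \<otimes> u = \<one>" if "u \<in> H" "H \<in> ?A" for u H using that tc tz by auto
  have B: "subgroup H G \<and> z \<notin> H \<and> t \<in> H \<and> t \<otimes> z \<notin> H \<and> H \<notin> ?A" if H: "H \<in> ?B" for H
  proof -
    from H consider "H = cyc G y" | "H = cyc G (y \<otimes> z)" by blast
    then obtain u where u: "u \<in> carrier G" "u \<otimes> u = t" "H = cyc G u" using y yt yz by metis
    have "H \<notin> ?A" using sqA[OF self_in_cyc[OF u(1)]] u(2,3) tc(2) by metis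
    then show ?thesis using root(1,2)[OF u(1,2) t] root(3)[OF u(1,2) t tz(1)] tne subgroup_cyc[OF u(1)] u(3) by metis
  qed
  have D: "subgroup H G \<and> z \<notin> H \<and> t \<otimes> z \<in> H \<and> H \<notin> ?A" if H: "H \<in> ?D" for H
  proof -
    from H consider "H = cyc G ?y" | "H = cyc G (?y \<otimes> z)" by blast
    then obtain u where u: "u \<in> carrier G" "u \<otimes> u = t \<otimes> z" "H = cyc G u" using y'c y't y'z by metis
    have "t \<otimes> z \<noteq> \<one>" using tz(1) by simp
    then have "H \<notin> ?A" using sqA[OF self_in_cyc[OF u(1)]] u(2,3) by metis
    then show ?thesis using root(1,2)[OF u(1,2) tz] subgroup_cyc[OF u(1)] u(3) by metis
  qed
  have "card (?A \<union> ?B \<union> ?D) = card ?A + card ?B + card ?D"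
  proof (rule card_Un3)
    show "?A \<inter> ?B = {}" using B by blast
    show "?A \<inter> ?D = {}" using D by blast
    show "?B \<inter> ?D = {}" using B D by blast
  qed auto
  moreover have "card ?A = 3" using tc tz tne by (simp add: doubleton_eq_iff)
  moreover have "card ?B = 2" using ne[OF y yt t] by simp
  moreover have "card ?D = 2" using ne[OF y'c y't tz] by simp
  moreover have "card (?A \<union> ?B \<union> ?D) \<le> cd_defect G"
  proof (rule card_le_cd_defect)
    have A: "subgroup H G \<and> z \<notin> H" if "H \<in> ?A" for H
    proof -
      have "subgroup {\<one>, t} G" "subgroup {\<one>, t \<otimes> z} G"
        using subgroup_cyc[OF tc(1)] subgroup_cyc[of "t \<otimes> z"] cyc_involution[OF t(1)] cyc_involution[OF tz(1)] tc(1) by simp_all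
      then show ?thesis using that triv_subgroup z_ne t(2) tz(2) by auto
    qed
    fix H assume "H \<in> ?A \<union> ?B \<union> ?D"
    then have "subgroup H G \<and> z \<notin> H" using A B D by (elim UnE) blast+
    then show "subgroup H G" "H \<notin> cd_lattice G" using notin_cd by blast+
  qed
  ultimately show False using le by linarith
qed

end

text \<open>These assumptions are contradictory.  They force the centralizer \<open>C\<close> of \<open>t\<close> to have order 16 and
  \<open>y\<^sup>2 = z\<close> for all \<open>y \<in> C\<close> not in \<open>E = {1, z, t, t z}\<close>.  Conjugation by some \<open>g \<notin> C\<close> either moves an element of \<open>C\<close> out of its coset
  of the center, and then many cyclic subgroups of order 4 are outside the lattice, or it yields
  involutions outside of \<open>C\<close>.\<close>

locale two_group_center_two_small_defect = two_group_center_two +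
  fixes t :: 'a
  assumes t: "t \<in> involutions" "t \<noteq> z" and le: "cd_defect G \<le> 6"
begin

abbreviation C :: "'a set" where "C \<equiv> centralizer G {t}"

abbreviation E :: "'a set" where "E \<equiv> {\<one>, z, t, t \<otimes> z}"

lemma t_closed [simp]: "t \<in> carrier G" and t_ne: "t \<noteq> \<one>" and t_sq [simp]: "t \<otimes> t = \<one>"
  using t(1) by auto

lemma subgroup_C: "subgroup C G"
  by (intro subgroup_centralizer) simp

lemma mem_C_iff: "y \<in> C \<longleftrightarrow> y \<in> carrier G \<and> y \<otimes> t = t \<otimes> y"
  by (simp add: centralizer_def)

lemma order_eq_C: "order G = 2 * card C"
  by (rule involution_class_cases(2)[OF t le])

lemma tz: "t \<otimes> z \<in> involutions" "t \<otimes> z \<noteq> z" "t \<noteq> t \<otimes> z"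
  using mult_z_involution[OF t] z_ne by simp_all

lemma subgroup_E: "subgroup E G" and card_E: "card E = 4"
  by (rule klein(4,5)[OF z_involution t z_comm[OF t_closed]])+

lemma E_subset_C: "E \<subseteq> C"
  using z_comm[OF t_closed] by (auto simp: mem_C_iff m_assoc)

lemma E_central: "\<lbrakk>e \<in> E; y \<in> C\<rbrakk> \<Longrightarrow> e \<otimes> y = y \<otimes> e"
proof -
  assume e: "e \<in> E" and y: "y \<in> C"
  have yc: "y \<in> carrier G" "y \<otimes> t = t \<otimes> y" using y by (simp_all add: mem_C_iff)
  have "t \<otimes> z \<otimes> y = y \<otimes> (t \<otimes> z)" using yc z_comm[OF yc(1)] by (metis m_assoc t_closed z_closed)
  then show ?thesis using e yc z_comm[OF yc(1)] by auto
qed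

lemma sq_one_imp_E: "\<lbrakk>y \<in> C; y \<otimes> y = \<one>\<rbrakk> \<Longrightarrow> y \<in> E"
proof (rule ccontr)
  assume y: "y \<in> C" "y \<otimes> y = \<one>" and no: "y \<notin> E"
  have "t \<otimes> y = y \<otimes> t" "y \<in> carrier G" using y(1) by (simp_all add: mem_C_iff)
  then have "7 \<le> cd_defect G" using commuting_involutions_defect[OF t, of y] y(2) no by simp
  then show False using le by simp
qed

lemma sq_mem_E: "\<lbrakk>y \<in> C; y \<otimes> y \<in> E; y \<notin> E\<rbrakk> \<Longrightarrow> y \<otimes> y = z"
  using sq_one_imp_E[of y] square_not_involution[OF t le, of y] square_not_involution[OF tz(1,2) le, of y]
  by (auto simp: mem_C_iff)

text \<open>The abelian subgroup A of index 2 in C satisfies |A|^2 <= 2 |G| = 8 |A|, while the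
  nonabelian C with the central subgroup E of order 4 has more than 8 elements. This leaves |A| = 8.
  For y outside E, y^4 turns out to be 1 or t; as t and t z have no square roots, y^2 lies in E and
  must be z.\<close>

lemma centralizer_order_16:
  shows "card C = 16" "\<exists>x\<in>C. \<exists>y\<in>C. x \<otimes> y \<noteq> y \<otimes> x" "\<And>y. \<lbrakk>y \<in> C; y \<notin> E\<rbrakk> \<Longrightarrow> y \<otimes> y = z"
proof -
  have pow: "(2::nat) ^ n = 2 * 2 ^ (n - 1)" using n4 by (simp flip: power_Suc)
  then have cC: "card C = 2 ^ (n - 1)" using order_eq_C order_eq by simp
  have "(2::nat) ^ 3 \<le> 2 ^ (n - 1)" using n4 by (intro power_increasing) auto
  then have C8: "8 \<le> card C" using cC by simp
  have sq: "card A * card A \<le> 4 * card C" if "subgroup A G" "\<And>x y. \<lbrakk>x \<in> A; y \<in> A\<rbrakk> \<Longrightarrow> x \<otimes> y = y \<otimes> x" for A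
    using card_sq_commutative_le[OF that carrier_in_cd] cd_measure_carrier_center(1) center_eq z_ne order_eq_C by simp
  show nonab: "\<exists>x\<in>C. \<exists>y\<in>C. x \<otimes> y \<noteq> y \<otimes> x"
  proof (rule ccontr)
    assume "\<not> ?thesis"
    then have "card C * card C \<le> 4 * card C" using sq[OF subgroup_C] by blast
    then show False using C8 by simp
  qed
  have "\<not> card C \<le> 8"
  proof
    assume "card C \<le> 8"
    then have "card C \<le> 2 * card E" using card_E by simp
    moreover have "E \<subseteq> centralizer G C"
    proof
      fix e assume e: "e \<in> E"
      then have "e \<in> carrier G" using E_subset_C mem_C_iff by blast
      then show "e \<in> centralizer G C" using E_central[OF e] unfolding centralizer_def by blast
    qed
    ultimately have "\<forall>x\<in>C. \<forall>y\<in>C. x \<otimes> y = y \<otimes> x"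
      using commute_if_central_index_le_p[OF subgroup_E _ subgroup_C E_subset_C] by blast
    then show False using nonab by blast
  qed
  have n3: "n \<ge> 3" using n4 by simp
  have "y \<in> E" if "y \<in> C" "y \<otimes> y \<in> {\<one>, t}" for y
    using sq_one_imp_E[OF that(1)] square_not_involution[OF t le, of y] that by (auto simp: mem_C_iff)
  from unique_involution_mod_in_centralizer[OF n3 t(1) order_eq_C z_center this] obtain A where
    A: "subgroup A G" "A \<subseteq> C" "\<And>x y. \<lbrakk>x \<in> A; y \<in> A\<rbrakk> \<Longrightarrow> x \<otimes> y = y \<otimes> x"
    "A = C \<or> card C = 2 * card A \<and> (\<forall>x\<in>C - A. x \<otimes> x \<in> A \<and> (\<forall>a\<in>A. \<exists>s\<in>{\<one>, t}. a \<otimes> x = x \<otimes> inv a \<otimes> s))"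
    by blast
  have "A \<noteq> C" using A(3) nonab by blast
  then have A2: "card C = 2 * card A" "\<And>x. x \<in> C - A \<Longrightarrow> x \<otimes> x \<in> A"
    "\<And>x a. \<lbrakk>x \<in> C - A; a \<in> A\<rbrakk> \<Longrightarrow> \<exists>s\<in>{\<one>, t}. a \<otimes> x = x \<otimes> inv a \<otimes> s" using A(4) by blast+
  have "card A * card A \<le> 8 * card A" using sq[OF A(1,3)] A2(1) by simp
  then have A8: "card A \<le> 8" using card_subgroup_pos[OF A(1)] by simp
  obtain i where i: "card A = 2 ^ i" using card_subgroup[OF A(1)] by blast
  have "\<not> i \<le> 2"
  proof
    assume "i \<le> 2"
    then have "(2::nat) ^ i \<le> 2 ^ 2" by (intro power_increasing) auto
    then show False using \<open>\<not> card C \<le> 8\<close> A2(1) i by simp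
  qed
  then have "(2::nat) ^ 3 \<le> 2 ^ i" by (intro power_increasing) auto
  then have cA: "card A = 8" using i A8 by simp
  then show "card C = 16" using A2(1) by simp
  have AE: "a \<otimes> a \<in> {\<one>, t}" if a: "a \<in> A" "x \<in> C - A" "a \<otimes> x = x \<otimes> a" for a x
  proof -
    have ac: "a \<in> carrier G" "x \<in> carrier G" using subgroup.mem_carrier[OF A(1) a(1)] a(2) by (auto simp: centralizer_def)
    obtain s where s: "s \<in> {\<one>, t}" "a \<otimes> x = x \<otimes> inv a \<otimes> s" using A2(3)[OF a(2,1)] by blast
    have sc: "s \<in> carrier G" using s(1) by auto
    have "x \<otimes> a = x \<otimes> (inv a \<otimes> s)" using s(2) a(3) ac sc by (simp add: m_assoc)
    then have "a = inv a \<otimes> s" using ac sc by simp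
    then have "a \<otimes> a = a \<otimes> (inv a \<otimes> s)" by simp
    also have "\<dots> = s" using ac sc by (simp flip: m_assoc)
    finally show ?thesis using s(1) by simp
  qed
  \<comment> \<open>An element of E outside A commutes with all of A, which would put A into
    E.\<close>
  have EA: "e \<in> A" if e: "e \<in> E" for e
  proof (rule ccontr)
    assume "e \<notin> A"
    then have eA: "e \<in> C - A" using e E_subset_C by blast
    have "a \<in> E" if a: "a \<in> A" for a
    proof -
      have aC: "a \<in> C" using a A(2) by blast
      have "a \<otimes> a \<in> {\<one>, t}" by (rule AE[OF a eA E_central[OF e aC, symmetric]])
      then show ?thesis
        using sq_one_imp_E[OF aC] square_not_involution[OF t le, of a] aC by (auto simp: mem_C_iff)
    qed
    then have "card A \<le> card E" by (intro card_mono) auto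
    then show False using cA card_E by simp
  qed
  show "y \<otimes> y = z" if y: "y \<in> C" "y \<notin> E" for y
  proof (rule sq_mem_E[OF y(1) _ y(2)])
    have yc: "y \<in> carrier G" using y(1) by (simp add: mem_C_iff)
    have yyC: "y \<otimes> y \<in> C" by (rule subgroup.m_closed[OF subgroup_C y(1,1)])
    have "(y \<otimes> y) \<otimes> (y \<otimes> y) \<in> {\<one>, t}"
    \<comment> \<open>A is not cyclic, as it contains z and t, so its elements have order at most 4.
      Outside A, the square of y lies in A and commutes with y, and \<open>AE\<close> applies to
      it.\<close>
    proof (cases "y \<in> A")
      case True
      have sub: "cyc G y \<subseteq> A" by (rule cyc_subset[OF A(1) True])
      have "card (cyc G y) \<noteq> card A"
      proof
        assume "card (cyc G y) = card A"
        then have "cyc G y = A" using card_subset_eq[OF finite_subgroup[OF A(1)] sub] by blast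
        then have "z \<in> cyc G y" "t \<in> cyc G y" using EA by auto
        then show False using cyc_involution_unique[OF yc z_involution _ t(1)] t(2) by blast
      qed
      then have "ord y < 8" using card_mono[OF finite_subgroup[OF A(1)] sub] cA card_cyc[OF yc] by simp
      moreover obtain j where j: "ord y = 2 ^ j" using ord_eq_pow[OF yc] by blast
      ultimately have "(2::nat) ^ j < 2 ^ 3" by simp
      then have "j < 3" using power_less_imp_less_exp[of "2::nat" j 3] by simp
      then have "ord y dvd 2 ^ 2" unfolding j by (intro le_imp_power_dvd) simp
      then have "y [^] (2 + 2::nat) = \<one>" using pow_eq_id[OF yc, of 4] by simp
      then show ?thesis using pow2[OF yc] by (simp only: nat_pow_mult[OF yc, symmetric] insert_iff simp_thms)
    next
      case False
      then have yA: "y \<in> C - A" using y(1) by blast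
      show ?thesis by (rule AE[OF A2(2)[OF yA] yA]) (simp add: m_assoc yc)
    qed
    then show "y \<otimes> y \<in> E"
      using sq_one_imp_E[OF yyC] square_not_involution[OF t le, of "y \<otimes> y"] yc by auto
  qed
qed

text \<open>If y were central in C, an x outside E and y E would have x^2 = y^2 = z and hence (x
  y)^2 = 1, so that x y lies in E, which contradicts the choice of x. For x not commuting with y,
  all of x^2, y^2 and (x y)^2 equal z, as in the quaternion group, and x conjugates y to y
  z.\<close>

lemma conj_in_C:
  assumes y: "y \<in> C" "y \<notin> E"
  shows "\<exists>x\<in>C. x \<otimes> y \<otimes> inv x = y \<otimes> z"
proof -
  have yc: "y \<in> carrier G" using y(1) by (simp add: mem_C_iff)
  have yy: "y \<otimes> y = z" by (rule centralizer_order_16(3)[OF y])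
  have "\<exists>x\<in>C. x \<otimes> y \<noteq> y \<otimes> x"
  proof (rule ccontr)
    assume "\<not> ?thesis"
    then have comm: "x \<otimes> y = y \<otimes> x" if "x \<in> C" for x using that by blast
    have "card (E \<union> (\<lambda>e. y \<otimes> e) ` E) \<le> card E + card ((\<lambda>e. y \<otimes> e) ` E)" by (rule card_Un_le)
    also have "\<dots> \<le> card E + card E" by (intro add_left_mono card_image_le) simp
    finally have "card (E \<union> (\<lambda>e. y \<otimes> e) ` E) < card C" using card_E centralizer_order_16(1) by simp
    then have "\<not> C \<subseteq> E \<union> (\<lambda>e. y \<otimes> e) ` E" using card_mono[of "E \<union> (\<lambda>e. y \<otimes> e) ` E" C] by auto
    then obtain x where x: "x \<in> C" "x \<notin> E" "x \<notin> (\<lambda>e. y \<otimes> e) ` E" by blast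
    have xc: "x \<in> carrier G" using x(1) by (simp add: mem_C_iff)
    have xx: "x \<otimes> x = z" by (rule centralizer_order_16(3)[OF x(1,2)])
    have "(x \<otimes> y) \<otimes> (x \<otimes> y) = x \<otimes> (y \<otimes> x) \<otimes> y" using xc yc by (simp add: m_assoc)
    also have "\<dots> = (x \<otimes> x) \<otimes> (y \<otimes> y)" unfolding comm[OF x(1), symmetric] using xc yc by (simp add: m_assoc)
    finally have "(x \<otimes> y) \<otimes> (x \<otimes> y) = \<one>" using xx yy by simp
    then have "x \<otimes> y \<in> E" using sq_one_imp_E subgroup.m_closed[OF subgroup_C x(1) y(1)] by blast
    then have zE: "z \<otimes> (x \<otimes> y) \<in> E" using subgroup.m_closed[OF subgroup_E, of z "x \<otimes> y"] by blast
    have "y \<otimes> (z \<otimes> (x \<otimes> y)) = (y \<otimes> z) \<otimes> (y \<otimes> x)" unfolding comm[OF x(1)] using xc yc by (simp add: m_assoc)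
    also have "\<dots> = z \<otimes> (y \<otimes> y) \<otimes> x" using xc yc z_comm[OF yc] by (metis m_assoc m_closed z_closed)
    finally have "x = y \<otimes> (z \<otimes> (x \<otimes> y))" using yy xc by simp
    then show False using x(3) zE by blast
  qed
  then obtain x where x: "x \<in> C" "x \<otimes> y \<noteq> y \<otimes> x" by blast
  have xc: "x \<in> carrier G" using x(1) by (simp add: mem_C_iff)
  have "x \<notin> E" using E_central[of x y] y(1) x(2) by blast
  then have xx: "x \<otimes> x = z" by (rule centralizer_order_16(3)[OF x(1)])
  have "x \<otimes> y \<notin> E"
  proof
    assume "x \<otimes> y \<in> E"
    then have "x \<otimes> y \<otimes> y = y \<otimes> (x \<otimes> y)" by (rule E_central[OF _ y(1)])
    then have "(x \<otimes> y) \<otimes> y = (y \<otimes> x) \<otimes> y" using xc yc by (simp add: m_assoc)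
    then show False using x(2) xc yc by simp
  qed
  then have xyxy: "(x \<otimes> y) \<otimes> (x \<otimes> y) = z"
    using centralizer_order_16(3) subgroup.m_closed[OF subgroup_C x(1) y(1)] by blast
  have r: "y \<otimes> (y \<otimes> w) = z \<otimes> w" "x \<otimes> (x \<otimes> w) = z \<otimes> w" "z \<otimes> (z \<otimes> w) = w"
    "x \<otimes> (z \<otimes> w) = z \<otimes> (x \<otimes> w)" if w: "w \<in> carrier G" for w
    using xc yc w xx yy z_comm[OF xc] by (simp_all flip: m_assoc)
  have "(x \<otimes> y) \<otimes> (x \<otimes> y) \<otimes> (y \<otimes> x) = x \<otimes> y"
    using xc yc r xx z_comm[OF yc] z_comm[OF xc] by (simp add: m_assoc)
  then have "x \<otimes> y = z \<otimes> (y \<otimes> x)" using xyxy by simp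
  also have "\<dots> = (y \<otimes> z) \<otimes> x" using xc yc z_comm[OF yc] by (simp flip: m_assoc)
  finally have "x \<otimes> y \<otimes> inv x = y \<otimes> z" using conj_eq_iff(2)[OF xc yc, of "y \<otimes> z"] yc by simp
  then show ?thesis using x(1) by blast
qed

lemma contradiction: False
proof -
  have "t \<otimes> z \<in> conj_class t" using involution_class_cases(1)[OF t le] by simp
  then obtain g0 where g0: "g0 \<in> carrier G" "g0 \<otimes> t \<otimes> inv g0 = t \<otimes> z" by auto
  have outside: "g \<notin> C" if g: "g \<in> carrier G" "g \<otimes> t \<otimes> inv g = t \<otimes> z" for g
  proof
    assume "g \<in> C"
    then have "g \<otimes> t \<otimes> inv g = t" using conj_eq_iff(2)[OF g(1) t_closed t_closed] by (simp add: mem_C_iff)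
    then show False using g(2) tz(3) by simp
  qed
  note idx = index2_mult_iff[OF subgroup_C order_eq_C]
  have C16: "card C = 16" and sqz: "\<And>y. \<lbrakk>y \<in> C; y \<notin> E\<rbrakk> \<Longrightarrow> y \<otimes> y = z"
    using centralizer_order_16 by blast+
  have Cc: "y \<in> carrier G" if "y \<in> C" for y using that by (simp add: mem_C_iff)
  have conj_mult: "g0 \<otimes> (x \<otimes> y) \<otimes> inv g0 = (g0 \<otimes> x \<otimes> inv g0) \<otimes> (g0 \<otimes> y \<otimes> inv g0)"
    if "x \<in> carrier G" "y \<in> carrier G" for x y using that g0(1) by (simp add: m_assoc)
  have conj_z: "g0 \<otimes> z \<otimes> inv g0 = z" using conj_eq_iff(2)[OF g0(1) z_closed z_closed] z_comm[OF g0(1)] by simp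
  \<comment> \<open>\<open>F\<close> consists of the elements of C that conjugation by
    \<open>g0\<close> keeps in their coset of the center.\<close>
  define F where "F = {y \<in> C. g0 \<otimes> y \<otimes> inv g0 \<in> {y, y \<otimes> z}}"
  show False
  proof (cases "F = C")
    case False
    have FC: "F \<subseteq> C" by (auto simp: F_def)
    have sF: "subgroup F G"
    proof (rule subgroup_finiteI)
      show "F \<subseteq> carrier G" using FC Cc by blast
      show "\<one> \<in> F" using subgroup.one_closed[OF subgroup_C] g0(1) by (simp add: F_def)
      fix x y assume xy: "x \<in> F" "y \<in> F"
      then have c: "x \<in> carrier G" "y \<in> carrier G" and C: "x \<in> C" "y \<in> C" using FC Cc by blast+
      have "(x \<otimes> z) \<otimes> y = x \<otimes> y \<otimes> z" "x \<otimes> (y \<otimes> z) = x \<otimes> y \<otimes> z" "(x \<otimes> z) \<otimes> (y \<otimes> z) = x \<otimes> y"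
        using c z_comm[OF c(2)] by (simp_all add: m_assoc flip: m_assoc[of z y z])
      then have "g0 \<otimes> (x \<otimes> y) \<otimes> inv g0 \<in> {x \<otimes> y, x \<otimes> y \<otimes> z}"
        unfolding conj_mult[OF c] using xy unfolding F_def by auto
      then show "x \<otimes> y \<in> F" using subgroup.m_closed[OF subgroup_C C] unfolding F_def by blast
    qed
    have EF: "e \<in> F" if "e \<in> E" for e
    proof -
      have tF: "t \<in> F" using g0(2) E_subset_C by (simp add: F_def)
      have zF: "z \<in> F" using conj_z E_subset_C by (simp add: F_def)
      show ?thesis using that tF zF subgroup.one_closed[OF sF] subgroup.m_closed[OF sF tF zF] by blast
    qed
    have fC: "finite C" by (rule finite_subgroup[OF subgroup_C])
    have "card F < card C" using False FC fC by (intro psubset_card_mono) auto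
    then have F16: "card F < 2 ^ 4" using C16 by simp
    obtain i where i: "card F = 2 ^ i" using card_subgroup[OF sF] by blast
    have "i < 4" using F16 power_less_imp_less_exp[of "2::nat" i 4] i by simp
    then have "card F \<le> 2 ^ 3" unfolding i by (intro power_increasing) auto
    then have d8: "8 \<le> card (C - F)" using card_Diff_subset[OF finite_subset[OF FC fC] FC] C16 by simp
    have cyc4: "card (cyc G y) = 4" "z \<in> cyc G y" if y: "y \<in> C - F" for y
    proof -
      have yc: "y \<in> carrier G" using y Cc by blast
      have yy: "y \<otimes> y = z" using sqz y EF by blast
      show "z \<in> cyc G y" using subgroup.m_closed[OF subgroup_cyc[OF yc] self_in_cyc[OF yc] self_in_cyc[OF yc]] yy by simp
      obtain j where j: "ord y = 2 ^ j" using ord_eq_pow[OF yc] by blast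
      have "y [^] (2 + 2::nat) = z \<otimes> z" using pow2[OF yc] yy by (simp only: nat_pow_mult[OF yc, symmetric])
      then have "ord y dvd 4" using pow_eq_id[OF yc, of 4] by simp
      moreover have "\<not> ord y dvd 2" using pow_eq_id[OF yc, of 2] pow2[OF yc] yy z_ne by simp
      ultimately have "ord y = 4" using j dvd_power_iff_le[of "2::nat" j 2] dvd_power_iff_le[of "2::nat" j 1] by (cases "j = 2") auto
      then show "card (cyc G y) = 4" using card_cyc[OF yc] by simp
    qed
    have out: "subgroup (cyc G y) G" "cyc G y \<notin> cd_lattice G" if y: "y \<in> C - F" for y
    proof -
      have yc: "y \<in> carrier G" using y Cc by blast
      show s: "subgroup (cyc G y) G" by (rule subgroup_cyc[OF yc])
      have "y \<notin> E" using EF y by blast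
      then obtain x where x: "x \<in> C" "x \<otimes> y \<otimes> inv x = y \<otimes> z" using conj_in_C y by blast
      \<comment> \<open>y z is a conjugate by \<open>conj_in_C\<close>, and the third conjugate is
        different because y is not in \<open>F\<close>. A class of size 3 keeps <y> out of the
        lattice although <y> contains z.\<close>
      have "{y, y \<otimes> z, g0 \<otimes> y \<otimes> inv g0} \<subseteq> conj_class y"
      proof (intro insert_subsetI empty_subsetI)
        show "y \<in> conj_class y" using yc by (auto intro!: image_eqI[of _ _ \<one>])
        show "y \<otimes> z \<in> conj_class y" using x Cc by (auto intro!: image_eqI[of _ _ x])
        show "g0 \<otimes> y \<otimes> inv g0 \<in> conj_class y" using g0(1) by blast
      qed
      then have "card {y, y \<otimes> z, g0 \<otimes> y \<otimes> inv g0} \<le> card (conj_class y)" using fin by (intro card_mono) auto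
      moreover have "card {y, y \<otimes> z, g0 \<otimes> y \<otimes> inv g0} = 3" using y yc z_ne by (auto simp: F_def)
      ultimately show "cyc G y \<notin> cd_lattice G"
        using large_class_notin_cd[OF s _ self_in_cyc[OF yc]] cyc4(1)[OF y] by simp
    qed
    \<comment> \<open>Each <y> has only two elements besides 1 and z, so the at least eight elements
      of C - F need at least four such subgroups. With the trivial subgroup, <t> and <t z> there are
      seven.\<close>
    let ?I = "cyc G ` (C - F)" and ?T = "{{\<one>}, {\<one>, t}, {\<one>, t \<otimes> z}}"
    have "C - F \<subseteq> (\<Union>H\<in>?I. H - {\<one>, z})"
    proof
      fix y assume y: "y \<in> C - F"
      then have "y \<in> cyc G y - {\<one>, z}" using self_in_cyc Cc EF by auto
      then show "y \<in> (\<Union>H\<in>?I. H - {\<one>, z})" using y by blast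
    qed
    then have "card (C - F) \<le> card (\<Union>H\<in>?I. H - {\<one>, z})"
      using fC finite_subgroup out(1) by (intro card_mono) auto
    also have "\<dots> \<le> (\<Sum>H\<in>?I. card (H - {\<one>, z}))" by (rule card_UN_le) (use fC in auto)
    also have "\<dots> \<le> (\<Sum>H\<in>?I. 2)"
    proof (rule sum_mono)
      fix H assume "H \<in> ?I"
      then obtain y where y: "y \<in> C - F" "H = cyc G y" by blast
      have "{\<one>, z} \<subseteq> H" using y cyc4(2) subgroup.one_closed[OF out(1)] by blast
      then show "card (H - {\<one>, z}) \<le> 2" using cyc4(1)[OF y(1)] y(2) z_ne by (simp add: card_Diff_subset)
    qed
    finally have I4: "4 \<le> card ?I" using d8 by simp
    have disj: "?T \<inter> ?I = {}"
    proof -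
      have "card {\<one>, x} \<noteq> 4" for x :: 'a by (cases "x = \<one>") auto
      then have "card H \<noteq> 4" if "H \<in> ?T" for H using that by auto
      moreover have "card H = 4" if "H \<in> ?I" for H using that cyc4(1) by blast
      ultimately show ?thesis by blast
    qed
    have fI: "finite ?I" using fC by blast
    have "card (?T \<union> ?I) = card ?T + card ?I" by (rule card_Un_disjoint[OF _ fI disj]) simp
    moreover have "card ?T = 3" using t_ne tz z_ne by (auto simp: doubleton_eq_iff)
    moreover have "card (?T \<union> ?I) \<le> cd_defect G"
    proof (rule card_le_cd_defect)
      have T: "subgroup H G \<and> z \<notin> H" if "H \<in> ?T" for H
      proof -
        have "subgroup {\<one>, t} G" "subgroup {\<one>, t \<otimes> z} G"
          using subgroup_cyc[of t] subgroup_cyc[of "t \<otimes> z"] cyc_involution[OF t(1)] cyc_involution[OF tz(1)] by simp_all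
        then show ?thesis using that triv_subgroup z_ne t(2) tz(2) by auto
      qed
      fix H assume H: "H \<in> ?T \<union> ?I"
      then show "subgroup H G" using T out(1) by blast
      show "H \<notin> cd_lattice G" using H T out(2) notin_cd by blast
    qed
    ultimately show False using I4 le by linarith
  next
    case True
    have flip: "g0 \<otimes> y \<otimes> inv g0 = y \<or> g0 \<otimes> y \<otimes> inv g0 = y \<otimes> z" if "y \<in> C" for y
      using True that unfolding F_def by blast
    have "\<not> C \<subseteq> E" using card_mono[of E C] card_E C16 by auto
    then obtain y0 where y0: "y0 \<in> C" "y0 \<notin> E" by blast
    have y0c: "y0 \<in> carrier G" by (rule Cc[OF y0(1)])
    \<comment> \<open>If \<open>g0\<close> moves y0 to y0 z, it fixes t y0, because it also moves t
      to t z.\<close>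
    have "\<exists>w\<in>C. w \<notin> E \<and> g0 \<otimes> w \<otimes> inv g0 = w"
    proof (cases "g0 \<otimes> y0 \<otimes> inv g0 = y0")
      case True
      then show ?thesis using y0 by blast
    next
      case False
      then have fy: "g0 \<otimes> y0 \<otimes> inv g0 = y0 \<otimes> z" using flip[OF y0(1)] by blast
      have tE: "t \<in> E" by simp
      have "g0 \<otimes> (t \<otimes> y0) \<otimes> inv g0 = (t \<otimes> z) \<otimes> (y0 \<otimes> z)" using conj_mult[OF t_closed y0c] g0(2) fy by simp
      also have "\<dots> = t \<otimes> (z \<otimes> y0) \<otimes> z" using y0c by (simp add: m_assoc)
      also have "\<dots> = t \<otimes> y0" unfolding z_comm[OF y0c] using y0c by (simp flip: m_assoc)
      finally have "g0 \<otimes> (t \<otimes> y0) \<otimes> inv g0 = t \<otimes> y0" .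
      moreover have "t \<otimes> y0 \<notin> E" using subgroup_cancel(1)[OF subgroup_E tE y0c] y0(2) by blast
      moreover have "t \<otimes> y0 \<in> C" using subgroup.m_closed[OF subgroup_C subsetD[OF E_subset_C tE] y0(1)] .
      ultimately show ?thesis by blast
    qed
    then obtain w where w: "w \<in> C" "w \<notin> E" "g0 \<otimes> w \<otimes> inv g0 = w" by blast
    have wc: "w \<in> carrier G" by (rule Cc[OF w(1)])
    have ww: "w \<otimes> w = z" by (rule sqz[OF w(1,2)])
    have gw: "g0 \<otimes> w = w \<otimes> g0" using conj_eq_iff(2)[OF g0(1) wc wc] w(3) by simp
    have wt: "w \<otimes> t = t \<otimes> w" using w(1) by (simp add: mem_C_iff)
    have g0C: "g0 \<notin> C" by (rule outside[OF g0])
    \<comment> \<open>Two shifts by z cancel, so the square of \<open>g0\<close> centralizes C. It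
      also commutes with \<open>g0\<close>, and C together with \<open>g0\<close> generates
      G.\<close>
    have "g0 \<otimes> g0 \<in> center"
      unfolding center_iff
    proof (intro conjI ballI)
      show "g0 \<otimes> g0 \<in> carrier G" using g0(1) by simp
      have inC: "g0 \<otimes> g0 \<otimes> y = y \<otimes> (g0 \<otimes> g0)" if y: "y \<in> C" for y
      proof -
        have yc: "y \<in> carrier G" by (rule Cc[OF y])
        have "g0 \<otimes> (g0 \<otimes> y \<otimes> inv g0) \<otimes> inv g0 = y"
          using flip[OF y] conj_mult[OF yc z_closed] conj_z yc by (auto simp: m_assoc)
        then have "g0 \<otimes> g0 \<otimes> y \<otimes> inv (g0 \<otimes> g0) = y" using g0(1) yc by (simp add: m_assoc inv_mult_group)
        then show ?thesis using conj_eq_iff(2)[of "g0 \<otimes> g0" y y] g0(1) yc by simp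
      qed
      fix x assume x: "x \<in> carrier G"
      show "g0 \<otimes> g0 \<otimes> x = x \<otimes> (g0 \<otimes> g0)"
      proof (cases "x \<in> C")
        case False
        have "g0 \<otimes> x \<in> C" using idx[OF g0(1) x] g0C False by blast
        then have "g0 \<otimes> g0 \<otimes> (g0 \<otimes> x) = g0 \<otimes> x \<otimes> (g0 \<otimes> g0)" by (rule inC)
        then have "g0 \<otimes> (g0 \<otimes> g0 \<otimes> x) = g0 \<otimes> (x \<otimes> (g0 \<otimes> g0))" using g0(1) x by (simp add: m_assoc)
        then show ?thesis using g0(1) x by simp
      qed (rule inC)
    qed
    then have g0sq: "g0 \<otimes> g0 = \<one> \<or> g0 \<otimes> g0 = z" using center_eq by simp
    \<comment> \<open>Either \<open>g0\<close> has trivial square, or its square is z = w^2 and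
      \<open>g0\<close> w has trivial square.\<close>
    have "\<exists>g\<in>carrier G. g \<notin> C \<and> g \<otimes> t = t \<otimes> z \<otimes> g \<and> g \<otimes> w = w \<otimes> g \<and> g \<otimes> g = \<one>"
    proof (cases "g0 \<otimes> g0 = \<one>")
      case True
      have "g0 \<otimes> t = t \<otimes> z \<otimes> g0" using conj_eq_iff(2)[OF g0(1) t_closed, of "t \<otimes> z"] g0(2) by simp
      then show ?thesis using True g0(1) g0C gw by blast
    next
      case False
      let ?g = "g0 \<otimes> w"
      have gc: "?g \<in> carrier G" using g0(1) wc by simp
      have "?g \<otimes> ?g = g0 \<otimes> (w \<otimes> g0) \<otimes> w" using g0(1) wc by (simp add: m_assoc)
      also have "\<dots> = (g0 \<otimes> g0) \<otimes> (w \<otimes> w)" unfolding gw[symmetric] using g0(1) wc by (simp add: m_assoc)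
      finally have "?g \<otimes> ?g = \<one>" using False g0sq ww by auto
      moreover have "?g \<notin> C" using idx[OF g0(1) wc] g0C w(1) by blast
      moreover have "?g \<otimes> t = t \<otimes> z \<otimes> ?g"
      proof -
        have "?g \<otimes> t = g0 \<otimes> t \<otimes> w" using g0(1) wc wt by (simp add: m_assoc)
        also have "g0 \<otimes> t = t \<otimes> z \<otimes> g0" using conj_eq_iff(2)[OF g0(1) t_closed, of "t \<otimes> z"] g0(2) by simp
        finally show ?thesis using g0(1) wc by (simp add: m_assoc)
      qed
      moreover have "w \<otimes> ?g = w \<otimes> g0 \<otimes> w" using g0(1) wc by (simp add: m_assoc)
      then have "?g \<otimes> w = w \<otimes> ?g" using gw by simp
      ultimately show ?thesis using gc by blast
    qed
    then obtain g where g: "g \<in> carrier G" "g \<notin> C" "g \<otimes> t = t \<otimes> z \<otimes> g" "g \<otimes> w = w \<otimes> g" "g \<otimes> g = \<one>" by blast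
    \<comment> \<open>t, g and \<open>?u\<close> lie in three different cosets of the center: g and
      \<open>?u\<close> are outside C, and they differ by the noncentral factor t w.\<close>
    let ?u = "t \<otimes> w \<otimes> g"
    have twC: "t \<otimes> w \<in> C" using subgroup.m_closed[OF subgroup_C _ w(1)] E_subset_C by blast
    have twc: "t \<otimes> w \<in> carrier G" by (rule Cc[OF twC])
    have uC: "?u \<notin> C" using idx[OF twc g(1)] twC g(2) by blast
    have uc: "?u \<in> carrier G" using twc g(1) by simp
    have sq: "?u \<otimes> ?u = \<one>"
    proof -
      have "?u \<otimes> ?u = t \<otimes> w \<otimes> (g \<otimes> t) \<otimes> (w \<otimes> g)" using g(1) wc by (simp add: m_assoc)
      also have "\<dots> = t \<otimes> w \<otimes> (t \<otimes> z \<otimes> g) \<otimes> (g \<otimes> w)" by (simp only: g(3,4))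
      also have "\<dots> = t \<otimes> w \<otimes> t \<otimes> z \<otimes> (g \<otimes> g) \<otimes> w" using g(1) wc by (simp add: m_assoc)
      also have "\<dots> = t \<otimes> (w \<otimes> t) \<otimes> (z \<otimes> w)" unfolding g(5) using wc by (simp add: m_assoc)
      also have "\<dots> = (t \<otimes> t) \<otimes> (w \<otimes> w) \<otimes> z"
        unfolding wt z_comm[OF wc] using wc by (simp only: m_assoc m_closed t_closed z_closed)
      finally show ?thesis using ww by simp
    qed
    have nC: "x \<noteq> \<one> \<and> x \<noteq> z \<and> x \<notin> {t, t \<otimes> z}" if "x \<notin> C" for x using that E_subset_C by blast
    have tw_ne: "t \<otimes> w \<notin> {\<one>, z}"
    proof
      assume "t \<otimes> w \<in> {\<one>, z}"
      then have "t \<otimes> w \<in> E" by blast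
      then show False using subgroup_cancel(1)[OF subgroup_E _ wc, of t] w(2) by blast
    qed
    have "?u \<noteq> g" using tw_ne twc g(1) by simp
    moreover have "?u \<noteq> g \<otimes> z"
    proof
      assume "?u = g \<otimes> z"
      then have "t \<otimes> w \<otimes> g = z \<otimes> g" using z_comm[OF g(1)] by simp
      then show False using tw_ne twc g(1) by simp
    qed
    moreover have "g \<in> involutions" "?u \<in> involutions" using g(1,5) nC[OF g(2)] uc sq nC[OF uC] by blast+
    ultimately have "7 \<le> cd_defect G"
      using nC[OF g(2)] nC[OF uC] by (intro three_pairs_defect[OF t, of g ?u]) blast+
    then show False using le by simp
  qed
qed

end

section \<open>Classification of the 2-groups by the order of the center\<close>

context two_group
begin

lemma defect_center_2:
  assumes n: "n \<ge> 4" and c: "card center = 2" and full: "carrier G \<in> cd_lattice G"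
    and zt: "z \<in> center" "z \<in> involutions" "t \<in> involutions" "t \<noteq> z"
  shows "7 \<le> cd_defect G"
proof (rule ccontr)
  assume "\<not> ?thesis"
  then have le: "cd_defect G \<le> 6" by simp
  have z1: "z \<noteq> \<one>" using zt(2) by simp
  have sub: "{\<one>, z} \<subseteq> center" using subgroup.one_closed[OF subgroup_center] zt(1) by blast
  have "card {\<one>, z} = 2" using z1 by simp
  then have "center = {\<one>, z}" using card_subset_eq[OF finite_subgroup[OF subgroup_center] sub] c by simp
  then interpret two_group_center_two_small_defect G n z t
    by unfold_locales (use z1 n full zt le in auto)
  show False by (rule contradiction)
qed

theorem two_group_classification:
  assumes n: "n \<ge> 1" and nc: "\<And>g. g \<in> carrier G \<Longrightarrow> cyc G g \<noteq> carrier G" and le: "cd_defect G \<le> 6"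
  shows "G \<cong> integer_mod_group (2 ^ 1) \<times>\<times> integer_mod_group 2 \<or> G \<cong> quaternion_group \<or>
    (\<exists>k\<in>{2..3}. G \<cong> modular_p_group 2 k)"
  using n
proof (cases rule: unique_involution_cases)
  case unique
  then show ?thesis using unique_involution_classification[OF n nc _ le] by blast
next
  case (many z t)
  have zc: "z \<in> carrier G" and tc: "t \<in> carrier G" using many by auto
  have tcyc: "t \<notin> cyc G z" using many by (auto simp: cyc_involution[OF many(2)])
  have pow: "(2::nat) ^ n = 2 * 2 ^ (n - 1)" using n by (simp flip: power_Suc)
  have n2: "n \<ge> 2"
  proof (rule ccontr)
    assume "\<not> n \<ge> 2"
    then have "n = 1" using n by simp
    then have "card (cyc G z) = card (carrier G)"
      using card_cyc[OF zc] involution_ord[OF many(2)] order_eq by (simp add: order_def)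
    then show False using nc[OF zc] card_subset_eq[OF fin subgroup.subset[OF subgroup_cyc[OF zc]]] by blast
  qed
  consider "n = 2" | "n \<ge> 3" "\<forall>x\<in>carrier G. \<forall>y\<in>carrier G. x \<otimes> y = y \<otimes> x"
    | (nonab) x y where "n \<ge> 3" "x \<in> carrier G" "y \<in> carrier G" "x \<otimes> y \<noteq> y \<otimes> x" using n2 by fastforce
  then show ?thesis
  proof cases
    case 1
    \<comment> \<open>For n = 2 the subgroup <z> has index 2, and the split case applies with k = r
      = 1.\<close>
    have "z \<otimes> t = t \<otimes> z [^] (1::nat)" using center_comm[OF many(1) tc] zc by simp
    from almost_cyclic_classification[OF zc _ _ _ nc tc tcyc this, of 1] show ?thesis
      using 1 involution_ord[OF many(2)] by auto
  next
    case 2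
    then show ?thesis using defect_abelian_large[OF _ nc] le by fastforce
  next
    case nonab
    consider "n = 3" | "n \<ge> 4" using nonab(1) by linarith
    then show ?thesis
    proof cases
      case 1
      then have "G \<cong> modular_p_group 2 2" by (rule order_8_classification[OF _ nc nonab(2-4) many])
      then show ?thesis by auto
    next
      case 2
      have full: "carrier G \<in> cd_lattice G"
        using defect_carrier_notin_cd[OF nonab(1) nc many] le by fastforce
      obtain c where c: "card center = 2 ^ c" using card_subgroup[OF subgroup_center] by blast
      have c2: "2 \<le> card center" by (rule p_le_card_center[OF n])
      have "\<not> card (carrier G) \<le> 2 * card center"
        using commute_if_central_index_le_p[OF subgroup_center _ subgroup_self subgroup.subset[OF subgroup_center]] nonab by blast
      then have "2 * (2::nat) ^ c < 2 ^ n" using c order_eq by (simp add: order_def)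
      then have "(2::nat) ^ Suc c < 2 ^ n" by simp
      then have cn: "Suc c < n" by (metis power_less_imp_less_exp one_less_numeral_iff semiring_norm(76))
      show ?thesis
      proof (cases "n = c + 2")
        case True
        then have "order G = 4 * card center" using order_eq c by simp
        then show ?thesis using center_index_4_classification[OF 2 nc _ le] by blast
      next
        case False
        consider "c = 0" | "c = 1" | "c = 2" | "c \<ge> 3" by linarith
        then have "7 \<le> cd_defect G"
        proof cases
          case 1
          then show ?thesis using c c2 by simp
        next
          case c: 2
          then show ?thesis using defect_center_2[OF 2 _ full many] \<open>card center = 2 ^ c\<close> by simp
        next
          case 3
          \<comment> \<open>Here n >= 5, because Suc c < n and n is not c + 2.\<close>
          then show ?thesis using defect_center_4[OF _ _ full many] c cn False by simp
        next
          case 4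
          then have "(2::nat) ^ 3 \<le> 2 ^ c" by (intro power_increasing) auto
          then show ?thesis using defect_center_ge_8[OF nonab(1) _ many] c by simp
        qed
        then show ?thesis using le by simp
      qed
    qed
  qed
qed

end

section \<open>The classification for all primes and the defects of the listed groups\<close>

theorem mainTheorem1:
  fixes G (structure) and p n :: nat
  assumes "Factorial_Ring.prime p" and "group G" and "finite (carrier G)"
    and "order G = p ^ n" and "n \<ge> 1"
  shows
    "(cd_defect G \<le> p\<^sup>2 + p \<longleftrightarrow>
        (\<exists>k\<in>{1..p\<^sup>2 + p}. G \<cong> integer_mod_group (p ^ k)) \<or>
        (\<exists>t\<in>{1..p - 1}. G \<cong> integer_mod_group (p ^ t) \<times>\<times> integer_mod_group p) \<or>
        G \<cong> quaternion_group \<or>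
        (\<exists>k\<in>{2..p + 1}. G \<cong> modular_p_group p k))
     \<and> (\<forall>k\<in>{1..p\<^sup>2 + p}. G \<cong> integer_mod_group (p ^ k) \<longrightarrow> cd_defect G = k)
     \<and> (\<forall>t\<in>{1..p - 1}. G \<cong> integer_mod_group (p ^ t) \<times>\<times> integer_mod_group p \<longrightarrow>
           cd_defect G = t * (p + 1) + 1)
     \<and> (G \<cong> quaternion_group \<longrightarrow> cd_defect G = 1)
     \<and> (\<forall>k\<in>{2..p + 1}. G \<cong> modular_p_group p k \<longrightarrow>
           cd_defect G = (if p = 2 \<and> k = 2 then 5 else (k - 1) * (p + 1)))"
proof -
  interpret p_group G p n
    using assms by (simp add: p_group_def p_group_axioms_def finite_group_def finite_group_axioms_def)
  note p = \<open>Factorial_Ring.prime p\<close>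
  have transfer: "cd_defect G = cd_defect K" if "p_group K q m" "G \<cong> K" for K :: "('k, 'l) monoid_scheme" and q m
    using cd_defect_iso[OF finite_group_axioms p_group.axioms(1)[OF that(1)] that(2)] .
  have cyclic: "cd_defect G = k" if "k \<in> {1..p\<^sup>2 + p}" "G \<cong> integer_mod_group (p ^ k)" for k
    using transfer[OF p_group_integer_mod_group[OF p] that(2)] cd_defect_integer_mod_group[OF p, of k] that(1) by simp
  have product: "cd_defect G = t * (p + 1) + 1"
    if "t \<in> {1..p - 1}" "G \<cong> integer_mod_group (p ^ t) \<times>\<times> integer_mod_group p" for t
    using transfer[OF p_group_integer_mod_prod[OF p] that(2)] cd_defect_integer_mod_prod[OF p, of t] that(1) by simp
  have quaternion: "cd_defect G = 1" if "G \<cong> quaternion_group"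
    using transfer[OF p_group_quaternion that] cd_defect_quaternion by simp
  have modular: "cd_defect G = (if p = 2 \<and> k = 2 then 5 else (k - 1) * (p + 1))"
    if k: "k \<in> {2..p + 1}" "G \<cong> modular_p_group p k" for k
  proof -
    have "k \<ge> 2" using k(1) by simp
    from transfer[OF cd_defect_modular_p_group(1)[OF p this] k(2)] cd_defect_modular_p_group(2)[OF p this]
    show ?thesis by (rule HOL.trans)
  qed
  have "cd_defect G \<le> p\<^sup>2 + p \<longleftrightarrow>
        (\<exists>k\<in>{1..p\<^sup>2 + p}. G \<cong> integer_mod_group (p ^ k)) \<or>
        (\<exists>t\<in>{1..p - 1}. G \<cong> integer_mod_group (p ^ t) \<times>\<times> integer_mod_group p) \<or>
        G \<cong> quaternion_group \<or>
        (\<exists>k\<in>{2..p + 1}. G \<cong> modular_p_group p k)" (is "_ \<longleftrightarrow> ?list")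
  proof
    assume le: "cd_defect G \<le> p\<^sup>2 + p"
    show ?list
    proof (cases "\<exists>g\<in>carrier G. cyc G g = carrier G")
      case True
      then obtain g where g: "g \<in> carrier G" "cyc G g = carrier G" by blast
      have "n \<in> {1..p\<^sup>2 + p}" using cyclic_defect[OF g] le \<open>n \<ge> 1\<close> by simp
      then show ?thesis using cyclic_iso_integer_mod_group[OF g] by blast
    next
      case False
      then have nc: "cyc G g \<noteq> carrier G" if "g \<in> carrier G" for g using that by blast
      show ?thesis
      proof (cases "p = 2")
        case True
        then have two: "two_group G n" using p_group_axioms by (simp add: two_group_def)
        have "cd_defect G \<le> 6" using le True by simp
        from two_group.two_group_classification[OF two \<open>n \<ge> 1\<close> nc this] show ?thesis
          unfolding True by fastforce
      next
        case False
        from odd_classification[OF this \<open>n \<ge> 1\<close> nc le] show ?thesis by blast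
      qed
    qed
  next
    have square: "p\<^sup>2 + p = p * (p + 1)" by (simp add: power2_eq_square)
    assume ?list
    then consider k where "k \<in> {1..p\<^sup>2 + p}" "G \<cong> integer_mod_group (p ^ k)"
      | t where "t \<in> {1..p - 1}" "G \<cong> integer_mod_group (p ^ t) \<times>\<times> integer_mod_group p"
      | "G \<cong> quaternion_group" | k where "k \<in> {2..p + 1}" "G \<cong> modular_p_group p k" by blast
    then show "cd_defect G \<le> p\<^sup>2 + p"
    proof cases
      case (1 k)
      then show ?thesis using cyclic by simp
    next
      case (2 t)
      then have "t + 1 \<le> p" using p_gt(2) by auto
      \<comment> \<open>(t + 1) (p + 1) exceeds the defect t (p + 1) + 1 by p.\<close>
      then have "(t + 1) * (p + 1) \<le> p * (p + 1)" by (rule mult_le_mono1)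
      then show ?thesis unfolding product[OF 2] square by simp
    next
      case 3
      then show ?thesis using quaternion p_gt(1) by simp
    next
      case (4 k)
      show ?thesis
      proof (cases "p = 2 \<and> k = 2")
        \<comment> \<open>The dihedral group of order 8: its defect 5 is still below p^2 + p =
          6.\<close>
        case True
        then show ?thesis using modular[OF 4] by simp
      next
        case False
        have "(k - 1) * (p + 1) \<le> p * (p + 1)" using 4(1) by (intro mult_le_mono1) auto
        then show ?thesis using False modular[OF 4] square by simp
      qed
    qed
  qed
  then show ?thesis using cyclic product quaternion modular by blast
qed

end
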